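(* Let $S$ be a finite semigroup such that $\mathbb{Z}S$ has an identity element. The algebra $\mathbb{Q}S$ has no nonzero nilpotent elements and has the hyperbolic property if, and only if, $S$ admits a principal series for which every factor is isomorphic to one of the groups below, with at most one factor of type (ii): (i) a Higman group; (ii) one of the cyclic groups $C_5$, $C_8$ or $C_{12}$. Moreover, in this case $S$ is an inverse semigroup and it is the disjoint union of groups of type (i) with at most one group of type (ii).
   Context: A finite group is a Higman group if it is abelian of exponent dividing $4$ or $6$, or a Hamiltonian $2$-group. $C_n$ is the cyclic group of order $n$. A $\mathbb{Z}$-order of a finite dimensional unital $\mathbb{Q}$-algebra $\mathcal{A}$ is a unital subring $\Gamma$, finitely generated as a $\mathbb{Z}$-module, with $\mathbb{Q}\Gamma=\mathcal{A}$. $\mathcal{A}$ has the hyperbolic property if $\mathbb{Z}^2$ does not embed in the unit group $\mathcal{U}(\Gamma)$ for a $\mathbb{Z}$-order $\Gamma$ of $\mathcal{A}$ (independent of the order). A principal series of $S$ is a chain $S=S_1\supset S_2\supset\cdots\supset S_n\supset S_{n+1}=\emptyset$ of ideals of $S$ in which each $S_{i+1}$ is maximal among the ideals of $S$ properly contained in $S_i$. Its factors are the Rees quotients $S_i/S_{i+1}=(S_i\setminus S_{i+1})\cup\{\theta\}$, with $st$ taken in $S$ if $st\notin S_{i+1}$ and $st=\theta$ otherwise ($S_n/\emptyset=S_n$). A factor is said to be isomorphic to a group $G$ if it is isomorphic to $G^{\theta}=G\cup\{\theta\}$, the group with a zero adjoined (or to $G$ itself for the last factor $S_n$). Elements $a,b\in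 S$ are inverses if $aba=a$ and $bab=b$; $S$ is an inverse semigroup if every nonzero element has a unique inverse. *)

theory Defs
  imports
    "HOL-Algebra.Elementary_Groups"
    "HOL-Algebra.Generated_Groups"
    "HOL-Algebra.Multiplicative_Group"
    "HOL-Algebra.Subrings"
    "HOL-Algebra.Module"
    "HOL-Library.Disjoint_Sets"
begin

section \<open>Finite semigroups\<close>

text \<open>
  Semigroups are monoid records whose unit field is ignored: nothing below reads the unit
  of \<open>S\<close>. The library's \<open>iso\<close>, hence also \<open>\<cong>\<close>, only looks at the carrier and the product,
  so it is the right notion of isomorphism for such records.
\<close>

locale finite_semigroup =
  fixes S (structure)
  assumes finite_carrier: "finite (carrier S)"
    and nonempty: "carrier S \<noteq> {}"
    and m_closed: "\<lbrakk>x \<in> carrier S; y \<in> carrier S\<rbrakk> \<Longrightarrow> x \<otimes> y \<in> carrier S"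
    and m_assoc: "\<lbrakk>x \<in> carrier S; y \<in> carrier S; z \<in> carrier S\<rbrakk>
      \<Longrightarrow> (x \<otimes> y) \<otimes> z = x \<otimes> (y \<otimes> z)"

definition semigroup_zero :: "('s, 'm) monoid_scheme \<Rightarrow> 's \<Rightarrow> bool" where
  "semigroup_zero S z \<longleftrightarrow> z \<in> carrier S \<and>
     (\<forall>s \<in> carrier S. z \<otimes>\<^bsub>S\<^esub> s = z \<and> s \<otimes>\<^bsub>S\<^esub> z = z)"

definition inverse_semigroup :: "('s, 'm) monoid_scheme \<Rightarrow> bool" where
  "inverse_semigroup S \<longleftrightarrow>
     (\<forall>a \<in> carrier S. \<not> semigroup_zero S a \<longrightarrow>
        (\<exists>!b. b \<in> carrier S \<and>
           a \<otimes>\<^bsub>S\<^esub> b \<otimes>\<^bsub>S\<^esub> a = a \<and> b \<otimes>\<^bsub>S\<^esub> a \<otimes>\<^bsub>S\<^esub> b = b))"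


section \<open>Principal series and their factors\<close>

text \<open>The empty set counts as an ideal, because it is the last term of a principal series.\<close>

definition semigroup_ideal :: "('s, 'm) monoid_scheme \<Rightarrow> 's set \<Rightarrow> bool" where
  "semigroup_ideal S I \<longleftrightarrow> I \<subseteq> carrier S \<and>
     (\<forall>x \<in> I. \<forall>s \<in> carrier S. s \<otimes>\<^bsub>S\<^esub> x \<in> I \<and> x \<otimes>\<^bsub>S\<^esub> s \<in> I)"

definition principal_series :: "('s, 'm) monoid_scheme \<Rightarrow> nat \<Rightarrow> (nat \<Rightarrow> 's set) \<Rightarrow> bool" where
  "principal_series S n I \<longleftrightarrow>
     I 1 = carrier S \<and> I (Suc n) = {} \<and>
     (\<forall>i \<in> {1..Suc n}. semigroup_ideal S (I i)) \<and>
     (\<forall>i \<in> {1..n}. I (Suc i) \<subset> I i \<and>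
        \<not> (\<exists>J. semigroup_ideal S J \<and> I (Suc i) \<subset> J \<and> J \<subset> I i))"

text \<open>
  In the Rees quotient \<open>I / J\<close> the element \<open>None\<close> is the adjoined zero; there is none if
  \<open>J\<close> is empty. The quotient is only a semigroup, so its unit field is left undefined.
\<close>

definition rees_quotient ::
    "('s, 'm) monoid_scheme \<Rightarrow> 's set \<Rightarrow> 's set \<Rightarrow> 's option monoid" where
  "rees_quotient S I J =
     \<lparr>carrier = Some ` (I - J) \<union> (if J = {} then {} else {None}),
      monoid.mult = (\<lambda>x y. case (x, y) of
          (Some s, Some t) \<Rightarrow> if s \<otimes>\<^bsub>S\<^esub> t \<notin> J then Some (s \<otimes>\<^bsub>S\<^esub> t) else None
        | _ \<Rightarrow> None),
      one = undefined\<rparr>"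

definition with_zero :: "('g, 'm) monoid_scheme \<Rightarrow> 'g option monoid" where
  "with_zero G =
     \<lparr>carrier = insert None (Some ` carrier G),
      monoid.mult = (\<lambda>x y. case (x, y) of
          (Some g, Some h) \<Rightarrow> Some (g \<otimes>\<^bsub>G\<^esub> h)
        | _ \<Rightarrow> None),
      one = Some \<one>\<^bsub>G\<^esub>\<rparr>"

definition factor_iso_group ::
    "('s, 'm) monoid_scheme \<Rightarrow> 's set \<Rightarrow> 's set \<Rightarrow> ('g, 'k) monoid_scheme \<Rightarrow> bool" where
  "factor_iso_group S I J G \<longleftrightarrow>
     (if J = {} then rees_quotient S I J \<cong> G else rees_quotient S I J \<cong> with_zero G)"


section \<open>The groups in the classification\<close>

definition group_exponent :: "('g, 'm) monoid_scheme \<Rightarrow> nat" where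
  "group_exponent G = Lcm (group.ord G ` carrier G)"

definition hamiltonian_group :: "('g, 'm) monoid_scheme \<Rightarrow> bool" where
  "hamiltonian_group G \<longleftrightarrow>
     group G \<and> \<not> comm_group G \<and> (\<forall>H. subgroup H G \<longrightarrow> H \<lhd> G)"

definition higman_group :: "('g, 'm) monoid_scheme \<Rightarrow> bool" where
  "higman_group G \<longleftrightarrow> finite (carrier G) \<and>
     (comm_group G \<and> (group_exponent G dvd 4 \<or> group_exponent G dvd 6)
      \<or> hamiltonian_group G \<and> (\<exists>k. order G = 2 ^ k))"

definition cyclic_5_8_12 :: "('g, 'm) monoid_scheme \<Rightarrow> bool" where
  "cyclic_5_8_12 G \<longleftrightarrow> group G \<and> (\<exists>m \<in> {5, 8, 12}. G \<cong> integer_mod_group m)"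

text \<open>
  A subset \<open>X\<close> of \<open>S\<close> is a group with property \<open>P\<close> under the product of \<open>S\<close>; its unit \<open>e\<close>
  is an idempotent of \<open>S\<close>, in general not a unit of \<open>S\<close>. The properties used for \<open>P\<close> below
  all include being a group, so \<open>X\<close> is closed under the product.
\<close>

definition group_inside :: "('s monoid \<Rightarrow> bool) \<Rightarrow> 's monoid \<Rightarrow> 's set \<Rightarrow> bool" where
  "group_inside P S X \<longleftrightarrow> (\<exists>e. P (S\<lparr>carrier := X, one := e\<rparr>))"


section \<open>Semigroup algebras\<close>

definition identity_of :: "'a set \<Rightarrow> ('a \<Rightarrow> 'a \<Rightarrow> 'a) \<Rightarrow> 'a \<Rightarrow> bool" where
  "identity_of A m e \<longleftrightarrow> e \<in> A \<and> (\<forall>x \<in> A. m e x = x \<and> m x e = x)"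

definition convolution ::
    "('s, 'm) monoid_scheme \<Rightarrow> ('s \<Rightarrow> 'r::comm_ring_1) \<Rightarrow> ('s \<Rightarrow> 'r) \<Rightarrow> 's \<Rightarrow> 'r" where
  "convolution S f g =
     (\<lambda>s. \<Sum>(t, u) \<in> {(t, u). t \<in> carrier S \<and> u \<in> carrier S \<and> t \<otimes>\<^bsub>S\<^esub> u = s}. f t * g u)"

text \<open>
  The semigroup algebra of a finite semigroup \<open>S\<close> over the coefficient ring \<open>'r\<close>: the function
  \<open>f\<close> stands for the formal sum of the \<open>f s \<cdot> s\<close>. The unit field is the identity element of
  the algebra if there is one, and meaningless otherwise.
\<close>

definition semigroup_algebra ::
    "('s, 'm) monoid_scheme \<Rightarrow> ('r::comm_ring_1, 's \<Rightarrow> 'r) module" where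
  "semigroup_algebra S =
     (let A = {f. \<forall>s. s \<notin> carrier S \<longrightarrow> f s = 0} in
      \<lparr>carrier = A,
       monoid.mult = convolution S,
       one = (THE e. identity_of A (convolution S) e),
       zero = (\<lambda>_. 0),
       add = (\<lambda>f g s. f s + g s),
       smult = (\<lambda>c f s. c * f s)\<rparr>)"

abbreviation integral_semigroup_ring :: "('s, 'm) monoid_scheme \<Rightarrow> (int, 's \<Rightarrow> int) module" where
  "integral_semigroup_ring S \<equiv> semigroup_algebra S"

abbreviation rational_semigroup_algebra ::
    "('s, 'm) monoid_scheme \<Rightarrow> (rat, 's \<Rightarrow> rat) module" where
  "rational_semigroup_algebra S \<equiv> semigroup_algebra S"

definition has_identity :: "('a, 'm) monoid_scheme \<Rightarrow> bool" where
  "has_identity A \<longleftrightarrow> (\<exists>e. identity_of (carrier A) (\<otimes>\<^bsub>A\<^esub>) e)"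

definition no_nonzero_nilpotents :: "('a, 'm) ring_scheme \<Rightarrow> bool" where
  "no_nonzero_nilpotents A \<longleftrightarrow>
     (\<forall>x \<in> carrier A. (\<exists>k::nat. k > 0 \<and> x [^]\<^bsub>A\<^esub> k = \<zero>\<^bsub>A\<^esub>) \<longrightarrow> x = \<zero>\<^bsub>A\<^esub>)"


section \<open>Orders and the hyperbolic property\<close>

text \<open>
  In a finite dimensional unital algebra over the rationals: the additive subgroup generated by
  a set is its span over the integers, and the one generated by the rational multiples of the
  elements of \<open>\<Gamma>\<close> is the rational span of \<open>\<Gamma>\<close>. Note that \<open>subring\<close> includes the unit.
\<close>

definition Z_order :: "(rat, 'a, 'm) module_scheme \<Rightarrow> 'a set \<Rightarrow> bool" where
  "Z_order A \<Gamma> \<longleftrightarrow>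
     subring \<Gamma> A \<and>
     (\<exists>B. finite B \<and> B \<subseteq> \<Gamma> \<and> generate (add_monoid A) B = \<Gamma>) \<and>
     generate (add_monoid A) {q \<odot>\<^bsub>A\<^esub> x | q x. x \<in> \<Gamma>} = carrier A"

text \<open>
  The unit groups of any two orders are commensurable, so quantifying over all orders instead
  would define the same property.
\<close>

definition hyperbolic_property :: "(rat, 'a, 'm) module_scheme \<Rightarrow> bool" where
  "hyperbolic_property A \<longleftrightarrow>
     (\<exists>\<Gamma>. Z_order A \<Gamma> \<and>
        mon (integer_group \<times>\<times> integer_group) (units_of (A\<lparr>carrier := \<Gamma>\<rparr>)) = {})"


section \<open>The two descriptions of the semigroup\<close>

definition has_hyperbolic_series :: "'s monoid \<Rightarrow> bool" where
  "has_hyperbolic_series S \<longleftrightarrow>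
     (\<exists>n I. principal_series S n I \<and>
        (\<forall>i \<in> {1..n}. \<exists>G :: 's monoid.
           (higman_group G \<or> cyclic_5_8_12 G) \<and> factor_iso_group S (I i) (I (Suc i)) G) \<and>
        card {i \<in> {1..n}. \<exists>G :: 's monoid.
           cyclic_5_8_12 G \<and> factor_iso_group S (I i) (I (Suc i)) G} \<le> 1)"

definition disjoint_union_of_groups :: "'s monoid \<Rightarrow> bool" where
  "disjoint_union_of_groups S \<longleftrightarrow>
     (\<exists>\<G>. partition_on (carrier S) \<G> \<and>
        (\<forall>X \<in> \<G>. group_inside higman_group S X \<or> group_inside cyclic_5_8_12 S X) \<and>
        card {X \<in> \<G>. group_inside cyclic_5_8_12 S X} \<le> 1)"

end

theory Submission
  imports
    Defs
    "HOL-Analysis.Kronecker_Approximation_Theorem"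
    "HOL-Number_Theory.Residues"
    "HOL-Computational_Algebra.Polynomial"
    "HOL-Algebra.Sylow"
begin

text \<open>
  If the algebra is reduced, then \<open>(es - ese)\<^sup>2 = 0 = (se - ese)\<^sup>2\<close> makes the idempotents \<open>e\<close> of \<open>S\<close>
  central, and differences of powers of \<open>s\<close> that square to zero give \<open>s ^ (p + 1) = s\<close> for some
  \<open>p > 0\<close>: \<open>S\<close> is a semilattice of groups \<open>H e\<close>. The maps \<open>s \<mapsto> se\<close>, set to 0 where \<open>se\<close> lies outside
  \<open>H e\<close>, embed the integral semigroup ring into the product of the group rings of the \<open>H e\<close>, and a unit
  of one of these extends by 1 to a unit of the semigroup ring. Hence the question is about finite
  groups whose integral group ring is reduced and has no two independent commuting units, and only one
  of the \<open>H e\<close> can have a unit of infinite order.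

  In such a group every subgroup \<open>H\<close> is normal, since otherwise a product of \<open>card H - \<Sum>H\<close>, some
  \<open>g\<close> and \<open>\<Sum>H\<close> is a nonzero element of square zero. Bass cyclic units bound the orders of the
  elements, and splitting the quaternions over the third roots of unity excludes elements of order 3
  from the nonabelian case. Conversely, if every conjugate of \<open>g\<close> is \<open>g\<close> or its inverse, then each \<open>x\<close>
  commutes with its adjoint \<open>x*\<close>, so the ring is reduced. In a Higman group the central elements
  \<open>g + inv g\<close> have integral eigenvalues, so the unit \<open>w = u u*\<close> satisfies \<open>w w = 1\<close>, is therefore equal to 1
  and \<open>u\<close> is plus or minus a group element. For order 5, 8 and 12 all values of a unit at the roots of unity
  are governed by one real number, and Dirichlet approximation gives the dependence.
\<close>

text \<open>The rings of the statement are records whose unit depends on \<open>S\<close>. To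
  calculate in a type class, every group ring is realised by left translations inside one type, the
  additive endomorphisms of \<open>'s \<Rightarrow> int\<close>: a subgroup reuses the translations
  of the whole group, the components at all idempotents have the same type, and integer polynomials
  can be evaluated there.

  No unit theorem is invoked. For orders 5, 8 and 12 the squared absolute values of a unit are
  integer polynomials in the trace \<open>2 * Re z\<close>, which is an integer or one of two
  conjugate quadratic irrationals. In the other direction no pair of units is shown independent by a
  rank count. A Bass unit commutes with its image under a change of generator; a relation between
  the two would scale logarithms by a constant ratio along the orbit of a root of unity, the finite
  orbit makes the ratio 1, and a comparison of cosines refutes this. Order 10 escapes this argument
  and takes an exponent that is not coprime to 10; order 24 falls because it contains elements of
  order 8 and of order 12.\<close>

typedef 's int_endo =
  "{F :: ('s \<Rightarrow> int) \<Rightarrow> 's \<Rightarrow> int. \<forall>f g. F (\<lambda>s. f s + g s) = (\<lambda>s. F f s + F g s)}"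
  by (rule exI[of _ "\<lambda>f. f"]) auto

setup_lifting type_definition_int_endo

instantiation int_endo :: (type) ring_1
begin

lift_definition zero_int_endo :: "'a int_endo" is "\<lambda>f s. 0" by auto
lift_definition one_int_endo :: "'a int_endo" is "\<lambda>f. f" by auto
lift_definition plus_int_endo :: "'a int_endo \<Rightarrow> 'a int_endo \<Rightarrow> 'a int_endo"
  is "\<lambda>F G f s. F f s + G f s" by (auto simp: algebra_simps)
lift_definition minus_int_endo :: "'a int_endo \<Rightarrow> 'a int_endo \<Rightarrow> 'a int_endo"
  is "\<lambda>F G f s. F f s - G f s" by (auto simp: algebra_simps)
lift_definition uminus_int_endo :: "'a int_endo \<Rightarrow> 'a int_endo"
  is "\<lambda>F f s. - F f s" by (auto simp: algebra_simps)
lift_definition times_int_endo :: "'a int_endo \<Rightarrow> 'a int_endo \<Rightarrow> 'a int_endo"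
  is "\<lambda>F G f. F (G f)" by auto

instance
proof
  show "(0 :: 'a int_endo) \<noteq> 1"
    by transfer (metis zero_neq_one)
qed (transfer; auto simp: algebra_simps)+

end

section \<open>Integral group rings of finite groups\<close>

text \<open>\<open>D_indep\<close> is freeness over the integers: the span \<open>ZG\<close> of the
  \<open>D g\<close> is a copy of the integral group ring inside an arbitrary ring.\<close>

locale int_group_ring = group G for G (structure) +
  fixes D :: "'a \<Rightarrow> 'r::ring_1"
  assumes finite_G: "finite (carrier G)"
    and D_mult: "\<lbrakk>x \<in> carrier G; y \<in> carrier G\<rbrakk> \<Longrightarrow> D (x \<otimes> y) = D x * D y"
    and D_one: "D \<one> = 1"
    and D_indep: "\<lbrakk>(\<Sum>g\<in>carrier G. of_int (f g) * D g) = 0; g \<in> carrier G\<rbrakk> \<Longrightarrow> f g = (0::int)"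
begin

definition lift :: "('a \<Rightarrow> int) \<Rightarrow> 'r" where
  "lift f = (\<Sum>g\<in>carrier G. of_int (f g) * D g)"

definition ZG :: "'r set" where
  "ZG = range lift"

text \<open>By \<open>D_indep\<close> the chosen function is unique on the carrier. The value 0
  elsewhere later turns \<open>cf x\<close> into an element of the semigroup ring, when the group
  sits inside \<open>S\<close>.\<close>

definition cf :: "'r \<Rightarrow> 'a \<Rightarrow> int" where
  "cf x g = (if g \<in> carrier G then (SOME f. lift f = x) g else 0)"

text \<open>The linear extension of inversion, an involution that reverses products.\<close>

definition star :: "'r \<Rightarrow> 'r" where
  "star x = lift (\<lambda>g. cf x (inv g))"

lemma lift_cong: "(\<And>g. g \<in> carrier G \<Longrightarrow> f g = h g) \<Longrightarrow> lift f = lift h"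
  unfolding lift_def by (rule sum.cong) auto

lemma lift_add: "lift f + lift h = lift (\<lambda>g. f g + h g)"
  unfolding lift_def by (simp add: sum.distrib algebra_simps)

lemma lift_uminus: "- lift f = lift (\<lambda>g. - f g)"
  unfolding lift_def by (simp add: sum_negf)

lemma lift_diff: "lift f - lift h = lift (\<lambda>g. f g - h g)"
  unfolding lift_def by (simp add: sum_subtractf algebra_simps)

lemma lift_zero: "lift (\<lambda>g. 0) = 0"
  unfolding lift_def by simp

lemma lift_scale: "of_int c * lift f = lift (\<lambda>g. c * f g)"
  unfolding lift_def by (simp add: sum_distrib_left mult.assoc)

lemma lift_eq_iff: "lift f = lift h \<longleftrightarrow> (\<forall>g\<in>carrier G. f g = h g)"
proof
  assume "lift f = lift h"
  then have "lift (\<lambda>g. f g - h g) = 0" by (simp add: lift_diff[symmetric])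
  then show "\<forall>g\<in>carrier G. f g = h g"
    using D_indep[of "\<lambda>g. f g - h g"] unfolding lift_def by auto
qed (auto intro: lift_cong)

lemma cf_lift: "cf (lift f) g = (if g \<in> carrier G then f g else 0)"
proof -
  have "lift (SOME h. lift h = lift f) = lift f" by (rule someI[of "\<lambda>h. lift h = lift f" f]) simp
  then show ?thesis unfolding cf_def by (auto simp: lift_eq_iff)
qed

lemma lift_in_ZG [simp]: "lift f \<in> ZG"
  by (simp add: ZG_def)

lemma lift_cf: "x \<in> ZG \<Longrightarrow> lift (cf x) = x"
  unfolding ZG_def by (auto simp: lift_eq_iff cf_lift)

lemma cf_outside: "g \<notin> carrier G \<Longrightarrow> cf x g = 0"
  by (simp add: cf_def)

lemma ZG_eqI: "\<lbrakk>x \<in> ZG; y \<in> ZG; \<And>g. g \<in> carrier G \<Longrightarrow> cf x g = cf y g\<rbrakk> \<Longrightarrow> x = y"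
  by (metis lift_cf lift_cong)

lemma zero_in_ZG [simp]: "0 \<in> ZG"
  by (subst lift_zero[symmetric]) (rule lift_in_ZG)

lemma add_in_ZG [simp]: "\<lbrakk>x \<in> ZG; y \<in> ZG\<rbrakk> \<Longrightarrow> x + y \<in> ZG"
  unfolding ZG_def by (auto simp: lift_add)

lemma uminus_in_ZG [simp]: "x \<in> ZG \<Longrightarrow> - x \<in> ZG"
  unfolding ZG_def by (auto simp: lift_uminus)

lemma diff_in_ZG [simp]: "\<lbrakk>x \<in> ZG; y \<in> ZG\<rbrakk> \<Longrightarrow> x - y \<in> ZG"
  using add_in_ZG[of x "- y"] by simp

lemma sum_in_ZG: "(\<And>i. i \<in> I \<Longrightarrow> f i \<in> ZG) \<Longrightarrow> sum f I \<in> ZG"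
  by (induction I rule: infinite_finite_induct) auto

lemma D_eq_lift: "h \<in> carrier G \<Longrightarrow> D h = lift (\<lambda>g. if g = h then 1 else 0)"
proof -
  assume h: "h \<in> carrier G"
  have "lift (\<lambda>g. if g = h then 1 else 0) = (\<Sum>g\<in>carrier G. if g = h then D g else 0)"
    unfolding lift_def by (rule sum.cong) auto
  then show ?thesis using h finite_G by simp
qed

lemma D_in_ZG [simp]: "h \<in> carrier G \<Longrightarrow> D h \<in> ZG"
  by (simp add: D_eq_lift)

lemma cf_D: "h \<in> carrier G \<Longrightarrow> cf (D h) g = (if g = h then 1 else 0)"
  by (auto simp: D_eq_lift cf_lift)

lemma one_in_ZG [simp]: "1 \<in> ZG"
  using D_in_ZG[of \<one>] D_one by simp

lemma cf_one: "cf 1 g = (if g = \<one> then 1 else 0)"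
  using cf_D[of \<one>] D_one by simp

lemma cf_add: "\<lbrakk>x \<in> ZG; y \<in> ZG\<rbrakk> \<Longrightarrow> cf (x + y) g = cf x g + cf y g"
  unfolding ZG_def by (auto simp: lift_add cf_lift)

lemma cf_uminus: "x \<in> ZG \<Longrightarrow> cf (- x) g = - cf x g"
  unfolding ZG_def by (auto simp: lift_uminus cf_lift)

lemma cf_diff: "\<lbrakk>x \<in> ZG; y \<in> ZG\<rbrakk> \<Longrightarrow> cf (x - y) g = cf x g - cf y g"
  unfolding ZG_def by (auto simp: lift_diff cf_lift)

lemma cf_zero: "cf 0 g = 0"
  using cf_lift[of "\<lambda>_. 0" g] lift_zero by simp

lemma of_int_mult_in_ZG [simp]: "x \<in> ZG \<Longrightarrow> of_int c * x \<in> ZG"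
  unfolding ZG_def by (auto simp: lift_scale)

lemma cf_scale: "x \<in> ZG \<Longrightarrow> cf (of_int c * x) g = c * cf x g"
  unfolding ZG_def by (auto simp: lift_scale cf_lift)

lemma cf_sum: "(\<And>i. i \<in> I \<Longrightarrow> f i \<in> ZG) \<Longrightarrow> cf (sum f I) g = (\<Sum>i\<in>I. cf (f i) g)"
  by (induction I rule: infinite_finite_induct) (auto simp: cf_zero cf_add sum_in_ZG)

lemma of_int_in_ZG [simp]: "of_int c \<in> ZG"
  using of_int_mult_in_ZG[OF one_in_ZG, of c] by simp

lemma ZG_expand: "x \<in> ZG \<Longrightarrow> x = (\<Sum>g\<in>carrier G. of_int (cf x g) * D g)"
  using lift_cf[of x] unfolding lift_def by simp

text \<open>Identities that are linear or bilinear in ring elements come down to group elements in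
  this way.\<close>

lemma ZG_induct [consumes 1, case_names zero step]:
  assumes "x \<in> ZG" and "P 0"
    and "\<And>c g x. \<lbrakk>g \<in> carrier G; x \<in> ZG; P x\<rbrakk> \<Longrightarrow> P (of_int c * D g + x)"
  shows "P x"
proof -
  have "P (\<Sum>g\<in>A. of_int (cf x g) * D g)" if "finite A" "A \<subseteq> carrier G" for A
    using that
  proof (induction A rule: finite_induct)
    case (insert a A)
    then show ?case
      using assms(3)[of a "\<Sum>g\<in>A. of_int (cf x g) * D g" "cf x a"]
        sum_in_ZG[of A "\<lambda>g. of_int (cf x g) * D g"]
      by (simp add: subset_iff)
  qed (simp add: assms(2))
  then show ?thesis using finite_G ZG_expand[OF assms(1)] by (metis order_refl)
qed

text \<open>This replaces division by integers, so the group rings keep integral coefficients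
  throughout.\<close>

lemma ZG_torsion_free: "\<lbrakk>x \<in> ZG; of_int c * x = 0; c \<noteq> 0\<rbrakk> \<Longrightarrow> x = 0"
  by (rule ZG_eqI) (auto simp: cf_zero dest: cf_scale[of x c])

section \<open>Coefficients of products\<close>

lemma D_mult_lift: 
  assumes h: "h \<in> carrier G"
  shows "D h * lift f = lift (\<lambda>g. f (inv h \<otimes> g))"
proof -
  have "D h * lift f = (\<Sum>k\<in>carrier G. of_int (f k) * D (h \<otimes> k))"
    unfolding lift_def sum_distrib_left using h
    by (intro sum.cong) (auto simp: D_mult mult.assoc[symmetric] simp flip: mult_of_int_commute)
  also have "\<dots> = lift (\<lambda>g. f (inv h \<otimes> g))"
    unfolding lift_def using h
    by (intro sum.reindex_bij_witness[of _ "\<lambda>g. inv h \<otimes> g" "\<lambda>k. h \<otimes> k"])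
       (auto simp: m_assoc[symmetric])
  finally show ?thesis .
qed

lemma lift_mult_D: 
  assumes h: "h \<in> carrier G"
  shows "lift f * D h = lift (\<lambda>g. f (g \<otimes> inv h))"
proof -
  have "lift f * D h = (\<Sum>k\<in>carrier G. of_int (f k) * D (k \<otimes> h))"
    unfolding lift_def sum_distrib_right using h
    by (intro sum.cong) (auto simp: D_mult mult.assoc)
  also have "\<dots> = lift (\<lambda>g. f (g \<otimes> inv h))"
    unfolding lift_def using h
    by (intro sum.reindex_bij_witness[of _ "\<lambda>g. g \<otimes> inv h" "\<lambda>k. k \<otimes> h"])
       (auto simp: m_assoc)
  finally show ?thesis .
qed

lemma cf_D_mult:
  assumes "h \<in> carrier G" "x \<in> ZG" "g \<in> carrier G"
  shows "cf (D h * x) g = cf x (inv h \<otimes> g)"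
proof -
  have "D h * x = lift (\<lambda>g. cf x (inv h \<otimes> g))"
    using D_mult_lift[OF assms(1), of "cf x"] assms(2) by (simp add: lift_cf)
  then show ?thesis using assms by (simp add: cf_lift)
qed

lemma cf_mult_D:
  assumes "h \<in> carrier G" "x \<in> ZG" "g \<in> carrier G"
  shows "cf (x * D h) g = cf x (g \<otimes> inv h)"
proof -
  have "x * D h = lift (\<lambda>g. cf x (g \<otimes> inv h))"
    using lift_mult_D[OF assms(1), of "cf x"] assms(2) by (simp add: lift_cf)
  then show ?thesis using assms by (simp add: cf_lift)
qed

lemma D_mult_in_ZG: "\<lbrakk>h \<in> carrier G; x \<in> ZG\<rbrakk> \<Longrightarrow> D h * x \<in> ZG"
  using D_mult_lift[of h "cf x"] by (simp add: lift_cf)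

lemma mult_in_ZG [simp]:
  assumes x: "x \<in> ZG" and y: "y \<in> ZG"
  shows "x * y \<in> ZG"
  using x
proof (induction rule: ZG_induct)
  case (step c g x)
  then show ?case using D_mult_in_ZG[OF step(1) y] by (simp add: distrib_right mult.assoc)
qed simp

lemma power_in_ZG [simp]: "x \<in> ZG \<Longrightarrow> x ^ n \<in> ZG"
  by (induction n) auto

text \<open>The coefficient at \<open>\<one>\<close> is the trace form. Paired with
  \<open>star\<close> it becomes a sum of squares, the source of all positivity arguments.\<close>

lemma cf_mult_one:
  assumes x: "x \<in> ZG" and y: "y \<in> ZG"
  shows "cf (x * y) \<one> = (\<Sum>g\<in>carrier G. cf x g * cf y (inv g))"
proof -
  have "x * y = (\<Sum>g\<in>carrier G. of_int (cf x g) * (D g * y))"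
    by (subst ZG_expand[OF x]) (simp add: sum_distrib_right mult.assoc)
  also have "cf \<dots> \<one> = (\<Sum>g\<in>carrier G. cf (of_int (cf x g) * (D g * y)) \<one>)"
    by (rule cf_sum) (simp add: y)
  also have "\<dots> = (\<Sum>g\<in>carrier G. cf x g * cf y (inv g))"
    by (rule sum.cong) (auto simp: y cf_scale cf_D_mult)
  finally show ?thesis .
qed

section \<open>The adjoint and the positive definite form\<close>

lemma star_in_ZG [simp]: "star x \<in> ZG"
  by (simp add: star_def)

lemma cf_star: "g \<in> carrier G \<Longrightarrow> cf (star x) g = cf x (inv g)"
  by (simp add: star_def cf_lift)

lemma star_add: "\<lbrakk>x \<in> ZG; y \<in> ZG\<rbrakk> \<Longrightarrow> star (x + y) = star x + star y"
  by (rule ZG_eqI) (auto simp: cf_star cf_add)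

lemma star_scale: "x \<in> ZG \<Longrightarrow> star (of_int c * x) = of_int c * star x"
  by (rule ZG_eqI) (auto simp: cf_star cf_scale)

lemma star_D: "h \<in> carrier G \<Longrightarrow> star (D h) = D (inv h)"
  by (rule ZG_eqI) (auto simp: cf_star cf_D)

lemma star_zero: "star 0 = 0"
  by (rule ZG_eqI) (auto simp: cf_star cf_zero)

lemma star_one: "star 1 = 1"
  using star_D[of \<one>] D_one by simp

lemma star_star: "x \<in> ZG \<Longrightarrow> star (star x) = x"
  by (rule ZG_eqI) (auto simp: cf_star)

lemma star_D_mult: "\<lbrakk>h \<in> carrier G; x \<in> ZG\<rbrakk> \<Longrightarrow> star (D h * x) = star x * D (inv h)"
  by (rule ZG_eqI) (auto simp: cf_star cf_D_mult cf_mult_D inv_mult_group)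

lemma star_mult:
  assumes x: "x \<in> ZG" and y: "y \<in> ZG"
  shows "star (x * y) = star y * star x"
  using x
proof (induction rule: ZG_induct)
  case (step c g x)
  have "star (D g * y) = star y * D (inv g)"
    by (rule star_D_mult) (auto simp: step y)
  then have "star ((of_int c * D g + x) * y) = of_int c * (star y * D (inv g)) + star y * star x"
    using step y by (simp add: distrib_right mult.assoc star_add star_scale)
  also have "of_int c * (star y * D (inv g)) = star y * (of_int c * D (inv g))"
    by (metis mult.assoc mult_of_int_commute)
  finally show ?case using step by (simp add: distrib_left star_add star_scale star_D)
qed (simp add: star_zero)

lemma cf_norm: "x \<in> ZG \<Longrightarrow> cf (x * star x) \<one> = (\<Sum>g\<in>carrier G. (cf x g)\<^sup>2)"
  by (simp add: cf_mult_one cf_star power2_eq_square)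

lemma norm_zeroD:
  assumes "x \<in> ZG" "x * star x = 0"
  shows "x = 0"
proof -
  have "(\<Sum>g\<in>carrier G. (cf x g)\<^sup>2) = 0"
    using cf_norm[OF assms(1)] assms(2) by (simp add: cf_zero)
  then have "\<forall>g\<in>carrier G. (cf x g)\<^sup>2 = 0"
    using finite_G by (subst (asm) sum_nonneg_eq_0_iff) auto
  then show ?thesis by (intro ZG_eqI) (auto simp: assms cf_zero)
qed

text \<open>Integer squares with sum 1 consist of one entry 1 and zeros. Units are recognised as
  trivial through this fact.\<close>

lemma norm_oneD:
  assumes x: "x \<in> ZG" and "(\<Sum>g\<in>carrier G. (cf x g)\<^sup>2) = 1"
  shows "\<exists>g\<in>carrier G. x = D g \<or> x = - D g"
proof -
  have "\<exists>g\<in>carrier G. cf x g \<noteq> 0" using assms(2) by (metis (mono_tags, lifting) sum.neutral zero_neq_one zero_power2)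
  then obtain g where g: "g \<in> carrier G" "cf x g \<noteq> 0" by blast
  have split: "(cf x g)\<^sup>2 + (\<Sum>h\<in>carrier G - {g}. (cf x h)\<^sup>2) = 1"
    using assms(2) finite_G g by (metis sum.remove)
  have nn: "(\<Sum>h\<in>carrier G - {g}. (cf x h)\<^sup>2) \<ge> 0" by (rule sum_nonneg) auto
  have "(cf x g)\<^sup>2 \<ge> 1" using g by (smt (verit) zero_less_power2)
  then have 1: "(cf x g)\<^sup>2 = 1" and 0: "(\<Sum>h\<in>carrier G - {g}. (cf x h)\<^sup>2) = 0"
    using split nn by linarith+
  from 0 have z: "\<forall>h\<in>carrier G - {g}. cf x h = 0"
    using finite_G by (subst (asm) sum_nonneg_eq_0_iff) auto
  from 1 have "cf x g = 1 \<or> cf x g = -1" by (simp add: power2_eq_1_iff)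
  then show ?thesis
  proof
    assume "cf x g = 1"
    then have "x = D g" using z g by (intro ZG_eqI) (auto simp: cf_D x)
    then show ?thesis using g by blast
  next
    assume "cf x g = -1"
    then have "x = - D g" using z g by (intro ZG_eqI) (auto simp: cf_D cf_uminus x)
    then show ?thesis using g by blast
  qed
qed

lemma D_power: "g \<in> carrier G \<Longrightarrow> D g ^ k = D (g [^] (k::nat))"
  by (induction k) (auto simp: D_one D_mult power_commutes[symmetric] simp del: power_Suc power.simps(2) simp: power_Suc2)

text \<open>The order of the group kills the group element, the factor 2 kills the sign.\<close>

lemma trivial_unit_torsion:
  assumes "g \<in> carrier G" "x = D g \<or> x = - D g"
  shows "x ^ (2 * card (carrier G)) = 1"
proof -
  have "D g ^ (2 * card (carrier G)) = 1"
    using assms pow_order_eq_1[of g] D_power[of g "card (carrier G)"] D_one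
    by (simp add: Coset.order_def mult.commute[of 2] power_mult)
  then show ?thesis using assms(2) by (auto simp: power_minus_even)
qed

end

section \<open>Groups in which every conjugate of an element is the element or its inverse\<close>

lemma mult_of_int_left_commute: "x * (of_int c * y) = of_int c * (x * (y :: 'r::ring_1))"
  by (metis mult.assoc mult_of_int_commute)

lemma square_minus_4: "(t - 2) * (t + 2) = t * t - (4 :: 'r::ring_1)"
  by (simp add: algebra_simps mult_2 mult_2_right)

lemma square_minus_1: "(t - 1) * (t + 1) = t * t - (1 :: 'r::ring_1)"
  by (simp add: algebra_simps)

text \<open>One hypothesis for all groups of the classification: abelian groups satisfy the first
  alternative, and in a Hamiltonian 2-group the exponent 4 leaves only these two possibilities for a
  conjugate.\<close>

locale higman_conj = int_group_ring +
  assumes conj_cases: "\<lbrakk>g \<in> carrier G; h \<in> carrier G\<rbrakk> \<Longrightarrow> h \<otimes> g \<otimes> inv h = g \<or> h \<otimes> g \<otimes> inv h = inv g"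
begin

text \<open>Put \<open>k = g \<otimes> inv h\<close>. Then \<open>inv h \<otimes> g\<close> is a
  conjugate of \<open>k\<close>, hence \<open>k\<close> or \<open>inv k\<close>, and both sides are
  \<open>D k + D (inv k)\<close>.\<close>

lemma norm_polar_D:
  assumes g: "g \<in> carrier G" and h: "h \<in> carrier G"
  shows "D g * D (inv h) + D h * D (inv g) = D (inv h) * D g + D (inv g) * D h"
proof -
  define k where "k = g \<otimes> inv h"
  have k: "k \<in> carrier G" using g h by (simp add: k_def)
  have 1: "inv h \<otimes> g = inv h \<otimes> k \<otimes> inv (inv h)"
    using g h by (simp add: k_def m_assoc)
  have 2: "inv g \<otimes> h = inv (inv h \<otimes> g)" "h \<otimes> inv g = inv k"
    using g h by (simp_all add: k_def inv_mult_group)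
  have "inv h \<otimes> g = k \<or> inv h \<otimes> g = inv k"
    unfolding 1 using conj_cases[OF k, of "inv h"] h by auto
  then show ?thesis
    using g h k 2 by (auto simp: D_mult[symmetric] k_def[symmetric] add.commute)
qed

text \<open>\<open>x * star x\<close> is quadratic; only its polarisation is additive in each
  argument and can be checked on group elements.\<close>

lemma norm_polar:
  assumes x: "x \<in> ZG" and y: "y \<in> ZG"
  shows "x * star y + y * star x = star y * x + star x * y"
  using x
proof (induction rule: ZG_induct)
  case (step c g x)
  have "D g * star y + y * D (inv g) = star y * D g + D (inv g) * y"
    using y
  proof (induction rule: ZG_induct)
    case (step d h z)
    have "D g * star (of_int d * D h + z) + (of_int d * D h + z) * D (inv g) =
        of_int d * (D g * D (inv h) + D h * D (inv g)) + (D g * star z + z * D (inv g))"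
      using step \<open>g \<in> carrier G\<close>
      by (simp add: star_add star_scale star_D distrib_left distrib_right mult.assoc
          mult_of_int_left_commute add_ac)
    also have "\<dots> = of_int d * (D (inv h) * D g + D (inv g) * D h) + (star z * D g + D (inv g) * z)"
      using norm_polar_D[OF \<open>g \<in> carrier G\<close>, of h] step by simp
    also have "\<dots> = star (of_int d * D h + z) * D g + D (inv g) * (of_int d * D h + z)"
      using step \<open>g \<in> carrier G\<close>
      by (simp add: star_add star_scale star_D distrib_left distrib_right mult.assoc
          mult_of_int_left_commute add_ac)
    finally show ?case .
  qed (simp add: star_zero)
  note * = this
  have "(of_int c * D g + x) * star y + y * star (of_int c * D g + x) =
      of_int c * (D g * star y + y * D (inv g)) + (x * star y + y * star x)"
    using step by (simp add: star_add star_scale star_D distrib_left distrib_right mult.assoc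
        mult_of_int_left_commute add_ac)
  also have "\<dots> = of_int c * (star y * D g + D (inv g) * y) + (star y * x + star x * y)"
    using * step by simp
  also have "\<dots> = star y * (of_int c * D g + x) + star (of_int c * D g + x) * y"
    using step by (simp add: star_add star_scale star_D distrib_left distrib_right mult.assoc
        mult_of_int_left_commute add_ac)
  finally show ?case .
qed (simp add: star_zero)

text \<open>The polarised identity at \<open>y = x\<close> is twice the claim, and the ring is
  torsion free.\<close>

lemma norm_normal:
  assumes x: "x \<in> ZG"
  shows "x * star x = star x * x"
proof -
  have "x * star x + x * star x = star x * x + star x * x" by (rule norm_polar[OF x x])
  then have "of_int 2 * (x * star x - star x * x) = 0" by (simp add: algebra_simps mult_2)
  then have "x * star x - star x * x = 0" by (rule ZG_torsion_free[rotated]) (auto simp: x)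
  then show ?thesis by simp
qed

text \<open>For \<open>y = x * star x\<close> normality brings the two factors \<open>x\<close>
  together, so \<open>y * y = 0\<close>. As \<open>star y = y\<close>, positivity gives
  \<open>y = 0\<close>, and then \<open>x = 0\<close>.\<close>

lemma ZG_reduced:
  assumes x: "x \<in> ZG" and 0: "x * x = 0"
  shows "x = 0"
proof -
  define y where "y = x * star x"
  have y: "y \<in> ZG" "star y = y" using x by (simp_all add: y_def star_mult star_star)
  have "y * y = x * (star x * x) * star x" by (simp add: y_def mult.assoc)
  also have "\<dots> = x * (x * star x) * star x" by (simp add: norm_normal x)
  also have "\<dots> = 0" using 0 by (simp add: mult.assoc[symmetric])
  finally have "y = 0" using norm_zeroD[of y] y by simp
  then show ?thesis using norm_zeroD[of x] x by (simp add: y_def)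
qed

text \<open>Conjugation fixes or swaps the two terms, which makes the sum central. A character of
  the cyclic group of \<open>g\<close> sends it to \<open>2 * Re z\<close> for a root of unity
  \<open>z\<close>.\<close>

definition tr2 where "tr2 g = D g + D (inv g)"

lemma tr2_in_ZG [simp]: "g \<in> carrier G \<Longrightarrow> tr2 g \<in> ZG"
  by (simp add: tr2_def)

lemma tr2_central:
  assumes g: "g \<in> carrier G" and x: "x \<in> ZG"
  shows "tr2 g * x = x * tr2 g"
  using x
proof (induction rule: ZG_induct)
  case (step c h x)
  let ?k = "h \<otimes> g \<otimes> inv h"
  have hg: "h \<otimes> g = ?k \<otimes> h" "h \<otimes> inv g = inv ?k \<otimes> h"
    using g step by (simp_all add: m_assoc inv_mult_group)
  have "D h * tr2 g = D (?k \<otimes> h) + D (inv ?k \<otimes> h)"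
    using g step hg by (simp add: tr2_def distrib_left D_mult[symmetric])
  also have "\<dots> = D (g \<otimes> h) + D (inv g \<otimes> h)"
    using conj_cases[OF g \<open>h \<in> carrier G\<close>] g by (elim disjE) (simp_all add: add.commute)
  also have "\<dots> = tr2 g * D h"
    using g step by (simp add: tr2_def distrib_right D_mult[symmetric])
  finally show ?case using step
    by (simp add: distrib_left distrib_right mult.assoc[symmetric] flip: mult_of_int_commute)
       (simp add: mult.assoc)
qed simp

lemma central_mult:
  assumes "\<forall>x\<in>ZG. r * x = x * r" "\<forall>x\<in>ZG. q * x = x * q"
  shows "\<forall>x\<in>ZG. r * q * x = x * (r * q)"
proof
  fix x assume x: "x \<in> ZG"
  have "r * q * x = r * (q * x)" by (rule mult.assoc)
  also have "\<dots> = r * (x * q)" using assms(2) x by simp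
  also have "\<dots> = r * x * q" by (rule mult.assoc[symmetric])
  also have "\<dots> = x * r * q" using assms(1) x by simp
  finally show "r * q * x = x * (r * q)" by (simp only: mult.assoc)
qed

text \<open>Multiply the factors of the vanishing product onto \<open>y\<close> one at a time. The
  last nonzero result is killed by the next factor, so it is an eigenvector; the factors used so far
  form \<open>r\<close>.\<close>

lemma split_eigen:
  assumes "y \<in> ZG" "y \<noteq> 0" and t: "t \<in> ZG" "\<And>x. x \<in> ZG \<Longrightarrow> t * x = x * t"
    and "y * prod_list (map (\<lambda>l. t - of_int l) ls) = 0"
  shows "\<exists>r\<in>ZG. (\<forall>x\<in>ZG. r * x = x * r) \<and> y * r \<noteq> 0 \<and> (\<exists>l::int. t * (y * r) = of_int l * (y * r))"
  using assms(1,2,5)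
proof (induction ls arbitrary: y)
  case (Cons l ls)
  let ?s = "t - of_int l"
  have s: "?s \<in> ZG" "\<And>x. x \<in> ZG \<Longrightarrow> ?s * x = x * ?s"
    using t by (auto simp: algebra_simps mult_of_int_commute)
  show ?case
  proof (cases "y * ?s = 0")
    case True
    then have "t * (y * 1) = of_int l * (y * 1)"
      using t(2)[OF Cons(2)] by (simp add: algebra_simps mult_of_int_commute)
    then show ?thesis using Cons(3) by (intro bexI[of _ 1]) auto
  next
    case False
    have "y * ?s * prod_list (map (\<lambda>l. t - of_int l) ls) = 0"
      using Cons(4) by (simp add: mult.assoc)
    from Cons.IH[OF _ False this] Cons(2) s(1) obtain r where r: "r \<in> ZG" "\<forall>x\<in>ZG. r * x = x * r"
      "y * ?s * r \<noteq> 0" "\<exists>l::int. t * (y * ?s * r) = of_int l * (y * ?s * r)" by auto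
    have "\<forall>x\<in>ZG. ?s * r * x = x * (?s * r)"
      by (rule central_mult[OF _ r(2)]) (use s(2) in blast)
    moreover have "?s * r \<in> ZG" using r(1) s(1) by (rule mult_in_ZG[rotated])
    ultimately show ?thesis using r(3,4) by (intro bexI[of _ "?s * r"] conjI) (simp_all only: mult.assoc simp_thms)
  qed
qed simp

text \<open>Further multiplication by elements of the ring on the right preserves the eigenvector
  equations already obtained, so the splitting can be repeated for every element of
  \<open>A\<close>.\<close>

lemma common_eigen:
  assumes "finite A" "A \<subseteq> carrier G" and y: "y \<in> ZG" "y \<noteq> 0"
    and "\<And>g. g \<in> carrier G \<Longrightarrow> \<exists>ls. prod_list (map (\<lambda>l. tr2 g - of_int l) ls) = 0"
  shows "\<exists>r\<in>ZG. (\<forall>x\<in>ZG. r * x = x * r) \<and> y * r \<noteq> 0 \<and>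
    (\<forall>g\<in>A. \<exists>l::int. tr2 g * (y * r) = of_int l * (y * r))"
  using assms(1,2)
proof (induction A rule: finite_induct)
  case empty
  then show ?case using y by (intro bexI[of _ 1]) auto
next
  case (insert a A)
  then obtain r where r: "r \<in> ZG" "\<forall>x\<in>ZG. r * x = x * r" "y * r \<noteq> 0"
    "\<forall>g\<in>A. \<exists>l::int. tr2 g * (y * r) = of_int l * (y * r)" by auto
  from insert assms(5)[of a] obtain ls where "prod_list (map (\<lambda>l. tr2 a - of_int l) ls) = 0" by auto
  then have "y * r * prod_list (map (\<lambda>l. tr2 a - of_int l) ls) = 0" by simp
  moreover have "a \<in> carrier G" "y * r \<in> ZG" using insert y r(1) by auto
  ultimately obtain q where q: "q \<in> ZG" "\<forall>x\<in>ZG. q * x = x * q" "y * r * q \<noteq> 0"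
    "\<exists>l::int. tr2 a * (y * r * q) = of_int l * (y * r * q)"
    using split_eigen[OF _ r(3) tr2_in_ZG tr2_central] by blast
  have "\<exists>l::int. tr2 g * (y * r * q) = of_int l * (y * r * q)" if "g \<in> A" for g
    using r(4) that by (metis mult.assoc)
  with q(4) have "\<forall>g\<in>insert a A. \<exists>l::int. tr2 g * (y * r * q) = of_int l * (y * r * q)"
    by blast
  moreover have "\<forall>x\<in>ZG. r * q * x = x * (r * q)" by (rule central_mult[OF r(2) q(2)])
  moreover have "r * q \<in> ZG" using r(1) q(1) by simp
  ultimately show ?case using q(3)
    by (intro bexI[of _ "r * q"] conjI) (simp_all only: mult.assoc simp_thms)
qed

text \<open>\<open>x + star x\<close> is an integral combination of the elements
  \<open>tr2 g\<close>, each of which acts on \<open>z\<close> by an integer.\<close>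

lemma star_eigen:
  assumes z: "z \<in> ZG" and t: "\<forall>g\<in>carrier G. \<exists>l::int. tr2 g * z = of_int l * z" and x: "x \<in> ZG"
  shows "\<exists>n::int. (x + star x) * z = of_int n * z"
  using x
proof (induction rule: ZG_induct)
  case zero
  then show ?case by (intro exI[of _ 0]) (simp add: star_zero)
next
  case (step c g x)
  then obtain n where n: "(x + star x) * z = of_int n * z" by auto
  obtain l where l: "tr2 g * z = of_int l * z" using t step by auto
  have *: "(of_int c * D g + x) + star (of_int c * D g + x) = of_int c * tr2 g + (x + star x)"
    using step by (simp add: tr2_def star_add star_scale star_D algebra_simps)
  have "((of_int c * D g + x) + star (of_int c * D g + x)) * z = of_int c * (tr2 g * z) + (x + star x) * z"
    unfolding * by (simp only: distrib_right mult.assoc)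
  also have "\<dots> = of_int (c * l + n) * z"
    unfolding n l by (simp add: distrib_right mult.assoc)
  finally have "((of_int c * D g + x) + star (of_int c * D g + x)) * z = of_int (c * l + n) * z" .
  then show ?case by blast
qed

text \<open>The norm is not additive: expanding it at \<open>of_int c * D g + x\<close> leaves the
  integer \<open>c * c\<close>, a cross term \<open>v + star v\<close> covered by
  \<open>star_eigen\<close>, and the norm of \<open>x\<close>.\<close>

lemma norm_eigen:
  assumes z: "z \<in> ZG" and t: "\<forall>g\<in>carrier G. \<exists>l::int. tr2 g * z = of_int l * z" and x: "x \<in> ZG"
  shows "\<exists>n::int. (x * star x) * z = of_int n * z"
  using x
proof (induction rule: ZG_induct)
  case zero
  then show ?case by (intro exI[of _ 0]) simp
next
  case (step c g x)
  define v where "v = of_int c * (D g * star x)"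
  have v: "v \<in> ZG" "star v = of_int c * (x * D (inv g))"
    using step star_D_mult[of g "star x"] by (simp_all add: v_def star_scale star_star)
  obtain m where m: "(v + star v) * z = of_int m * z" using star_eigen[OF z t v(1)] by auto
  obtain n where n: "(x * star x) * z = of_int n * z" using step by auto
  have "D g * D (inv g) = 1" using step by (simp add: D_mult[symmetric] D_one)
  then have "D g * (of_int c * D (inv g)) = of_int c" by (simp add: mult_of_int_left_commute)
  then have *: "(of_int c * D g + x) * star (of_int c * D g + x) = of_int (c * c) + (v + star v) + x * star x"
    using step unfolding v(2) unfolding v_def
    by (simp add: star_add star_scale star_D distrib_left distrib_right mult.assoc add_ac
        mult_of_int_left_commute[of x])
  have "((of_int c * D g + x) * star (of_int c * D g + x)) * z =
      of_int (c * c) * z + (v + star v) * z + (x * star x) * z"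
    unfolding * by (simp only: distrib_right)
  also have "\<dots> = of_int (c * c + m + n) * z"
    unfolding m n by (simp add: distrib_right)
  finally have "((of_int c * D g + x) * star (of_int c * D g + x)) * z = of_int (c * c + m + n) * z" .
  then show ?case by blast
qed

text \<open>On a common eigenvector of the \<open>tr2 g\<close> the norms of \<open>u\<close> and of
  its inverse act by integers with product 1, so the norm of \<open>u\<close> squares to 1 there.
  Reducedness takes the place of a decomposition of the algebra into simple factors.\<close>

theorem unit_torsion:
  assumes ev: "\<And>g. g \<in> carrier G \<Longrightarrow> \<exists>ls. prod_list (map (\<lambda>l. tr2 g - of_int l) ls) = 0"
    and u: "u \<in> ZG" and v: "v \<in> ZG" and uv: "u * v = 1" "v * u = 1"
  shows "u ^ (2 * card (carrier G)) = 1"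
proof -
  define w where "w = u * star u"
  \<comment> \<open>As \<open>star (star v) = v\<close>, this is \<open>star v * v\<close>, the
    inverse of \<open>w\<close>; it is written as a norm so that \<open>norm_eigen\<close>
    applies.\<close>
  define w' where "w' = star v * star (star v)"
  have w: "w \<in> ZG" "w' \<in> ZG" "star w = w" using u v by (simp_all add: w_def w'_def star_mult star_star)
  have "w' * w = star v * (v * u) * star u" using v by (simp add: w_def w'_def star_star mult.assoc)
  also have "\<dots> = star (u * v)" using u v uv by (simp add: star_mult[symmetric])
  finally have w'w: "w' * w = 1" by (simp add: uv star_one)
  have "w * w = 1"
  proof (rule ccontr)
    assume "w * w \<noteq> 1"
    \<comment> \<open>A nonzero \<open>y\<close> has a multiple \<open>z = y * r\<close> on which
      all \<open>tr2 g\<close> act by integers. There \<open>y\<close> acts as 0, and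
      \<open>z * z = 0\<close> follows because \<open>z\<close> is itself a multiple of
      \<open>y\<close>.\<close>
    define y where "y = w * w - 1"
    have y: "y \<in> ZG" "y \<noteq> 0" using w \<open>w * w \<noteq> 1\<close> by (simp_all add: y_def)
    obtain r where r: "r \<in> ZG" "\<forall>x\<in>ZG. r * x = x * r" "y * r \<noteq> 0"
      "\<forall>g\<in>carrier G. \<exists>l::int. tr2 g * (y * r) = of_int l * (y * r)"
      using common_eigen[OF finite_G order_refl y ev] by blast
    define z where "z = y * r"
    have z: "z \<in> ZG" "z \<noteq> 0" using y r by (simp_all add: z_def)
    obtain n where n: "w * z = of_int n * z"
      using norm_eigen[OF z(1) _ u] r unfolding z_def w_def by blast
    obtain n' where n': "w' * z = of_int n' * z"
      using norm_eigen[OF z(1) _ star_in_ZG[of v]] r unfolding z_def w'_def by blast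
    have "z = w' * (w * z)" using w'w by (simp add: mult.assoc[symmetric])
    also have "\<dots> = of_int n * (w' * z)" unfolding n by (metis mult.assoc mult_of_int_commute)
    also have "\<dots> = of_int (n * n') * z" unfolding n' by (simp add: mult.assoc)
    finally have "of_int (n * n' - 1) * z = 0" by (simp add: left_diff_distrib)
    then have "n * n' - 1 = 0" using ZG_torsion_free[OF z(1)] z(2) by blast
    then have "\<bar>n\<bar> = 1" by (metis abs_zmult_eq_1 eq_iff_diff_eq_0 abs_one)
    then have nn: "n * n = 1" by (metis abs_mult_self_eq mult_1)
    have "w * w * z = of_int n * (w * z)" by (metis n mult.assoc mult_of_int_commute)
    also have "\<dots> = of_int (n * n) * z" by (simp add: n mult.assoc)
    finally have "y * z = 0" using nn by (simp add: y_def left_diff_distrib)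
    have "z * z = y * (r * y) * r" by (simp only: z_def mult.assoc)
    also have "r * y = z" using r(2) y(1) by (simp only: z_def)
    finally have "z * z = 0" using \<open>y * z = 0\<close> by simp
    then show False using ZG_reduced z by blast
  qed
  \<comment> \<open>\<open>w\<close> is its own adjoint, so \<open>w * w = 1\<close> says that its
    coefficients have square sum 1. Its coefficient at \<open>\<one>\<close> is the square sum of
    the coefficients of \<open>u\<close>, a positive integer, hence 1.\<close>
  then have "(\<Sum>g\<in>carrier G. (cf w g)\<^sup>2) = 1" using cf_norm[OF w(1)] w by (simp add: cf_one)
  moreover have "(cf w \<one>)\<^sup>2 \<le> (\<Sum>g\<in>carrier G. (cf w g)\<^sup>2)"
    by (rule member_le_sum) (auto simp: finite_G)
  ultimately have "(cf w \<one>)\<^sup>2 \<le> 1" by simp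
  moreover have "cf w \<one> = (\<Sum>g\<in>carrier G. (cf u g)\<^sup>2)" using cf_norm[OF u] by (simp add: w_def)
  moreover have "(\<Sum>g\<in>carrier G. (cf u g)\<^sup>2) \<ge> 0" by (rule sum_nonneg) auto
  moreover have "(\<Sum>g\<in>carrier G. (cf u g)\<^sup>2) \<noteq> 0"
  proof
    assume "(\<Sum>g\<in>carrier G. (cf u g)\<^sup>2) = 0"
    then have "\<forall>g\<in>carrier G. (cf u g)\<^sup>2 = 0"
      using finite_G by (subst (asm) sum_nonneg_eq_0_iff) auto
    then have "u = 0" by (intro ZG_eqI) (auto simp: u cf_zero)
    then show False using uv by simp
  qed
  ultimately have "(\<Sum>g\<in>carrier G. (cf u g)\<^sup>2) = 1"
    by (simp add: abs_square_le_1)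
  then show ?thesis using norm_oneD[OF u] trivial_unit_torsion by blast
qed

lemma tr2_square:
  assumes g: "g \<in> carrier G"
  shows "tr2 g * tr2 g = tr2 (g [^] (2::nat)) + 2"
proof -
  have ab: "D g * D (inv g) = 1" "D (inv g) * D g = 1"
    using g by (simp_all add: D_mult[symmetric] D_one)
  have "D (g [^] (2::nat)) = D g * D g" "D (inv (g [^] (2::nat))) = D (inv g) * D (inv g)"
    using g by (simp_all add: D_mult[symmetric] numeral_2_eq_2 inv_mult_group)
  then show ?thesis using ab by (simp add: tr2_def distrib_left distrib_right add_ac flip: one_add_one)
qed

text \<open>The values \<open>2 * Re z\<close> at the fourth roots of unity are 0, 2 and -2. For the
  square \<open>s\<close> of \<open>g\<close> one has \<open>g \<otimes> s = inv g\<close>, so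
  \<open>tr2 g\<close> absorbs \<open>D s\<close> and is killed by \<open>tr2 s - 2\<close>.\<close>

lemma eigenvalues_4:
  assumes g: "g \<in> carrier G" and 4: "g [^] (4::nat) = \<one>"
  shows "\<exists>ls. prod_list (map (\<lambda>l. tr2 g - of_int l) ls) = 0"
proof -
  define s where "s = g [^] (2::nat)"
  have s: "s \<in> carrier G" "s \<otimes> s = \<one>" using g 4 by (simp_all add: s_def nat_pow_mult)
  then have "inv s = s" using inv_equality by blast
  have "s \<otimes> g \<otimes> g = \<one>" "s \<otimes> g = g \<otimes> s" using s g by (simp_all add: s_def numeral_2_eq_2 m_assoc)
  then have gs: "g \<otimes> s = inv g" using g s inv_equality[of "g \<otimes> s" g] by simp
  then have "inv g \<otimes> s = g" using g s by (metis m_assoc r_one)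
  then have "tr2 g * D s = tr2 g"
    using g s gs by (simp add: tr2_def distrib_right D_mult[symmetric] add.commute)
  then have "tr2 g * (tr2 s - 2) = 0"
    using \<open>inv s = s\<close> by (simp add: tr2_def[of s] right_diff_distrib distrib_left flip: one_add_one)
  moreover have "prod_list (map (\<lambda>l. tr2 g - of_int l) [0, 2, -2]) = tr2 g * (tr2 g * tr2 g - 4)"
    by (simp add: square_minus_4)
  ultimately have "prod_list (map (\<lambda>l. tr2 g - of_int l) [0, 2, -2]) = 0"
    using tr2_square[OF g] diff_diff_eq2[of "tr2 s" 4 2]
    by (simp add: s_def[symmetric] add_diff_eq[symmetric])
  then show ?thesis by blast
qed

text \<open>The values \<open>2 * Re z\<close> at the sixth roots of unity are 2, 1, -1 and -2. The
  square \<open>s\<close> of \<open>g\<close> has its own square as inverse, whence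
  \<open>tr2 s * tr2 s = tr2 s + 2\<close>.\<close>

lemma eigenvalues_6:
  assumes g: "g \<in> carrier G" and 6: "g [^] (6::nat) = \<one>"
  shows "\<exists>ls. prod_list (map (\<lambda>l. tr2 g - of_int l) ls) = 0"
proof -
  define s where "s = g [^] (2::nat)"
  have s: "s \<in> carrier G" "s \<otimes> s \<otimes> s = \<one>" using g 6 by (simp_all add: s_def nat_pow_mult)
  then have "s [^] (2::nat) = inv s" by (simp add: numeral_2_eq_2 inv_equality)
  then have "tr2 s * tr2 s = tr2 s + 2" using tr2_square[OF s(1)] s by (simp add: tr2_def add.commute)
  moreover have "prod_list (map (\<lambda>l. tr2 g - of_int l) [2, -2, 1, -1]) = (tr2 g * tr2 g - 4) * (tr2 g * tr2 g - 1)"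
    by (simp add: square_minus_4[symmetric] square_minus_1[symmetric] mult.assoc)
  moreover have "(tr2 s - 2) * (tr2 s + 1) = tr2 s * tr2 s - tr2 s - 2"
    by (simp add: algebra_simps mult_2 mult_2_right)
  ultimately have "prod_list (map (\<lambda>l. tr2 g - of_int l) [2, -2, 1, -1]) = 0"
    using tr2_square[OF g] by (simp add: s_def[symmetric] add_diff_eq[symmetric])
  then show ?thesis by blast
qed

theorem higman_unit_torsion:
  assumes "(\<forall>g\<in>carrier G. g [^] (4::nat) = \<one>) \<or> (\<forall>g\<in>carrier G. g [^] (6::nat) = \<one>)"
    and "u \<in> ZG" "v \<in> ZG" "u * v = 1" "v * u = 1"
  shows "u ^ (2 * card (carrier G)) = 1"
proof (rule unit_torsion[OF _ assms(2-)])
  fix g assume "g \<in> carrier G"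
  then show "\<exists>ls. prod_list (map (\<lambda>l. tr2 g - of_int l) ls) = 0"
    using assms(1) eigenvalues_4[of g] eigenvalues_6[of g] by auto
qed

end

section \<open>Integer polynomials at roots of unity\<close>

text \<open>Horner evaluation in an arbitrary ring. Integers are central, so it is multiplicative
  although the target, an endomorphism ring, is not commutative.\<close>

definition ev :: "int poly \<Rightarrow> 'r::ring_1 \<Rightarrow> 'r" where
  "ev P x = fold_coeffs (\<lambda>a y. of_int a + x * y) P 0"

lemma ev_0 [simp]: "ev 0 x = 0"
  by (simp add: ev_def)

lemma ev_pCons [simp]: "ev (pCons a P) x = of_int a + x * ev P x"
  by (cases "P = 0 \<and> a = 0") (auto simp: ev_def)

lemma ev_1 [simp]: "ev 1 x = 1"
  by (simp add: one_pCons)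

lemma ev_add [simp]: "ev (P + Q) x = ev P x + ev Q x"
  by (induction P Q rule: poly_induct2) (auto simp: algebra_simps)

lemma ev_uminus [simp]: "ev (- P) x = - ev P x"
  by (induction P) (auto simp: algebra_simps)

lemma ev_diff [simp]: "ev (P - Q) x = ev P x - ev Q x"
  using ev_add[of P "- Q" x] by simp

lemma ev_smult [simp]: "ev (smult a P) x = of_int a * ev P x"
  by (induction P) (auto simp: distrib_left mult.assoc mult_of_int_left_commute mult_of_int_commute[of _ "of_int a"])

lemma ev_mult [simp]: "ev (P * Q) x = ev P x * ev Q x"
  by (induction P) (auto simp: algebra_simps)

lemma ev_power [simp]: "ev (P ^ k) x = ev P x ^ k"
  by (induction k) auto

lemma ev_sum [simp]: "ev (sum f A) x = (\<Sum>i\<in>A. ev (f i) x)"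
  by (induction A rule: infinite_finite_induct) auto

lemma ev_pcompose: "ev (pcompose P Q) x = ev P (ev Q x)"
  by (induction P) (auto simp: pcompose_pCons)

lemma ev_of_int: "ev P (of_int c) = of_int (poly P c)"
  by (induction P) auto

lemma ev_cnj: "ev P (cnj z) = cnj (ev P z)"
  by (induction P) auto

abbreviation X_pow_minus_1 :: "nat \<Rightarrow> int poly" where
  "X_pow_minus_1 n \<equiv> [:0, 1:] ^ n - 1"

lemma ev_dvd_zero: "\<lbrakk>X_pow_minus_1 n dvd P; x ^ n = 1\<rbrakk> \<Longrightarrow> ev P x = 0"
  by (auto elim!: dvdE)

lemma ev_unit_pair:
  "\<lbrakk>X_pow_minus_1 n dvd P * Q - 1; x ^ n = 1\<rbrakk> \<Longrightarrow> ev P x * ev Q x = 1"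
  using ev_dvd_zero[of n "P * Q - 1" x] by simp

subsection \<open>Reduction of exponents\<close>

text \<open>The remainder modulo \<open>X_pow_minus_1 n\<close>: the value at \<open>k\<close>
  collects the coefficients of all exponents congruent to \<open>k\<close>. Multiplication by the
  variable is the cyclic shift, where \<open>k + n - 1\<close> stands for \<open>k - 1\<close>
  without leaving the naturals.\<close>

definition fold_exp :: "nat \<Rightarrow> int poly \<Rightarrow> nat \<Rightarrow> int" where
  "fold_exp n P = fold_coeffs (\<lambda>a f k. (if k = 0 then a else 0) + f ((k + n - 1) mod n)) P (\<lambda>_. 0)"

lemma fold_exp_0 [simp]: "fold_exp n 0 k = 0"
  by (simp add: fold_exp_def)

lemma fold_exp_pCons [simp]:
  "fold_exp n (pCons a P) k = (if k = 0 then a else 0) + fold_exp n P ((k + n - 1) mod n)"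
  by (cases "P = 0 \<and> a = 0") (auto simp: fold_exp_def)

lemma ev_fold_exp:
  assumes n: "n > 0" and x: "x ^ n = 1"
  shows "ev P x = (\<Sum>k<n. of_int (fold_exp n P k) * x ^ k)"
proof (induction P)
  case (pCons a P)
  have "x * ev P x = (\<Sum>k<n. of_int (fold_exp n P k) * x ^ Suc k)"
    by (simp add: pCons sum_distrib_left mult_of_int_left_commute)
  also have "\<dots> = (\<Sum>k<n. of_int (fold_exp n P ((k + n - 1) mod n)) * x ^ k)"
  proof (rule sum.reindex_bij_witness[of _ "\<lambda>k. (k + n - 1) mod n" "\<lambda>k. Suc k mod n"])
    fix k assume k: "k \<in> {..<n}"
    show 1: "(Suc k mod n + n - 1) mod n = k"
      using k n by (cases "Suc k = n") auto
    show "Suc k mod n \<in> {..<n}" using n by auto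
    have "x ^ (Suc k mod n) = x ^ Suc k"
      using k x by (cases "Suc k = n") auto
    then show "of_int (fold_exp n P ((Suc k mod n + n - 1) mod n)) * x ^ (Suc k mod n) =
        of_int (fold_exp n P k) * x ^ Suc k" by (simp only: 1)
  next
    fix k assume k: "k \<in> {..<n}"
    show "Suc ((k + n - 1) mod n) mod n = k" using k n by (cases k) (auto simp: mod_Suc)
    show "(k + n - 1) mod n \<in> {..<n}" using n by auto
  qed
  finally have *: "x * ev P x = (\<Sum>k<n. of_int (fold_exp n P ((k + n - 1) mod n)) * x ^ k)" .
  have "of_int a = (\<Sum>k<n. of_int (if k = 0 then a else 0) * x ^ k)"
    using n by (subst sum.cong[OF refl, of _ _ "\<lambda>k. if k = 0 then of_int a else 0"]) auto
  then show ?case using * by (simp add: sum.distrib[symmetric] distrib_right)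
qed simp

text \<open>The remainder has degree below \<open>n\<close> and \<open>n\<close> complex roots.
  Identities checked at complex roots of unity pass to other rings in this way.\<close>

lemma fold_exp_zeroI:
  assumes n: "n > 0" and 0: "\<And>z::complex. z ^ n = 1 \<Longrightarrow> ev P z = 0" and k: "k < n"
  shows "fold_exp n P k = 0"
proof -
  define q where "q = (\<Sum>k<n. Polynomial.monom (of_int (fold_exp n P k) :: complex) k)"
  have coeff: "poly.coeff q k = (if k < n then of_int (fold_exp n P k) else 0)" for k
    by (auto simp: q_def coeff_sum)
  have "q = 0"
  proof (rule ccontr)
    assume "q \<noteq> 0"
    have "degree q < n" 
      using \<open>q \<noteq> 0\<close> by (metis coeff leading_coeff_0_iff)
    moreover have "poly q z = 0" if "z ^ n = 1" for z
      using 0[OF that] ev_fold_exp[OF n that, of P] by (simp add: q_def poly_sum poly_monom)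
    then have "{z. z ^ n = 1} \<subseteq> {z. poly q z = 0}" by blast
    then have "card {z::complex. z ^ n = 1} \<le> card {z. poly q z = 0}"
      using poly_roots_finite[OF \<open>q \<noteq> 0\<close>] card_mono by blast
    moreover have "card {z::complex. z ^ n = 1} = n" using n by (simp add: card_roots_unity_eq)
    moreover have "card {z. poly q z = 0} \<le> degree q"
      using \<open>q \<noteq> 0\<close> by (rule card_poly_roots_bound)
    ultimately show False by simp
  qed
  then show ?thesis using coeff[of k] k by simp
qed

subsection \<open>Bass cyclic units\<close>

text \<open>Modulo the sum N of the powers below \<open>n\<close>, the geometric sum A of length
  \<open>a\<close> has the inverse B, because A times B telescopes to a geometric sum of length
  \<open>a * b'\<close>, which is 1 modulo \<open>n\<close>. At 1 the value of \<open>A ^ m\<close>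
  is only congruent to 1 modulo \<open>n\<close>; subtracting a multiple of N, which vanishes at the
  other roots, makes it equal to 1.\<close>

lemma bass_unit:
  assumes n: "n > 0" and co: "coprime a n"
  shows "\<exists>P Q m. m > 0 \<and> X_pow_minus_1 n dvd P * Q - 1 \<and>
    (\<forall>z::complex. z ^ n = 1 \<longrightarrow> z \<noteq> 1 \<longrightarrow> ev P z = (\<Sum>i<a. z ^ i) ^ m)"
proof -
  let ?X = "[:0, 1:] :: int poly"
  define N where "N = (\<Sum>i<n. ?X ^ i)"
  have M: "X_pow_minus_1 n = (?X - 1) * N"
    by (simp add: N_def power_diff_1_eq)
  have polyN: "poly N 1 = int n" by (simp add: N_def poly_sum)
  obtain b where "[a * b = 1] (mod n)" using co cong_solve_coprime_nat by auto
  \<comment> \<open>The shift by \<open>n\<close> keeps the congruence and makes \<open>b'\<close>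
    positive, so that \<open>a * b' - 1\<close> is a true difference.\<close>
  define b' where "b' = b + n"
  have ab1: "[a * b' = 1] (mod n)" using \<open>[a * b = 1] (mod n)\<close> by (simp add: b'_def cong_def distrib_left)
  have "coprime b' n" using ab1 by (metis cong_imp_coprime cong_sym coprime_1_left coprime_mult_left_iff)
  show ?thesis
  proof (cases "a = 0 \<or> b' = 0")
    case True
    \<comment> \<open>\<open>a = 0\<close> is coprime only to 1, and for \<open>n = 1\<close> there
      is no root of unity besides 1 at which a value is prescribed.\<close>
    then have "n = 1" using ab1 co n by (auto simp: b'_def)
    then show ?thesis by (intro exI[of _ 1]) auto
  next
    case False
    then have "a * b' \<ge> 1" by (cases "a * b'") auto
    then have "n dvd a * b' - 1" using ab1 unfolding cong_def by (metis mod_eq_dvd_iff_nat)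
    then obtain c where "a * b' - 1 = n * c" by blast
    then have c: "a * b' = 1 + c * n" using \<open>a * b' \<ge> 1\<close> by (metis le_add_diff_inverse mult.commute)
    \<comment> \<open>Euler's exponent serves \<open>a\<close> and its inverse \<open>b'\<close> at
      once.\<close>
    define m where "m = totient n"
    have m: "m > 0" using n by (simp add: m_def totient_gt_0_iff)
    have pow1: "\<exists>k::int. int e ^ m = 1 + k * int n" if "coprime e n" for e
    proof -
      have "[e ^ m = 1] (mod n)" using euler_theorem[OF that] by (simp add: m_def)
      then have "[int e ^ m = 1] (mod int n)" by (metis cong_int_iff of_nat_1 of_nat_power)
      then have "int n dvd int e ^ m - 1" by (simp add: cong_iff_dvd_diff)
      then obtain k where "int e ^ m - 1 = int n * k" by blast
      then show ?thesis by (intro exI[of _ k]) (simp add: algebra_simps)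
    qed
    obtain k where k: "int a ^ m = 1 + k * int n" using pow1[OF co] by blast
    obtain l where l: "int b' ^ m = 1 + l * int n" using pow1[OF \<open>coprime b' n\<close>] by blast
    define A where "A = (\<Sum>i<a. ?X ^ i)"
    define B where "B = (\<Sum>i<b'. (?X ^ a) ^ i)"
    define C where "C = (\<Sum>i<c. (?X ^ n) ^ i)"
    have "(?X - 1) * A * B = ?X ^ (a * b') - 1"
      using power_diff_1_eq[of ?X a] power_diff_1_eq[of "?X ^ a" b'] by (simp add: A_def B_def power_mult)
    also have "\<dots> = ?X * ((?X ^ n) ^ c - 1) + (?X - 1)"
      by (simp only: c power_add power_one_right power_mult[symmetric] mult.commute[of c]) (simp add: algebra_simps)
    also have "(?X ^ n) ^ c - 1 = (?X - 1) * N * C"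
      using power_diff_1_eq[of "?X ^ n" c] M by (simp add: C_def)
    finally have "(?X - 1) * A * B = ?X * ((?X - 1) * N * C) + (?X - 1)" .
    moreover have "(Y - 1) * (A * B - 1) = (Y - 1) * (Y * N * C)"
      if "(Y - 1) * A * B = Y * ((Y - 1) * N * C) + (Y - 1)" for Y :: "int poly"
      using that by (simp add: algebra_simps)
    ultimately have "(?X - 1) * (A * B - 1) = (?X - 1) * (?X * N * C)" by blast
    moreover have "?X - 1 \<noteq> 0" by (simp add: one_pCons)
    ultimately have "A * B - 1 = ?X * N * C" by (metis mult_left_cancel)
    then have AB: "A * B - 1 = N * (?X * C)" by (simp only: mult_ac)
    have "A * B - 1 dvd (A * B) ^ m - 1"
      using power_diff_1_eq[of "A * B" m] by simp
    then have ABm: "N dvd A ^ m * B ^ m - 1" using AB by (metis dvd_trans dvd_triv_left power_mult_distrib)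
    \<comment> \<open>\<open>N\<close> has the value \<open>n\<close> at 1 and \<open>k\<close> is
      the excess in \<open>a ^ m = 1 + k * n\<close>, so the correction sets the value at 1 to
      1.\<close>
    define P where "P = A ^ m - of_int k * N"
    define Q where "Q = B ^ m - of_int l * N"
    have "P * Q - 1 = (A ^ m * B ^ m - 1) + N * (of_int k * of_int l * N - of_int k * B ^ m - of_int l * A ^ m)"
      by (simp add: P_def Q_def algebra_simps)
    then have "N dvd P * Q - 1" using ABm by (simp only: dvd_add dvd_triv_left)
    then obtain E where E: "P * Q - 1 = N * E" by blast
    have "poly P 1 = 1" using k by (simp add: P_def A_def poly_sum polyN)
    moreover have "poly Q 1 = 1" using l by (simp add: Q_def B_def poly_sum polyN)
    \<comment> \<open>\<open>N\<close> does not vanish at 1, so the cofactor \<open>E\<close> does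
      and supplies the missing linear factor.\<close>
    ultimately have "poly (N * E) 1 = 0" unfolding E[symmetric] by simp
    then have "poly E 1 = 0" using polyN n by simp
    then have "[:-1, 1:] dvd E" by (simp add: poly_eq_0_iff_dvd)
    moreover have "?X - 1 = [:-1, 1:]" by (simp add: one_pCons)
    ultimately have "X_pow_minus_1 n dvd P * Q - 1"
      unfolding E M by (metis mult.commute mult_dvd_mono dvd_refl)
    moreover have "ev P z = (\<Sum>i<a. z ^ i) ^ m" if "z ^ n = 1" "z \<noteq> 1" for z :: complex
    proof -
      have "(z - 1) * (\<Sum>i<n. z ^ i) = 0" using power_diff_1_eq[of z n] that by simp
      then have "(\<Sum>i<n. z ^ i) = 0" using that by simp
      then show ?thesis by (simp add: P_def A_def N_def of_int_poly)
    qed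
    ultimately show ?thesis using m by blast
  qed
qed

subsection \<open>Absolute values on the unit circle\<close>

text \<open>On the unit circle \<open>z * z = 2 * Re z * z - 1\<close>, the recursion of the
  Chebyshev polynomials. It has two terms, so the traces of \<open>ev P z\<close> and
  \<open>z * ev P z\<close> are carried together.\<close>

lemma re_ev:
  "\<exists>E0 E1. \<forall>z. cmod z = 1 \<longrightarrow> 2 * Re (ev P z) = ev E0 (2 * Re z) \<and> 2 * Re (z * ev P z) = ev E1 (2 * Re z)"
proof (induction P)
  case 0
  show ?case by (intro exI[of _ 0]) simp
next
  case (pCons a P)
  then obtain E0 E1 where E: "\<And>z. cmod z = 1 \<Longrightarrow> 2 * Re (ev P z) = ev E0 (2 * Re z)"
    "\<And>z. cmod z = 1 \<Longrightarrow> 2 * Re (z * ev P z) = ev E1 (2 * Re z)" by blast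
  have "2 * Re (ev (pCons a P) z) = ev ([:2 * a:] + E1) (2 * Re z) \<and>
      2 * Re (z * ev (pCons a P) z) = ev ([:0, a:] + [:0, 1:] * E1 - E0) (2 * Re z)"
    if z: "cmod z = 1" for z
  proof -
    have "z * cnj z = 1" using z by (simp add: complex_mult_cnj cmod_def flip: of_real_power of_real_add)
    then have "z * z = complex_of_real (2 * Re z) * z - 1"
      using complex_add_cnj[of z] by (metis add_diff_cancel_right' distrib_left mult.commute of_real_mult)
    then have "z * (z * ev P z) = complex_of_real (2 * Re z) * (z * ev P z) - ev P z"
      by (metis (no_types, lifting) left_diff_distrib mult.assoc mult_1)
    moreover have "Re (complex_of_real (2 * Re z) * (z * ev P z)) = 2 * Re z * Re (z * ev P z)"
      by simp
    ultimately have "2 * Re (z * (z * ev P z)) = 2 * Re z * (2 * Re (z * ev P z)) - 2 * Re (ev P z)"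
      by (simp del: times_complex.sel)
    moreover have "Re (z * complex_of_int a) = Re z * of_int a" by simp
    ultimately show ?thesis using E[OF z] by (simp add: distrib_left del: times_complex.sel)
  qed
  then show ?case by blast
qed

text \<open>In the expanded square of a + z w, with w the value of the shorter polynomial, the mixed
  term is a trace covered by \<open>re_ev\<close>, and \<open>cmod z = 1\<close> removes z from the
  last term.\<close>

lemma cmod_ev_sq:
  "\<exists>F. \<forall>z. cmod z = 1 \<longrightarrow> (cmod (ev P z))\<^sup>2 = ev F (2 * Re z)"
proof (induction P)
  case 0
  show ?case by (intro exI[of _ 0]) simp
next
  case (pCons a P)
  then obtain F where F: "\<And>z. cmod z = 1 \<Longrightarrow> (cmod (ev P z))\<^sup>2 = ev F (2 * Re z)" by blast
  obtain E where E: "\<And>z. cmod z = 1 \<Longrightarrow> 2 * Re (z * ev P z) = ev E (2 * Re z)"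
    using re_ev[of P] by blast
  have sq: "(cmod (of_int a + w))\<^sup>2 = (of_int a)\<^sup>2 + of_int a * (2 * Re w) + (cmod w)\<^sup>2" for w
    unfolding cmod_power2 by (simp add: power2_eq_square algebra_simps)
  have "(cmod (ev (pCons a P) z))\<^sup>2 = ev ([:a * a:] + smult a E + F) (2 * Re z)" if z: "cmod z = 1" for z
  proof -
    have "(cmod (of_int a + z * ev P z))\<^sup>2 = (of_int a)\<^sup>2 + of_int a * (2 * Re (z * ev P z)) + (cmod (z * ev P z))\<^sup>2"
      by (rule sq)
    also have "(cmod (z * ev P z))\<^sup>2 = (cmod (ev P z))\<^sup>2" using z by (simp add: norm_mult)
    finally show ?thesis using E[OF z] F[OF z] by (simp add: power2_eq_square)
  qed
  then show ?case by blast
qed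

text \<open>Reduction modulo the quadratic polynomial with roots \<theta> and \<theta>'. The same
  integers serve both roots, which makes the two values conjugate.\<close>

lemma ev_quadratic:
  fixes \<theta> \<theta>' :: real
  assumes "\<theta> + \<theta>' = of_int s" "\<theta> * \<theta>' = of_int m"
  shows "\<exists>A B :: int. ev F \<theta> = of_int A + of_int B * \<theta> \<and> ev F \<theta>' = of_int A + of_int B * \<theta>'"
proof (induction F)
  case 0
  show ?case by (intro exI[of _ 0]) simp
next
  case (pCons a F)
  then obtain A B :: int where AB: "ev F \<theta> = of_int A + of_int B * \<theta>" "ev F \<theta>' = of_int A + of_int B * \<theta>'" by blast
  have sq: "\<theta> * \<theta> = of_int s * \<theta> - of_int m" "\<theta>' * \<theta>' = of_int s * \<theta>' - of_int m"
    unfolding assms[symmetric] by (simp_all add: algebra_simps)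
  have "\<theta> * (of_int A + of_int B * \<theta>) = of_int A * \<theta> + of_int B * (\<theta> * \<theta>)"
    "\<theta>' * (of_int A + of_int B * \<theta>') = of_int A * \<theta>' + of_int B * (\<theta>' * \<theta>')"
    by (simp_all add: algebra_simps)
  then show ?case unfolding sq
    by (intro exI[of _ "a - B * m"] exI[of _ "A + B * s"]) (simp add: AB algebra_simps)
qed

lemma root_unity_norm: "\<lbrakk>(z::complex) ^ n = 1; n > 0\<rbrakk> \<Longrightarrow> cmod z = 1"
  by (metis norm_one norm_power power_eq_1_iff norm_ge_zero less_not_refl)

text \<open>At an integral trace the squared absolute value of a unit is a nonnegative integer with
  an integral inverse.\<close>

lemma unit_norm_at_integer:
  assumes n: "n > 0" and P: "\<And>z::complex. z ^ n = 1 \<Longrightarrow> ev P z * ev P' z = 1"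
    and z: "z ^ n = 1" "2 * Re z = of_int t"
  shows "cmod (ev P z) = 1"
proof -
  obtain F F' where F: "\<And>z. cmod z = 1 \<Longrightarrow> (cmod (ev P z))\<^sup>2 = ev F (2 * Re z)"
    "\<And>z. cmod z = 1 \<Longrightarrow> (cmod (ev P' z))\<^sup>2 = ev F' (2 * Re z)"
    using cmod_ev_sq[of P] cmod_ev_sq[of P'] by blast
  have *: "(cmod (ev P z))\<^sup>2 = of_int (poly F t)" "(cmod (ev P' z))\<^sup>2 = of_int (poly F' t)"
    using F[OF root_unity_norm[OF z(1) n]] by (simp_all add: z ev_of_int)
  have "(cmod (ev P z))\<^sup>2 * (cmod (ev P' z))\<^sup>2 = 1"
    using arg_cong[OF P[OF z(1)], of cmod] by (simp add: norm_mult power_mult_distrib[symmetric])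
  then have "of_int (poly F t * poly F' t) = (1::real)" unfolding * by simp
  then have "poly F t * poly F' t = 1" by linarith
  moreover have "poly F t \<ge> 0" using *(1) by (metis of_int_0_le_iff zero_le_power2)
  ultimately have "poly F t = 1" by (metis abs_of_nonneg abs_zmult_eq_1 abs_one)
  then have "(cmod (ev P z))\<^sup>2 = 1\<^sup>2" using * by simp
  then show ?thesis by (metis norm_ge_zero power2_eq_imp_eq zero_le_one)
qed

text \<open>The squared absolute values \<open>p\<close> and \<open>p'\<close> at conjugate traces
  have an integral product, and so have those of the inverse unit. These nonnegative integers
  multiply to 1, hence \<open>p * p' = 1\<close>.\<close>

lemma unit_norm_at_quadratic:
  fixes \<theta> \<theta>' :: real
  assumes n: "n > 0" and \<theta>: "\<theta> + \<theta>' = of_int s" "\<theta> * \<theta>' = of_int m"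
    and att: "\<exists>z::complex. z ^ n = 1 \<and> 2 * Re z = \<theta>" "\<exists>z::complex. z ^ n = 1 \<and> 2 * Re z = \<theta>'"
    and P: "\<And>z::complex. z ^ n = 1 \<Longrightarrow> ev P z * ev P' z = 1"
  shows "\<exists>w>0. (\<forall>z. z ^ n = 1 \<longrightarrow> 2 * Re z = \<theta> \<longrightarrow> (cmod (ev P z))\<^sup>2 = w) \<and>
    (\<forall>z. z ^ n = 1 \<longrightarrow> 2 * Re z = \<theta>' \<longrightarrow> (cmod (ev P z))\<^sup>2 = 1 / w) \<and> (\<exists>k::int. w + 1 / w = of_int k)"
proof -
  obtain F F' where F0: "\<And>z. cmod z = 1 \<Longrightarrow> (cmod (ev P z))\<^sup>2 = ev F (2 * Re z)"
    "\<And>z. cmod z = 1 \<Longrightarrow> (cmod (ev P' z))\<^sup>2 = ev F' (2 * Re z)"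
    using cmod_ev_sq[of P] cmod_ev_sq[of P'] by blast
  have F: "(cmod (ev P z))\<^sup>2 = ev F (2 * Re z)" "(cmod (ev P' z))\<^sup>2 = ev F' (2 * Re z)" if "z ^ n = 1" for z
    using F0[OF root_unity_norm[OF that n]] by auto
  have prod: "(cmod (ev P z))\<^sup>2 * (cmod (ev P' z))\<^sup>2 = 1" if "z ^ n = 1" for z
    using arg_cong[OF P[OF that], of cmod] by (simp add: norm_mult power_mult_distrib[symmetric])
  define p where "p = ev F \<theta>" 
  define p' where "p' = ev F \<theta>'"
  define q where "q = ev F' \<theta>" 
  define q' where "q' = ev F' \<theta>'"
  have pq: "p * q = 1" "p \<ge> 0" "p' * q' = 1" "p' \<ge> 0"
    using att F prod unfolding p_def p'_def q_def q'_def by (metis zero_le_power2)+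
  obtain A B :: int where AB: "p = of_int A + of_int B * \<theta>" "p' = of_int A + of_int B * \<theta>'"
    using ev_quadratic[OF \<theta>] unfolding p_def p'_def by blast
  obtain A' B' :: int where AB': "q = of_int A' + of_int B' * \<theta>" "q' = of_int A' + of_int B' * \<theta>'"
    using ev_quadratic[OF \<theta>] unfolding q_def q'_def by blast
  \<comment> \<open>The norm form: the product of conjugates depends on \<theta> and \<theta>' only
    through their sum and their product.\<close>
  have nrm: "(of_int A + of_int B * \<theta>) * (of_int A + of_int B * \<theta>') = of_int (A * A + A * B * s + B * B * m)"
    for A B :: int
  proof -
    have "(of_int A + of_int B * \<theta>) * (of_int A + of_int B * \<theta>') =
      of_int A * of_int A + of_int A * of_int B * (\<theta> + \<theta>') + of_int B * of_int B * (\<theta> * \<theta>')"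
      by (simp add: algebra_simps)
    then show ?thesis unfolding \<theta> by simp
  qed
  obtain i where i: "p * p' = of_int i" using nrm[of A B] AB by metis
  obtain j where j: "q * q' = of_int j" using nrm[of A' B'] AB' by metis
  have "of_int (i * j) = (p * q) * (p' * q')" by (simp only: of_int_mult i[symmetric] j[symmetric] mult_ac)
  then have "of_int (i * j) = (1::real)" using pq by simp
  then have "i * j = 1" by linarith
  moreover have "i \<ge> 0" using i pq by (metis mult_nonneg_nonneg of_int_0_le_iff)
  ultimately have "i = 1" by (metis abs_of_nonneg abs_zmult_eq_1 abs_one)
  then have pp': "p * p' = 1" using i by simp
  then have "p > 0" using pq by (metis less_eq_real_def mult_zero_left zero_neq_one)
  moreover have "p' = 1 / p" using pp' \<open>p > 0\<close> by (simp add: field_simps)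
  moreover have "p + p' = of_int (2 * A + B * s)"
    unfolding AB of_int_add of_int_mult \<theta>[symmetric] by (simp add: algebra_simps)
  moreover have "\<forall>z. z ^ n = 1 \<longrightarrow> 2 * Re z = \<theta> \<longrightarrow> (cmod (ev P z))\<^sup>2 = p"
    using F by (auto simp: p_def)
  moreover have "\<forall>z. z ^ n = 1 \<longrightarrow> 2 * Re z = \<theta>' \<longrightarrow> (cmod (ev P z))\<^sup>2 = p'"
    using F by (auto simp: p'_def)
  ultimately show ?thesis by metis
qed

text \<open>Between 1/2 and 2 the sum \<open>w + 1 / w\<close> stays below 5/2. An integral value is
  therefore at most 2, the minimum, which is attained at 1 alone.\<close>

lemma near_1_integral_trace:
  fixes w :: real
  assumes "w > 0" "w + 1 / w = of_int k" "\<bar>ln w\<bar> < ln 2"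
  shows "w = 1"
proof -
  have w: "w < 2" "1 / 2 < w"
    using assms(1,3) ln_less_cancel_iff[of w 2] ln_less_cancel_iff[of "1/2" w]
    by (auto simp: abs_less_iff ln_div)
  then have "(w - 2) * (w - 1 / 2) < 0" by (intro mult_neg_pos) auto
  then have "w * w + 1 < w * (5 / 2)" by (simp add: algebra_simps add_divide_distrib diff_divide_distrib)
  then have "w * (w + 1 / w) < w * (5 / 2)" using assms(1) by (simp add: algebra_simps)
  then have "of_int k < (5 / 2 :: real)" using assms(1,2) by simp
  then have "of_int k < (3::real)" by linarith
  then have "k \<le> 2" by linarith
  have "w + 1 / w \<le> 2" using \<open>k \<le> 2\<close> unfolding assms(2) by linarith
  then have "w * (w + 1 / w) \<le> w * 2" using assms(1) by (intro mult_left_mono) auto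
  then have "(w - 1) * (w - 1) \<le> 0" using assms(1) by (simp add: algebra_simps)
  then show ?thesis by (metis mult_eq_0_iff eq_iff_diff_eq_0 linorder_not_le not_real_square_gt_zero)
qed

text \<open>Only one orbit of Galois conjugate values is not made of integers, so the absolute values
  of a unit form a single real number and two units have multiplicatively dependent ones:
  Dirichlet approximation makes a product of powers close to 1, and integrality makes it equal.\<close>

lemma quadratic_units_dep:
  fixes \<theta> \<theta>' :: real
  assumes n: "n > 0" and \<theta>: "\<theta> + \<theta>' = of_int s" "\<theta> * \<theta>' = of_int m"
    and att: "\<exists>z::complex. z ^ n = 1 \<and> 2 * Re z = \<theta>" "\<exists>z::complex. z ^ n = 1 \<and> 2 * Re z = \<theta>'"
    and roots: "\<And>z::complex. z ^ n = 1 \<Longrightarrow> (\<exists>t::int. 2 * Re z = of_int t) \<or> 2 * Re z = \<theta> \<or> 2 * Re z = \<theta>'"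
    and P: "\<And>z::complex. z ^ n = 1 \<Longrightarrow> ev P z * ev P' z = 1"
    and Q: "\<And>z::complex. z ^ n = 1 \<Longrightarrow> ev Q z * ev Q' z = 1"
  shows "\<exists>a b. (a, b) \<noteq> (0, 0) \<and> ((\<forall>z. z ^ n = 1 \<longrightarrow> cmod (ev (P ^ a * Q ^ b) z) = 1) \<or>
    (\<forall>z. z ^ n = 1 \<longrightarrow> cmod (ev (P ^ a * Q' ^ b) z) = 1))"
proof -
  \<comment> \<open>If the value at \<theta> is close to 1, integrality of \<open>w + 1 / w\<close>
    makes it equal to 1, there and at \<theta>'. At integral traces every unit has absolute value
    1.\<close>
  have one: "\<forall>z. z ^ n = 1 \<longrightarrow> cmod (ev W z) = 1"
    if W: "\<And>z::complex. z ^ n = 1 \<Longrightarrow> ev W z * ev W' z = 1"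
      and l: "\<exists>z::complex. z ^ n = 1 \<and> 2 * Re z = \<theta> \<and> \<bar>ln ((cmod (ev W z))\<^sup>2)\<bar> < ln 2" for W W'
  proof (intro allI impI)
    fix z :: complex assume z: "z ^ n = 1"
    obtain w k where w: "w > 0" "\<And>z. z ^ n = 1 \<Longrightarrow> 2 * Re z = \<theta> \<Longrightarrow> (cmod (ev W z))\<^sup>2 = w"
      "\<And>z. z ^ n = 1 \<Longrightarrow> 2 * Re z = \<theta>' \<Longrightarrow> (cmod (ev W z))\<^sup>2 = 1 / w" "w + 1 / w = of_int (k::int)"
      using unit_norm_at_quadratic[OF n \<theta> att W] by metis
    have "w = 1" using l w by (intro near_1_integral_trace[of w k]) auto
    then have sq: "2 * Re z = \<theta> \<or> 2 * Re z = \<theta>' \<Longrightarrow> (cmod (ev W z))\<^sup>2 = 1\<^sup>2" using w z by auto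
    from roots[OF z] show "cmod (ev W z) = 1"
    proof (elim disjE exE)
      fix t assume "2 * Re z = real_of_int t"
      then show ?thesis using unit_norm_at_integer[OF n W z] by blast
    qed (use sq in \<open>metis norm_ge_zero power2_eq_imp_eq zero_le_one\<close>)+
  qed
  obtain z0 :: complex where z0: "z0 ^ n = 1" "2 * Re z0 = \<theta>" using att by blast
  define f where "f = ln ((cmod (ev P z0))\<^sup>2)"
  define g where "g = ln ((cmod (ev Q z0))\<^sup>2)"
  have nz: "cmod (ev P z0) > 0" "cmod (ev Q z0) > 0" "cmod (ev Q' z0) > 0"
    using P[OF z0(1)] Q[OF z0(1)] by (auto simp: mult_eq_0_iff)
  have ln2: "ln 2 > (0::real)" by simp
  show ?thesis
  proof (cases "g = 0")
    case True
    have "\<forall>z. z ^ n = 1 \<longrightarrow> cmod (ev Q z) = 1"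
      by (rule one[of Q Q']) (use Q True z0 ln2 in \<open>auto simp: g_def\<close>)
    then show ?thesis by (intro exI[of _ 0] exI[of _ 1]) auto
  next
    case False
    \<comment> \<open>The Dirichlet error, at most \<open>1 / N\<close>, gets multiplied by
      \<open>\<bar>g\<bar>\<close>; this choice keeps the product below \<open>ln 2\<close>, the
      tolerance of \<open>near_1_integral_trace\<close>.\<close>
    define N where "N = nat \<lceil>\<bar>g\<bar> / ln 2\<rceil> + 1"
    have N: "real N > \<bar>g\<bar> / ln 2" "N > 0" unfolding N_def by linarith+
    obtain h k where hk: "0 < k" "\<bar>of_int k * (f / g) - of_int h\<bar> < 1 / N"
      using Dirichlet_approx[OF N(2), of "f / g"] by blast
    have "\<bar>of_int k * f - of_int h * g\<bar> = \<bar>of_int k * (f / g) - of_int h\<bar> * \<bar>g\<bar>"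
      using False by (simp add: abs_mult[symmetric] left_diff_distrib)
    also have "\<dots> < 1 / N * \<bar>g\<bar>" using hk False by (intro mult_strict_right_mono) auto
    also have "\<dots> < ln 2" using N by (simp add: field_simps)
    finally have small: "\<bar>of_int k * f - of_int h * g\<bar> < ln 2" .
    have lnp: "ln ((cmod (ev (P ^ a * R ^ b) z0))\<^sup>2) = real a * f + real b * ln ((cmod (ev R z0))\<^sup>2)"
      if "cmod (ev R z0) > 0" for a b R
      using nz that by (simp add: f_def norm_mult norm_power power_mult_distrib ln_mult ln_realpow power2_eq_square algebra_simps)
    have unit: "ev (P ^ a * R ^ b) z * ev (P' ^ a * R' ^ b) z = 1"
      if "\<And>z::complex. z ^ n = 1 \<Longrightarrow> ev R z * ev R' z = 1" "z ^ n = 1" for a b R R' and z :: complex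
    proof -
      have "ev (P ^ a * R ^ b) z * ev (P' ^ a * R' ^ b) z = (ev P z * ev P' z) ^ a * (ev R z * ev R' z) ^ b"
        by (simp add: power_mult_distrib mult_ac)
      then show ?thesis using P that by simp
    qed
    have "(cmod (ev Q z0))\<^sup>2 * (cmod (ev Q' z0))\<^sup>2 = 1"
      using arg_cong[OF Q[OF z0(1)], of cmod] by (simp add: norm_mult power_mult_distrib[symmetric])
    then have "ln ((cmod (ev Q z0))\<^sup>2) + ln ((cmod (ev Q' z0))\<^sup>2) = 0"
      using nz ln_mult[of "(cmod (ev Q z0))\<^sup>2" "(cmod (ev Q' z0))\<^sup>2"] by simp
    then have g': "ln ((cmod (ev Q' z0))\<^sup>2) = - g" by (simp add: g_def)
    show ?thesis
    \<comment> \<open>Polynomials have natural exponents, so a positive \<open>h\<close> is realised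
      through the inverse unit \<open>Q'\<close>.\<close>
    proof (cases "h \<le> 0")
      case True
      have "\<bar>ln ((cmod (ev (P ^ nat k * Q ^ nat (- h)) z0))\<^sup>2)\<bar> < ln 2"
        unfolding lnp[OF nz(2)] g_def[symmetric] using small hk True by simp
      then have "\<forall>z. z ^ n = 1 \<longrightarrow> cmod (ev (P ^ nat k * Q ^ nat (- h)) z) = 1"
        using z0 by (intro one[OF unit[OF Q]]) auto
      then show ?thesis using hk by (intro exI[of _ "nat k"] exI[of _ "nat (- h)"]) auto
    next
      case False
      have Q'': "\<And>z::complex. z ^ n = 1 \<Longrightarrow> ev Q' z * ev Q z = 1" using Q by (simp add: mult.commute)
      have "\<bar>ln ((cmod (ev (P ^ nat k * Q' ^ nat h) z0))\<^sup>2)\<bar> < ln 2"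
        unfolding lnp[OF nz(3)] g' using small hk False by simp
      then have "\<forall>z. z ^ n = 1 \<longrightarrow> cmod (ev (P ^ nat k * Q' ^ nat h) z) = 1"
        using z0 by (intro one[OF unit[OF Q'']]) auto
      then show ?thesis using hk by (intro exI[of _ "nat k"] exI[of _ "nat h"]) auto
    qed
  qed
qed

section \<open>Units in group rings of cyclic groups\<close>

lemma root_unity_trace:
  assumes z: "(z::complex) ^ n = 1" and n: "n > 0"
  shows "z * z = complex_of_real (2 * Re z) * z - 1" "z \<noteq> 0"
proof -
  have "z * cnj z = 1" using root_unity_norm[OF z n] by (simp add: complex_norm_square[symmetric])
  then show "z * z = complex_of_real (2 * Re z) * z - 1"
    using complex_add_cnj[of z] by (metis add_diff_cancel_right' distrib_left mult.commute)
  show "z \<noteq> 0" using z n by (auto simp: zero_power)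
qed

text \<open>For commuting invertible elements this is a relation with integral exponents that are
  not both 0: up to inversion the exponents have equal or opposite signs, and no inverse has to be
  written.\<close>

definition mult_dep :: "'r::monoid_mult \<Rightarrow> 'r \<Rightarrow> bool" where
  "mult_dep u v \<longleftrightarrow> (\<exists>a b :: nat. (a, b) \<noteq> (0, 0) \<and> (u ^ a * v ^ b = 1 \<or> u ^ a = v ^ b))"

lemma ev_commute: "x * ev P x = ev P x * x"
proof -
  have "ev ([:0, 1:] * P) x = ev (P * [:0, 1:]) x" by (simp only: mult.commute)
  then show ?thesis by (simp only: ev_mult) simp
qed

context int_group_ring
begin

definition unit_pair :: "'r \<Rightarrow> 'r \<Rightarrow> bool" where
  "unit_pair u v \<longleftrightarrow> u \<in> ZG \<and> v \<in> ZG \<and> u * v = 1 \<and> v * u = 1"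

lemma ord_pos: "x \<in> carrier G \<Longrightarrow> ord x > 0"
  using ord_ge_1[OF finite_G] by force

lemma D_ord: "x \<in> carrier G \<Longrightarrow> D x ^ ord x = 1"
  by (simp add: D_power D_one)

lemma ev_D_in_ZG [simp]: "x \<in> carrier G \<Longrightarrow> ev P (D x) \<in> ZG"
  by (induction P) auto

lemma cf_sum_powers:
  assumes x: "x \<in> carrier G" and k: "k < ord x"
  shows "cf (\<Sum>i<ord x. of_int (c i) * D x ^ i) (x [^] k) = c k"
proof -
  have inj: "inj_on (\<lambda>i. x [^] i) {..<ord x}"
    by (rule inj_on_subset[OF ord_inj[OF x]]) (use ord_pos[OF x] in auto)
  have "cf (\<Sum>i<ord x. of_int (c i) * D x ^ i) (x [^] k) =
      (\<Sum>i<ord x. c i * cf (D (x [^] i)) (x [^] k))"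
    using x by (subst cf_sum) (auto simp: cf_scale D_power)
  also have "\<dots> = (\<Sum>i<ord x. if i = k then c i else 0)"
    by (rule sum.cong) (use x k inj in \<open>auto simp: cf_D dest: inj_onD\<close>)
  also have "\<dots> = c k" using k by simp
  finally show ?thesis .
qed

text \<open>The powers of \<open>D x\<close> below the order are independent, so the whole remainder
  of \<open>P\<close> vanishes. Relations in the group ring can thus be read at complex roots of
  unity.\<close>

lemma ev_D_zeroD:
  assumes x: "x \<in> carrier G" and 0: "ev P (D x) = 0" and z: "z ^ ord x = 1"
  shows "ev P (z::complex) = 0"
proof -
  have "(\<Sum>k<ord x. of_int (fold_exp (ord x) P k) * D x ^ k) = 0"
    using ev_fold_exp[OF ord_pos[OF x] D_ord[OF x], of P] 0 by simp
  then have "fold_exp (ord x) P k = 0" if "k < ord x" for k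
    using cf_sum_powers[OF x that, of "fold_exp (ord x) P"] by (simp add: cf_zero)
  then show ?thesis using ev_fold_exp[OF ord_pos[OF x] z, of P] by simp
qed

text \<open>The way back: vanishing at all these roots of unity makes the remainder 0.\<close>

lemma ev_D_zeroI:
  assumes x: "x \<in> carrier G" and 0: "\<And>z::complex. z ^ ord x = 1 \<Longrightarrow> ev P z = 0"
  shows "ev P (D x) = 0"
  using ev_fold_exp[OF ord_pos[OF x] D_ord[OF x], of P] fold_exp_zeroI[OF ord_pos[OF x] 0] by simp

lemma star_ev:
  assumes x: "x \<in> carrier G"
  shows "star (ev P (D x)) = ev P (D (inv x))"
proof (induction P)
  case (pCons a P)
  have "star (of_int a) = of_int a" using star_scale[OF one_in_ZG, of a] star_one by simp
  then show ?case
    using x pCons star_D_mult[of x "ev P (D x)"] ev_commute[of "D (inv x)" P] by (simp add: star_add)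
qed (simp add: star_zero)

lemma inv_eq_pow: "x \<in> carrier G \<Longrightarrow> inv x = x [^] (ord x - 1)"
  using ord_pos[of x] by (intro inv_equality) (auto simp flip: nat_pow_Suc)

text \<open>A form of Kronecker's theorem: absolute value 1 at all roots makes the element inverse
  to its adjoint, and integral coefficients then leave only signed group elements.\<close>

lemma torsion_of_norm_1:
  assumes x: "x \<in> carrier G" and 1: "\<And>z::complex. z ^ ord x = 1 \<Longrightarrow> cmod (ev W z) = 1"
  shows "ev W (D x) ^ (2 * card (carrier G)) = 1"
proof -
  let ?n = "ord x"
  \<comment> \<open>The exponent \<open>ord x - 1\<close> is inversion in the group and conjugation
    at the roots of unity: \<open>V\<close> takes the squared absolute value of
    \<open>ev W z\<close> at \<open>z\<close>, and the norm of \<open>ev W (D x)\<close> at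
    \<open>D x\<close>.\<close>
  define V where "V = W * pcompose W ([:0, 1:] ^ (?n - 1))"
  have "ev (V - 1) z = 0" if z: "z ^ ?n = 1" for z :: complex
  proof -
    have "z * z ^ (?n - 1) = 1" using z ord_pos[OF x] by (simp flip: power_Suc)
    moreover have "z * cnj z = 1"
      using root_unity_norm[OF z ord_pos[OF x]] by (simp add: complex_norm_square[symmetric])
    ultimately have "z ^ (?n - 1) = cnj z" by (metis mult_cancel_left mult_zero_left zero_neq_one)
    then show ?thesis using 1[OF z]
      by (simp add: V_def ev_pcompose ev_cnj complex_norm_square[symmetric])
  qed
  then have "ev (V - 1) (D x) = 0" by (rule ev_D_zeroI[OF x])
  then have V1: "ev V (D x) = 1" by simp
  let ?U = "ev W (D x)"
  have "star ?U = ev W (D x ^ (?n - 1))"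
    using x by (simp add: star_ev inv_eq_pow D_power)
  then have "?U * star ?U = 1" using V1 by (simp add: V_def ev_pcompose)
  then have "(\<Sum>g\<in>carrier G. (cf ?U g)\<^sup>2) = 1" using cf_norm[of ?U] x by (simp add: cf_one)
  then show ?thesis using norm_oneD[of ?U] x trivial_unit_torsion by auto
qed

lemma ZG_cyclic:
  assumes x: "x \<in> carrier G" "carrier G = range (\<lambda>k::nat. x [^] k)" and r: "r \<in> ZG"
  shows "\<exists>P. r = ev P (D x)"
  using r
proof (induction rule: ZG_induct)
  case zero
  show ?case by (intro exI[of _ 0]) simp
next
  case (step c g r)
  then obtain P where P: "r = ev P (D x)" by blast
  obtain k :: nat where "g = x [^] k" using step x by auto
  then show ?case
    by (intro exI[of _ "Polynomial.smult c ([:0, 1:] ^ k) + P"]) (simp add: P D_power[OF x(1)])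
qed

lemma cyclic_units_dep:
  fixes \<theta> \<theta>' :: real
  assumes x: "x \<in> carrier G" "carrier G = range (\<lambda>k::nat. x [^] k)"
    and \<theta>: "\<theta> + \<theta>' = of_int s" "\<theta> * \<theta>' = of_int m"
    and att: "\<exists>z::complex. z ^ ord x = 1 \<and> 2 * Re z = \<theta>" "\<exists>z::complex. z ^ ord x = 1 \<and> 2 * Re z = \<theta>'"
    and roots: "\<And>z::complex. z ^ ord x = 1 \<Longrightarrow> (\<exists>t::int. 2 * Re z = of_int t) \<or> 2 * Re z = \<theta> \<or> 2 * Re z = \<theta>'"
    and u: "unit_pair u u'" and v: "unit_pair v v'"
  shows "mult_dep u v"
proof -
  obtain P P' Q Q' where P: "u = ev P (D x)" "u' = ev P' (D x)" and Q: "v = ev Q (D x)" "v' = ev Q' (D x)"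
    using ZG_cyclic[OF x] u v unfolding unit_pair_def by metis
  have PP: "ev P z * ev P' z = 1" and QQ: "ev Q z * ev Q' z = 1" if "z ^ ord x = 1" for z :: complex
    using ev_D_zeroD[OF x(1) _ that, of "P * P' - 1"] ev_D_zeroD[OF x(1) _ that, of "Q * Q' - 1"] u v
    by (simp_all add: unit_pair_def P Q)
  \<comment> \<open>Absolute value 1 gives triviality only up to torsion, which this exponent
    removes.\<close>
  let ?N = "2 * card (carrier G)"
  have N: "?N > 0" using finite_G one_closed by (simp add: card_gt_0_iff) blast
  have comm: "ev A (D x) * ev B (D x) = ev B (D x) * ev A (D x)" for A B
    using ev_mult[of A B "D x"] ev_mult[of B A "D x"] by (simp add: mult.commute)
  have pow: "(ev A (D x) ^ a * ev B (D x) ^ b) ^ k = ev A (D x) ^ (a * k) * ev B (D x) ^ (b * k)" for A B a b k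
  proof -
    have "ev ((A ^ a * B ^ b) ^ k) (D x) = ev (A ^ (a * k) * B ^ (b * k)) (D x)"
      by (simp only: power_mult_distrib power_mult)
    then show ?thesis by simp
  qed
  obtain a b where ab: "(a, b) \<noteq> (0, 0)" and
    "(\<forall>z. z ^ ord x = 1 \<longrightarrow> cmod (ev (P ^ a * Q ^ b) z) = 1) \<or>
     (\<forall>z. z ^ ord x = 1 \<longrightarrow> cmod (ev (P ^ a * Q' ^ b) z) = 1)"
    using quadratic_units_dep[OF ord_pos[OF x(1)] \<theta> att roots PP QQ] by blast
  then consider "ev (P ^ a * Q ^ b) (D x) ^ ?N = 1" | "ev (P ^ a * Q' ^ b) (D x) ^ ?N = 1"
    using torsion_of_norm_1[OF x(1)] by blast
  then show ?thesis
  proof cases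
    case 1
    then have "u ^ (a * ?N) * v ^ (b * ?N) = 1" by (simp add: pow P Q)
    moreover have "(a * ?N, b * ?N) \<noteq> (0, 0)" using ab N by simp
    ultimately show ?thesis unfolding mult_dep_def by blast
  next
    case 2
    then have *: "u ^ (a * ?N) * v' ^ (b * ?N) = 1" by (simp add: pow P Q)
    have "v' ^ (b * ?N) * v ^ (b * ?N) = 1"
    proof -
      have "v' ^ k * v ^ k = 1" for k
      proof -
        have "v' ^ k * v ^ k = ev ((Q' * Q) ^ k) (D x)" by (simp add: power_mult_distrib Q)
        also have "\<dots> = (v' * v) ^ k" by (simp add: Q)
        finally show ?thesis using v by (simp add: unit_pair_def)
      qed
      then show ?thesis .
    qed
    \<comment> \<open>Multiplying by a power of \<open>v\<close> trades the inverse
      \<open>v'\<close> for the second form of \<open>mult_dep\<close>.\<close>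
    then have "u ^ (a * ?N) * v' ^ (b * ?N) * v ^ (b * ?N) = u ^ (a * ?N)" by (simp only: mult.assoc mult_1_right)
    then have "u ^ (a * ?N) = v ^ (b * ?N)" unfolding * by simp
    moreover have "(a * ?N, b * ?N) \<noteq> (0, 0)" using ab N by simp
    ultimately show ?thesis unfolding mult_dep_def by blast
  qed
qed

end

subsection \<open>Traces of roots of unity\<close>

lemma Re_pow_unit:
  assumes z: "(z::complex) ^ n = 1" and n: "n > 0"
  defines "t \<equiv> 2 * Re z"
  shows "2 * Re (z ^ 2) = t\<^sup>2 - 2" "2 * Re (z ^ 3) = t ^ 3 - 3 * t"
proof -
  have sq: "z * z = complex_of_real t * z - 1" using root_unity_trace[OF z n] by (simp add: t_def)
  have "Re (z * z) = t * Re z - 1" unfolding sq by simp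
  then show 2: "2 * Re (z ^ 2) = t\<^sup>2 - 2" by (simp add: power2_eq_square t_def del: times_complex.sel)
  have "z * (z * z) = z * (complex_of_real t * z - 1)" by (simp only: sq)
  then have "z * (z * z) = complex_of_real t * (z * z) - z" by (simp only: right_diff_distrib mult_ac mult_1_right mult_1_left)
  then have "Re (z * (z * z)) = t * Re (z * z) - Re z" by simp
  then show "2 * Re (z ^ 3) = t ^ 3 - 3 * t" using \<open>Re (z * z) = t * Re z - 1\<close>
    by (simp add: power3_eq_cube power2_eq_square t_def algebra_simps del: times_complex.sel)
qed

text \<open>\<open>z ^ 3\<close> is the complex conjugate of \<open>z ^ 2\<close>. Equating the real
  parts gives a cubic in the trace with the factor \<open>t - 2\<close>.\<close>

lemma roots_5:
  assumes z: "(z::complex) ^ 5 = 1"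
  shows "2 * Re z = 2 \<or> (2 * Re z)\<^sup>2 + 2 * Re z = 1"
proof -
  define t where "t = 2 * Re z"
  have "z\<^sup>2 * z ^ 3 = 1" using z by (simp flip: power_add)
  moreover have "z\<^sup>2 * cnj (z\<^sup>2) = 1"
    using root_unity_norm[OF z] by (simp add: complex_norm_square[symmetric] norm_power del: complex_cnj_power)
  ultimately have "z ^ 3 = cnj (z\<^sup>2)" by (metis mult_cancel_left mult_zero_left zero_neq_one)
  then have "Re (z ^ 3) = Re (z\<^sup>2)" by (metis complex_cnj(1) cnj.simps(1))
  then have "t ^ 3 - 3 * t = t\<^sup>2 - 2" using Re_pow_unit[OF z] by (simp add: t_def)
  then have "(t - 2) * (t\<^sup>2 + t - 1) = 0" by (simp add: algebra_simps power2_eq_square power3_eq_cube)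
  then have "t - 2 = 0 \<or> t\<^sup>2 + t - 1 = 0" by (rule mult_eq_0_iff[THEN iffD1])
  then have "t = 2 \<or> t\<^sup>2 + t = 1" by linarith
  then show ?thesis unfolding t_def .
qed

text \<open>The angle is doubled twice: the trace of \<open>z ^ 4\<close> is 2 or -2.\<close>

lemma roots_8:
  assumes z: "(z::complex) ^ 8 = 1"
  shows "2 * Re z \<in> {0, 2, -2, sqrt 2, - sqrt 2}"
proof -
  define t where "t = 2 * Re z"
  have z2: "(z\<^sup>2) ^ 4 = 1" and z4: "(z ^ 4)\<^sup>2 = 1" using z by (simp_all flip: power_mult)
  define r where "r = t\<^sup>2 - 2"
  have "2 * Re ((z\<^sup>2)\<^sup>2) = r\<^sup>2 - 2"
    using Re_pow_unit(1)[OF z] Re_pow_unit(1)[OF z2] by (simp add: r_def t_def)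
  moreover have "z ^ 4 = 1 \<or> z ^ 4 = -1" using z4 power2_eq_1_iff by blast
  ultimately have "r\<^sup>2 = 4 \<or> r\<^sup>2 = 0" by (auto simp flip: power_mult)
  then have "r\<^sup>2 = 2\<^sup>2 \<or> r = 0" by auto
  then have "r = 2 \<or> r = -2 \<or> r = 0" by (metis power2_eq_iff)
  then have "t\<^sup>2 = 2\<^sup>2 \<or> t\<^sup>2 = 0 \<or> t\<^sup>2 = (sqrt 2)\<^sup>2" by (auto simp: r_def)
  then have "t = 2 \<or> t = -2 \<or> t = 0 \<or> t = sqrt 2 \<or> t = - sqrt 2"
    unfolding power2_eq_iff by auto
  then show ?thesis unfolding t_def[symmetric] by blast
qed

text \<open>The angle is tripled and then doubled: the trace of \<open>z ^ 6\<close> is 2 or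
  -2.\<close>

lemma roots_12:
  assumes z: "(z::complex) ^ 12 = 1"
  shows "2 * Re z \<in> {0, 1, -1, 2, -2, sqrt 3, - sqrt 3}"
proof -
  define t where "t = 2 * Re z"
  define r where "r = t ^ 3 - 3 * t"
  have z3: "(z ^ 3) ^ 4 = 1" and z6: "(z ^ 6)\<^sup>2 = 1" using z by (simp_all flip: power_mult)
  have r: "2 * Re (z ^ 3) = r" using Re_pow_unit(2)[OF z] by (simp add: r_def t_def)
  then have "2 * Re ((z ^ 3)\<^sup>2) = r\<^sup>2 - 2" using Re_pow_unit(1)[OF z3] by simp
  moreover have "z ^ 6 = 1 \<or> z ^ 6 = -1" using z6 power2_eq_1_iff by blast
  ultimately have "r\<^sup>2 = 4 \<or> r\<^sup>2 = 0" by (auto simp flip: power_mult)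
  then have "r\<^sup>2 = 2\<^sup>2 \<or> r = 0" by auto
  then have "r = 2 \<or> r = -2 \<or> r = 0" by (metis power2_eq_iff)
  \<comment> \<open>These are the equations \<open>t ^ 3 - 3 * t = 2\<close>, \<open>= -2\<close>
    and \<open>= 0\<close> in factored form.\<close>
  then have "(t - 2) * ((t + 1) * (t + 1)) = 0 \<or> (t + 2) * ((t - 1) * (t - 1)) = 0 \<or> t * (t\<^sup>2 - (sqrt 3)\<^sup>2) = 0"
    by (auto simp: r_def algebra_simps power2_eq_square power3_eq_cube)
  then have "t = 2 \<or> t = -1 \<or> t = -2 \<or> t = 1 \<or> t = 0 \<or> t\<^sup>2 = (sqrt 3)\<^sup>2" by auto
  then show ?thesis unfolding t_def[symmetric] power2_eq_iff by blast
qed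

lemma cis_root: "n > 0 \<Longrightarrow> cis (2 * pi / real n) ^ n = 1"
  by (simp add: Complex.DeMoivre)

text \<open>For these orders one pair of conjugate quadratic traces occurs besides the integral
  ones; the fields are those of the square roots of 5, 2 and 3.\<close>

lemma (in int_group_ring) units_dep_5_8_12:
  assumes x: "x \<in> carrier G" "carrier G = range (\<lambda>k::nat. x [^] k)" and n: "ord x \<in> {5, 8, 12}"
    and u: "unit_pair u u'" and v: "unit_pair v v'"
  shows "mult_dep u v"
proof -
  consider "ord x = 5" | "ord x = 8" | "ord x = 12" using n by auto
  then show ?thesis
  proof cases
    case 1
    define z where "z = cis (2 * pi / 5)"
    have z: "z ^ 5 = 1" using cis_root[of 5] by (simp add: z_def)
    have "cos (2 * pi / 5) < cos 0" by (rule cos_monotone_0_pi) auto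
    then have z1: "2 * Re z \<noteq> 2" by (simp add: z_def)
    define \<theta> where "\<theta> = 2 * Re z"
    have th: "\<theta>\<^sup>2 = 1 - \<theta>" using roots_5[OF z] z1 by (simp add: \<theta>_def)
    \<comment> \<open>Squaring \<open>z\<close> exchanges the conjugates: the new trace is the
      square of \<theta> minus 2, which equals \<open>- 1 - \<theta>\<close>.\<close>
    have "(z\<^sup>2) ^ 5 = (z ^ 5)\<^sup>2" by (simp flip: power_mult)
    then have att': "(z\<^sup>2) ^ 5 = 1 \<and> 2 * Re (z\<^sup>2) = - 1 - \<theta>"
      using Re_pow_unit(1)[OF z] z th by (simp add: \<theta>_def)
    show ?thesis
    proof (rule cyclic_units_dep[OF x _ _ _ _ _ u v])
      show "\<theta> + (- 1 - \<theta>) = of_int (- 1)" by simp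
      show "\<theta> * (- 1 - \<theta>) = of_int (- 1)" using th by (simp add: algebra_simps power2_eq_square)
      show "\<exists>z::complex. z ^ ord x = 1 \<and> 2 * Re z = \<theta>" using z 1 \<theta>_def by auto
      show "\<exists>z::complex. z ^ ord x = 1 \<and> 2 * Re z = - 1 - \<theta>" using att' 1 by metis
      fix w :: complex assume w: "w ^ ord x = 1"
      define t where "t = 2 * Re w"
      have "t = 2 \<or> t\<^sup>2 + t = 1" using roots_5 w 1 by (simp add: t_def)
      then have "t = of_int 2 \<or> (t - \<theta>) * (t - (- 1 - \<theta>)) = 0"
        using th by (auto simp: algebra_simps power2_eq_square)
      then have "t = of_int 2 \<or> t = \<theta> \<or> t = - 1 - \<theta>" by (metis eq_iff_diff_eq_0 mult_eq_0_iff)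
      then show "(\<exists>i::int. 2 * Re w = of_int i) \<or> 2 * Re w = \<theta> \<or> 2 * Re w = - 1 - \<theta>"
        unfolding t_def[symmetric] by blast
    qed
  next
    case 2
    show ?thesis
    proof (rule cyclic_units_dep[OF x _ _ _ _ _ u v])
      show "sqrt 2 + (- sqrt 2) = of_int 0" by simp
      show "sqrt 2 * (- sqrt 2) = of_int (- 2)" by simp
      have z: "cis (pi / 4) ^ 8 = 1" using cis_root[of 8] by simp
      have "Re (cis (pi / 4)) = sqrt 2 / 2" by (simp add: cos_45)
      then show "\<exists>z::complex. z ^ ord x = 1 \<and> 2 * Re z = sqrt 2"
        using z 2 by (intro exI[of _ "cis (pi / 4)"]) auto
      show "\<exists>z::complex. z ^ ord x = 1 \<and> 2 * Re z = - sqrt 2"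
        using z 2 \<open>Re (cis (pi / 4)) = sqrt 2 / 2\<close>
        by (intro exI[of _ "- cis (pi / 4)"]) (auto simp: power_minus_even)
      fix w :: complex assume w: "w ^ ord x = 1"
      have "2 * Re w \<in> {0, 2, -2, sqrt 2, - sqrt 2}" using roots_8 w 2 by simp
      then have "2 * Re w \<in> {of_int 0, of_int 2, of_int (-2), sqrt 2, - sqrt 2}" by simp
      then show "(\<exists>i::int. 2 * Re w = of_int i) \<or> 2 * Re w = sqrt 2 \<or> 2 * Re w = - sqrt 2"
        by blast
    qed
  next
    case 3
    show ?thesis
    proof (rule cyclic_units_dep[OF x _ _ _ _ _ u v])
      show "sqrt 3 + (- sqrt 3) = of_int 0" by simp
      show "sqrt 3 * (- sqrt 3) = of_int (- 3)" by simp
      have z: "cis (pi / 6) ^ 12 = 1" using cis_root[of 12] by simp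
      have "Re (cis (pi / 6)) = sqrt 3 / 2" by (simp add: cos_30)
      then show "\<exists>z::complex. z ^ ord x = 1 \<and> 2 * Re z = sqrt 3"
        using z 3 by (intro exI[of _ "cis (pi / 6)"]) auto
      show "\<exists>z::complex. z ^ ord x = 1 \<and> 2 * Re z = - sqrt 3"
        using z 3 \<open>Re (cis (pi / 6)) = sqrt 3 / 2\<close>
        by (intro exI[of _ "- cis (pi / 6)"]) (auto simp: power_minus_even)
      fix w :: complex assume w: "w ^ ord x = 1"
      have "2 * Re w \<in> {0, 1, -1, 2, -2, sqrt 3, - sqrt 3}" using roots_12 w 3 by simp
      then have "2 * Re w \<in> {of_int 0, of_int 1, of_int (-1), of_int 2, of_int (-2), sqrt 3, - sqrt 3}" by simp
      then show "(\<exists>i::int. 2 * Re w = of_int i) \<or> 2 * Re w = sqrt 3 \<or> 2 * Re w = - sqrt 3"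
        by blast
    qed
  qed
qed

section \<open>Bass units under a change of generator\<close>

definition geom_log :: "nat \<Rightarrow> complex \<Rightarrow> real" where
  "geom_log a z = \<bar>ln (cmod (\<Sum>i<a. z ^ i))\<bar>"

context int_group_ring
begin

text \<open>One polynomial gives units at all powers of \<open>x\<close>, since their orders divide
  \<open>ord x\<close>. Its value at another power is the twisted unit.\<close>

lemma bass_pair:
  assumes x: "x \<in> carrier G" and co: "coprime a (ord x)"
  obtains P P' m where "m > 0" "\<And>j::nat. unit_pair (ev P (D (x [^] j))) (ev P' (D (x [^] j)))"
    "\<And>z::complex. z ^ ord x = 1 \<Longrightarrow> ev P z * ev P' z = 1"
    "\<And>z::complex. z ^ ord x = 1 \<Longrightarrow> z \<noteq> 1 \<Longrightarrow> ev P z = (\<Sum>i<a. z ^ i) ^ m"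
proof -
  obtain P P' m where P: "m > 0" "X_pow_minus_1 (ord x) dvd P * P' - 1"
    "\<And>z::complex. z ^ ord x = 1 \<Longrightarrow> z \<noteq> 1 \<Longrightarrow> ev P z = (\<Sum>i<a. z ^ i) ^ m"
    using bass_unit[OF ord_pos[OF x] co] by metis
  have P': "X_pow_minus_1 (ord x) dvd P' * P - 1" using P(2) by (simp add: mult.commute)
  have "D (x [^] j) ^ ord x = 1" for j :: nat
    using x by (metis D_ord D_power power_commuting_commutes power_mult mult.commute power_one)
  then have "unit_pair (ev P (D (x [^] j))) (ev P' (D (x [^] j)))" for j :: nat
    using ev_unit_pair[OF P(2), of "D (x [^] j)"] ev_unit_pair[OF P', of "D (x [^] j)"] x
    by (simp add: unit_pair_def)
  then show thesis using that P ev_unit_pair[OF P(2)] by metis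
qed

text \<open>An absolute value other than 1 at a single root of unity rules out torsion.\<close>

lemma infinite_order_unit:
  assumes x: "x \<in> carrier G" and co: "coprime a (ord x)"
    and z: "z ^ ord x = 1" "z \<noteq> 1" "cmod (\<Sum>i<a. z ^ i) \<noteq> 1"
  shows "\<exists>P P'. unit_pair (ev P (D x)) (ev P' (D x)) \<and> (\<forall>k>0. ev P (D x) ^ k \<noteq> 1)"
proof -
  obtain P P' m where P: "m > 0" "\<And>j::nat. unit_pair (ev P (D (x [^] j))) (ev P' (D (x [^] j)))"
    "\<And>z::complex. z ^ ord x = 1 \<Longrightarrow> z \<noteq> 1 \<Longrightarrow> ev P z = (\<Sum>i<a. z ^ i) ^ m"
    using bass_pair[OF x co] by metis
  have "ev P (D x) ^ k \<noteq> 1" if "k > 0" for k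
  proof
    assume "ev P (D x) ^ k = 1"
    then have "ev (P ^ k - 1) z = 0" by (intro ev_D_zeroD[OF x _ z(1)]) simp
    then have "((\<Sum>i<a. z ^ i) ^ m) ^ k = 1" using P(3)[OF z(1,2)] by simp
    then have "cmod (\<Sum>i<a. z ^ i) ^ (m * k) = 1" by (metis norm_one norm_power power_mult)
    moreover have "m * k > 0" using P(1) that by simp
    ultimately show False using z(3) power_eq_imp_eq_base[of "cmod (\<Sum>i<a. z ^ i)" "m * k" 1] by simp
  qed
  moreover have "unit_pair (ev P (D x)) (ev P' (D x))" using P(2)[of 1] x by simp
  ultimately show ?thesis by blast
qed

definition comm_units_dep :: bool where
  "comm_units_dep \<longleftrightarrow> (\<forall>u u' v v'. unit_pair u u' \<longrightarrow> unit_pair v v' \<longrightarrow> u * v = v * u \<longrightarrow> mult_dep u v)"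

text \<open>The unit and its twist lie in one commutative ring, so they are dependent, and the
  relation is read at \<open>z\<close>. The absolute value in \<open>geom_log\<close> merges the two
  forms of \<open>mult_dep\<close>, and the exponent \<open>m\<close> of the Bass unit cancels. The
  twisting exponent may share factors with the order.\<close>

lemma twist_dep:
  assumes x: "x \<in> carrier G" and co: "coprime a (ord x)" and dep: comm_units_dep
  obtains r s :: nat where "(r, s) \<noteq> (0, 0)"
    "\<And>z. \<lbrakk>z ^ ord x = 1; z \<noteq> 1; z ^ c \<noteq> 1\<rbrakk> \<Longrightarrow> r * geom_log a z = s * geom_log a (z ^ c)"
proof -
  obtain P P' m where P: "m > 0" "\<And>j::nat. unit_pair (ev P (D (x [^] j))) (ev P' (D (x [^] j)))"
    "\<And>z::complex. z ^ ord x = 1 \<Longrightarrow> ev P z * ev P' z = 1"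
    "\<And>z::complex. z ^ ord x = 1 \<Longrightarrow> z \<noteq> 1 \<Longrightarrow> ev P z = (\<Sum>i<a. z ^ i) ^ m"
    using bass_pair[OF x co] by metis
  define Q where "Q = pcompose P ([:0, 1:] ^ c)"
  have Q: "ev Q (D x) = ev P (D (x [^] c))" using x by (simp add: Q_def ev_pcompose D_power)
  have "ev P (D x) * ev Q (D x) = ev Q (D x) * ev P (D x)"
    using ev_mult[of P Q "D x"] ev_mult[of Q P "D x"] by (simp add: mult.commute)
  moreover have "unit_pair (ev P (D x)) (ev P' (D x))" using P(2)[of 1] x by simp
  moreover have "unit_pair (ev Q (D x)) (ev P' (D (x [^] c)))" using P(2)[of c] Q by simp
  ultimately have "mult_dep (ev P (D x)) (ev Q (D x))" using dep unfolding comm_units_dep_def by blast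
  then obtain r s where rs: "(r, s) \<noteq> (0, 0)"
    "ev P (D x) ^ r * ev Q (D x) ^ s = 1 \<or> ev P (D x) ^ r = ev Q (D x) ^ s"
    unfolding mult_dep_def by blast
  have "r * geom_log a z = s * geom_log a (z ^ c)"
    if z: "z ^ ord x = 1" "z \<noteq> 1" "z ^ c \<noteq> 1" for z :: complex
  proof -
    define p where "p = cmod (\<Sum>i<a. z ^ i)"
    define q where "q = cmod (\<Sum>i<a. (z ^ c) ^ i)"
    have zc: "(z ^ c) ^ ord x = 1" using z by (metis mult.commute power_mult power_one)
    have pq: "cmod (ev P z) = p ^ m" "cmod (ev Q z) = q ^ m"
      using P(4)[OF z(1,2)] P(4)[OF zc z(3)] by (simp_all add: Q_def ev_pcompose p_def q_def norm_power)
    have "ev P z \<noteq> 0" "ev Q z \<noteq> 0" using P(3)[OF z(1)] P(3)[OF zc] by (auto simp: Q_def ev_pcompose)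
    then have "p \<noteq> 0" "q \<noteq> 0" using pq P(1) by (auto simp: zero_power)
    then have pos: "p > 0" "q > 0" by (simp_all add: p_def q_def)
    have "ev (P ^ r * Q ^ s - 1) (D x) = 0 \<or> ev (P ^ r - Q ^ s) (D x) = 0" using rs(2) by simp
    then have "ev (P ^ r * Q ^ s - 1) z = 0 \<or> ev (P ^ r - Q ^ s) z = 0"
      using ev_D_zeroD[OF x _ z(1)] by blast
    then have "ev P z ^ r * ev Q z ^ s = 1 \<or> ev P z ^ r = ev Q z ^ s" by simp
    then have "(p ^ m) ^ r * (q ^ m) ^ s = 1 \<or> (p ^ m) ^ r = (q ^ m) ^ s"
      by (metis pq norm_mult norm_one norm_power)
    then have "ln ((p ^ m) ^ r * (q ^ m) ^ s) = 0 \<or> ln ((p ^ m) ^ r) = ln ((q ^ m) ^ s)" by auto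
    then have "m * (r * ln p + s * ln q) = 0 \<or> m * (r * ln p) = m * (s * ln q)"
      using pos by (simp add: ln_mult ln_realpow algebra_simps)
    then have "r * ln p = - (s * ln q) \<or> r * ln p = s * ln q" using P(1) by auto
    then have "\<bar>r * ln p\<bar> = \<bar>s * ln q\<bar>" by auto
    then show ?thesis unfolding p_def q_def geom_log_def by (simp add: abs_mult)
  qed
  then show thesis by (rule that[OF rs(1)])
qed

text \<open>Each step from \<open>z\<close> to \<open>z ^ c\<close> multiplies the logarithm by the
  same ratio. As \<open>c\<close> has finite order modulo \<open>ord x\<close>, the steps return to
  \<open>z\<close>, the ratio is 1, and the strict inequality fails. The lower bound 1 makes both
  logarithms positive, so that their absolute values can be compared.\<close>

lemma no_twist:
  assumes x: "x \<in> carrier G" and co: "coprime a (ord x)" "coprime c (ord x)" and dep: comm_units_dep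
    and z: "z ^ ord x = 1" and 1: "1 < cmod (\<Sum>i<a. (z ^ c) ^ i)"
    and less: "cmod (\<Sum>i<a. (z ^ c) ^ i) < cmod (\<Sum>i<a. z ^ i)" and z1: "z \<noteq> 1"
  shows False
proof -
  define L where "L = geom_log a"
  obtain r s :: nat where rs: "(r, s) \<noteq> (0, 0)"
    "\<And>z. \<lbrakk>z ^ ord x = 1; z \<noteq> 1; z ^ c \<noteq> 1\<rbrakk> \<Longrightarrow> r * L z = s * L (z ^ c)"
    unfolding L_def by (rule twist_dep[OF x co(1) dep, of c]) (rule that, assumption, simp only: L_def)
  define d where "d = totient (ord x)"
  have d: "d > 0" using ord_pos[OF x] by (simp add: d_def totient_gt_0_iff)
  have "[c ^ d = 1] (mod ord x)" using euler_theorem[OF co(2)] by (simp add: d_def)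
  then have cd: "c ^ d mod ord x = 1 mod ord x" by (simp add: cong_def)
  have mod: "w ^ k = w ^ (k mod ord x)" if "w ^ ord x = 1" for w :: complex and k
    using that by (metis div_mult_mod_eq power_add power_mult mult.commute mult_1 power_one)
  have zd: "z ^ (c ^ d) = z" using mod[OF z, of "c ^ d"] mod[OF z, of 1] cd by simp
  \<comment> \<open>No member of the orbit is 1, because further steps lead from it back to
    \<open>z\<close>.\<close>
  have nz: "z ^ (c ^ k) \<noteq> 1" if "k \<le> d" for k
  proof
    assume "z ^ (c ^ k) = 1"
    then have "(z ^ (c ^ k)) ^ (c ^ (d - k)) = 1" by simp
    then have "z ^ (c ^ d) = 1" using that by (simp flip: power_mult power_add)
    then show False using zd z1 by simp
  qed
  have rootk: "(z ^ (c ^ k)) ^ ord x = 1" for k by (metis mult.commute power_mult power_one z)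
  have "r ^ k * L z = s ^ k * L (z ^ (c ^ k))" if "k \<le> d" for k
    using that
  proof (induction k)
    case (Suc k)
    have step: "r * L (z ^ (c ^ k)) = s * L (z ^ (c ^ Suc k))"
      using rs(2)[OF rootk nz[of k], of] nz[of "Suc k"] Suc by (simp add: power_mult mult.commute flip: power_mult)
    have "r ^ Suc k * L z = r * (r ^ k * L z)" by simp
    also have "\<dots> = s ^ k * (r * L (z ^ (c ^ k)))" using Suc by simp
    also have "\<dots> = s ^ Suc k * L (z ^ (c ^ Suc k))" unfolding step by simp
    finally show ?case .
  qed simp
  from this[of d] have "r ^ d * L z = s ^ d * L z" by (simp add: zd)
  moreover have Lz: "L z = ln (cmod (\<Sum>i<a. z ^ i))" "L z > 0"
    using 1 less ln_gt_zero[of "cmod (\<Sum>i<a. z ^ i)"] by (auto simp: L_def geom_log_def)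
  ultimately have "real r ^ d = real s ^ d" by simp
  then have "r = s" using d power_eq_imp_eq_base[of "real r" d "real s"] by simp
  then have "L z = L (z ^ c)" using rs(2)[OF z z1] rs(1) nz[of 1] d by simp
  moreover have "L (z ^ c) = ln (cmod (\<Sum>i<a. (z ^ c) ^ i))"
    using ln_gt_zero[OF 1] by (simp add: L_def geom_log_def)
  moreover have "ln (cmod (\<Sum>i<a. (z ^ c) ^ i)) < ln (cmod (\<Sum>i<a. z ^ i))"
    by (rule ln_less_cancel_iff[THEN iffD2]) (use 1 less in linarith)+
  ultimately show False using Lz(1) by simp
qed

end

section \<open>Excluded and surviving orders of elements\<close>

lemma geom2: "(\<Sum>i<2. (z::complex) ^ i) = 1 + z"
  by (simp add: numeral_2_eq_2)

lemma cmod_geom2: "cmod z = 1 \<Longrightarrow> (cmod (\<Sum>i<2. z ^ i))\<^sup>2 = 2 + 2 * Re z"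
  unfolding geom2 cmod_power2 using cmod_power2[of z] by (simp add: power2_eq_square algebra_simps)

text \<open>Both sums are palindromic: with the middle power of \<open>z\<close> taken out, a
  polynomial in the trace remains.\<close>

lemma geom_unit:
  assumes z: "(z::complex) ^ n = 1" "n > 0"
  shows "cmod (\<Sum>i<3. z ^ i) = \<bar>1 + 2 * Re z\<bar>"
    and "cmod (\<Sum>i<5. z ^ i) = \<bar>(2 * Re z)\<^sup>2 + 2 * Re z - 1\<bar>"
proof -
  define t where "t = complex_of_real (2 * Re z)"
  have sq: "z * z = t * z - 1" using root_unity_trace[OF z] by (simp add: t_def)
  have nz: "cmod z = 1" using root_unity_norm[OF z] .
  have "(\<Sum>i<3. z ^ i) = 1 + z + z * z" by (simp add: eval_nat_numeral)
  also have "\<dots> = z * complex_of_real (1 + 2 * Re z)" unfolding sq by (simp add: algebra_simps t_def)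
  finally show "cmod (\<Sum>i<3. z ^ i) = \<bar>1 + 2 * Re z\<bar>" using nz by (simp only: norm_mult norm_of_real mult_1)
  have "(\<Sum>i<5. z ^ i) = 1 + z + z * z + z * (z * z) + (z * z) * (z * z)" by (simp add: eval_nat_numeral)
  also have "\<dots> = (z * z) * (t * t + t - 1)"
  proof -
    have "z * (z * z) = z * (t * z - 1)" by (simp only: sq)
    then have 3: "z * (z * z) = t * (z * z) - z" by (simp only: right_diff_distrib mult_ac mult_1_right mult_1_left)
    have "(z * z) * (z * z) = t * (z * (z * z)) - z * z"
      by (metis (no_types, opaque_lifting) 3 mult.assoc mult.commute right_diff_distrib)
    moreover have "1 + z + w + (t * w - z) + (t * (t * w - z) - w) = w * (t * t + t - 1)" if "w = t * z - 1" for w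
    proof -
      have "t * (t * w - z) = t * t * w - (w + 1)" using that by (simp add: right_diff_distrib mult.assoc)
      then show ?thesis by (simp add: algebra_simps)
    qed
    ultimately show ?thesis using 3 sq by simp
  qed
  also have "\<dots> = (z * z) * complex_of_real ((2 * Re z)\<^sup>2 + 2 * Re z - 1)"
    by (simp add: t_def power2_eq_square)
  finally show "cmod (\<Sum>i<5. z ^ i) = \<bar>(2 * Re z)\<^sup>2 + 2 * Re z - 1\<bar>"
    using nz by (simp only: norm_mult norm_of_real mult_1)
qed

context int_group_ring
begin

text \<open>Length 2 and exponent 2 are coprime to an odd order. From 7 on, the angle
  \<open>4 * pi / n\<close> stays below \<open>2 * pi / 3\<close>, which keeps the smaller of the
  two sums above 1 in absolute value.\<close>

lemma no_odd_order:
  assumes x: "x \<in> carrier G" and n: "odd (ord x)" "ord x \<ge> 7" and dep: comm_units_dep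
  shows False
proof -
  define n where "n = ord x"
  define z where "z = cis (2 * pi / n)"
  have n7: "n \<ge> 7" "n > 0" using n by (simp_all add: n_def)
  have z: "z ^ n = 1" using cis_root[OF n7(2)] by (simp add: z_def)
  have z2: "z\<^sup>2 = cis (4 * pi / n)" by (simp add: z_def Complex.DeMoivre)
  have "cos (4 * pi / n) < cos (2 * pi / n)" using n7 by (intro cos_monotone_0_pi) (auto simp: field_simps)
  moreover have "cos (2 * pi / 3) < cos (4 * pi / n)" using n7 by (intro cos_monotone_0_pi) (auto simp: field_simps)
  then have c4: "- (1/2) < cos (4 * pi / n)" by (simp add: cos_120)
  moreover have "(cmod (\<Sum>i<2. z ^ i))\<^sup>2 = 2 + 2 * cos (2 * pi / n)" by (subst cmod_geom2) (auto simp: z_def)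
  moreover have "(cmod (\<Sum>i<2. (z\<^sup>2) ^ i))\<^sup>2 = 2 + 2 * cos (4 * pi / n)" by (subst cmod_geom2) (auto simp: z2)
  ultimately have "1\<^sup>2 < (cmod (\<Sum>i<2. (z\<^sup>2) ^ i))\<^sup>2" "(cmod (\<Sum>i<2. (z\<^sup>2) ^ i))\<^sup>2 < (cmod (\<Sum>i<2. z ^ i))\<^sup>2"
    by auto
  then have "1 < cmod (\<Sum>i<2. (z\<^sup>2) ^ i)" "cmod (\<Sum>i<2. (z\<^sup>2) ^ i) < cmod (\<Sum>i<2. z ^ i)"
    by (auto intro: power2_less_imp_less)
  moreover have "cos (2 * pi / n) < cos 0" using n7 by (intro cos_monotone_0_pi) (auto simp: field_simps)
  then have "z \<noteq> 1" by (auto simp: z_def complex_eq_iff)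
  ultimately show False
    using no_twist[OF x _ _ dep, of 2 2 z] z n by (simp add: n_def)
qed

text \<open>Length 3 and exponent 3: the angles \<open>pi / 8\<close> and \<open>3 * pi / 8\<close>
  both have a positive cosine, so both sums exceed 1.\<close>

lemma no_order_16:
  assumes x: "x \<in> carrier G" and n: "ord x = 16" and dep: comm_units_dep
  shows False
proof -
  define z where "z = cis (pi / 8)"
  have z: "z ^ 16 = 1" using cis_root[of 16] by (simp add: z_def)
  have z3: "z ^ 3 = cis (3 * pi / 8)" by (simp add: z_def Complex.DeMoivre)
  have "(z ^ 3) ^ 16 = (z ^ 16) ^ 3" by (simp flip: power_mult)
  then have z3': "(z ^ 3) ^ 16 = 1" using z by simp
  have "cos (3 * pi / 8) < cos (pi / 8)" by (intro cos_monotone_0_pi) auto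
  moreover have "cos (3 * pi / 8) > 0" by (intro cos_gt_zero) simp_all
  moreover have "cmod (\<Sum>i<3. z ^ i) = \<bar>1 + 2 * cos (pi / 8)\<bar>" using geom_unit(1)[OF z] by (simp add: z_def)
  moreover have "cmod (\<Sum>i<3. (z ^ 3) ^ i) = \<bar>1 + 2 * cos (3 * pi / 8)\<bar>" using geom_unit(1)[OF z3'] by (simp add: z3)
  moreover have "cos (pi / 8) < cos 0" by (intro cos_monotone_0_pi) auto
  then have "z \<noteq> 1" by (auto simp: z_def complex_eq_iff)
  moreover have "coprime 3 (16::nat)" by (simp add: coprime_iff_gcd_eq_1 gcd_non_0_nat)
  ultimately show False
    using no_twist[OF x _ _ dep, of 3 3 z] z n by simp
qed

text \<open>An exponent coprime to 10 fixes or swaps conjugate traces, where the logarithms of a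
  unit agree up to sign, so it gives no contradiction. The exponent 6 fixes the fifth roots of unity
  but sends the primitive tenth root \<open>z\<close> to \<open>- z\<close>. The former force the
  ratio 1, the latter then give a wrong value of \<open>cos (pi / 5)\<close>.\<close>

lemma no_order_10:
  assumes x: "x \<in> carrier G" and n: "ord x = 10" and dep: comm_units_dep
  shows False
proof -
  define L where "L = geom_log 3"
  have co: "coprime 3 (10::nat)" by (simp add: coprime_iff_gcd_eq_1 gcd_non_0_nat)
  obtain r s :: nat where rs: "(r, s) \<noteq> (0, 0)"
    "\<And>z. \<lbrakk>z ^ 10 = 1; z \<noteq> 1; z ^ 6 \<noteq> 1\<rbrakk> \<Longrightarrow> r * L z = s * L (z ^ 6)"
    unfolding L_def by (rule twist_dep[OF x _ dep, of 3 6, unfolded n, OF co]) (rule that, assumption, simp only: L_def)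
  define z where "z = cis (pi / 5)"
  have z: "z ^ 10 = 1" using cis_root[of 10] by (simp add: z_def)
  have z5: "z ^ 5 = -1" by (simp add: z_def Complex.DeMoivre)
  then have z6: "z ^ 6 = - z" by (simp add: eval_nat_numeral)
  define w where "w = z\<^sup>2"
  have w: "w = cis (2 * pi / 5)" by (simp add: w_def z_def Complex.DeMoivre)
  have "z ^ 12 = z ^ 10 * z\<^sup>2" by (simp flip: power_add)
  then have w6: "w ^ 6 = w" using z by (simp add: w_def flip: power_mult)
  have "w ^ 10 = (z ^ 10)\<^sup>2" by (simp add: w_def flip: power_mult)
  then have w10: "w ^ 10 = 1" using z by simp
  have c25: "cos (2 * pi / 5) > 0" by (intro cos_gt_zero) simp_all
  have "cos (2 * pi / 5) < cos 0" "cos (pi / 5) < cos 0" by (intro cos_monotone_0_pi; auto)+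
  then have ne: "w \<noteq> 1" "z \<noteq> 1" by (auto simp: w z_def complex_eq_iff)
  have c5: "cos (pi / 5) > 0" by (intro cos_gt_zero) simp_all
  then have "Re (- z) \<noteq> 1" by (simp add: z_def)
  then have ne6: "z ^ 6 \<noteq> 1" unfolding z6 by (metis one_complex.sel(1))
  have "L w = ln (1 + 2 * cos (2 * pi / 5))" using geom_unit(1)[OF w10] c25 by (simp add: L_def geom_log_def w)
  then have "L w > 0" using c25 by simp
  then have "r = s" using rs(2)[OF w10 ne(1)] ne by (simp add: w6)
  then have "L z = L (- z)" using rs(2)[OF z ne(2) ne6] rs(1) by (simp add: z6)
  define c where "c = cos (pi / 5)"
  have c: "c > sqrt 2 / 2" using cos_monotone_0_pi[of "pi / 5" "pi / 4"] by (simp add: c_def cos_45)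
  have "(- z) ^ 10 = 1" using z by (simp add: power_minus_even)
  have Lv: "L z = ln (1 + 2 * c)" "L (- z) = \<bar>ln \<bar>1 - 2 * c\<bar>\<bar>"
    using geom_unit(1)[OF z] geom_unit(1)[OF \<open>(- z) ^ 10 = 1\<close>] c5 by (simp_all add: L_def geom_log_def z_def c_def)
  have "1 < sqrt 2" by simp
  then have c2: "2 * c > 1" "c > 0" using c by linarith+
  from \<open>L z = L (- z)\<close> have "ln (1 + 2 * c) = ln (2 * c - 1) \<or> ln (1 + 2 * c) = - ln (2 * c - 1)"
    unfolding Lv using c2 by (auto simp: abs_if split: if_splits)
  \<comment> \<open>The first case is absurd. The second says \<open>c * c = 1 / 2\<close>, the
    cosine of \<open>pi / 4\<close> instead of \<open>pi / 5\<close>.\<close>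
  then have "1 + 2 * c = 2 * c - 1 \<or> 1 + 2 * c = inverse (2 * c - 1)"
    using c2 ln_inj_iff[of "1 + 2 * c" "2 * c - 1"] ln_inj_iff[of "1 + 2 * c" "inverse (2 * c - 1)"]
      ln_inverse[of "2 * c - 1"] by auto
  then have "(1 + 2 * c) * (2 * c - 1) = 1" using c2 by (auto simp: field_simps)
  then have "c * c = 1 / 2" by (simp add: algebra_simps)
  moreover have "(sqrt 2 / 2) * (sqrt 2 / 2) < c * c" using c c2 by (intro mult_strict_mono) auto
  ultimately show False by simp
qed

text \<open>2, 3 and 5 are the least lengths above 1 that are coprime to 5, 8 and 12; the units are
  tested at the primitive root of smallest angle.\<close>

lemma infinite_order_unit_5_8_12:
  assumes x: "x \<in> carrier G" and n: "ord x \<in> {5, 8, 12}"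
  shows "\<exists>P P'. unit_pair (ev P (D x)) (ev P' (D x)) \<and> (\<forall>k>0. ev P (D x) ^ k \<noteq> 1)"
proof -
  consider "ord x = 5" | "ord x = 8" | "ord x = 12" using n by auto
  then show ?thesis
  proof cases
    case 1
    define z where "z = cis (2 * pi / 5)"
    have z: "z ^ 5 = 1" using cis_root[of 5] by (simp add: z_def)
    have c: "cos (2 * pi / 5) > 0" by (intro cos_gt_zero) simp_all
    have "(cmod (\<Sum>i<2. z ^ i))\<^sup>2 = 2 + 2 * cos (2 * pi / 5)" by (subst cmod_geom2) (auto simp: z_def)
    then have "cmod (\<Sum>i<2. z ^ i) \<noteq> 1" using c by auto
    moreover have "cos (2 * pi / 5) < cos 0" by (intro cos_monotone_0_pi) auto
    then have "z \<noteq> 1" by (auto simp: z_def complex_eq_iff)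
    moreover have "coprime 2 (ord x)" using 1 by simp
    ultimately show ?thesis using infinite_order_unit[OF x, of 2 z] z 1 by simp
  next
    case 2
    define z where "z = cis (pi / 4)"
    have z: "z ^ 8 = 1" using cis_root[of 8] by (simp add: z_def)
    have "cmod (\<Sum>i<3. z ^ i) \<noteq> 1" using geom_unit(1)[OF z] by (simp add: z_def cos_45)
    moreover have "z \<noteq> 1" by (auto simp: z_def complex_eq_iff sin_45)
    moreover have "coprime 3 (ord x)" using 2 by (simp add: coprime_iff_gcd_eq_1 gcd_non_0_nat)
    ultimately show ?thesis using infinite_order_unit[OF x, of 3 z] z 2 by simp
  next
    case 3
    define z where "z = cis (pi / 6)"
    have z: "z ^ 12 = 1" using cis_root[of 12] by (simp add: z_def)
    have "cmod (\<Sum>i<5. z ^ i) = \<bar>2 + sqrt 3\<bar>" using geom_unit(2)[OF z] by (simp add: z_def cos_30)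
    then have "cmod (\<Sum>i<5. z ^ i) \<noteq> 1" by (smt (verit) real_sqrt_gt_zero)
    moreover have "z \<noteq> 1" by (auto simp: z_def complex_eq_iff sin_30)
    moreover have "coprime 5 (ord x)" using 3 by (simp add: coprime_iff_gcd_eq_1 gcd_non_0_nat)
    ultimately show ?thesis using infinite_order_unit[OF x, of 5 z] z 3 by simp
  qed
qed

end

section \<open>Finite groups all of whose subgroups are normal\<close>

context group
begin

lemma inv_cancel_left:
  "\<lbrakk>h \<in> carrier G; r \<in> carrier G\<rbrakk> \<Longrightarrow> inv h \<otimes> (h \<otimes> r) = r"
  "\<lbrakk>h \<in> carrier G; r \<in> carrier G\<rbrakk> \<Longrightarrow> h \<otimes> (inv h \<otimes> r) = r"
  by (simp_all add: m_assoc[symmetric])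

lemma centralize_mult:
  "\<lbrakk>x \<otimes> y = y \<otimes> x; z \<otimes> y = y \<otimes> z; x \<in> carrier G; y \<in> carrier G; z \<in> carrier G\<rbrakk>
    \<Longrightarrow> x \<otimes> z \<otimes> y = y \<otimes> (x \<otimes> z)"
  by (metis m_assoc)

lemma centralize_pow:
  "\<lbrakk>x \<otimes> y = y \<otimes> x; x \<in> carrier G; y \<in> carrier G\<rbrakk> \<Longrightarrow> x [^] (k::nat) \<otimes> y = y \<otimes> x [^] k"
  by (induction k) (simp_all add: centralize_mult)

lemma centralize_inv:
  assumes "x \<otimes> y = y \<otimes> x" "x \<in> carrier G" "y \<in> carrier G"
  shows "inv x \<otimes> y = y \<otimes> inv x"
proof -
  have "inv x \<otimes> y = inv x \<otimes> (y \<otimes> x) \<otimes> inv x" using assms(2,3) by (simp add: m_assoc)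
  also have "\<dots> = inv x \<otimes> (x \<otimes> y) \<otimes> inv x" using assms(1) by simp
  also have "\<dots> = y \<otimes> inv x" using assms(2,3) by (simp add: m_assoc[symmetric])
  finally show ?thesis .
qed

lemma centralize_cancel:
  assumes "x \<otimes> z \<otimes> y = y \<otimes> (x \<otimes> z)" "z \<otimes> y = y \<otimes> z" "x \<in> carrier G" "y \<in> carrier G" "z \<in> carrier G"
  shows "x \<otimes> y = y \<otimes> x"
proof -
  have "x \<otimes> z \<otimes> inv z \<otimes> y = y \<otimes> (x \<otimes> z \<otimes> inv z)"
    by (rule centralize_mult) (use assms centralize_inv in auto)
  then show ?thesis using assms by (simp add: m_assoc)
qed

text \<open>Finiteness makes inverses natural powers.\<close>

lemma generate_eq_powers:
  assumes "finite (carrier G)" "x \<in> carrier G"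
  shows "generate G {x} = range (\<lambda>k::nat. x [^] k)"
  using generate_pow_nat[OF assms(2)] ord_ge_1[OF assms] by auto

lemma conj_pow:
  assumes "x \<in> carrier G" "h \<in> carrier G"
  shows "(h \<otimes> x \<otimes> inv h) [^] (k::nat) = h \<otimes> x [^] k \<otimes> inv h"
  by (induction k) (use assms in \<open>simp_all add: m_assoc inv_cancel_left\<close>)

lemma conj_eqD:
  assumes "h \<otimes> x \<otimes> inv h = y" "x \<in> carrier G" "h \<in> carrier G"
  shows "h \<otimes> x = y \<otimes> h"
  using assms by (auto simp: m_assoc)

end

locale dedekind_group = group +
  assumes finite_group: "finite (carrier G)"
    and subgroup_normal: "\<And>H. subgroup H G \<Longrightarrow> H \<lhd> G"
begin

lemma conj_power:
  assumes "x \<in> carrier G" "h \<in> carrier G"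
  shows "\<exists>k::nat. h \<otimes> x \<otimes> inv h = x [^] k"
proof -
  have "generate G {x} \<lhd> G" using assms by (intro subgroup_normal generate_is_subgroup) auto
  then have "h \<otimes> x \<otimes> inv h \<in> generate G {x}"
    using assms unfolding normal_inv_iff by (blast intro: generate.incl)
  then show ?thesis using generate_eq_powers[OF finite_group assms(1)] by auto
qed

text \<open>A conjugate of \<open>x\<close> is a power of \<open>x\<close> of the same order; among
  the exponents 0 to 3 the even ones are possible only for \<open>x = \<one>\<close>.\<close>

lemma conj_exp4:
  assumes x: "x \<in> carrier G" "x [^] (4::nat) = \<one>" and h: "h \<in> carrier G"
  shows "h \<otimes> x \<otimes> inv h = x \<or> h \<otimes> x \<otimes> inv h = inv x"
proof -
  obtain k :: nat where k: "h \<otimes> x \<otimes> inv h = x [^] k" using conj_power[OF x(1) h] by blast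
  define j where "j = k mod 4"
  have "x [^] k = x [^] (4 * (k div 4) + j)" by (simp add: j_def)
  also have "\<dots> = x [^] j" using x by (simp add: nat_pow_mult[symmetric] nat_pow_pow[symmetric])
  finally have kj: "h \<otimes> x \<otimes> inv h = x [^] j" using k by simp
  have one: "x = \<one>" if "h \<otimes> x \<otimes> inv h = \<one>"
    using conj_eqD[OF that x(1) h] h x by simp
  have "j < 4" by (simp add: j_def)
  then consider "j = 0" | "j = 1" | "j = 2" | "j = 3" by linarith
  then show ?thesis
  proof cases
    case 1
    then show ?thesis using kj one by simp
  next
    case 2
    then show ?thesis using kj x by simp
  next
    case 3
    have "h \<otimes> x [^] (2::nat) \<otimes> inv h = \<one>"
      using conj_pow[OF x(1) h, of 2] kj 3 x by (simp add: nat_pow_pow)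
    then have "h \<otimes> x [^] (2::nat) = h" using conj_eqD[of h "x [^] (2::nat)" \<one>] x h by simp
    then have "x [^] (2::nat) = \<one>" using h x by (metis l_cancel_one' nat_pow_closed r_cancel_one' l_cancel_one)
    then show ?thesis using kj 3 one by simp
  next
    case 4
    have "x [^] (3::nat) \<otimes> x = \<one>" using x by (simp add: eval_nat_numeral)
    then have "x [^] (3::nat) = inv x" using x by (simp add: inv_equality)
    then show ?thesis using kj 4 by simp
  qed
qed

definition commutator :: "'a \<Rightarrow> 'a \<Rightarrow> 'a" where
  "commutator x y = x \<otimes> y \<otimes> inv x \<otimes> inv y"

lemma commutator_closed [simp]:
  "\<lbrakk>x \<in> carrier G; y \<in> carrier G\<rbrakk> \<Longrightarrow> commutator x y \<in> carrier G"
  by (simp add: commutator_def)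

lemma commutator_swap:
  "\<lbrakk>x \<in> carrier G; y \<in> carrier G\<rbrakk> \<Longrightarrow> x \<otimes> y = commutator x y \<otimes> (y \<otimes> x)"
  by (simp add: commutator_def m_assoc inv_cancel_left)

lemma commutator_eq_1_iff:
  "\<lbrakk>x \<in> carrier G; y \<in> carrier G\<rbrakk> \<Longrightarrow> commutator x y = \<one> \<longleftrightarrow> x \<otimes> y = y \<otimes> x"
  using commutator_swap[of x y] by (metis commutator_closed l_one m_closed r_cancel_one)

text \<open>Read one way the commutator is \<open>x\<close> times a conjugate of
  \<open>inv x\<close>, the other way a conjugate of \<open>y\<close> times
  \<open>inv y\<close>.\<close>

lemma commutator_power:
  assumes x: "x \<in> carrier G" and y: "y \<in> carrier G"
  shows "\<exists>i::nat. commutator x y = x [^] i" "\<exists>i::nat. commutator x y = y [^] i"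
proof -
  obtain k l :: nat where k: "y \<otimes> inv x \<otimes> inv y = inv x [^] k" and l: "x \<otimes> y \<otimes> inv x = y [^] l"
    using conj_power x y by (metis inv_closed)
  have gen: "\<exists>i::nat. inv z [^] j = z [^] i" if z: "z \<in> carrier G" for z and j :: nat
  proof -
    have "inv z \<in> generate G {z}" by (rule generate.inv) simp
    then obtain i :: nat where "inv z = z [^] i" using generate_eq_powers[OF finite_group z] by auto
    then show ?thesis using z by (auto simp: nat_pow_pow)
  qed
  have "commutator x y = x \<otimes> inv x [^] k" using x y by (simp add: commutator_def k[symmetric] m_assoc)
  moreover obtain i :: nat where "inv x [^] k = x [^] i" using gen[OF x] by blast
  ultimately show "\<exists>i::nat. commutator x y = x [^] i" using x by (metis nat_pow_Suc2)
  have "commutator x y = y [^] l \<otimes> inv y [^] (1::nat)" using x y by (simp add: commutator_def l)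
  moreover obtain i :: nat where "inv y [^] (1::nat) = y [^] i" using gen[OF y] by blast
  ultimately show "\<exists>i::nat. commutator x y = y [^] i" using y by (metis nat_pow_mult)
qed

text \<open>A nontrivial commutator generates the group of \<open>x\<close>. It is also a power of
  \<open>y\<close>, so it commutes with \<open>y\<close>, and then so does \<open>x\<close>.\<close>

lemma prime_order_central:
  assumes x: "x \<in> carrier G" "prime (ord x)" and y: "y \<in> carrier G"
  shows "x \<otimes> y = y \<otimes> x"
proof (rule ccontr)
  assume nc: "x \<otimes> y \<noteq> y \<otimes> x"
  define c where "c = commutator x y"
  have c: "c \<in> carrier G" "c \<noteq> \<one>" using commutator_eq_1_iff[of x y] nc x y by (auto simp: c_def)
  obtain i k :: nat where i: "c = x [^] i" and k: "c = y [^] k"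
    using commutator_power[OF x(1) y] unfolding c_def by blast
  have "\<not> ord x dvd i" using i c x pow_eq_id[of x i] by simp
  then have "coprime i (ord x)" using x by (metis coprime_commute prime_imp_coprime)
  then obtain j where "[i * j = 1] (mod ord x)" using cong_solve_coprime_nat by auto
  then have "x [^] (i * j) = x [^] (1::nat)"
    using x by (metis cong_def div_mult_mod_eq nat_pow_mult nat_pow_pow nat_pow_one pow_ord_eq_1 mult.commute l_one nat_pow_closed)
  then have "x = c [^] j" using i x by (simp add: nat_pow_pow)
  moreover have "y [^] k \<otimes> y = y \<otimes> y [^] k" using y by (simp add: nat_pow_Suc2[symmetric])
  then have "c \<otimes> y = y \<otimes> c" using k by simp
  ultimately have "x \<otimes> y = y \<otimes> x" using centralize_pow c y by simp
  then show False using nc by simp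
qed

end

section \<open>Hamiltonian 2-groups have exponent 4\<close>

locale dedekind_2_group = dedekind_group +
  fixes N
  assumes order_2: "Coset.order G = 2 ^ N"
begin

lemma ord_2_power: "x \<in> carrier G \<Longrightarrow> \<exists>m. ord x = 2 ^ m"
  using ord_dvd_group_order[of x] order_2 by (metis divides_primepow_nat two_is_prime_nat)

text \<open>Minimality lets each square commute with the other element, so the commutator has order
  2 and is the only involution in either cyclic group. Were \<open>ord x\<close> above 4, dividing
  \<open>y\<close> by a power of \<open>x\<close> would lower its order without making the pair
  commute.\<close>

lemma minimal_pair:
  assumes x: "x \<in> carrier G" and y: "y \<in> carrier G" and nc: "x \<otimes> y \<noteq> y \<otimes> x"
    and le: "ord y \<le> ord x"
    and mini: "\<And>x' y'. \<lbrakk>x' \<in> carrier G; y' \<in> carrier G; x' \<otimes> y' \<noteq> y' \<otimes> x'\<rbrakk> \<Longrightarrow> ord x + ord y \<le> ord x' + ord y'"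
  shows "x [^] (4::nat) = \<one> \<and> y [^] (4::nat) = \<one>"
proof -
  obtain m n where mn: "ord x = 2 ^ m" "ord y = 2 ^ n" using ord_2_power x y by blast
  have ne: "x \<noteq> \<one>" "y \<noteq> \<one>" using nc x y by auto
  then have "m \<noteq> 0" "n \<noteq> 0" using mn ord_eq_1 x y by (metis power_0)+
  moreover have "n \<noteq> 1"
    using prime_order_central[OF y _ x] nc mn by auto
  moreover have nm: "n \<le> m" using le mn by simp
  ultimately have n2: "n \<ge> 2" "m \<ge> 2" by simp_all
  have half: "ord (z [^] (2::nat)) < ord z" if "z \<in> carrier G" "ord z = 2 ^ k" "k \<ge> 2" for z k
    using that ord_pow[of z 2] by (simp add: dvd_power)
  have x2: "x [^] (2::nat) \<otimes> y = y \<otimes> x [^] (2::nat)"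
    using mini[of "x [^] (2::nat)" y] half[OF x mn(1)] x y n2 by force
  have y2: "y [^] (2::nat) \<otimes> x = x \<otimes> y [^] (2::nat)"
    using mini[of x "y [^] (2::nat)"] half[OF y mn(2)] x y n2 by force
  define c where "c = commutator x y"
  have c: "c \<in> carrier G" "c \<noteq> \<one>" using commutator_eq_1_iff[of x y] nc x y by (auto simp: c_def)
  obtain i k :: nat where i: "c = x [^] i" and k: "c = y [^] k"
    using commutator_power[OF x y] unfolding c_def by blast
  have cx: "c \<otimes> x = x \<otimes> c" using x centralize_pow[of x x i] i by simp
  have cy: "c \<otimes> y = y \<otimes> c" using y centralize_pow[of y y k] k by simp
  have sw: "x \<otimes> y = c \<otimes> (y \<otimes> x)" using commutator_swap[OF x y] by (simp add: c_def)
  \<comment> \<open>Moving \<open>y\<close> past both factors \<open>x\<close> produces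
    \<open>c\<close> twice, but the square of \<open>x\<close> commutes with \<open>y\<close>; so
    \<open>c \<otimes> c = \<one>\<close>.\<close>
  have "x \<otimes> x \<otimes> y = x \<otimes> c \<otimes> (y \<otimes> x)" using x y c sw by (simp add: m_assoc)
  also have "\<dots> = c \<otimes> (x \<otimes> y) \<otimes> x" using cx x y c by (simp add: m_assoc[symmetric])
  also have "\<dots> = c \<otimes> c \<otimes> (y \<otimes> (x \<otimes> x))" using sw x y c by (simp add: m_assoc)
  also have "y \<otimes> (x \<otimes> x) = x \<otimes> x \<otimes> y" using x2 x by (simp add: numeral_2_eq_2)
  finally have cc: "c \<otimes> c = \<one>" using x y c by (metis m_closed r_cancel_one)
  \<comment> \<open>A cyclic group of order \<open>2 ^ e\<close> has only one element of order
    2.\<close>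
  have invol: "c = z [^] ((2::nat) ^ (e - 1))"
    if z: "z \<in> carrier G" "ord z = 2 ^ e" "e \<ge> 2" and ci: "c = z [^] i" for z e and i :: nat
  proof -
    have e: "(2::nat) ^ e = 2 * 2 ^ (e - 1)" using z(3) by (cases e) auto
    have "z [^] (i * 2) = \<one>" using cc ci z(1) by (simp add: mult_2_right nat_pow_mult)
    then have "2 ^ e dvd i * 2" using pow_eq_id[OF z(1)] z(2) by simp
    then have "2 ^ (e - 1) dvd i" using e by simp
    then obtain j where j: "i = 2 ^ (e - 1) * j" by blast
    have "odd j"
    proof
      assume "even j"
      then have "2 ^ e dvd i" unfolding j e by auto
      then show False using c ci pow_eq_id[OF z(1), of i] z(2) by simp
    qed
    then obtain j' where "j = Suc (2 * j')" by (metis oddE Suc_eq_plus1)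
    then have "i = 2 ^ e * j' + 2 ^ (e - 1)" using j e by simp
    moreover have "z [^] (2 ^ e * j') = \<one>" using pow_eq_id[OF z(1)] z(2) by simp
    ultimately show ?thesis using ci z(1) by (simp add: nat_pow_mult[symmetric])
  qed
  have ckx: "c = x [^] ((2::nat) ^ (m - 1))" using invol[OF x mn(1)] n2 i by blast
  have cky: "c = y [^] ((2::nat) ^ (n - 1))" using invol[OF y mn(2)] n2 k by blast
  have "m = 2"
  proof (rule ccontr)
    assume "m \<noteq> 2"
    \<comment> \<open>With this exponent \<open>x [^] e\<close> and \<open>y\<close> have the same
      power of exponent \<open>2 ^ (n - 1)\<close>, namely \<open>c\<close>; their quotient
      \<open>z\<close> is to have smaller order than \<open>y\<close>.\<close>
    define e where "e = (2::nat) ^ (m - n)"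
    define z where "z = inv (x [^] e) \<otimes> y"
    have z: "z \<in> carrier G" using x y by (simp add: z_def)
    have "x [^] e \<otimes> z = y" using x y by (simp add: z_def m_assoc[symmetric])
    moreover have "x [^] e \<otimes> x = x \<otimes> x [^] e" using x by (simp add: centralize_pow)
    ultimately have ncz: "x \<otimes> z \<noteq> z \<otimes> x"
      using nc centralize_mult[of "x [^] e" x z] x z by auto
    have "e * 2 ^ (n - 1) = 2 ^ (m - 1)" using nm n2 by (simp add: e_def flip: power_add)
    then have cxe: "(x [^] e) [^] ((2::nat) ^ (n - 1)) = c" using x ckx by (simp add: nat_pow_pow)
    have "z [^] ((2::nat) ^ (n - 1)) = \<one>"
    proof (cases "m = n")
      case False
      then obtain e' where e': "e = 2 * e'" using nm by (cases "m - n") (auto simp: e_def)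
      have "x [^] e \<otimes> y = y \<otimes> x [^] e"
        unfolding e' using x y centralize_pow[OF x2] by (simp add: nat_pow_pow)
      then have "inv (x [^] e) \<otimes> y = y \<otimes> inv (x [^] e)" using x y by (intro centralize_inv) auto
      then have "z [^] ((2::nat) ^ (n - 1)) = inv (x [^] e) [^] ((2::nat) ^ (n - 1)) \<otimes> y [^] ((2::nat) ^ (n - 1))"
        unfolding z_def using x y by (intro pow_mult_distrib) auto
      also have "\<dots> = inv c \<otimes> c" using x cxe cky by (simp add: nat_pow_inv)
      finally show ?thesis using c by simp
    next
      case True
      \<comment> \<open>For equal orders \<open>x\<close> and \<open>y\<close> themselves are
        divided and the square of \<open>z\<close> picks up a factor \<open>c\<close>. It disappears
        because \<open>n \<ge> 3\<close> makes \<open>q\<close> even; for \<open>n = 2\<close> it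
        would survive, as in the quaternion group.\<close>
      then have e1: "e = 1" and n3: "n \<ge> 3" using \<open>m \<noteq> 2\<close> n2 by (simp_all add: e_def)
      have zx: "z = inv x \<otimes> y" using x e1 by (simp add: z_def)
      have "y \<otimes> inv x = inv x \<otimes> (x \<otimes> y) \<otimes> inv x" using x y by (simp add: m_assoc[symmetric])
      also have "\<dots> = inv x \<otimes> c \<otimes> y" unfolding sw using x y c by (simp add: m_assoc)
      finally have yx: "y \<otimes> inv x = inv x \<otimes> c \<otimes> y" .
      have cix: "inv x \<otimes> c = c \<otimes> inv x" using centralize_inv[of x c] cx x c by simp
      define x' where "x' = inv (x [^] (2::nat))"
      have x': "x' \<in> carrier G" "x' = inv x \<otimes> inv x" using x by (simp_all add: x'_def numeral_2_eq_2 inv_mult_group)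
      have "z [^] (2::nat) = inv x \<otimes> (y \<otimes> inv x) \<otimes> y"
        using x y by (simp add: zx numeral_2_eq_2 m_assoc)
      also have "\<dots> = c \<otimes> (x' \<otimes> y [^] (2::nat))"
        unfolding yx cix using x y c x' cix by (simp add: numeral_2_eq_2 m_assoc) (simp add: m_assoc[symmetric] cix)
      finally have z2: "z [^] (2::nat) = c \<otimes> (x' \<otimes> y [^] (2::nat))" .
      have x'y: "x' \<otimes> y = y \<otimes> x'" using centralize_inv[OF x2] x y by (simp add: x'_def)
      have "x' \<otimes> c = c \<otimes> x'" using x' x c cix centralize_mult[of "inv x" c "inv x"] by simp
      then have comm1: "c \<otimes> (x' \<otimes> y [^] (2::nat)) = x' \<otimes> y [^] (2::nat) \<otimes> c"
        using centralize_mult[of x' c "y [^] (2::nat)"] centralize_pow[of y c 2] cy c x' y by simp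
      have comm2: "x' \<otimes> y [^] (2::nat) = y [^] (2::nat) \<otimes> x'"
        using centralize_pow[of y x' 2] x'y x' y by simp
      define q where "q = (2::nat) ^ (n - 2)"
      have q: "2 * q = 2 ^ (n - 1)" "even q" using n3 by (auto simp: q_def simp flip: power_Suc)
      have "z [^] (2 * q) = (c \<otimes> (x' \<otimes> y [^] (2::nat))) [^] q"
        using z z2 by (simp add: nat_pow_pow[symmetric])
      also have "\<dots> = c [^] q \<otimes> (x' [^] q \<otimes> (y [^] (2::nat)) [^] q)"
        using pow_mult_distrib[OF comm1, of q] pow_mult_distrib[OF comm2, of q] x'(1) y c by simp
      also have "c [^] q = \<one>"
      proof -
        obtain q' where "q = 2 * q'" using q(2) by blast
        moreover have "c [^] (2::nat) = \<one>" using cc c by (simp add: numeral_2_eq_2)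
        ultimately show ?thesis using c by (simp add: nat_pow_pow[symmetric])
      qed
      also have "x' [^] q = inv c"
        using x q(1) ckx True by (simp add: x'_def nat_pow_inv nat_pow_pow)
      also have "(y [^] (2::nat)) [^] q = c" using y q(1) cky by (simp add: nat_pow_pow)
      finally show ?thesis using c q(1) by simp
    qed
    then have "ord z dvd 2 ^ (n - 1)" using pow_eq_id[OF z] by blast
    then have "ord z \<le> 2 ^ (n - 1)" by (rule dvd_imp_le) simp
    also have "\<dots> < 2 ^ n" using n2 by simp
    finally show False using mini[OF x z ncz] mn by simp
  qed
  then have "ord x = 4" "ord y = 4" using mn n2 nm by auto
  then show ?thesis using pow_ord_eq_1 x y by metis
qed

lemma quaternion_pair:
  assumes "a \<in> carrier G" "b \<in> carrier G" "a \<otimes> b \<noteq> b \<otimes> a"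
  shows "\<exists>x\<in>carrier G. \<exists>y\<in>carrier G. x \<otimes> y \<noteq> y \<otimes> x \<and> x [^] (4::nat) = \<one> \<and> y [^] (4::nat) = \<one>"
proof -
  define Q where "Q = (\<lambda>(x, y). x \<in> carrier G \<and> y \<in> carrier G \<and> x \<otimes> y \<noteq> y \<otimes> x)"
  have "Q (a, b)" using assms by (simp add: Q_def)
  then obtain p where p: "Q p" "\<And>q. Q q \<Longrightarrow> ord (fst p) + ord (snd p) \<le> ord (fst q) + ord (snd q)"
    using ex_has_least_nat[of Q "(a, b)" "\<lambda>p. ord (fst p) + ord (snd p)"] by blast
  obtain x y where xy: "p = (x, y)" by (cases p)
  have x: "x \<in> carrier G" "y \<in> carrier G" "x \<otimes> y \<noteq> y \<otimes> x" using p(1) xy by (auto simp: Q_def)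
  have mini: "ord x + ord y \<le> ord x' + ord y'"
    if "x' \<in> carrier G" "y' \<in> carrier G" "x' \<otimes> y' \<noteq> y' \<otimes> x'" for x' y'
    using p(2)[of "(x', y')"] that xy by (simp add: Q_def)
  show ?thesis
  proof (cases "ord y \<le> ord x")
    case True
    then show ?thesis using minimal_pair[OF x True mini] x by blast
  next
    case False
    have "y [^] (4::nat) = \<one> \<and> x [^] (4::nat) = \<one>"
      by (rule minimal_pair) (use x False mini in \<open>auto simp: add.commute\<close>)
    then show ?thesis using x by blast
  qed
qed

text \<open>Conjugation by \<open>y\<close> sends \<open>x \<otimes> z\<close> to
  \<open>inv x \<otimes> z\<close>, which must be a power of \<open>x \<otimes> z\<close>. The
  parity of the exponent, and then of its half, bounds the order of \<open>z\<close>.\<close>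

lemma centralizer_exp4:
  assumes x: "x \<in> carrier G" "x [^] (4::nat) = \<one>" and y: "y \<in> carrier G" "y [^] (4::nat) = \<one>"
    and nc: "x \<otimes> y \<noteq> y \<otimes> x"
    and z: "z \<in> carrier G" "z \<otimes> x = x \<otimes> z" "z \<otimes> y = y \<otimes> z"
  shows "z [^] (4::nat) = \<one>"
proof -
  have yxy: "y \<otimes> x \<otimes> inv y = inv x"
    using conj_exp4[OF x y(1)] nc conj_eqD[of y x x] x y by auto
  define c where "c = x [^] (2::nat)"
  have c: "c \<in> carrier G" "c \<otimes> c = \<one>" using x by (simp_all add: c_def nat_pow_mult)
  have xi: "inv x = c \<otimes> x"
    using x by (intro inv_equality) (simp_all add: c_def eval_nat_numeral m_assoc)
  have "y \<otimes> (x \<otimes> z) \<otimes> inv y = inv x \<otimes> z"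
    using yxy z x y centralize_inv[of y z] by (metis inv_closed m_assoc m_closed)
  moreover obtain k :: nat where "y \<otimes> (x \<otimes> z) \<otimes> inv y = (x \<otimes> z) [^] k"
    using conj_power[of "x \<otimes> z" y] x y z by auto
  moreover have "(x \<otimes> z) [^] k = x [^] k \<otimes> z [^] k" using z x by (intro pow_mult_distrib) auto
  ultimately have k: "c \<otimes> x \<otimes> z = x [^] k \<otimes> z [^] k" using xi by simp
  have zc: "z \<otimes> c = c \<otimes> z" using centralize_pow[of x z 2] z x by (simp add: c_def)
  have zk: "z [^] j \<otimes> x = x \<otimes> z [^] j" "z [^] j \<otimes> y = y \<otimes> z [^] j" for j :: nat
    using centralize_pow z x y by auto
  have yc: "c \<otimes> y = y \<otimes> c"
  proof -
    have "y \<otimes> c \<otimes> inv y = inv x [^] (2::nat)" using conj_pow[OF x(1) y(1), of 2] yxy by (simp add: c_def)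
    also have "\<dots> = inv c" using x by (simp add: c_def nat_pow_inv)
    also have "\<dots> = c" using c by (simp add: inv_equality)
    finally show ?thesis using conj_eqD[of y c c] c y by simp
  qed
  show ?thesis
  proof (cases "even k")
    case True
    \<comment> \<open>An even power of \<open>x\<close> is a power of \<open>c\<close> and commutes
      with \<open>y\<close>, so \<open>inv x\<close> would commute with \<open>y\<close> as
      well.\<close>
    then obtain j where "k = 2 * j" by blast
    then have xk: "x [^] k = c [^] j" using x by (simp add: c_def nat_pow_pow)
    have "c [^] j \<otimes> z [^] k \<otimes> y = y \<otimes> (c [^] j \<otimes> z [^] k)"
      by (rule centralize_mult) (use centralize_pow yc c y zk z in auto)
    then have "c \<otimes> x \<otimes> z \<otimes> y = y \<otimes> (c \<otimes> x \<otimes> z)" using k xk by simp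
    then have "c \<otimes> x \<otimes> y = y \<otimes> (c \<otimes> x)" using centralize_cancel[of "c \<otimes> x" z y] z c x y by simp
    then have "inv x \<otimes> y = y \<otimes> inv x" using xi by simp
    then have "x \<otimes> y = y \<otimes> x" using centralize_inv[of "inv x" y] x y by simp
    then show ?thesis using nc by simp
  next
    case False
    then obtain l where l: "k = Suc (2 * l)" by (metis oddE Suc_eq_plus1)
    have cl: "c [^] l = (if even l then \<one> else c)"
    proof (cases "even l")
      case True
      then obtain l' where "l = 2 * l'" by blast
      moreover have "c [^] (2::nat) = \<one>" using c by (simp add: numeral_2_eq_2)
      ultimately show ?thesis using c True by (simp add: nat_pow_pow[symmetric])
    next
      case False
      then obtain l' where "l = Suc (2 * l')" by (metis oddE Suc_eq_plus1)
      moreover have "c [^] (2::nat) = \<one>" using c by (simp add: numeral_2_eq_2)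
      ultimately show ?thesis using c False by (simp add: nat_pow_pow[symmetric])
    qed
    have "x [^] k = c [^] l \<otimes> x" using x l by (simp add: c_def nat_pow_pow)
    moreover have "z [^] k = z [^] (2 * l) \<otimes> z" using l z by simp
    ultimately have "c \<otimes> x \<otimes> z = c [^] l \<otimes> x \<otimes> z [^] (2 * l) \<otimes> z" using k x z c by (simp add: m_assoc)
    then have "c \<otimes> x = c [^] l \<otimes> x \<otimes> z [^] (2 * l)" using x z c by simp
    then have "c \<otimes> x = c [^] l \<otimes> z [^] (2 * l) \<otimes> x" using zk x z c by (simp add: m_assoc)
    then have cz: "c = c [^] l \<otimes> z [^] (2 * l)" using x z c by simp
    show ?thesis
    proof (cases "even l")
      case True
      \<comment> \<open>Here \<open>c = z [^] (2 * l)\<close>, so \<open>w\<close> squares to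
        \<open>c \<otimes> c = \<one>\<close>. Elements of prime order are central, and
        \<open>x\<close> would commute with \<open>y\<close>.\<close>
      define w where "w = x \<otimes> z [^] l"
      have w: "w \<in> carrier G" using x z by (simp add: w_def)
      have "w [^] (2::nat) = c \<otimes> z [^] (2 * l)"
        unfolding w_def c_def using x z zk[of l] by (subst pow_mult_distrib) (auto simp: nat_pow_pow mult.commute)
      also have "\<dots> = \<one>" using cz cl True c z by simp
      finally have "ord w dvd 2" using pow_eq_id[OF w] by blast
      then have "ord w = 1 \<or> ord w = 2" using prime_nat_iff two_is_prime_nat by blast
      then have "w \<otimes> y = y \<otimes> w"
        using ord_eq_1[OF w] prime_order_central[OF w _ y(1)] y by auto
      then have "x \<otimes> y = y \<otimes> x"
        unfolding w_def using centralize_cancel[of x "z [^] l" y] zk[of l] x y z by simp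
      then show ?thesis using nc by simp
    next
      case False
      \<comment> \<open>Now \<open>ord z\<close> is a power of 2 that divides twice an odd
        number.\<close>
      then have "c = c \<otimes> z [^] (2 * l)" using cz cl by simp
      then have "inv c \<otimes> (c \<otimes> z [^] (2 * l)) = inv c \<otimes> c" by (rule arg_cong[OF sym])
      then have "z [^] (2 * l) = \<one>" using c z by (simp add: inv_cancel_left)
      then have "ord z dvd 2 * l" using pow_eq_id[OF z(1)] by blast
      moreover obtain t where t: "ord z = 2 ^ t" using ord_2_power[OF z(1)] by blast
      ultimately have *: "2 ^ t dvd 2 * l" by simp
      have "t \<le> 1"
      proof (rule ccontr)
        assume "\<not> t \<le> 1"
        then have "2\<^sup>2 dvd (2::nat) ^ t" by (intro le_imp_power_dvd) simp
        then have "4 dvd 2 * l" using * dvd_trans by fastforce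
        then show False using False by presburger
      qed
      then have "ord z dvd 4" using t le_imp_power_dvd[of t 2 "2::nat"] by simp
      then show ?thesis using pow_eq_id[OF z(1)] by blast
    qed
  qed
qed

text \<open>\<open>g\<close> fixes or inverts each member of a noncommuting pair of exponent 4.
  Conjugation by \<open>x\<close>, \<open>y\<close> and their product realises the nontrivial sign
  patterns, so some \<open>g \<otimes> q\<close> centralises the pair and
  \<open>centralizer_exp4\<close> applies to it.\<close>

theorem hamiltonian_exp4:
  assumes nc: "a \<in> carrier G" "b \<in> carrier G" "a \<otimes> b \<noteq> b \<otimes> a" and g: "g \<in> carrier G"
  shows "g [^] (4::nat) = \<one>"
proof -
  obtain x y where x: "x \<in> carrier G" "x [^] (4::nat) = \<one>" and y: "y \<in> carrier G" "y [^] (4::nat) = \<one>"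
    and nc: "x \<otimes> y \<noteq> y \<otimes> x"
    using quaternion_pair[OF nc] by blast
  have yx: "y \<otimes> x = inv x \<otimes> y"
    using conj_exp4[OF x y(1)] nc conj_eqD[of y x] x y by metis
  have xy: "x \<otimes> y = inv y \<otimes> x"
    using conj_exp4[OF y x(1)] nc conj_eqD[of x y] x y by metis
  \<comment> \<open>The last condition makes \<open>q\<close> commute with the centraliser of the
    pair, hence \<open>g\<close> is a product of two commuting elements of exponent 4.\<close>
  have fin: "g [^] (4::nat) = \<one>"
    if q: "q \<in> carrier G" "q [^] (4::nat) = \<one>" "(g \<otimes> q) \<otimes> x = x \<otimes> (g \<otimes> q)" "(g \<otimes> q) \<otimes> y = y \<otimes> (g \<otimes> q)"
      and c: "\<And>z. \<lbrakk>z \<in> carrier G; z \<otimes> x = x \<otimes> z; z \<otimes> y = y \<otimes> z\<rbrakk> \<Longrightarrow> z \<otimes> q = q \<otimes> z" for q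
  proof -
    define z where "z = g \<otimes> q"
    have z: "z \<in> carrier G" using g q by (simp add: z_def)
    have z4: "z [^] (4::nat) = \<one>" using centralizer_exp4[OF x y nc z] q(3,4) by (simp add: z_def)
    have zq: "z \<otimes> q = q \<otimes> z" using c[OF z] q(3,4) by (simp add: z_def)
    have gz: "g = z \<otimes> inv q" using g q by (simp add: z_def m_assoc)
    have "z \<otimes> inv q = inv q \<otimes> z" using centralize_inv[of q z] zq q z by simp
    then have "g [^] (4::nat) = z [^] (4::nat) \<otimes> inv q [^] (4::nat)"
      unfolding gz using z q by (intro pow_mult_distrib) auto
    then show ?thesis using z4 q by (simp add: nat_pow_inv)
  qed
  have gx: "g \<otimes> x = x \<otimes> g \<or> g \<otimes> x = inv x \<otimes> g"
    using conj_exp4[OF x g] conj_eqD[of g x] x g by metis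
  have gy: "g \<otimes> y = y \<otimes> g \<or> g \<otimes> y = inv y \<otimes> g"
    using conj_exp4[OF y g] conj_eqD[of g y] y g by metis
  have xi: "g \<otimes> inv x = x \<otimes> g" if "g \<otimes> x = inv x \<otimes> g"
    using that x g by (metis inv_closed m_assoc r_inv l_inv r_one inv_cancel_left(2) m_closed)
  have yi: "g \<otimes> inv y = y \<otimes> g" if "g \<otimes> y = inv y \<otimes> g"
    using that y g by (metis inv_closed m_assoc r_inv l_inv r_one inv_cancel_left(2) m_closed)
  show ?thesis
  proof (cases "g \<otimes> x = x \<otimes> g"; cases "g \<otimes> y = y \<otimes> g")
    assume "g \<otimes> x = x \<otimes> g" "g \<otimes> y = y \<otimes> g"
    then show ?thesis using fin[of \<one>] g x y by simp
  next
    assume 1: "g \<otimes> x = x \<otimes> g" and "g \<otimes> y \<noteq> y \<otimes> g"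
    then have 2: "g \<otimes> inv y = y \<otimes> g" using gy yi by blast
    have "g \<otimes> x \<otimes> x = x \<otimes> (g \<otimes> x)" using 1 x g by (simp add: m_assoc)
    moreover have "g \<otimes> x \<otimes> y = y \<otimes> (g \<otimes> x)" using 2 xy x y g by (metis inv_closed m_assoc)
    ultimately show ?thesis using fin[of x] x by simp
  next
    assume "g \<otimes> x \<noteq> x \<otimes> g" and 1: "g \<otimes> y = y \<otimes> g"
    then have 2: "g \<otimes> inv x = x \<otimes> g" using gx xi by blast
    have "g \<otimes> y \<otimes> y = y \<otimes> (g \<otimes> y)" using 1 y g by (simp add: m_assoc)
    moreover have "g \<otimes> y \<otimes> x = x \<otimes> (g \<otimes> y)" using 2 yx x y g by (metis inv_closed m_assoc)
    ultimately show ?thesis using fin[of y] y by simp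
  next
    assume "g \<otimes> x \<noteq> x \<otimes> g" "g \<otimes> y \<noteq> y \<otimes> g"
    then have gxi: "g \<otimes> inv x = x \<otimes> g" and gyi: "g \<otimes> inv y = y \<otimes> g" using gx gy xi yi by blast+
    have 1: "g \<otimes> (x \<otimes> y) \<otimes> x = x \<otimes> (g \<otimes> (x \<otimes> y))"
    proof -
      have "g \<otimes> (x \<otimes> y) \<otimes> x = g \<otimes> (x \<otimes> (inv x \<otimes> y))" using yx g x y by (simp add: m_assoc)
      also have "\<dots> = g \<otimes> (inv x \<otimes> (x \<otimes> y))" using x y by (simp add: inv_cancel_left)
      also have "\<dots> = x \<otimes> (g \<otimes> (x \<otimes> y))" using gxi g x y by (metis inv_closed m_assoc m_closed)
      finally show ?thesis .
    qed
    have 2: "g \<otimes> (x \<otimes> y) \<otimes> y = y \<otimes> (g \<otimes> (x \<otimes> y))"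
    proof -
      have "g \<otimes> (x \<otimes> y) \<otimes> y = g \<otimes> (inv y \<otimes> (x \<otimes> y))" using xy g x y by (simp add: m_assoc)
      also have "\<dots> = y \<otimes> (g \<otimes> (x \<otimes> y))" using gyi g x y by (metis inv_closed m_assoc m_closed)
      finally show ?thesis .
    qed
    have "(x \<otimes> y) [^] (2::nat) = x \<otimes> (y \<otimes> x) \<otimes> y" using x y by (simp add: numeral_2_eq_2 m_assoc)
    also have "\<dots> = y [^] (2::nat)" unfolding yx using x y by (simp add: numeral_2_eq_2 m_assoc inv_cancel_left)
    finally have "((x \<otimes> y) [^] (2::nat)) [^] (2::nat) = (y [^] (2::nat)) [^] (2::nat)" by simp
    then have "(x \<otimes> y) [^] (4::nat) = \<one>" using x y by (simp add: nat_pow_pow)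
    moreover have "z \<otimes> (x \<otimes> y) = x \<otimes> y \<otimes> z"
      if "z \<in> carrier G" "z \<otimes> x = x \<otimes> z" "z \<otimes> y = y \<otimes> z" for z
      using that x y by (metis m_assoc)
    ultimately show ?thesis using fin[of "x \<otimes> y"] x y 1 2 by simp
  qed
qed

end

section \<open>Groups with few units\<close>

text \<open>All these numbers divide 4 or 6.\<close>

lemma proper_divisor_5_8_12:
  fixes d n :: nat
  assumes "n \<in> {5, 8, 12}" "d dvd n" "d < n"
  shows "d \<in> {1, 2, 3, 4, 6}"
proof -
  have "d < 12" using assms by auto
  then have "d \<in> {0, 1, 2, 3, 4, 5, 6, 7, 8, 9, 10, 11}" by (simp, presburger)
  then show ?thesis using assms by auto
qed

context int_group_ring
begin

text \<open>The same translations serve the subgroup; independence is inherited by extending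
  coefficients by 0.\<close>

lemma subgroup_ring:
  assumes H: "subgroup H G"
  shows "int_group_ring (G\<lparr>carrier := H\<rparr>) D"
proof -
  interpret H: group "G\<lparr>carrier := H\<rparr>" by (rule subgroup.subgroup_is_group[OF H is_group])
  have sub: "H \<subseteq> carrier G" by (rule subgroup.subset[OF H])
  show ?thesis
  proof unfold_locales
    show "finite (carrier (G\<lparr>carrier := H\<rparr>))" using finite_subset[OF sub finite_G] by simp
    show "D (x \<otimes>\<^bsub>G\<lparr>carrier := H\<rparr>\<^esub> y) = D x * D y"
      if "x \<in> carrier (G\<lparr>carrier := H\<rparr>)" "y \<in> carrier (G\<lparr>carrier := H\<rparr>)" for x y
      using that sub by (auto intro: D_mult)
    show "D \<one>\<^bsub>G\<lparr>carrier := H\<rparr>\<^esub> = 1" by (simp add: D_one)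
    fix f :: "'a \<Rightarrow> int" and g
    assume 0: "(\<Sum>g\<in>carrier (G\<lparr>carrier := H\<rparr>). of_int (f g) * D g) = 0" and g: "g \<in> carrier (G\<lparr>carrier := H\<rparr>)"
    have "(\<Sum>g\<in>carrier G. of_int (if g \<in> H then f g else 0) * D g) = (\<Sum>g\<in>H. of_int (f g) * D g)"
      using finite_G sub by (intro sum.mono_neutral_cong_right) auto
    then have "(\<Sum>g\<in>carrier G. of_int (if g \<in> H then f g else 0) * D g) = 0" using 0 by simp
    from D_indep[OF this, of g] g sub show "f g = 0" by auto
  qed
qed

lemma supported_in_subgroup_ring:
  assumes H: "subgroup H G" and r: "r \<in> ZG" and supp: "\<And>g. g \<in> carrier G \<Longrightarrow> g \<notin> H \<Longrightarrow> cf r g = 0"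
  shows "r \<in> int_group_ring.ZG (G\<lparr>carrier := H\<rparr>) D"
proof -
  interpret H: int_group_ring "G\<lparr>carrier := H\<rparr>" D by (rule subgroup_ring[OF H])
  have "r = (\<Sum>g\<in>carrier G. of_int (cf r g) * D g)" by (rule ZG_expand[OF r])
  also have "\<dots> = (\<Sum>g\<in>H. of_int (cf r g) * D g)"
    using finite_G subgroup.subset[OF H] supp by (intro sum.mono_neutral_cong_right) auto
  also have "\<dots> = H.lift (cf r)" by (simp add: H.lift_def)
  finally show ?thesis using H.lift_in_ZG[of "cf r"] by simp
qed

lemma ev_D_support:
  assumes x: "x \<in> carrier G" and g: "g \<in> carrier G" "g \<notin> generate G {x}"
  shows "cf (ev P (D x)) g = 0"
  using g
proof (induction P arbitrary: g)
  case (pCons a P)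
  have sub: "subgroup (generate G {x}) G" using x by (intro generate_is_subgroup) auto
  have "inv x \<otimes> g \<notin> generate G {x}"
  proof
    assume "inv x \<otimes> g \<in> generate G {x}"
    moreover have "x \<in> generate G {x}" by (rule generate.incl) simp
    ultimately have "x \<otimes> (inv x \<otimes> g) \<in> generate G {x}" by (rule generate.eng[rotated])
    then show False using pCons(3,4) x by (simp add: inv_cancel_left)
  qed
  then have "cf (D x * ev P (D x)) g = 0" using pCons x by (simp add: cf_D_mult)
  moreover have "g \<noteq> \<one>" using pCons(4) generate.one by metis
  then have "cf (of_int a) g = 0" using cf_scale[OF one_in_ZG, of a g] by (simp add: cf_one)
  ultimately show ?case using x by (simp add: cf_add)
qed (simp add: cf_zero)

lemma ev_commute2:
  assumes "a * b = b * (a::'r)"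
  shows "ev P a * ev Q b = ev Q b * ev P a"
proof -
  have 1: "a * ev Q b = ev Q b * a"
  proof (induction Q)
    case (pCons c Q)
    have "a * (b * ev Q b) = b * (a * ev Q b)" using assms by (metis mult.assoc)
    then have "a * (b * ev Q b) = b * ev Q b * a" using pCons by (simp add: mult.assoc)
    then show ?case by (simp add: distrib_left distrib_right mult_of_int_commute)
  qed simp
  show ?thesis
  proof (induction P)
    case (pCons c P)
    have "a * ev P a * ev Q b = a * ev Q b * ev P a" using pCons by (simp add: mult.assoc)
    then have "a * ev P a * ev Q b = ev Q b * (a * ev P a)" using 1 by (simp add: mult.assoc)
    then show ?case by (simp add: distrib_left distrib_right mult_of_int_commute)
  qed simp
qed

lemma power_inverse: "unit_pair u v \<Longrightarrow> u ^ k * v ^ k = 1 \<and> v ^ k * u ^ k = 1"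
  by (simp add: unit_pair_def left_right_inverse_power)

text \<open>Two different cyclic subgroups with units of infinite order: a relation between these units
  would give a unit of infinite order in the group ring of the proper subgroup where they meet.\<close>

lemma unique_big_cyclic:
  assumes x: "x \<in> carrier G" "ord x \<in> {5, 8, 12}" and y: "y \<in> carrier G" "ord y \<in> {5, 8, 12}"
    and xy: "x \<otimes> y = y \<otimes> x" and dep: comm_units_dep
  shows "y \<in> generate G {x}"
proof (rule ccontr)
  assume ny: "y \<notin> generate G {x}"
  obtain P P' where P: "unit_pair (ev P (D x)) (ev P' (D x))" "\<forall>k>0. ev P (D x) ^ k \<noteq> 1"
    using infinite_order_unit_5_8_12[OF x] by blast
  obtain Q Q' where Q: "unit_pair (ev Q (D y)) (ev Q' (D y))" "\<forall>k>0. ev Q (D y) ^ k \<noteq> 1"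
    using infinite_order_unit_5_8_12[OF y] by blast
  define H where "H = generate G {x} \<inter> generate G {y}"
  have gx: "subgroup (generate G {x}) G" and gy: "subgroup (generate G {y}) G"
    using x y by (auto intro!: generate_is_subgroup)
  have H: "subgroup H G" unfolding H_def using gx gy by (rule subgroups_Inter_pair)
  have Hsub: "H \<subseteq> carrier G" by (rule subgroup.subset[OF H])
  interpret Y: group "G\<lparr>carrier := generate G {y}\<rparr>" by (rule subgroup.subgroup_is_group[OF gy is_group])
  have "subgroup H (G\<lparr>carrier := generate G {y}\<rparr>)"
    by (rule subgroup_incl[OF H gy]) (simp add: H_def)
  from Y.lagrange[OF this] have "card H dvd Coset.order (G\<lparr>carrier := generate G {y}\<rparr>)"
    by (rule dvdI[OF trans[OF sym mult.commute]])
  then have dvd: "card H dvd ord y" using generate_pow_card[OF y(1)] by (simp add: Coset.order_def)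
  have "H \<noteq> generate G {y}" using ny by (auto simp: H_def intro: generate.incl)
  then have "H \<subset> generate G {y}" by (auto simp: H_def)
  moreover have "finite (generate G {y})" using subgroup.subset[OF gy] finite_G finite_subset by blast
  ultimately have "card H < ord y" using psubset_card_mono generate_pow_card[OF y(1)] by metis
  \<comment> \<open>The exponent of \<open>H\<close> divides 4 or 6, and by
    \<open>higman_unit_torsion\<close> its group ring has only torsion units.\<close>
  with dvd have cardH: "card H dvd 4 \<or> card H dvd 6"
  proof -
    have "card H \<in> {1, 2, 3, 4, 6}"
      using proper_divisor_5_8_12[OF y(2) dvd \<open>card H < ord y\<close>] .
    then show ?thesis by auto
  qed
  interpret H: group "G\<lparr>carrier := H\<rparr>" by (rule subgroup.subgroup_is_group[OF H is_group])
  have pow: "h [^]\<^bsub>G\<lparr>carrier := H\<rparr>\<^esub> k = h [^] k" for h and k :: nat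
    by (simp add: nat_pow_def)
  have hc: "h [^] card H = \<one>" if "h \<in> H" for h
    using H.pow_order_eq_1[of h] that by (simp add: Coset.order_def pow)
  have exp: "(\<forall>h\<in>H. h [^] (4::nat) = \<one>) \<or> (\<forall>h\<in>H. h [^] (6::nat) = \<one>)"
    using cardH
  proof (elim disjE dvdE)
    fix k assume "4 = card H * k"
    then have "\<forall>h\<in>H. h [^] (4::nat) = \<one>" using hc Hsub by (metis nat_pow_one nat_pow_pow subsetD)
    then show ?thesis ..
  next
    fix k assume "6 = card H * k"
    then have "\<forall>h\<in>H. h [^] (6::nat) = \<one>" using hc Hsub by (metis nat_pow_one nat_pow_pow subsetD)
    then show ?thesis ..
  qed
  interpret HR: int_group_ring "G\<lparr>carrier := H\<rparr>" D by (rule subgroup_ring[OF H])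
  interpret HR: higman_conj "G\<lparr>carrier := H\<rparr>" D
  proof unfold_locales
    fix g h assume "g \<in> carrier (G\<lparr>carrier := H\<rparr>)" "h \<in> carrier (G\<lparr>carrier := H\<rparr>)"
    then have gh: "g \<in> H" "h \<in> H" by simp_all
    then obtain i j :: nat where "g = x [^] i" "h = x [^] j"
      using generate_eq_powers[OF finite_G x(1)] by (auto simp: H_def)
    then have "h \<otimes> g = g \<otimes> h" using x by (simp add: nat_pow_mult add.commute)
    then have "h \<otimes> g \<otimes> inv h = g" using subsetD[OF Hsub gh(1)] subsetD[OF Hsub gh(2)] by (simp add: m_assoc)
    moreover have "inv\<^bsub>G\<lparr>carrier := H\<rparr>\<^esub> h = inv h" using gh m_inv_consistent[OF H] by simp
    ultimately show "h \<otimes>\<^bsub>G\<lparr>carrier := H\<rparr>\<^esub> g \<otimes>\<^bsub>G\<lparr>carrier := H\<rparr>\<^esub> inv\<^bsub>G\<lparr>carrier := H\<rparr>\<^esub> h = g \<or>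
      h \<otimes>\<^bsub>G\<lparr>carrier := H\<rparr>\<^esub> g \<otimes>\<^bsub>G\<lparr>carrier := H\<rparr>\<^esub> inv\<^bsub>G\<lparr>carrier := H\<rparr>\<^esub> h = inv\<^bsub>G\<lparr>carrier := H\<rparr>\<^esub> g"
      by simp
  qed
  define N where "N = 2 * card H"
  have N: "N > 0" using subgroup.one_closed[OF H] finite_subset[OF Hsub finite_G] by (auto simp: N_def card_gt_0_iff)
  \<comment> \<open>A unit that belongs to both group rings is supported on the intersection of the
    cyclic groups.\<close>
  have tors: "ev A (D x) ^ N = 1"
    if u: "unit_pair (ev A (D x)) (ev A' (D x))" and eq: "ev A (D x) = ev B (D y)" "ev A' (D x) = ev B' (D y)" for A A' B B'
  proof -
    have in_H: "ev A (D x) \<in> HR.ZG" if "ev A (D x) = ev B (D y)" for A B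
    proof (rule supported_in_subgroup_ring[OF H])
      show "ev A (D x) \<in> ZG" using x by simp
      fix g assume "g \<in> carrier G" "g \<notin> H"
      then show "cf (ev A (D x)) g = 0"
        using ev_D_support[OF x(1), of g A] ev_D_support[OF y(1), of g B] that by (auto simp: H_def)
    qed
    have "ev A (D x) ^ (2 * card (carrier (G\<lparr>carrier := H\<rparr>))) = 1"
      by (rule HR.higman_unit_torsion[OF _ in_H[OF eq(1)] in_H[OF eq(2)]])
         (use exp u in \<open>auto simp: pow unit_pair_def\<close>)
    then show ?thesis by (simp add: N_def)
  qed
  have "ev P (D x) * ev Q (D y) = ev Q (D y) * ev P (D x)"
    using xy x y by (intro ev_commute2) (simp flip: D_mult)
  then have "mult_dep (ev P (D x)) (ev Q (D y))" using dep P Q unfolding comm_units_dep_def by blast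
  then obtain a b :: nat where ab: "(a, b) \<noteq> (0, 0)"
    and "ev P (D x) ^ a * ev Q (D y) ^ b = 1 \<or> ev P (D x) ^ a = ev Q (D y) ^ b"
    unfolding mult_dep_def by blast
  \<comment> \<open>The second unit is replaced by its inverse where necessary, so that the relation
    is an equality of powers.\<close>
  then obtain B B' where B: "unit_pair (ev B (D y)) (ev B' (D y))" "ev P (D x) ^ a = ev B (D y) ^ b"
    "\<forall>k>0. ev B (D y) ^ k \<noteq> 1"
  proof (elim disjE)
    assume 1: "ev P (D x) ^ a * ev Q (D y) ^ b = 1"
    have "ev P (D x) ^ a = ev P (D x) ^ a * (ev Q (D y) ^ b * ev Q' (D y) ^ b)"
      using power_inverse[OF Q(1)] by simp
    also have "\<dots> = ev Q' (D y) ^ b" using 1 by (simp add: mult.assoc[symmetric])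
    finally have eq: "ev P (D x) ^ a = ev Q' (D y) ^ b" .
    have pair: "unit_pair (ev Q' (D y)) (ev Q (D y))" using Q(1) by (simp add: unit_pair_def)
    have "\<forall>k>0. ev Q' (D y) ^ k \<noteq> 1" using Q(2) power_inverse[OF Q(1)] by (metis mult_1_right)
    then show thesis by (rule that[OF pair eq])
  next
    assume "ev P (D x) ^ a = ev Q (D y) ^ b"
    then show thesis using that Q by blast
  qed
  have inv_eq: "ev P' (D x) ^ a = ev B' (D y) ^ b"
  proof -
    have "ev P' (D x) ^ a = ev P' (D x) ^ a * (ev B (D y) ^ b * ev B' (D y) ^ b)"
      using power_inverse[OF B(1)] by simp
    also have "\<dots> = (ev P' (D x) ^ a * ev P (D x) ^ a) * ev B' (D y) ^ b" unfolding B(2) by (simp add: mult.assoc)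
    also have "\<dots> = ev B' (D y) ^ b" using power_inverse[OF P(1)] by simp
    finally show ?thesis .
  qed
  have "unit_pair (ev (P ^ a) (D x)) (ev (P' ^ a) (D x))"
    using power_inverse[OF P(1)] x by (simp add: unit_pair_def)
  then have "ev (P ^ a) (D x) ^ N = 1"
    by (rule tors[of _ _ "B ^ b" "B' ^ b"]) (simp_all add: B(2) inv_eq)
  then have 1: "ev P (D x) ^ (a * N) = 1" by (simp add: power_mult)
  then have "ev B (D y) ^ (b * N) = 1" using B(2) by (simp add: power_mult)
  then have "a * N = 0" "b * N = 0" using 1 P(2) B(3) by blast+
  then show False using N ab by simp
qed

end

section \<open>Orders of elements and the abelian case\<close>

lemma order_restriction:
  fixes N :: nat
  assumes "N > 0" and odd: "\<And>n. n dvd N \<Longrightarrow> odd n \<Longrightarrow> n < 7"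
    and "\<not> 10 dvd N" "\<not> 16 dvd N" "\<not> 24 dvd N"
  shows "N \<in> {1, 2, 3, 4, 5, 6, 8, 12}"
proof -
  have "\<exists>a m. N = 2 ^ a * m \<and> odd m" using \<open>N > 0\<close>
  proof (induction N rule: less_induct)
    case (less N)
    show ?case
    proof (cases "odd N")
      case True
      then show ?thesis by (intro exI[of _ 0] exI[of _ N]) simp
    next
      case False
      then obtain M where M: "N = 2 * M" by blast
      moreover from this have "\<exists>a m. M = 2 ^ a * m \<and> odd m" using less.prems by (intro less.IH) auto
      ultimately obtain a m where "M = 2 ^ a * m" "odd m" by blast
      then show ?thesis using M by (intro exI[of _ "Suc a"] exI[of _ m]) simp
    qed
  qed
  then obtain a m where am: "N = 2 ^ a * m" "odd m" by blast
  have "m < 7" using odd[of m] am by simp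
  have a: "a < 4"
  proof (rule ccontr)
    assume "\<not> a < 4"
    then have "(2::nat) ^ 4 dvd 2 ^ a" by (intro le_imp_power_dvd) simp
    then show False using assms(4) am by (simp add: dvd_mult2)
  qed
  have "m = 1 \<or> m = 3 \<or> m = 5" using \<open>m < 7\<close> am(2) by presburger
  moreover have "a = 0 \<or> a = 1 \<or> a = 2 \<or> a = 3" using a by linarith
  ultimately show ?thesis using am assms(3-5) by auto
qed

context int_group_ring
begin

text \<open>A cyclic group has elements of every order dividing its own, so excluding an order
  excludes its multiples. With order 24, an element of order 12 would lie in a subgroup of order
  8.\<close>

lemma possible_orders:
  assumes x: "x \<in> carrier G" and dep: comm_units_dep
  shows "ord x \<in> {1, 2, 3, 4, 5, 6, 8, 12}"
proof (rule order_restriction)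
  have ex: "\<exists>y\<in>carrier G. ord y = n" if d: "n dvd ord x" for n
  proof -
    obtain k where k: "ord x = n * k" using d by blast
    then have "k \<noteq> 0" using ord_pos[OF x] by auto
    then have "ord (x [^] k) = n" using ord_pow[OF x, of k] k by simp
    then show ?thesis using x by blast
  qed
  show "ord x > 0" by (rule ord_pos[OF x])
  show "n < 7" if "n dvd ord x" "odd n" for n
    using ex[OF that(1)] no_odd_order[OF _ _ _ dep] that(2) by (metis not_le_imp_less)
  show "\<not> 10 dvd ord x" using ex no_order_10[OF _ _ dep] by blast
  show "\<not> 16 dvd ord x" using ex no_order_16[OF _ _ dep] by blast
  show "\<not> 24 dvd ord x"
  proof
    assume "24 dvd ord x"
    then obtain y where y: "y \<in> carrier G" "ord y = 24" using ex by blast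
    have o: "ord (y [^] (3::nat)) = 8" "ord (y [^] (2::nat)) = 12" using ord_pow[OF y(1)] y(2) by simp_all
    have "y [^] (3::nat) \<otimes> y [^] (2::nat) = y [^] (2::nat) \<otimes> y [^] (3::nat)" using y by (simp add: nat_pow_mult)
    then have "y [^] (2::nat) \<in> generate G {y [^] (3::nat)}"
      using unique_big_cyclic[of "y [^] (3::nat)" "y [^] (2::nat)"] y o dep by simp
    then obtain k :: nat where "y [^] (2::nat) = (y [^] (3::nat)) [^] k"
      using generate_eq_powers[OF finite_G, of "y [^] (3::nat)"] y by auto
    then have "(y [^] (2::nat)) [^] (8::nat) = ((y [^] (3::nat)) [^] (8::nat)) [^] k"
      using y by (simp add: nat_pow_pow mult_ac)
    also have "(y [^] (3::nat)) [^] (8::nat) = \<one>" using o pow_eq_id[of "y [^] (3::nat)" 8] y by simp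
    finally have "12 dvd (8::nat)" using o pow_eq_id[of "y [^] (2::nat)" 8] y by simp
    then show False by simp
  qed
qed

lemma ord_12I:
  assumes z: "z \<in> carrier G" "z [^] (12::nat) = \<one>" "z [^] (4::nat) \<noteq> \<one>" "z [^] (6::nat) \<noteq> \<one>" and dep: comm_units_dep
  shows "ord z = 12"
proof -
  have "ord z dvd 12" "\<not> ord z dvd 4" "\<not> ord z dvd 6" using z pow_eq_id[OF z(1)] by auto
  then show ?thesis using possible_orders[OF z(1) dep] by auto
qed

text \<open>Every deviation is turned into an element of order 12. Without elements of order 5, 8 or
  12 this is absurd; with one such \<open>x\<close>, all elements of these orders lie in its cyclic
  group, and the new one does not.\<close>

theorem abelian_classification:
  assumes comm: "\<And>x y. \<lbrakk>x \<in> carrier G; y \<in> carrier G\<rbrakk> \<Longrightarrow> x \<otimes> y = y \<otimes> x" and dep: comm_units_dep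
  shows "(\<forall>g\<in>carrier G. g [^] (4::nat) = \<one>) \<or> (\<forall>g\<in>carrier G. g [^] (6::nat) = \<one>) \<or>
    (\<exists>x\<in>carrier G. ord x \<in> {5, 8, 12} \<and> carrier G = generate G {x})"
proof (cases "\<exists>x\<in>carrier G. ord x \<in> {5, 8, 12}")
  case False
  then have o: "ord g \<in> {1, 2, 3, 4, 6}" if "g \<in> carrier G" for g using possible_orders[OF that dep] that by auto
  have p12: "g [^] (12::nat) = \<one>" if "g \<in> carrier G" for g
    using o[OF that] pow_eq_id[OF that, of 12] by auto
  show ?thesis
  proof (rule ccontr)
    assume "\<not> ?thesis"
    then obtain x y where x: "x \<in> carrier G" "x [^] (4::nat) \<noteq> \<one>" and y: "y \<in> carrier G" "y [^] (6::nat) \<noteq> \<one>" by blast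
    \<comment> \<open>All elements have 12th power \<open>\<one>\<close>, so the fourth power of
      \<open>z\<close> is that of \<open>x\<close> and its sixth power that of \<open>y\<close>:
      both violations meet in \<open>z\<close>.\<close>
    define z where "z = x [^] (4::nat) \<otimes> y [^] (3::nat)"
    have z: "z \<in> carrier G" using x y by (simp add: z_def)
    have zk: "z [^] k = x [^] (4 * k) \<otimes> y [^] (3 * k)" for k :: nat
      unfolding z_def using x y comm by (subst pow_mult_distrib) (simp_all add: nat_pow_pow)
    have "x [^] (12 + 4 :: nat) = x [^] (4::nat)" "x [^] (12 + 12 :: nat) = \<one>" "y [^] (12 + 6 :: nat) = y [^] (6::nat)"
      using p12[OF x(1)] p12[OF y(1)] x(1) y(1) nat_pow_mult[OF x(1), of 12 4, symmetric]
        nat_pow_mult[OF x(1), of 12 12, symmetric] nat_pow_mult[OF y(1), of 12 6, symmetric]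
      by (simp_all only: l_one nat_pow_closed one_closed)
    moreover have "x [^] (12 * 4 :: nat) = \<one>" "y [^] (12 * 3 :: nat) = \<one>"
      using p12[OF x(1)] p12[OF y(1)] nat_pow_pow[OF x(1), of 12 4, symmetric] nat_pow_pow[OF y(1), of 12 3, symmetric]
      by (simp_all only: nat_pow_one)
    ultimately have "z [^] (4::nat) = x [^] (4::nat)" "z [^] (6::nat) = y [^] (6::nat)" "z [^] (12::nat) = \<one>"
      using zk[of 4] zk[of 6] zk[of 12] p12[OF y(1)] x y by simp_all
    then have "ord z = 12" using ord_12I[OF z] x y dep by simp
    then show False using o[OF z] by simp
  qed
next
  case True
  then obtain x where x: "x \<in> carrier G" "ord x \<in> {5, 8, 12}" by blast
  have big: "y \<in> generate G {x}" if "y \<in> carrier G" "ord y \<in> {5, 8, 12}" for y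
    using unique_big_cyclic[OF x that comm[OF x(1) that(1)] dep] .
  have sub: "subgroup (generate G {x}) G" using x by (intro generate_is_subgroup) auto
  have p12: "g [^] (12::nat) = \<one>" if "g \<in> carrier G" "g \<notin> generate G {x}" for g
    using possible_orders[OF that(1) dep] big[OF that(1)] that(2) pow_eq_id[OF that(1), of 12] by auto
  have n12: "ord g \<noteq> 12" if "g \<in> carrier G" "g \<notin> generate G {x}" for g using big that by auto
  have xk: "x [^] k \<in> generate G {x}" for k :: nat using generate_eq_powers[OF finite_G x(1)] by auto
  have nin: "x [^] k \<otimes> y \<notin> generate G {x}" if "y \<in> carrier G" "y \<notin> generate G {x}" for y and k :: nat
  proof
    assume "x [^] k \<otimes> y \<in> generate G {x}"
    then have "inv (x [^] k) \<otimes> (x [^] k \<otimes> y) \<in> generate G {x}"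
      using subgroup.m_closed[OF sub] subgroup.m_inv_closed[OF sub] xk by metis
    then show False using that x by (simp add: inv_cancel_left)
  qed
  have "generate G {x} = carrier G"
  proof (rule ccontr)
    assume "generate G {x} \<noteq> carrier G"
    then obtain y where y: "y \<in> carrier G" "y \<notin> generate G {x}" using subgroup.subset[OF sub] by blast
    have pd: "(x [^] k \<otimes> z) [^] l = x [^] (k * l) \<otimes> z [^] l" if "z \<in> carrier G" for z and k l :: nat
      using x that comm by (subst pow_mult_distrib) (simp_all add: nat_pow_pow)
    \<comment> \<open>Outside the cyclic group every order divides 12. Applied to \<open>y\<close>
      and to \<open>x \<otimes> y\<close> this gives \<open>x\<close> the order 12.\<close>
    have "(x [^] (1::nat) \<otimes> y) [^] (12::nat) = \<one>" using p12[OF _ nin[OF y, of 1]] x y by simp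
    then have x12: "x [^] (12::nat) = \<one>" unfolding pd[OF y(1)] using p12[OF y] x by simp
    then have "ord x = 12" using x pow_eq_id[OF x(1), of 12] by auto
    then have x46: "x [^] (4::nat) \<noteq> \<one>" "x [^] (6::nat) \<noteq> \<one>" using pow_eq_id[OF x(1)] by auto
    \<comment> \<open>A product of an outside element with a power of \<open>x\<close> is outside
      again, so it suffices to make one of order 12.\<close>
    have no: False if z: "z \<in> carrier G" "z \<notin> generate G {x}"
      and w: "(x [^] k \<otimes> z) [^] (4::nat) \<noteq> \<one>" "(x [^] k \<otimes> z) [^] (6::nat) \<noteq> \<one>" for z and k :: nat
      using ord_12I[OF _ p12[OF _ nin[OF z, of k]] w dep] n12[OF _ nin[OF z, of k]] x z by simp
    have x1: "\<one> \<in> generate G {x}" by (rule generate.one)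
    have x18: "x [^] (18::nat) = x [^] (6::nat)" "x [^] (16::nat) = x [^] (4::nat)" "x [^] (24::nat) = \<one>"
      using x12 x nat_pow_mult[OF x(1), of 12 6] nat_pow_mult[OF x(1), of 12 4] nat_pow_mult[OF x(1), of 12 12] by simp_all
    \<comment> \<open>\<open>y\<close> is the quotient of its fourth and third powers, so its part
      of exponent 3 or its part of exponent 4 lies outside.\<close>
    have y12: "y [^] (4::nat) \<otimes> inv (y [^] (3::nat)) = y"
    proof -
      have "y [^] (4::nat) = y \<otimes> y [^] (3::nat)" using y nat_pow_Suc2[of y 3] by simp
      then show ?thesis using y by (simp add: m_assoc)
    qed
    show False
    proof (cases "y [^] (4::nat) \<in> generate G {x}")
      case False
      define z where "z = y [^] (4::nat)"
      have z: "z \<in> carrier G" "z \<notin> generate G {x}" "z [^] (3::nat) = \<one>"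
        using False y p12[OF y] by (simp_all add: z_def nat_pow_pow)
      have z4: "z [^] (4::nat) = z" using z nat_pow_mult[OF z(1), of 3 1] by simp
      have z6: "z [^] (6::nat) = \<one>" using z nat_pow_mult[OF z(1), of 3 3] by simp
      have "z \<noteq> \<one>" using z x1 by blast
      \<comment> \<open>\<open>z\<close> has order 3; the factor \<open>x [^] 3\<close> contributes
        the order 4.\<close>
      show False
        by (rule no[OF z(1,2), of 3]) (use pd[OF z(1)] z4 z6 \<open>z \<noteq> \<one>\<close> z x12 x18 x46 x in simp_all)
    next
      case True
      define z where "z = y [^] (3::nat)"
      have "z \<notin> generate G {x}"
      proof
        assume "z \<in> generate G {x}"
        then have "y [^] (4::nat) \<otimes> inv (y [^] (3::nat)) \<in> generate G {x}"
          using True subgroup.m_closed[OF sub] subgroup.m_inv_closed[OF sub] unfolding z_def by metis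
        then show False using y y12 by simp
      qed
      then have z: "z \<in> carrier G" "z \<notin> generate G {x}" "z [^] (4::nat) = \<one>"
        using y p12[OF y] by (simp_all add: z_def nat_pow_pow)
      have z6: "z [^] (6::nat) = z [^] (2::nat)" using z nat_pow_mult[OF z(1), of 4 2] by simp
      show False
      proof (cases "z [^] (2::nat) = \<one>")
        case True
        show False
          by (rule no[OF z(1,2), of 1]) (use pd[OF z(1), of 1 4] pd[OF z(1), of 1 6] z6 True z x46 x in simp_all)
      next
        case False
        \<comment> \<open>\<open>z\<close> has order 4; the factor \<open>x [^] 4\<close>
          contributes the order 3.\<close>
        show False
          by (rule no[OF z(1,2), of 4]) (use pd[OF z(1)] z6 False z x18 x46 x in simp_all)
      qed
    qed
  qed
  then show ?thesis using x by auto
qed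

text \<open>Over the rationals \<open>NH\<close> is \<open>card H\<close> times an idempotent, and
  idempotents of a reduced ring are central. That \<open>NH\<close> commutes with \<open>D g\<close>
  means that \<open>g\<close> normalises \<open>H\<close>.\<close>

lemma reduced_normal_subgroup:
  assumes red: "\<And>r. \<lbrakk>r \<in> ZG; r * r = 0\<rbrakk> \<Longrightarrow> r = 0" and H: "subgroup H G"
  shows "H \<lhd> G"
proof -
  have sub: "H \<subseteq> carrier G" by (rule subgroup.subset[OF H])
  define NH where "NH = lift (\<lambda>g. if g \<in> H then 1 else 0)"
  have NH: "NH \<in> ZG" by (simp add: NH_def)
  have cfN: "cf NH g = (if g \<in> H then 1 else 0)" if "g \<in> carrier G" for g
    using that by (simp add: NH_def cf_lift)
  have DN: "D h * NH = NH" if h: "h \<in> H" for h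
  proof (rule ZG_eqI)
    fix g assume g: "g \<in> carrier G"
    have "inv h \<otimes> g \<in> H \<longleftrightarrow> g \<in> H"
    proof
      assume "inv h \<otimes> g \<in> H"
      then have "h \<otimes> (inv h \<otimes> g) \<in> H" using h subgroup.m_closed[OF H] by blast
      then show "g \<in> H" using g h sub by (auto simp: inv_cancel_left)
    qed (use h subgroup.m_closed[OF H] subgroup.m_inv_closed[OF H] in blast)
    then show "cf (D h * NH) g = cf NH g" using h sub g NH by (auto simp: cf_D_mult cfN)
  qed (use NH h sub in auto)
  define c where "c = int (card H)"
  have c0: "c \<noteq> 0" using subgroup.one_closed[OF H] finite_subset[OF sub finite_G] by (auto simp: c_def)
  have "NH = (\<Sum>g\<in>H. D g)"
    unfolding NH_def lift_def using finite_G sub by (intro sum.mono_neutral_cong_right) auto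
  then have "NH * NH = (\<Sum>g\<in>H. D g * NH)" by (metis sum_distrib_right)
  also have "\<dots> = of_int c * NH" by (simp add: DN c_def)
  finally have NN: "NH * NH = of_int c * NH" .
  then have N0: "(of_int c - NH) * NH = 0" "NH * (of_int c - NH) = 0"
    by (simp_all add: left_diff_distrib right_diff_distrib mult_of_int_commute)
  have cent: "NH * r = r * NH" if r: "r \<in> ZG" for r
  proof -
    \<comment> \<open>This and the mirrored product are the off-diagonal corners of the Peirce
      decomposition; each has square 0.\<close>
    have "NH * r * (of_int c - NH) * (NH * r * (of_int c - NH)) =
      NH * r * ((of_int c - NH) * NH) * r * (of_int c - NH)" by (simp only: mult.assoc)
    also have "\<dots> = 0" by (simp only: N0 mult_zero_left mult_zero_right)
    finally have "NH * r * (of_int c - NH) * (NH * r * (of_int c - NH)) = 0" .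
    then have 1: "NH * r * (of_int c - NH) = 0" by (rule red[rotated]) (simp_all add: N0 r NH)
    have "(of_int c - NH) * r * NH * ((of_int c - NH) * r * NH) =
      (of_int c - NH) * r * (NH * (of_int c - NH)) * r * NH" by (simp only: mult.assoc)
    also have "\<dots> = 0" by (simp only: N0 mult_zero_left mult_zero_right)
    finally have "(of_int c - NH) * r * NH * ((of_int c - NH) * r * NH) = 0" .
    then have 2: "(of_int c - NH) * r * NH = 0" by (rule red[rotated]) (simp_all add: N0 r NH)
    have "of_int c * (NH * r) = NH * r * NH" using 1 by (simp add: right_diff_distrib mult_of_int_commute)
    moreover have "of_int c * (r * NH) = NH * r * NH" using 2 by (simp add: left_diff_distrib mult.assoc)
    ultimately have "of_int c * (NH * r - r * NH) = 0" by (simp add: right_diff_distrib)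
    then have "NH * r - r * NH = 0" by (rule ZG_torsion_free[rotated]) (simp_all add: c0 r NH)
    then show ?thesis by simp
  qed
  show ?thesis
    unfolding normal_inv_iff
  proof (intro conjI ballI H)
    fix g h assume g: "g \<in> carrier G" and h: "h \<in> H"
    have hG: "h \<in> carrier G" using h sub by blast
    have "cf (D g * NH) (g \<otimes> h) = 1" using g h hG NH by (simp add: cf_D_mult inv_cancel_left cfN)
    then have "cf (NH * D g) (g \<otimes> h) = 1" using cent[of "D g"] g by simp
    then have "cf NH (g \<otimes> h \<otimes> inv g) = 1" using g hG NH by (simp add: cf_mult_D)
    then show "g \<otimes> h \<otimes> inv g \<in> H" using g hG by (simp add: cfN split: if_splits)
  qed
qed

end

text \<open>If C is -1 and T is a primitive third root of unity, X and Y generate quaternions, and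
  \<open>1 + T * X + T * (T * Y)\<close> has norm 1 + T^2 + T^4 = 0. The factors
  \<open>1 - C\<close> and \<open>1 - T\<close> of \<open>a\<close> enforce these conditions in the
  group ring. The expansion of \<open>a\<close> serves to read its coefficient at the
  identity.\<close>

lemma quaternion_times_3:
  fixes X Y C T :: "'r::ring_1"
  assumes sq: "X * X = C" "Y * Y = C" "C * C = 1" and xy: "X * Y = C * (Y * X)" and t: "T * (T * T) = 1"
    and c: "X * C = C * X" "Y * C = C * Y" "T * C = C * T" "X * T = T * X" "Y * T = T * Y"
  defines "a \<equiv> (1 - C) * ((1 - T) * (1 - T * X - T * (T * Y)))"
  shows "a * (1 + T * X + T * (T * Y)) = 0"
    and "a * X * (1 + T * X + T * (T * Y)) = a * (1 + T * X - T * (T * Y)) * X"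
    and "a = 1 - C - T + C * T - (T * X - C * (T * X) - T * (T * X) + C * (T * (T * X))) -
      (T * (T * Y) - C * (T * (T * Y)) - Y + C * Y)"
proof -
  have shift: "p * (q * r) = s * r" if "p * q = s" for p q r s :: 'r
    using that by (simp only: mult.assoc[symmetric])
  have shift2: "p * (q * r) = s * (u * r)" if "p * q = s * u" for p q r s u :: 'r
    using that by (simp only: mult.assoc[symmetric])
  \<comment> \<open>Extended by a right factor, the relations rewrite every product to the order C,
    T, Y, X.\<close>
  have sq': "X * (X * r) = C * r" "Y * (Y * r) = C * r" "C * (C * r) = r" "X * (Y * r) = C * (Y * (X * r))"
    "T * (T * (T * r)) = r" "X * (C * r) = C * (X * r)" "Y * (C * r) = C * (Y * r)" "T * (C * r) = C * (T * r)"
    "X * (T * r) = T * (X * r)" "Y * (T * r) = T * (Y * r)" for r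
  proof -
    show "X * (X * r) = C * r" "Y * (Y * r) = C * r" by (rule shift[OF sq(1)], rule shift[OF sq(2)])
    show "C * (C * r) = r" using shift[OF sq(3), of r] by simp
    show "X * (Y * r) = C * (Y * (X * r))" using shift2[OF xy, of r] by (simp only: mult.assoc)
    show "T * (T * (T * r)) = r" using shift[OF t, of r] by (simp only: mult.assoc mult_1_left)
    show "X * (C * r) = C * (X * r)" "Y * (C * r) = C * (Y * r)" "T * (C * r) = C * (T * r)"
      "X * (T * r) = T * (X * r)" "Y * (T * r) = T * (Y * r)"
      by (rule shift2[OF c(1)], rule shift2[OF c(2)], rule shift2[OF c(3)], rule shift2[OF c(4)], rule shift2[OF c(5)])
  qed
  show "a * (1 + T * X + T * (T * Y)) = 0"
    unfolding a_def by (simp add: algebra_simps sq xy t c sq')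
  show "a * X * (1 + T * X + T * (T * Y)) = a * (1 + T * X - T * (T * Y)) * X"
    unfolding a_def by (simp add: algebra_simps sq xy t c sq')
  show "a = 1 - C - T + C * T - (T * X - C * (T * X) - T * (T * X) + C * (T * (T * X))) -
      (T * (T * Y) - C * (T * (T * Y)) - Y + C * Y)"
    unfolding a_def by (simp add: algebra_simps sq xy t c sq')
qed

locale reduced_dedekind_ring = int_group_ring + dedekind_group +
  assumes reduced: "\<lbrakk>r \<in> ZG; r * r = 0\<rbrakk> \<Longrightarrow> r = 0"
begin

text \<open>The primitive third roots of unity make -1 a sum of two squares, so the quaternions split
  over them and the group ring has zero divisors that reducedness excludes.\<close>

lemma no_quaternion_times_3:
  assumes x: "x \<in> carrier G" "x [^] (4::nat) = \<one>" and y: "y \<in> carrier G" "y [^] (4::nat) = \<one>"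
    and nc: "x \<otimes> y \<noteq> y \<otimes> x"
    and h: "h \<in> carrier G" "h [^] (3::nat) = \<one>" "h \<noteq> \<one>" "h \<otimes> x = x \<otimes> h" "h \<otimes> y = y \<otimes> h"
  shows False
proof -
  have yxy: "y \<otimes> x \<otimes> inv y = inv x"
    using conj_exp4[OF x y(1)] nc conj_eqD[of y x x] x y by auto
  have xyx: "x \<otimes> y \<otimes> inv x = inv y"
    using conj_exp4[OF y x(1)] nc conj_eqD[of x y y] x y by auto
  \<comment> \<open>\<open>x \<otimes> x\<close>, \<open>y \<otimes> y\<close> and the commutator
    turn out to be the same involution, as in the quaternion group of order 8.\<close>
  define c where "c = x \<otimes> x"
  have c: "c \<in> carrier G" "c \<otimes> c = \<one>" using x by (simp_all add: c_def eval_nat_numeral m_assoc)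
  have ic: "inv c = c" using c by (simp add: inv_equality)
  have "x \<otimes> y \<otimes> inv x \<otimes> inv y = inv (y \<otimes> y)" using xyx x y by (simp add: inv_mult_group)
  moreover have "x \<otimes> y \<otimes> inv x \<otimes> inv y = x \<otimes> (y \<otimes> inv x \<otimes> inv y)" using x y by (simp add: m_assoc)
  moreover have "y \<otimes> inv x \<otimes> inv y = inv (y \<otimes> x \<otimes> inv y)" using x y by (simp add: inv_mult_group m_assoc)
  ultimately have "inv (y \<otimes> y) = c" using yxy x by (simp add: c_def)
  then have cy: "c = y \<otimes> y" using ic y by (metis inv_inv m_closed)
  have "commutator x y = c" using \<open>inv (y \<otimes> y) = c\<close> \<open>x \<otimes> y \<otimes> inv x \<otimes> inv y = inv (y \<otimes> y)\<close>
    by (simp add: commutator_def)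
  then have c1: "c \<noteq> \<one>" and sw: "x \<otimes> y = c \<otimes> (y \<otimes> x)"
    using commutator_eq_1_iff[of x y] commutator_swap[of x y] nc x y by auto
  have "y \<otimes> c = c \<otimes> y" using y by (simp add: cy m_assoc)
  moreover have "x \<otimes> c = c \<otimes> x" using x by (simp add: c_def m_assoc)
  moreover have "h \<otimes> c = c \<otimes> h"
    unfolding c_def using centralize_mult[OF h(4)[symmetric] h(4)[symmetric] x(1) h(1) x(1)] by (rule sym)
  ultimately have com: "x \<otimes> c = c \<otimes> x" "y \<otimes> c = c \<otimes> y" "h \<otimes> c = c \<otimes> h" by blast+
  define X where "X = D x"
  define Y where "Y = D y"
  define C where "C = D c"
  define T where "T = D h"
  have XYCT: "X \<in> ZG" "Y \<in> ZG" "C \<in> ZG" "T \<in> ZG" using x y c h by (simp_all add: X_def Y_def C_def T_def)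
  have h3: "h \<otimes> (h \<otimes> h) = \<one>" using h by (simp add: eval_nat_numeral m_assoc)
  have rel: "X * X = C" "Y * Y = C" "C * C = 1" "X * Y = C * (Y * X)" "T * (T * T) = 1"
    "X * C = C * X" "Y * C = C * Y" "T * C = C * T" "X * T = T * X" "Y * T = T * Y"
    using x y c h h3 com sw by (simp_all add: X_def Y_def C_def T_def D_mult[symmetric] D_one cy c_def[symmetric])
  define a where "a = (1 - C) * ((1 - T) * (1 - T * X - T * (T * Y)))"
  define b where "b = 1 + T * X + T * (T * Y)"
  have ab: "a \<in> ZG" "b \<in> ZG" using XYCT by (simp_all add: a_def b_def)
  have 0: "a * b = 0" using quaternion_times_3(1)[OF rel] by (simp add: a_def b_def)
  \<comment> \<open>In a reduced ring a vanishing product may be reversed and admits inserted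
    factors: \<open>b * a = 0\<close> and \<open>a * X * b = 0\<close>.\<close>
  have "b * a * (b * a) = b * (a * b) * a" by (simp only: mult.assoc)
  also have "\<dots> = 0" by (simp add: 0)
  finally have "b * a * (b * a) = 0" .
  then have ba: "b * a = 0" by (rule reduced[rotated]) (simp_all add: 0 ab)
  have "a * X * b * (a * X * b) = a * X * (b * a) * X * b" by (simp only: mult.assoc)
  also have "\<dots> = 0" by (simp add: ba)
  finally have "a * X * b * (a * X * b) = 0" .
  then have "a * X * b = 0" by (rule reduced[rotated]) (simp_all add: ab XYCT)
  \<comment> \<open>Moving \<open>X\<close> to the right has changed the sign of the term with
    \<open>Y\<close>, so the difference from \<open>a * b = 0\<close> isolates this term, which is
    invertible.\<close>
  then have "a * (1 + T * X - T * (T * Y)) * X = 0"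
    using quaternion_times_3(2)[OF rel] by (simp add: a_def b_def)
  then have "a * (1 + T * X - T * (T * Y)) * (X * (X * C)) = 0" by (simp add: mult.assoc[symmetric])
  moreover have "X * (X * C) = X * X * C" by (simp only: mult.assoc)
  then have "X * (X * C) = 1" by (simp only: rel)
  ultimately have "a * (1 + T * X - T * (T * Y)) = 0" by simp
  then have "a * b - a * (1 + T * X - T * (T * Y)) = 0" using 0 by simp
  then have "a * (T * (T * Y) + T * (T * Y)) = 0" by (simp add: b_def right_diff_distrib[symmetric])
  then have "of_int 2 * a * (T * (T * Y)) = 0" by (simp add: distrib_left mult_2 distrib_right)
  then have "of_int 2 * a * (T * (T * Y)) * (Y * C * T) = 0" by simp
  moreover have "T * (T * Y) * (Y * C * T) = 1"
    using rel by (metis mult.assoc mult_1_right mult_1_left)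
  ultimately have "of_int 2 * a = 0" by (metis mult.assoc mult_1_right)
  then have "a = 0" using ab ZG_torsion_free by (metis zero_neq_numeral of_int_numeral)
  \<comment> \<open>Apart from \<open>D \<one>\<close>, the expansion of \<open>a\<close> contains
    only group elements different from \<open>\<one>\<close>. So \<open>a\<close> has coefficient 1
    there and is not 0.\<close>
  have nx: "k \<otimes> x \<noteq> \<one>" "k \<otimes> y \<noteq> \<one>" if "k \<in> carrier G" "k \<otimes> x = x \<otimes> k" "k \<otimes> y = y \<otimes> k" for k
  proof -
    show "k \<otimes> x \<noteq> \<one>"
    proof
      assume "k \<otimes> x = \<one>"
      then have "x \<otimes> k \<otimes> y = y \<otimes> (x \<otimes> k)" using that y by simp
      then show False using centralize_cancel[of x k y] that x y nc by simp
    qed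
    show "k \<otimes> y \<noteq> \<one>"
    proof
      assume "k \<otimes> y = \<one>"
      then have "y \<otimes> k \<otimes> x = x \<otimes> (y \<otimes> k)" using that x by simp
      then show False using centralize_cancel[of y k x] that x y nc by simp
    qed
  qed
  have ch: "c \<otimes> h \<noteq> \<one>"
  proof
    assume "c \<otimes> h = \<one>"
    then have "c = inv h" using inv_equality[of c h] c h by simp
    then have "h \<otimes> h = \<one>" using c h by (metis inv_inv ic)
    then show False using h3 h by simp
  qed
  have cm: "k \<otimes> l \<otimes> z = z \<otimes> (k \<otimes> l)"
    if "k \<otimes> z = z \<otimes> k" "l \<otimes> z = z \<otimes> l" "k \<in> carrier G" "l \<in> carrier G" "z \<in> carrier G" for k l z
    using centralize_mult that by blast
  have hh: "h \<otimes> h \<otimes> x = x \<otimes> (h \<otimes> h)" "h \<otimes> h \<otimes> y = y \<otimes> (h \<otimes> h)" using cm h x y by auto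
  have ne: "h \<otimes> x \<noteq> \<one>" "c \<otimes> h \<otimes> x \<noteq> \<one>" "h \<otimes> h \<otimes> x \<noteq> \<one>" "c \<otimes> (h \<otimes> h) \<otimes> x \<noteq> \<one>"
    "h \<otimes> h \<otimes> y \<noteq> \<one>" "c \<otimes> (h \<otimes> h) \<otimes> y \<noteq> \<one>" "y \<noteq> \<one>" "c \<otimes> y \<noteq> \<one>"
    using nx(1)[of h] nx(1)[of "c \<otimes> h"] nx(1)[of "h \<otimes> h"] nx(1)[of "c \<otimes> (h \<otimes> h)"]
      nx(2)[of "h \<otimes> h"] nx(2)[of "c \<otimes> (h \<otimes> h)"] nx(2)[of \<one>] nx(2)[of c]
      cm[of c _ h] cm[of c _ "h \<otimes> h"] com h x y c hh by auto
  have "a = D \<one> - D c - D h + D (c \<otimes> h) -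
      (D (h \<otimes> x) - D (c \<otimes> h \<otimes> x) - D (h \<otimes> h \<otimes> x) + D (c \<otimes> (h \<otimes> h) \<otimes> x)) -
      (D (h \<otimes> h \<otimes> y) - D (c \<otimes> (h \<otimes> h) \<otimes> y) - D y + D (c \<otimes> y))"
    unfolding a_def quaternion_times_3(3)[OF rel] using x(1) y(1) c(1) h(1)
    by (simp add: X_def Y_def C_def T_def D_mult D_one mult.assoc)
  then have "cf a \<one> = 1"
    using x(1) y(1) c(1) h(1,3) ne ch c1 by (simp add: cf_add cf_diff cf_D eq_commute[of \<one>])
  then show False using \<open>a = 0\<close> by (simp add: cf_zero)
qed

text \<open>An element h of odd prime order is central, and multiplying by it raises orders. The
  admissible orders then confine a noncommuting pair to exponent 4 and the prime to 3, the case
  excluded by \<open>no_quaternion_times_3\<close>.\<close>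

theorem hamiltonian_2_group:
  assumes dep: comm_units_dep and nc: "a \<in> carrier G" "b \<in> carrier G" "a \<otimes> b \<noteq> b \<otimes> a"
  shows "\<exists>k. Coset.order G = 2 ^ k"
proof (rule ccontr)
  assume not2: "\<nexists>k. Coset.order G = 2 ^ k"
  have pos: "Coset.order G > 0" using finite_G by (simp add: order_gt_0_iff_finite)
  have "\<exists>p. prime p \<and> p \<noteq> 2 \<and> p dvd Coset.order G"
  proof (rule ccontr)
    assume "\<nexists>p. prime p \<and> p \<noteq> 2 \<and> p dvd Coset.order G"
    moreover obtain k m where km: "Coset.order G = 2 ^ k * m" "\<not> 2 dvd m"
      using pos by (metis multiplicity_decompose' not_gr_zero not_prime_unit two_is_prime_nat)
    ultimately have "m = 1" by (metis dvd_mult prime_factor_nat dvd_trans)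
    then show False using km not2 by simp
  qed
  then obtain p where p: "prime p" "p \<noteq> 2" "p dvd Coset.order G" by blast
  then obtain m where "Coset.order G = p ^ 1 * m" by auto
  then obtain P where P: "subgroup P G" "card P = p"
    using sylow_thm[OF p(1) is_group _ finite_G] by (metis power_one_right)
  have "P \<noteq> {\<one>}" using P(2) p(1) by auto
  then obtain h where h: "h \<in> P" "h \<noteq> \<one>" using subgroup.one_closed[OF P(1)] by blast
  have hG: "h \<in> carrier G" using h subgroup.subset[OF P(1)] by blast
  interpret PG: group "G\<lparr>carrier := P\<rparr>" by (rule subgroup.subgroup_is_group[OF P(1) is_group])
  have "h [^]\<^bsub>G\<lparr>carrier := P\<rparr>\<^esub> p = \<one>" using PG.pow_order_eq_1[of h] h P by (simp add: Coset.order_def)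
  then have "h [^] p = \<one>" by (simp add: nat_pow_def)
  then have "ord h dvd p" using pow_eq_id[OF hG] by simp
  then have oh: "ord h = p" using p(1) h ord_eq_1[OF hG] by (metis prime_nat_iff)
  then have p35: "p = 3 \<or> p = 5" using possible_orders[OF hG dep] p by auto
  have hc: "h \<otimes> z = z \<otimes> h" if "z \<in> carrier G" for z
    using prime_order_central[OF hG] oh p that by simp
  \<comment> \<open>Elements of prime order are central. So order 6 cannot occur, and for order 12
    the cube of \<open>x\<close> still fails to commute, because its product with \<open>x\<close>
    has order 3.\<close>
  have step: "\<exists>z\<in>carrier G. z [^] (8::nat) = \<one> \<and> z \<otimes> y \<noteq> y \<otimes> z"
    if x: "x \<in> carrier G" and y: "y \<in> carrier G" and nc: "x \<otimes> y \<noteq> y \<otimes> x" for x y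
  proof -
    have cen: "z \<otimes> y = y \<otimes> z" if "z \<in> carrier G" "prime (ord z)" for z
      using prime_order_central[OF that y] .
    have "\<not> prime (ord x)" using cen[OF x] nc by blast
    moreover have "ord x \<noteq> 1" using nc x y ord_eq_1[OF x] by auto
    ultimately have "ord x \<in> {4, 6, 8, 12}" using possible_orders[OF x dep] by auto
    then consider "ord x dvd 8" | "ord x = 6" | "ord x = 12" by auto
    then show ?thesis
    proof cases
      case 1
      then show ?thesis using x nc pow_eq_id[OF x] by blast
    next
      case 2
      have "ord (x [^] (2::nat)) = 3" "ord (x [^] (3::nat)) = 2" using ord_pow[OF x] 2 by simp_all
      then have "x [^] (2::nat) \<otimes> y = y \<otimes> x [^] (2::nat)" "x [^] (3::nat) \<otimes> y = y \<otimes> x [^] (3::nat)"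
        using x by (auto intro!: cen)
      moreover have "x \<otimes> x [^] (2::nat) = x [^] (3::nat)" using x nat_pow_Suc2[of x 2] by simp
      ultimately have "x \<otimes> y = y \<otimes> x" using centralize_cancel[of x "x [^] (2::nat)" y] x y by simp
      then show ?thesis using nc by blast
    next
      case 3
      have "ord (x [^] (4::nat)) = 3" "ord (x [^] (3::nat)) = 4" using ord_pow[OF x] 3 by simp_all
      then have 4: "x [^] (4::nat) \<otimes> y = y \<otimes> x [^] (4::nat)" and 8: "(x [^] (3::nat)) [^] (8::nat) = \<one>"
        using x pow_eq_id[of "x [^] (3::nat)" 8] by (auto intro!: cen)
      have "x \<otimes> x [^] (3::nat) = x [^] (4::nat)" using x nat_pow_Suc2[of x 3] by simp
      then have "x [^] (3::nat) \<otimes> y \<noteq> y \<otimes> x [^] (3::nat)"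
        using centralize_cancel[of x "x [^] (3::nat)" y] x y 4 nc by auto
      then show ?thesis using 8 x by blast
    qed
  qed
  obtain x where x: "x \<in> carrier G" "x [^] (8::nat) = \<one>" "x \<otimes> b \<noteq> b \<otimes> x" using step[OF nc] by blast
  obtain y where y: "y \<in> carrier G" "y [^] (8::nat) = \<one>" "y \<otimes> x \<noteq> x \<otimes> y"
    using step[OF nc(2) x(1)] x by metis
  \<comment> \<open>\<open>h \<otimes> z\<close> must have an admissible order as well; this decides
    \<open>p\<close> and bounds the order of \<open>z\<close>.\<close>
  have p4: "p = 3 \<and> z [^] (4::nat) = \<one>" if z: "z \<in> carrier G" "z [^] (8::nat) = \<one>" "z \<noteq> \<one>" for z
  proof -
    define w where "w = h \<otimes> z"
    have w: "w \<in> carrier G" using hG z by (simp add: w_def)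
    have wk: "w [^] k = h [^] k \<otimes> z [^] k" for k :: nat
      unfolding w_def using hG z hc by (intro pow_mult_distrib) auto
    have zk: "z [^] (8 * k) = \<one>" for k :: nat using z by (simp add: nat_pow_pow[symmetric])
    have hk: "h [^] k = \<one> \<longleftrightarrow> p dvd k" for k using pow_eq_id[OF hG] oh by simp
    have "w [^] (8::nat) \<noteq> \<one>" using wk[of 8] hk[of 8] p35 z hG by auto
    then have "\<not> ord w dvd 8" using pow_eq_id[OF w] by simp
    then have o: "ord w \<in> {3, 5, 6, 12}" using possible_orders[OF w dep] by auto
    show ?thesis
    proof (cases "ord w = 5")
      case True
      then have w5: "w [^] (5::nat) = \<one>" using pow_ord_eq_1[OF w] by simp
      have "w [^] (40::nat) = \<one>" using True pow_eq_id[OF w] by simp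
      then have "h [^] (40::nat) = \<one>" using wk[of 40] zk[of 5] hG by simp
      then have "p = 5" using hk[of 40] p35 by auto
      then have "h [^] (5::nat) = \<one>" using hk[of 5] by simp
      then have "z [^] (5::nat) = \<one>" using w5 wk[of 5] z by simp
      then have "ord z dvd 5" "ord z dvd 8" using pow_eq_id[OF z(1)] z(2) by auto
      then have "ord z dvd gcd 5 8" by (rule gcd_greatest)
      moreover have "gcd 5 (8::nat) = 1" by (simp add: gcd_non_0_nat)
      ultimately have "z = \<one>" using ord_eq_1[OF z(1)] by simp
      then show ?thesis using z by simp
    next
      case False
      then have "ord w dvd 12" using o by auto
      then have w12: "w [^] (12::nat) = \<one>" by (simp only: pow_eq_id[OF w])
      then have "w [^] (24::nat) = \<one>" using nat_pow_mult[OF w, of 12 12] by simp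
      then have "h [^] (24::nat) = \<one>" using wk[of 24] zk[of 3] hG by simp
      then have "p = 3" using hk[of 24] p35 by auto
      then have "h [^] (12::nat) = \<one>" using hk[of 12] by simp
      then have "z [^] (12::nat) = \<one>" using w12 wk[of 12] z by simp
      then have "z [^] (4::nat) = \<one>" using nat_pow_mult[OF z(1), of 8 4] z by simp
      then show ?thesis using \<open>p = 3\<close> by simp
    qed
  qed
  have "x \<noteq> \<one>" "y \<noteq> \<one>" using x y by auto
  then have 4: "x [^] (4::nat) = \<one>" "y [^] (4::nat) = \<one>" "p = 3" using p4 x y by blast+
  have "h [^] (3::nat) = \<one>" using oh 4(3) pow_ord_eq_1[OF hG] by simp
  then show False
    using no_quaternion_times_3[OF x(1) 4(1) y(1) 4(2) _ hG _ h(2)] hc x y by metis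
qed

end

section \<open>The groups of the classification\<close>

lemma Rep_int_endo_sum:
  "Rep_int_endo (\<Sum>i\<in>I. F i) f s = (\<Sum>i\<in>I. Rep_int_endo (F i) f s)"
  by (induction I rule: infinite_finite_induct)
    (auto simp: zero_int_endo.rep_eq plus_int_endo.rep_eq)

lemma Rep_int_endo_scale:
  "Rep_int_endo (of_int c * F) f s = c * Rep_int_endo F f s"
proof -
  have "Rep_int_endo (of_nat n) f s = int n * f s" for n f s
    by (induction n) (auto simp: zero_int_endo.rep_eq plus_int_endo.rep_eq one_int_endo.rep_eq algebra_simps)
  then have "Rep_int_endo (of_int c) f s = c * f s" for f s
    by (cases c rule: int_cases2) (auto simp: uminus_int_endo.rep_eq)
  then show ?thesis by (simp add: times_int_endo.rep_eq)
qed

text \<open>The regular representation on functions. Arguments outside the carrier are left alone,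
  so that the unit of the group acts as the identity of the whole endomorphism ring.\<close>

lift_definition left_endo :: "('s, 'm) monoid_scheme \<Rightarrow> 's \<Rightarrow> 's int_endo" is
  "\<lambda>G x f t. if t \<in> carrier G then f (inv\<^bsub>G\<^esub> x \<otimes>\<^bsub>G\<^esub> t) else f t"
  by auto

text \<open>Applied to the indicator of the unit, a combination of translations returns its
  coefficients; this is independence.\<close>

lemma left_endo_group_ring:
  assumes "group G" and fin: "finite (carrier G)"
  shows "int_group_ring G (left_endo G)"
proof -
  interpret group G by fact
  show ?thesis
  proof unfold_locales
    show "left_endo G (x \<otimes>\<^bsub>G\<^esub> y) = left_endo G x * left_endo G y"
      if "x \<in> carrier G" "y \<in> carrier G" for x y
      using that by (intro Rep_int_endo_inject[THEN iffD1])
        (simp add: left_endo.rep_eq times_int_endo.rep_eq fun_eq_iff inv_mult_group m_assoc)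
    show "left_endo G \<one>\<^bsub>G\<^esub> = 1"
      by (intro Rep_int_endo_inject[THEN iffD1]) (simp add: left_endo.rep_eq one_int_endo.rep_eq fun_eq_iff)
    fix f :: "'a \<Rightarrow> int" and g
    assume 0: "(\<Sum>g\<in>carrier G. of_int (f g) * left_endo G g) = 0" and g: "g \<in> carrier G"
    let ?d = "\<lambda>t. if t = \<one>\<^bsub>G\<^esub> then 1 else (0::int)"
    have "0 = Rep_int_endo (\<Sum>h\<in>carrier G. of_int (f h) * left_endo G h) ?d g"
      unfolding 0 by (simp add: zero_int_endo.rep_eq)
    also have "\<dots> = (\<Sum>h\<in>carrier G. f h * ?d (inv\<^bsub>G\<^esub> h \<otimes>\<^bsub>G\<^esub> g))"
      using g by (simp add: Rep_int_endo_sum Rep_int_endo_scale left_endo.rep_eq)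
    also have "\<dots> = (\<Sum>h\<in>carrier G. if h = g then f h else 0)"
    proof (rule sum.cong[OF refl])
      fix h assume h: "h \<in> carrier G"
      have "inv\<^bsub>G\<^esub> h \<otimes>\<^bsub>G\<^esub> g = \<one>\<^bsub>G\<^esub> \<longleftrightarrow> h = g" using h g by (metis inv_inv inv_equality inv_closed l_inv)
      then show "f h * ?d (inv\<^bsub>G\<^esub> h \<otimes>\<^bsub>G\<^esub> g) = (if h = g then f h else 0)" by simp
    qed
    also have "\<dots> = f g" using g fin by simp
    finally show "f g = 0" by simp
  qed (rule fin)
qed

lemma (in group) exponent_dvd_iff:
  "group_exponent G dvd n \<longleftrightarrow> (\<forall>g\<in>carrier G. g [^] n = \<one>)"
proof -
  have "group_exponent G dvd n \<longleftrightarrow> (\<forall>g\<in>carrier G. ord g dvd n)"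
    unfolding group_exponent_def by (simp add: Lcm_dvd_iff)
  then show ?thesis by (simp add: pow_eq_id)
qed

text \<open>Both kinds of Higman groups are brought to the form used by \<open>higman_conj\<close>
  and \<open>higman_unit_torsion\<close>.\<close>

lemma higman_group_properties:
  assumes "higman_group G"
  shows "group G" "finite (carrier G)"
    "\<And>g h. \<lbrakk>g \<in> carrier G; h \<in> carrier G\<rbrakk> \<Longrightarrow>
      h \<otimes>\<^bsub>G\<^esub> g \<otimes>\<^bsub>G\<^esub> inv\<^bsub>G\<^esub> h = g \<or> h \<otimes>\<^bsub>G\<^esub> g \<otimes>\<^bsub>G\<^esub> inv\<^bsub>G\<^esub> h = inv\<^bsub>G\<^esub> g"
    "(\<forall>g\<in>carrier G. g [^]\<^bsub>G\<^esub> (4::nat) = \<one>\<^bsub>G\<^esub>) \<or> (\<forall>g\<in>carrier G. g [^]\<^bsub>G\<^esub> (6::nat) = \<one>\<^bsub>G\<^esub>)"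
proof -
  show fin: "finite (carrier G)" using assms by (simp add: higman_group_def)
  show grp: "group G" using assms by (auto simp: higman_group_def hamiltonian_group_def comm_group_def)
  interpret group G by (rule grp)
  have *: "(\<forall>g\<in>carrier G. \<forall>h\<in>carrier G. h \<otimes>\<^bsub>G\<^esub> g \<otimes>\<^bsub>G\<^esub> inv\<^bsub>G\<^esub> h = g \<or> h \<otimes>\<^bsub>G\<^esub> g \<otimes>\<^bsub>G\<^esub> inv\<^bsub>G\<^esub> h = inv\<^bsub>G\<^esub> g) \<and>
    ((\<forall>g\<in>carrier G. g [^]\<^bsub>G\<^esub> (4::nat) = \<one>\<^bsub>G\<^esub>) \<or> (\<forall>g\<in>carrier G. g [^]\<^bsub>G\<^esub> (6::nat) = \<one>\<^bsub>G\<^esub>))"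
  proof (cases "comm_group G")
    case True
    then interpret comm_group G .
    have "h \<otimes>\<^bsub>G\<^esub> g \<otimes>\<^bsub>G\<^esub> inv\<^bsub>G\<^esub> h = g" if "g \<in> carrier G" "h \<in> carrier G" for g h
      using that m_comm[of h g] by (simp add: m_assoc)
    moreover have "group_exponent G dvd 4 \<or> group_exponent G dvd 6"
      using assms True by (auto simp: higman_group_def hamiltonian_group_def)
    ultimately show ?thesis using exponent_dvd_iff by blast
  next
    case False
    then obtain k where k: "Coset.order G = 2 ^ k" and ham: "\<And>H. subgroup H G \<Longrightarrow> H \<lhd> G"
      using assms by (auto simp: higman_group_def hamiltonian_group_def)
    interpret dedekind_2_group G k
      by (intro dedekind_2_group.intro dedekind_group.intro dedekind_group_axioms.intro
          dedekind_2_group_axioms.intro grp fin k ham)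
    obtain a b where "a \<in> carrier G" "b \<in> carrier G" "a \<otimes>\<^bsub>G\<^esub> b \<noteq> b \<otimes>\<^bsub>G\<^esub> a"
      using False group_comm_groupI by blast
    then have "g [^]\<^bsub>G\<^esub> (4::nat) = \<one>\<^bsub>G\<^esub>" if "g \<in> carrier G" for g using hamiltonian_exp4 that by blast
    then show ?thesis using conj_exp4 by blast
  qed
  show "h \<otimes>\<^bsub>G\<^esub> g \<otimes>\<^bsub>G\<^esub> inv\<^bsub>G\<^esub> h = g \<or> h \<otimes>\<^bsub>G\<^esub> g \<otimes>\<^bsub>G\<^esub> inv\<^bsub>G\<^esub> h = inv\<^bsub>G\<^esub> g"
    if "g \<in> carrier G" "h \<in> carrier G" for g h using * that by blast
  show "(\<forall>g\<in>carrier G. g [^]\<^bsub>G\<^esub> (4::nat) = \<one>\<^bsub>G\<^esub>) \<or> (\<forall>g\<in>carrier G. g [^]\<^bsub>G\<^esub> (6::nat) = \<one>\<^bsub>G\<^esub>)" using * by blast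
qed

text \<open>The unit arguments work with a generator and its order instead of an
  isomorphism.\<close>

lemma (in group) iso_integer_mod_group_iff:
  assumes m: "m > 0"
  shows "G \<cong> integer_mod_group m \<longleftrightarrow> (\<exists>x\<in>carrier G. ord x = m \<and> carrier G = range (\<lambda>k::nat. x [^] k))"
proof
  assume "G \<cong> integer_mod_group m"
  then obtain f where f: "f \<in> iso G (integer_mod_group m)" by (auto simp: is_iso_def)
  let ?Z = "integer_mod_group m"
  interpret Z: group ?Z by simp
  interpret f: group_hom G ?Z f by unfold_locales (use f in \<open>simp add: iso_def\<close>)
  have bij: "bij_betw f (carrier G) (carrier ?Z)" using f by (simp add: iso_def)
  have cZ: "carrier ?Z = {0..<int m}" using m by (simp add: carrier_integer_mod_group)
  have "1 mod int m \<in> carrier ?Z" using m by (simp add: cZ)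
  then obtain x where x: "x \<in> carrier G" "f x = 1 mod int m" using bij by (metis bij_betw_iff_bijections)
  have fx: "f (x [^] k) = int k mod int m" for k :: nat
    using f.hom_nat_pow[OF x(1), of k] x(2) by (simp add: mod_mult_right_eq)
  have inj: "a = b" if "a \<in> carrier G" "b \<in> carrier G" "f a = f b" for a b
    using bij that by (auto simp: bij_betw_def dest: inj_onD)
  have "x [^] k = \<one> \<longleftrightarrow> m dvd k" for k :: nat
  proof -
    have "x [^] k = \<one> \<longleftrightarrow> f (x [^] k) = f \<one>" using inj x by auto
    also have "\<dots> \<longleftrightarrow> int k mod int m = 0" by (simp add: fx)
    also have "\<dots> \<longleftrightarrow> m dvd k" by (simp flip: dvd_eq_mod_eq_0)
    finally show ?thesis .
  qed
  then have "ord x = m" using ord_unique[OF x(1)] by blast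
  moreover have "g \<in> range (\<lambda>k::nat. x [^] k)" if g: "g \<in> carrier G" for g
  proof -
    have "f g \<in> {0..<int m}" using f.hom_closed[OF g] cZ by simp
    then have "f (x [^] nat (f g)) = f g" unfolding fx by simp
    then have "x [^] nat (f g) = g" using inj x g by auto
    then show ?thesis by (metis rangeI)
  qed
  then have "carrier G = range (\<lambda>k::nat. x [^] k)" using x by auto
  ultimately show "\<exists>x\<in>carrier G. ord x = m \<and> carrier G = range (\<lambda>k::nat. x [^] k)" using x by blast
next
  assume "\<exists>x\<in>carrier G. ord x = m \<and> carrier G = range (\<lambda>k::nat. x [^] k)"
  then obtain x where x: "x \<in> carrier G" "ord x = m" "carrier G = range (\<lambda>k::nat. x [^] k)" by blast
  let ?Z = "integer_mod_group m"
  interpret Z: group ?Z by simp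
  have cZ: "carrier ?Z = {0..<int m}" using m by (simp add: carrier_integer_mod_group)
  have md: "x [^] (k mod m) = x [^] k" for k :: nat
  proof -
    have "x [^] k = x [^] (m * (k div m) + k mod m)" by simp
    also have "\<dots> = x [^] (k mod m)" using x(1,2) pow_ord_eq_1[OF x(1)]
      by (simp only: nat_pow_mult[symmetric] nat_pow_pow[symmetric] nat_pow_one l_one nat_pow_closed)
    finally show ?thesis by simp
  qed
  define f where "f i = x [^] nat i" for i
  have "f \<in> hom ?Z G"
  proof (rule homI)
    fix i j assume "i \<in> carrier ?Z" "j \<in> carrier ?Z"
    then have ij: "i \<ge> 0" "j \<ge> 0" by (simp_all add: cZ)
    then have "nat ((i + j) mod int m) = (nat i + nat j) mod m" by (simp add: nat_mod_distrib nat_add_distrib)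
    then show "f (i \<otimes>\<^bsub>?Z\<^esub> j) = f i \<otimes> f j" using x by (simp add: f_def md nat_pow_mult)
  qed (use x in \<open>simp add: f_def\<close>)
  moreover have "inj_on f (carrier ?Z)"
  proof (rule inj_onI)
    fix i j assume ij: "i \<in> carrier ?Z" "j \<in> carrier ?Z" and eq: "f i = f j"
    have "x [^] i = x [^] j" using eq ij by (simp add: f_def cZ flip: int_pow_int)
    then have "int m dvd j - i" using int_pow_eq[OF x(1)] x(2) by simp
    then have "j mod int m = i mod int m" by (simp add: mod_eq_dvd_iff)
    then show "i = j" using ij by (simp add: cZ)
  qed
  moreover have "carrier G \<subseteq> f ` carrier ?Z"
  proof
    fix g assume "g \<in> carrier G"
    then obtain k :: nat where "g = x [^] k" using x by auto
    then have "g = f (int (k mod m))" by (simp add: f_def md del: of_nat_mod)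
    moreover have "int (k mod m) \<in> carrier ?Z" using m by (simp add: cZ)
    ultimately show "g \<in> f ` carrier ?Z" by blast
  qed
  ultimately have "f \<in> iso ?Z G" by (auto simp: iso_def bij_betw_def hom_def)
  then show "G \<cong> ?Z" using Z.iso_sym is_iso_def by blast
qed

lemma cyclic_5_8_12_iff:
  "cyclic_5_8_12 G \<longleftrightarrow> group G \<and> (\<exists>x\<in>carrier G. group.ord G x \<in> {5, 8, 12} \<and> carrier G = range (\<lambda>k::nat. x [^]\<^bsub>G\<^esub> k))"
proof (cases "group G")
  case True
  then interpret group G .
  show ?thesis unfolding cyclic_5_8_12_def using iso_integer_mod_group_iff True by auto
qed (simp add: cyclic_5_8_12_def)

lemma cyclic_5_8_12_conj:
  assumes "cyclic_5_8_12 G"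
  shows "\<And>g h. \<lbrakk>g \<in> carrier G; h \<in> carrier G\<rbrakk> \<Longrightarrow> h \<otimes>\<^bsub>G\<^esub> g \<otimes>\<^bsub>G\<^esub> inv\<^bsub>G\<^esub> h = g"
proof -
  interpret group G using assms unfolding cyclic_5_8_12_iff by blast
  obtain x where x: "x \<in> carrier G" "carrier G = range (\<lambda>k::nat. x [^]\<^bsub>G\<^esub> k)" using assms unfolding cyclic_5_8_12_iff by blast
  fix g h assume gh: "g \<in> carrier G" "h \<in> carrier G"
  then obtain i j :: nat where "g = x [^]\<^bsub>G\<^esub> i" "h = x [^]\<^bsub>G\<^esub> j" using x by blast
  then have "h \<otimes>\<^bsub>G\<^esub> g = g \<otimes>\<^bsub>G\<^esub> h" using x by (simp add: nat_pow_mult add.commute)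
  then show "h \<otimes>\<^bsub>G\<^esub> g \<otimes>\<^bsub>G\<^esub> inv\<^bsub>G\<^esub> h = g" using gh by (simp add: m_assoc)
qed

theorem (in int_group_ring) few_units_classification:
  assumes red: "\<And>r. \<lbrakk>r \<in> ZG; r * r = 0\<rbrakk> \<Longrightarrow> r = 0" and dep: comm_units_dep
  shows "higman_group G \<or> cyclic_5_8_12 G"
proof (cases "comm_group G")
  case True
  then interpret comm_group G .
  have "(\<forall>g\<in>carrier G. g [^] (4::nat) = \<one>) \<or> (\<forall>g\<in>carrier G. g [^] (6::nat) = \<one>) \<or>
    (\<exists>x\<in>carrier G. ord x \<in> {5, 8, 12} \<and> carrier G = generate G {x})"
    by (rule abelian_classification[OF m_comm dep])
  then show ?thesis
  proof (elim disjE)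
    assume "\<exists>x\<in>carrier G. ord x \<in> {5, 8, 12} \<and> carrier G = generate G {x}"
    then show ?thesis using generate_eq_powers[OF finite_G] is_group cyclic_5_8_12_iff by metis
  qed (use exponent_dvd_iff True finite_G in \<open>auto simp: higman_group_def\<close>)
next
  case False
  then obtain a b where ab: "a \<in> carrier G" "b \<in> carrier G" "a \<otimes> b \<noteq> b \<otimes> a"
    using group_comm_groupI by blast
  have ded: "dedekind_group G"
    by (intro dedekind_group.intro is_group dedekind_group_axioms.intro finite_G) (rule reduced_normal_subgroup[OF red])
  interpret reduced_dedekind_ring G D
    by (intro reduced_dedekind_ring.intro int_group_ring_axioms ded reduced_dedekind_ring_axioms.intro) (rule red)
  have "hamiltonian_group G" using False subgroup_normal is_group by (simp add: hamiltonian_group_def)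
  then show ?thesis using hamiltonian_2_group[OF dep ab] finite_G by (simp add: higman_group_def)
qed

section \<open>Semilattices of groups\<close>

text \<open>Clifford semigroups, the semilattices of groups: central idempotents, and for each
  element an inverse that commutes with it.\<close>

locale clifford_semigroup = finite_semigroup +
  assumes idem_central: "\<lbrakk>e \<in> carrier S; e \<otimes> e = e; s \<in> carrier S\<rbrakk> \<Longrightarrow> e \<otimes> s = s \<otimes> e"
    and regular: "s \<in> carrier S \<Longrightarrow>
      \<exists>t\<in>carrier S. s \<otimes> t = t \<otimes> s \<and> s \<otimes> t \<otimes> s = s \<and> t \<otimes> s \<otimes> t = t"
begin

definition idem :: "'a \<Rightarrow> bool" where
  "idem e \<longleftrightarrow> e \<in> carrier S \<and> e \<otimes> e = e"

text \<open>The maximal subgroup of \<open>S\<close> with unit \<open>e\<close>.\<close>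

definition H :: "'a \<Rightarrow> 'a set" where
  "H e = {s \<in> carrier S. e \<otimes> s = s \<and> (\<exists>t\<in>carrier S. e \<otimes> t = t \<and> s \<otimes> t = e \<and> t \<otimes> s = e)}"

abbreviation Gp :: "'a \<Rightarrow> ('a, 'b) monoid_scheme" where
  "Gp e \<equiv> S\<lparr>carrier := H e, one := e\<rparr>"

lemma idemI: "\<lbrakk>e \<in> carrier S; e \<otimes> e = e\<rbrakk> \<Longrightarrow> idem e"
  by (simp add: idem_def)

lemma idem_closed [simp]: "idem e \<Longrightarrow> e \<in> carrier S"
  by (simp add: idem_def)

lemma idem_idem [simp]: "idem e \<Longrightarrow> e \<otimes> e = e"
  by (simp add: idem_def)

lemma central: "\<lbrakk>idem e; s \<in> carrier S\<rbrakk> \<Longrightarrow> s \<otimes> e = e \<otimes> s"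
  by (rule idem_central[symmetric]) simp_all

lemma H_sub: "s \<in> H e \<Longrightarrow> s \<in> carrier S"
  by (simp add: H_def)

lemma H_unit: "\<lbrakk>idem e; s \<in> H e\<rbrakk> \<Longrightarrow> e \<otimes> s = s \<and> s \<otimes> e = s"
  using central[of e s] by (simp add: H_def)

lemma H_I: "\<lbrakk>s \<in> carrier S; e \<otimes> s = s; t \<in> carrier S; e \<otimes> t = t; s \<otimes> t = e; t \<otimes> s = e\<rbrakk> \<Longrightarrow> s \<in> H e"
  by (auto simp: H_def)

lemma H_inverse:
  assumes "s \<in> H e"
  shows "\<exists>t\<in>H e. s \<otimes> t = e \<and> t \<otimes> s = e"
proof -
  obtain t where "t \<in> carrier S" "e \<otimes> t = t" "s \<otimes> t = e" "t \<otimes> s = e" "s \<in> carrier S" "e \<otimes> s = s"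
    using assms by (auto simp: H_def)
  then show ?thesis using H_I[of t e s] by blast
qed

lemma idem_mult: "\<lbrakk>idem e; idem f\<rbrakk> \<Longrightarrow> idem (e \<otimes> f)"
proof -
  assume ef: "idem e" "idem f"
  have "e \<otimes> f \<otimes> (e \<otimes> f) = e \<otimes> (f \<otimes> e) \<otimes> f" using ef by (simp add: m_assoc m_closed)
  also have "\<dots> = e \<otimes> (e \<otimes> f) \<otimes> f" using ef central[of e f] by simp
  also have "\<dots> = e \<otimes> e \<otimes> (f \<otimes> f)" using ef by (simp only: m_assoc m_closed idem_closed)
  finally show "idem (e \<otimes> f)" using ef by (intro idemI) (simp_all add: m_closed)
qed

text \<open>The product of the inverses in reverse order is the inverse, since the central
  idempotents can be moved out of the way.\<close>

lemma H_mult: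
  assumes e: "idem e" and f: "idem f" and s: "s \<in> H e" and t: "t \<in> H f"
  shows "s \<otimes> t \<in> H (e \<otimes> f)"
proof -
  obtain s' where s': "s' \<in> H e" "s \<otimes> s' = e" "s' \<otimes> s = e" using H_inverse[OF s] by blast
  obtain t' where t': "t' \<in> H f" "t \<otimes> t' = f" "t' \<otimes> t = f" using H_inverse[OF t] by blast
  note c = H_sub[OF s] H_sub[OF t] H_sub[OF s'(1)] H_sub[OF t'(1)] idem_closed[OF e] idem_closed[OF f]
  have ab: "e \<otimes> f \<otimes> (x \<otimes> y) = x \<otimes> y" if "x \<in> carrier S" "y \<in> carrier S"
    "e \<otimes> x = x" "f \<otimes> y = y" for x y
  proof -
    have "e \<otimes> f \<otimes> (x \<otimes> y) = e \<otimes> (f \<otimes> x) \<otimes> y" using that c by (simp add: m_assoc m_closed)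
    also have "\<dots> = e \<otimes> (x \<otimes> f) \<otimes> y" using central[OF f that(1)] by simp
    also have "\<dots> = (e \<otimes> x) \<otimes> (f \<otimes> y)" using that(1,2) c by (simp only: m_assoc m_closed)
    finally show ?thesis using that by simp
  qed
  have ab': "e \<otimes> f \<otimes> (y \<otimes> x) = y \<otimes> x" if "x \<in> carrier S" "y \<in> carrier S"
    "e \<otimes> x = x" "f \<otimes> y = y" for x y
  proof -
    have "e \<otimes> f \<otimes> (y \<otimes> x) = e \<otimes> (f \<otimes> y) \<otimes> x" using that(1,2) c by (simp only: m_assoc m_closed)
    also have "\<dots> = (e \<otimes> y) \<otimes> x" using that(4) by simp
    also have "\<dots> = (y \<otimes> e) \<otimes> x" using central[OF e that(2)] by simp
    also have "\<dots> = y \<otimes> x" using that c by (simp add: m_assoc m_closed)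
    finally show ?thesis .
  qed
  have units: "e \<otimes> s = s" "f \<otimes> t = t" "e \<otimes> s' = s'" "f \<otimes> t' = t'" "s \<otimes> e = s" "t' \<otimes> f = t'" "s' \<otimes> e = s'"
    using H_unit[OF e s] H_unit[OF f t] H_unit[OF e s'(1)] H_unit[OF f t'(1)] by auto
  have 1: "s \<otimes> t \<otimes> (t' \<otimes> s') = e \<otimes> f"
  proof -
    have "s \<otimes> t \<otimes> (t' \<otimes> s') = s \<otimes> (t \<otimes> t') \<otimes> s'" using c by (simp only: m_assoc m_closed)
    also have "\<dots> = f \<otimes> s \<otimes> s'" using t' central[OF f c(1)] by simp
    also have "\<dots> = f \<otimes> e" using c s' by (simp add: m_assoc m_closed)
    finally show ?thesis using central[OF e c(6)] by simp
  qed
  have 2: "t' \<otimes> s' \<otimes> (s \<otimes> t) = e \<otimes> f"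
  proof -
    have "t' \<otimes> s' \<otimes> (s \<otimes> t) = t' \<otimes> (s' \<otimes> s) \<otimes> t" using c by (simp only: m_assoc m_closed)
    also have "\<dots> = e \<otimes> t' \<otimes> t" using s' central[OF e c(4)] by simp
    also have "\<dots> = e \<otimes> f" using c t' by (simp add: m_assoc m_closed)
    finally show ?thesis .
  qed
  show ?thesis
    by (rule H_I[of _ _ "t' \<otimes> s'"]) (use 1 2 ab[of s t] ab'[of s' t'] units c in \<open>auto simp: m_closed\<close>)
qed

lemma idem_in_H: "idem e \<Longrightarrow> e \<in> H e"
  by (rule H_I[of _ _ e]) auto

lemma Gp_group: 
  assumes e: "idem e"
  shows "group (Gp e)"
proof (rule groupI)
  show "x \<otimes>\<^bsub>Gp e\<^esub> y \<in> carrier (Gp e)" if "x \<in> carrier (Gp e)" "y \<in> carrier (Gp e)" for x y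
    using H_mult[OF e e] that e by auto
  show "\<one>\<^bsub>Gp e\<^esub> \<in> carrier (Gp e)" using idem_in_H[OF e] by simp
  show "x \<otimes>\<^bsub>Gp e\<^esub> y \<otimes>\<^bsub>Gp e\<^esub> z = x \<otimes>\<^bsub>Gp e\<^esub> (y \<otimes>\<^bsub>Gp e\<^esub> z)"
    if "x \<in> carrier (Gp e)" "y \<in> carrier (Gp e)" "z \<in> carrier (Gp e)" for x y z
    using that H_sub by (auto intro: m_assoc)
  show "\<one>\<^bsub>Gp e\<^esub> \<otimes>\<^bsub>Gp e\<^esub> x = x" if "x \<in> carrier (Gp e)" for x
    using that H_unit[OF e] by auto
  show "\<exists>y\<in>carrier (Gp e). y \<otimes>\<^bsub>Gp e\<^esub> x = \<one>\<^bsub>Gp e\<^esub>" if "x \<in> carrier (Gp e)" for x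
    using that H_inverse[of x e] by auto
qed

lemma finite_H: "finite (H e)"
  using finite_carrier by (rule rev_finite_subset) (auto simp: H_def)

lemma H_cover:
  assumes s: "s \<in> carrier S"
  shows "\<exists>e. idem e \<and> s \<in> H e"
proof -
  obtain t where t: "t \<in> carrier S" "s \<otimes> t = t \<otimes> s" "s \<otimes> t \<otimes> s = s" "t \<otimes> s \<otimes> t = t"
    using regular[OF s] by blast
  have "s \<otimes> t \<otimes> (s \<otimes> t) = (s \<otimes> t \<otimes> s) \<otimes> t" using s t(1) by (simp only: m_assoc m_closed)
  then have "idem (s \<otimes> t)" using s t by (intro idemI) (simp_all add: m_closed)
  moreover have "s \<in> H (s \<otimes> t)"
    by (rule H_I[of _ _ t]) (use s t in auto)
  ultimately show ?thesis by blast
qed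

lemma H_disjoint:
  assumes e: "idem e" and f: "idem f" and s: "s \<in> H e" "s \<in> H f"
  shows "e = f"
proof -
  obtain t where t: "t \<in> H e" "s \<otimes> t = e" "t \<otimes> s = e" using H_inverse[OF s(1)] by blast
  obtain u where u: "u \<in> H f" "s \<otimes> u = f" "u \<otimes> s = f" using H_inverse[OF s(2)] by blast
  note c = H_sub[OF s(1)] H_sub[OF t(1)] H_sub[OF u(1)]
  have "f \<otimes> e = f \<otimes> s \<otimes> t" using c t(2) f by (simp add: m_assoc)
  then have 1: "f \<otimes> e = e" using H_unit[OF f s(2)] t(2) by simp
  have "e \<otimes> f = e \<otimes> s \<otimes> u" using c u(2) e by (simp add: m_assoc)
  then have "e \<otimes> f = f" using H_unit[OF e s(1)] u(2) by simp
  then show ?thesis using 1 central[OF e idem_closed[OF f]] by simp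
qed

text \<open>The homomorphism of \<open>S\<close> onto its semilattice of idempotents.\<close>

definition ue :: "'a \<Rightarrow> 'a" where
  "ue s = (THE e. idem e \<and> s \<in> H e)"

lemma ue: "s \<in> carrier S \<Longrightarrow> idem (ue s) \<and> s \<in> H (ue s)"
  unfolding ue_def by (rule theI') (metis H_cover H_disjoint)

lemma ue_eq: "\<lbrakk>idem e; s \<in> H e\<rbrakk> \<Longrightarrow> ue s = e"
  using H_disjoint ue H_sub by blast

lemma ue_closed [simp]: "s \<in> carrier S \<Longrightarrow> ue s \<in> carrier S"
  using ue by simp

lemma ue_mult: "\<lbrakk>s \<in> carrier S; t \<in> carrier S\<rbrakk> \<Longrightarrow> ue (s \<otimes> t) = ue s \<otimes> ue t"
  by (rule ue_eq) (use ue idem_mult H_mult in blast)+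

lemma in_H_iff: "\<lbrakk>idem e; s \<in> carrier S\<rbrakk> \<Longrightarrow> s \<in> H e \<longleftrightarrow> ue s = e"
  using ue ue_eq by blast

text \<open>In the semilattice order the condition reads \<open>e \<le> ue s\<close>.\<close>

lemma mult_idem_in_H_iff:
  assumes e: "idem e" and s: "s \<in> carrier S"
  shows "s \<otimes> e \<in> H e \<longleftrightarrow> ue s \<otimes> e = e"
  using assms in_H_iff[OF e m_closed[OF s idem_closed[OF e]]] ue_mult[OF s idem_closed[OF e]]
    ue_eq[OF e idem_in_H[OF e]] by simp

text \<open>The size of the principal ideal of \<open>e\<close>. It is strictly monotone in the
  semilattice order and so allows the idempotents to be listed from top to bottom.\<close>

definition rank :: "'a \<Rightarrow> nat" where
  "rank e = card ((\<lambda>s. e \<otimes> s) ` carrier S)"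

lemma rank_less:
  assumes e: "idem e" and f: "idem f" and ef: "f \<otimes> e = e" "e \<noteq> f"
  shows "rank e < rank f"
  unfolding rank_def
proof (rule psubset_card_mono)
  show "finite ((\<lambda>s. f \<otimes> s) ` carrier S)" using finite_carrier by simp
  have "e \<otimes> s \<in> (\<lambda>s. f \<otimes> s) ` carrier S" if "s \<in> carrier S" for s
    using that e f ef by (intro image_eqI[of _ _ "e \<otimes> s"]) (simp_all add: m_assoc[symmetric] m_closed)
  moreover have "f \<in> (\<lambda>s. f \<otimes> s) ` carrier S" using f by (intro image_eqI[of _ _ f]) auto
  moreover have "f \<notin> (\<lambda>s. e \<otimes> s) ` carrier S"
  proof
    assume "f \<in> (\<lambda>s. e \<otimes> s) ` carrier S"
    then obtain s where s: "s \<in> carrier S" "f = e \<otimes> s" by blast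
    then have "e \<otimes> f = f" using e by (simp add: m_assoc[symmetric])
    then show False using ef central[OF e, of f] f by simp
  qed
  ultimately show "(\<lambda>s. e \<otimes> s) ` carrier S \<subset> (\<lambda>s. f \<otimes> s) ` carrier S" by blast
qed

lemma factor_iso_H:
  assumes e: "idem e" and J: "semigroup_ideal S J" and I: "I - J = H e"
  shows "factor_iso_group S I J (Gp e)"
proof -
  have mJ: "s \<otimes> t \<notin> J" if "s \<in> H e" "t \<in> H e" for s t
    using H_mult[OF e e that] e I by auto
  show ?thesis
  proof (cases "J = {}")
    case True
    have "the \<in> iso (rees_quotient S I J) (Gp e)"
      using True I H_mult[OF e e] e
      by (auto simp: iso_def hom_def rees_quotient_def bij_betw_def inj_on_def image_image)
    then show ?thesis using True by (auto simp: factor_iso_group_def is_iso_def)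
  next
    case False
    have "(\<lambda>x. x) \<in> iso (rees_quotient S I J) (with_zero (Gp e))"
      using False I H_mult[OF e e] e mJ
      by (auto simp: iso_def hom_def rees_quotient_def with_zero_def bij_betw_def)
    then show ?thesis using False by (auto simp: factor_iso_group_def is_iso_def)
  qed
qed

text \<open>List the idempotents by falling rank; each ideal is the union of the groups from one
  position on. A product belongs to an idempotent below those of its factors, hence no earlier in
  the list. The differences are single groups, which leaves no room for ideals in between.\<close>

lemma principal_series_exists:
  obtains n I and es :: "nat \<Rightarrow> 'a" where "principal_series S n I"
    "\<And>i. i \<in> {1..n} \<Longrightarrow> idem (es i) \<and> I i - I (Suc i) = H (es i)" "inj_on es {1..n}"
proof -
  define E where "E = {e. idem e}"
  have finE: "finite E" using finite_carrier by (rule rev_finite_subset) (auto simp: E_def)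
  obtain xs where xs: "set xs = E" "distinct xs" using finite_distinct_list[OF finE] by blast
  define l where "l = sort_key (\<lambda>e. - int (rank e)) xs"
  have l: "set l = E" "distinct l" "\<And>i j. i < j \<Longrightarrow> j < length l \<Longrightarrow> rank (l ! j) \<le> rank (l ! i)"
  proof -
    show "set l = E" "distinct l" using xs by (simp_all add: l_def)
    fix i j assume ij: "i < j" "j < length l"
    have "sorted (map (\<lambda>e. - int (rank e)) l)" by (simp add: l_def)
    then show "rank (l ! j) \<le> rank (l ! i)" using ij by (auto simp: sorted_iff_nth_mono dest!: spec[of _ i])
  qed
  define n where "n = length l"
  \<comment> \<open>The series counts from 1, the list from 0.\<close>
  define es where "es i = l ! (i - 1)" for i
  define I where "I i = {s \<in> carrier S. \<exists>j. i \<le> j \<and> j \<le> n \<and> 1 \<le> j \<and> ue s = es j}" for i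
  have es: "idem (es i)" if "i \<in> {1..n}" for i
  proof -
    have "i - 1 < length l" using that by (auto simp: n_def)
    then have "l ! (i - 1) \<in> E" using nth_mem l(1) by blast
    then show ?thesis by (simp add: es_def E_def)
  qed
  have inj: "inj_on es {1..n}"
  proof (rule inj_onI)
    fix i j assume ij: "i \<in> {1..n}" "j \<in> {1..n}" "es i = es j"
    then have "i - 1 < length l" "j - 1 < length l" "l ! (i - 1) = l ! (j - 1)" by (auto simp: es_def n_def)
    then have "i - 1 = j - 1" using nth_eq_iff_index_eq[OF l(2)] by blast
    then show "i = j" using ij by (cases i; cases j) auto
  qed
  have diff: "I i - I (Suc i) = H (es i)" if i: "i \<in> {1..n}" for i
  proof (intro equalityI subsetI)
    fix s assume "s \<in> I i - I (Suc i)"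
    then have s: "s \<in> carrier S" "s \<in> I i" "s \<notin> I (Suc i)" by (auto simp: I_def)
    then obtain j where j: "i \<le> j" "j \<le> n" "1 \<le> j" "ue s = es j" by (auto simp: I_def)
    then have "\<not> Suc i \<le> j" using s by (auto simp: I_def)
    then show "s \<in> H (es i)" using j s ue[of s] by (metis le_antisym not_less_eq_eq)
  next
    fix s assume "s \<in> H (es i)"
    then have s: "s \<in> carrier S" "ue s = es i" using ue_eq es[OF i] H_sub by auto
    then have "s \<in> I i" using i by (auto simp: I_def)
    moreover have "s \<notin> I (Suc i)"
    proof
      assume "s \<in> I (Suc i)"
      then obtain j where "Suc i \<le> j" "j \<le> n" "es i = es j" using s by (auto simp: I_def)
      then show False using inj i by (auto dest!: inj_onD)
    qed
    ultimately show "s \<in> I i - I (Suc i)" by blast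
  qed
  have ideal: "semigroup_ideal S (I i)" for i
    unfolding semigroup_ideal_def
  proof (intro conjI ballI)
    show "I i \<subseteq> carrier S" by (auto simp: I_def)
    fix x s assume x: "x \<in> I i" and s: "s \<in> carrier S"
    obtain j where j: "x \<in> carrier S" "i \<le> j" "j \<le> n" "1 \<le> j" "ue x = es j" using x by (auto simp: I_def)
    define g where "g = es j \<otimes> ue s"
    have e: "idem (es j)" "idem (ue s)" using es[of j] j ue[OF s] by auto
    then have g: "idem g" "es j \<otimes> g = g" using idem_mult by (auto simp: g_def m_assoc[symmetric])
    have "g \<in> set l" using g l(1) by (simp add: E_def)
    then obtain k where k: "k < length l" "l ! k = g" by (auto simp: in_set_conv_nth)
    \<comment> \<open>\<open>g\<close> lies below \<open>es j\<close>. Listed before it,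
      \<open>g\<close> would have at least its rank and therefore be equal to it.\<close>
    have "j \<le> Suc k"
    proof (rule ccontr)
      assume "\<not> j \<le> Suc k"
      then have less: "k < j - 1" "j - 1 < length l" using j by (auto simp: n_def)
      then have "rank (es j) \<le> rank g" using l(3)[OF less] k by (simp add: es_def)
      then have "g = es j" using rank_less[OF g(1) e(1) g(2)] by fastforce
      then show False using k less l(2) by (auto simp: es_def nth_eq_iff_index_eq)
    qed
    then have "\<exists>j. i \<le> j \<and> j \<le> n \<and> 1 \<le> j \<and> g = es j"
      using j k by (intro exI[of _ "Suc k"]) (auto simp: es_def n_def)
    moreover have "ue (x \<otimes> s) = g" "ue (s \<otimes> x) = g"
      using ue_mult j s central[OF e(1), of "ue s"] by (simp_all add: g_def)
    ultimately show "s \<otimes> x \<in> I i" "x \<otimes> s \<in> I i" using j s by (auto simp: I_def m_closed)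
  qed
  have "principal_series S n I"
    unfolding principal_series_def
  proof (intro conjI ballI)
    show "I 1 = carrier S"
    proof -
      have "\<exists>j. 1 \<le> j \<and> j \<le> n \<and> 1 \<le> j \<and> ue s = es j" if "s \<in> carrier S" for s
      proof -
        have "ue s \<in> set l" using ue[OF that] l(1) by (simp add: E_def)
        then obtain k where "k < length l" "l ! k = ue s" by (auto simp: in_set_conv_nth)
        then show ?thesis by (intro exI[of _ "Suc k"]) (auto simp: es_def n_def)
      qed
      then show ?thesis by (auto simp: I_def)
    qed
    show "I (Suc n) = {}" by (auto simp: I_def)
    show "semigroup_ideal S (I i)" for i by (rule ideal)
    fix i assume i: "i \<in> {1..n}"
    have "I (Suc i) \<subseteq> I i" unfolding I_def using Suc_leD by blast
    moreover have "es i \<in> I i - I (Suc i)" using diff[OF i] idem_in_H[OF es[OF i]] by simp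
    ultimately show "I (Suc i) \<subset> I i" by blast
    show "\<not> (\<exists>J. semigroup_ideal S J \<and> I (Suc i) \<subset> J \<and> J \<subset> I i)"
    proof
      assume "\<exists>J. semigroup_ideal S J \<and> I (Suc i) \<subset> J \<and> J \<subset> I i"
      then obtain J where J: "semigroup_ideal S J" "I (Suc i) \<subset> J" "J \<subset> I i" by blast
      then obtain s where s: "s \<in> J" "s \<in> H (es i)" using diff[OF i] by blast
      obtain s' where s': "s' \<in> H (es i)" "s' \<otimes> s = es i" using H_inverse[OF s(2)] by blast
      \<comment> \<open>An ideal that meets a group contains its unit and hence the whole
        group.\<close>
      have ei: "es i \<in> J" using J(1) s s' H_sub unfolding semigroup_ideal_def by metis
      have "t \<in> J" if "t \<in> H (es i)" for t
        using J(1) ei H_unit[OF es[OF i] that] H_sub[OF that] unfolding semigroup_ideal_def by metis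
      then have "I i \<subseteq> J" using diff[OF i] J(2) by blast
      then show False using J(3) by blast
    qed
  qed
  then show thesis using that es diff inj by metis
qed

end

section \<open>Principal series with group factors\<close>

lemma higman_group_iso:
  assumes iso: "G \<cong> K" and K: "group K" and h: "higman_group G"
  shows "higman_group K"
proof -
  interpret G: group G by (rule higman_group_properties(1)[OF h])
  interpret K: group K by (rule K)
  obtain f where f: "f \<in> iso G K" using iso by (auto simp: is_iso_def)
  interpret f: group_hom G K f by unfold_locales (use f in \<open>simp add: iso_def\<close>)
  have bij: "bij_betw f (carrier G) (carrier K)" using f by (simp add: iso_def)
  have surj: "\<And>k. k \<in> carrier K \<Longrightarrow> \<exists>g\<in>carrier G. k = f g" using bij by (auto simp: bij_betw_def)
  have inj: "\<And>a b. \<lbrakk>a \<in> carrier G; b \<in> carrier G; f a = f b\<rbrakk> \<Longrightarrow> a = b"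
    using bij by (auto simp: bij_betw_def dest: inj_onD)
  have fin: "finite (carrier K)" using bij h bij_betw_finite by (auto simp: higman_group_def)
  have comm: "comm_group K" if "comm_group G"
  proof (rule K.group_comm_groupI)
    fix x y assume "x \<in> carrier K" "y \<in> carrier K"
    then obtain a b where "a \<in> carrier G" "b \<in> carrier G" "x = f a" "y = f b" using surj by metis
    then show "x \<otimes>\<^bsub>K\<^esub> y = y \<otimes>\<^bsub>K\<^esub> x"
      using comm_monoid.m_comm[OF comm_group.axioms(1)[OF that], of a b] by (metis f.hom_mult)
  qed
  have comm': "comm_group G" if "comm_group K"
  proof (rule G.group_comm_groupI)
    fix x y assume xy: "x \<in> carrier G" "y \<in> carrier G"
    then have "f (x \<otimes>\<^bsub>G\<^esub> y) = f (y \<otimes>\<^bsub>G\<^esub> x)"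
      using comm_monoid.m_comm[OF comm_group.axioms(1)[OF that], of "f x" "f y"] by simp
    then show "x \<otimes>\<^bsub>G\<^esub> y = y \<otimes>\<^bsub>G\<^esub> x" using inj xy by simp
  qed
  have exp: "group_exponent K dvd n" if e: "group_exponent G dvd n" for n
    unfolding K.exponent_dvd_iff
  proof
    fix k assume "k \<in> carrier K"
    then obtain g where g: "g \<in> carrier G" "k = f g" using surj by blast
    then have "g [^]\<^bsub>G\<^esub> n = \<one>\<^bsub>G\<^esub>" using e G.exponent_dvd_iff by blast
    then show "k [^]\<^bsub>K\<^esub> n = \<one>\<^bsub>K\<^esub>" using g f.hom_nat_pow[of g n] by simp
  qed
  have normal: "L \<lhd> K" if ham: "hamiltonian_group G" and L: "subgroup L K" for L
  proof -
    define M where "M = {g \<in> carrier G. f g \<in> L}"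
    have "subgroup M G"
      by (rule G.subgroupI) (use subgroup.one_closed[OF L] subgroup.m_closed[OF L] subgroup.m_inv_closed[OF L]
        in \<open>auto simp: M_def intro!: exI[of _ "\<one>\<^bsub>G\<^esub>"]\<close>)
    then have nM: "M \<lhd> G" using ham by (simp add: hamiltonian_group_def)
    show ?thesis unfolding K.normal_inv_iff
    proof (intro conjI ballI L)
      fix x h assume x: "x \<in> carrier K" and h: "h \<in> L"
      obtain a b where ab: "a \<in> carrier G" "b \<in> carrier G" "x = f a" "h = f b"
        using surj x h subgroup.subset[OF L] by (metis subsetD)
      then have "a \<otimes>\<^bsub>G\<^esub> b \<otimes>\<^bsub>G\<^esub> inv\<^bsub>G\<^esub> a \<in> M" using nM h unfolding G.normal_inv_iff by (auto simp: M_def)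
      then show "x \<otimes>\<^bsub>K\<^esub> h \<otimes>\<^bsub>K\<^esub> inv\<^bsub>K\<^esub> x \<in> L" using ab by (simp add: M_def)
    qed
  qed
  have "Coset.order K = Coset.order G" using bij_betw_same_card[OF bij] by (simp add: Coset.order_def)
  then have "hamiltonian_group K \<and> (\<exists>k. Coset.order K = 2 ^ k)"
    if "hamiltonian_group G" "\<exists>k. Coset.order G = 2 ^ k"
    using that comm' normal K by (auto simp: hamiltonian_group_def)
  then show ?thesis using h fin comm exp unfolding higman_group_def by blast
qed

lemma cyclic_5_8_12_iso:
  assumes "G \<cong> K" "group K" "cyclic_5_8_12 G"
  shows "cyclic_5_8_12 K"
proof -
  have "group G" using assms by (simp add: cyclic_5_8_12_def)
  then have "K \<cong> G" by (rule group.iso_sym[OF _ assms(1)])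
  then show ?thesis using assms iso_trans unfolding cyclic_5_8_12_def by blast
qed

section \<open>From group factors to a semilattice of groups\<close>

context finite_semigroup
begin

text \<open>Once the isomorphism is seen to respect the zeros, products of nonzero elements stay
  outside \<open>J\<close>, and the difference of the ideals is a group inside \<open>S\<close>
  itself.\<close>

lemma factor_iso_groupD:
  assumes iso: "factor_iso_group S I J G" and G: "group G" and I: "semigroup_ideal S I"
  shows "\<exists>e. group (S\<lparr>carrier := I - J, one := e\<rparr>) \<and> G \<cong> S\<lparr>carrier := I - J, one := e\<rparr>"
proof -
  interpret G: group G by (rule G)
  let ?R = "rees_quotient S I J"
  have "\<exists>f. bij_betw f (carrier G) (I - J) \<and>
    (\<forall>x\<in>carrier G. \<forall>y\<in>carrier G. f (x \<otimes>\<^bsub>G\<^esub> y) = f x \<otimes> f y)"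
  proof (cases "J = {}")
    case True
    then obtain h where h: "h \<in> iso ?R G" using iso by (auto simp: factor_iso_group_def is_iso_def)
    have c: "carrier ?R = Some ` I" using True by (simp add: rees_quotient_def)
    have bij: "bij_betw h (Some ` I) (carrier G)" using h c by (simp add: iso_def)
    have hm: "h (Some (s \<otimes> t)) = h (Some s) \<otimes>\<^bsub>G\<^esub> h (Some t)" if "s \<in> I" "t \<in> I" for s t
    proof -
      have "h (Some s \<otimes>\<^bsub>?R\<^esub> Some t) = h (Some s) \<otimes>\<^bsub>G\<^esub> h (Some t)"
        using h that c by (intro hom_mult) (auto simp: iso_def)
      then show ?thesis using True by (simp add: rees_quotient_def)
    qed
    define p where "p = h \<circ> Some"
    have bp: "bij_betw p I (carrier G)"
      unfolding p_def by (rule bij_betw_trans[OF _ bij]) (auto simp: bij_betw_def inj_on_def)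
    define f where "f = inv_into I p"
    have bf: "bij_betw f (carrier G) I" unfolding f_def by (rule bij_betw_inv_into[OF bp])
    have fI: "f x \<in> I" "p (f x) = x" if "x \<in> carrier G" for x
      using bf bp that by (auto simp: f_def bij_betw_def f_inv_into_f inv_into_into)
    have "f (x \<otimes>\<^bsub>G\<^esub> y) = f x \<otimes> f y" if "x \<in> carrier G" "y \<in> carrier G" for x y
    proof -
      have "p (f x \<otimes> f y) = x \<otimes>\<^bsub>G\<^esub> y" using hm[OF fI(1) fI(1)] fI that by (simp add: p_def)
      moreover have "f x \<otimes> f y \<in> I"
        using I fI(1)[OF that(1)] fI(1)[OF that(2)] unfolding semigroup_ideal_def by blast
      ultimately show ?thesis using bp by (metis bij_betw_inv_into_left f_def)
    qed
    then show ?thesis using bf True by auto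
  next
    case False
    then obtain h where h: "h \<in> iso ?R (with_zero G)" using iso by (auto simp: factor_iso_group_def is_iso_def)
    have c: "carrier ?R = insert None (Some ` (I - J))" using False by (auto simp: rees_quotient_def)
    have cz: "carrier (with_zero G) = insert None (Some ` carrier G)" by (simp add: with_zero_def)
    have bij: "bij_betw h (insert None (Some ` (I - J))) (insert None (Some ` carrier G))" using h c cz by (simp add: iso_def)
    have hm: "h (a \<otimes>\<^bsub>?R\<^esub> b) = h a \<otimes>\<^bsub>with_zero G\<^esub> h b" if "a \<in> carrier ?R" "b \<in> carrier ?R" for a b
      using h that by (intro hom_mult) (auto simp: iso_def)
    \<comment> \<open>If \<open>a\<close> is mapped to the zero, then so is its product with
      \<open>None\<close>, which is \<open>None\<close>.\<close>
    have hN: "h None = None"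
    proof -
      obtain a where a: "a \<in> carrier ?R" "h a = None" using bij c by (metis bij_betw_def image_iff insertI1)
      have "h (None \<otimes>\<^bsub>?R\<^esub> a) = h None \<otimes>\<^bsub>with_zero G\<^esub> h a" using a c by (intro hm) auto
      then show ?thesis using a by (auto simp: rees_quotient_def with_zero_def split: option.splits)
    qed
    have hS: "\<exists>g\<in>carrier G. h (Some s) = Some g" if "s \<in> I - J" for s
    proof -
      have "h (Some s) \<in> insert None (Some ` carrier G)" using bij_betwE[OF bij] that by blast
      moreover have "h (Some s) \<noteq> None"
        using bij hN that by (auto simp: bij_betw_def inj_on_def)
      ultimately show ?thesis by auto
    qed
    define p where "p s = the (h (Some s))" for s
    have hp: "h (Some s) = Some (p s)" "p s \<in> carrier G" if "s \<in> I - J" for s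
      using hS[OF that] by (auto simp: p_def)
    have clos: "s \<otimes> t \<in> I - J \<and> p (s \<otimes> t) = p s \<otimes>\<^bsub>G\<^esub> p t" if st: "s \<in> I - J" "t \<in> I - J" for s t
    proof -
      have *: "h (Some s \<otimes>\<^bsub>?R\<^esub> Some t) = Some (p s \<otimes>\<^bsub>G\<^esub> p t)"
        using hm[of "Some s" "Some t"] c st hp by (simp add: with_zero_def)
      have "s \<otimes> t \<notin> J" using * hN by (auto simp: rees_quotient_def split: if_splits)
      moreover have "s \<otimes> t \<in> I" using I st unfolding semigroup_ideal_def by blast
      ultimately show ?thesis using * hp(1)[of "s \<otimes> t"] by (auto simp: rees_quotient_def)
    qed
    have bp: "bij_betw p (I - J) (carrier G)"
      unfolding bij_betw_def
    proof
      show "inj_on p (I - J)"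
      proof (rule inj_onI)
        fix s t assume "s \<in> I - J" "t \<in> I - J" "p s = p t"
        then have "h (Some s) = h (Some t)" using hp by simp
        then show "s = t" using bij \<open>s \<in> I - J\<close> \<open>t \<in> I - J\<close> by (auto simp: bij_betw_def dest: inj_onD)
      qed
      show "p ` (I - J) = carrier G"
      proof
        show "carrier G \<subseteq> p ` (I - J)"
        proof
          fix g assume "g \<in> carrier G"
          then obtain a where "a \<in> insert None (Some ` (I - J))" "h a = Some g"
            using bij_betw_imp_surj_on[OF bij] by (metis (no_types, lifting) imageE imageI insertI2)
          then obtain s where "s \<in> I - J" "h (Some s) = Some g" using hN by auto
          then show "g \<in> p ` (I - J)" by (intro image_eqI[of _ _ s]) (simp_all add: p_def)
        qed
      qed (use hp in auto)
    qed
    define f where "f = inv_into (I - J) p"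
    have bf: "bij_betw f (carrier G) (I - J)" unfolding f_def by (rule bij_betw_inv_into[OF bp])
    have fI: "f x \<in> I - J" "p (f x) = x" if "x \<in> carrier G" for x
      using bf bp that by (auto simp: f_def bij_betw_def f_inv_into_f inv_into_into)
    have "f (x \<otimes>\<^bsub>G\<^esub> y) = f x \<otimes> f y" if "x \<in> carrier G" "y \<in> carrier G" for x y
    proof -
      have "p (f x \<otimes> f y) = x \<otimes>\<^bsub>G\<^esub> y" "f x \<otimes> f y \<in> I - J"
        using clos[OF fI(1) fI(1)] fI that by auto
      then show ?thesis using bp by (metis bij_betw_inv_into_left f_def)
    qed
    then show ?thesis using bf by blast
  qed
  then obtain f where bf: "bij_betw f (carrier G) (I - J)"
    and fm: "\<And>x y. \<lbrakk>x \<in> carrier G; y \<in> carrier G\<rbrakk> \<Longrightarrow> f (x \<otimes>\<^bsub>G\<^esub> y) = f x \<otimes> f y" by blast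
  define K where "K = S\<lparr>carrier := I - J, one := f \<one>\<^bsub>G\<^esub>\<rparr>"
  have surj: "\<And>k. k \<in> carrier K \<Longrightarrow> \<exists>g\<in>carrier G. k = f g" using bf by (auto simp: bij_betw_def K_def)
  have fK: "\<And>g. g \<in> carrier G \<Longrightarrow> f g \<in> carrier K" using bf by (auto simp: bij_betw_def K_def)
  have fm': "\<And>x y. \<lbrakk>x \<in> carrier G; y \<in> carrier G\<rbrakk> \<Longrightarrow> f x \<otimes>\<^bsub>K\<^esub> f y = f (x \<otimes>\<^bsub>G\<^esub> y)" using fm by (simp add: K_def)
  have oneK: "\<one>\<^bsub>K\<^esub> = f \<one>\<^bsub>G\<^esub>" by (simp add: K_def)
  have "group K"
  proof (rule groupI)
    fix x assume "x \<in> carrier K"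
    then obtain a where a: "a \<in> carrier G" "x = f a" using surj by blast
    show "\<one>\<^bsub>K\<^esub> \<otimes>\<^bsub>K\<^esub> x = x" using a by (simp add: oneK fm')
    show "\<exists>y\<in>carrier K. y \<otimes>\<^bsub>K\<^esub> x = \<one>\<^bsub>K\<^esub>" using a by (intro bexI[of _ "f (inv\<^bsub>G\<^esub> a)"]) (simp_all add: oneK fm' fK)
    fix y assume "y \<in> carrier K"
    then obtain b where b: "b \<in> carrier G" "y = f b" using surj by blast
    show "x \<otimes>\<^bsub>K\<^esub> y \<in> carrier K" using a b by (simp add: fm' fK)
    fix z assume "z \<in> carrier K"
    then obtain d where d: "d \<in> carrier G" "z = f d" using surj by blast
    show "x \<otimes>\<^bsub>K\<^esub> y \<otimes>\<^bsub>K\<^esub> z = x \<otimes>\<^bsub>K\<^esub> (y \<otimes>\<^bsub>K\<^esub> z)" using a b d by (simp add: fm' G.m_assoc)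
  qed (simp add: oneK fK)
  moreover have "f \<in> iso G K" using bf fm' fK by (auto simp: iso_def hom_def K_def)
  ultimately show ?thesis unfolding K_def is_iso_def by blast
qed

text \<open>\<open>lv\<close> measures how deep in the series an element lies: a product is at least
  as deep as its factors, and every level is a group. Idempotents are first shown to commute with
  each other and then with all elements.\<close>

lemma clifford_from_levels:
  fixes lv :: "'a \<Rightarrow> nat"
  assumes mono: "\<And>s t. \<lbrakk>s \<in> carrier S; t \<in> carrier S\<rbrakk> \<Longrightarrow> lv s \<le> lv (s \<otimes> t) \<and> lv t \<le> lv (s \<otimes> t)"
    and grp: "\<And>s. s \<in> carrier S \<Longrightarrow> \<exists>e. group (S\<lparr>carrier := {t \<in> carrier S. lv t = lv s}, one := e\<rparr>)"
  shows "clifford_semigroup S"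
proof -
  have lvl: "\<exists>g\<in>carrier S. lv g = lv s \<and> g \<otimes> g = g \<and> (\<forall>t\<in>carrier S. lv t = lv s \<longrightarrow>
      g \<otimes> t = t \<and> t \<otimes> g = t \<and> (t \<otimes> t = t \<longrightarrow> t = g) \<and> lv (t \<otimes> t) = lv s \<and>
      (\<exists>u\<in>carrier S. lv u = lv s \<and> t \<otimes> u = g \<and> u \<otimes> t = g))" if s: "s \<in> carrier S" for s
  proof -
    define X where "X = {t \<in> carrier S. lv t = lv s}"
    obtain e where "group (S\<lparr>carrier := X, one := e\<rparr>)" using grp[OF s] unfolding X_def by blast
    then interpret K: group "S\<lparr>carrier := X, one := e\<rparr>" .
    have e: "e \<in> X" using K.one_closed by simp
    have un: "e \<otimes> t = t" "t \<otimes> e = t" if "t \<in> X" for t using K.l_one[of t] K.r_one[of t] that by simp_all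
    show ?thesis
    proof (rule bexI[of _ e], intro conjI ballI impI)
      show "lv e = lv s" "e \<in> carrier S" using e by (simp_all add: X_def)
      show "e \<otimes> e = e" by (rule un[OF e])
      fix t assume "t \<in> carrier S" "lv t = lv s"
      then have t: "t \<in> X" by (simp add: X_def)
      show "e \<otimes> t = t" "t \<otimes> e = t" by (rule un[OF t])+
      show "t = e" if "t \<otimes> t = t" using K.l_cancel_one[of t t] that t by simp
      show "lv (t \<otimes> t) = lv s" using K.m_closed[of t t] t by (simp add: X_def)
      obtain u where "u \<in> X" "t \<otimes> u = e" "u \<otimes> t = e"
        using K.r_inv[of t] K.l_inv[of t] K.inv_closed[of t] t by auto
      then show "\<exists>u\<in>carrier S. lv u = lv s \<and> t \<otimes> u = e \<and> u \<otimes> t = e" by (auto simp: X_def)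
    qed
  qed
  have lv_sq: "lv (s \<otimes> s) = lv s" if "s \<in> carrier S" for s
    using lvl[OF that] that by blast
  have comm: "e \<otimes> f = f \<otimes> e \<and> e \<otimes> f \<otimes> (e \<otimes> f) = e \<otimes> f"
    if e: "e \<in> carrier S" "e \<otimes> e = e" and f: "f \<in> carrier S" "f \<otimes> f = f" for e f
  proof -
    have ef: "e \<otimes> f \<in> carrier S" "f \<otimes> e \<in> carrier S" using e f by (simp_all add: m_closed)
    \<comment> \<open>The square of \<open>e \<otimes> f\<close> stays in its level and has
      \<open>f \<otimes> e\<close> as a factor; by symmetry both products lie in one level.\<close>
    have le: "lv (f \<otimes> e) \<le> lv (e \<otimes> f)" if e: "e \<in> carrier S" and f: "f \<in> carrier S" for e f
    proof -
      have "lv (e \<otimes> f) = lv ((e \<otimes> f) \<otimes> (e \<otimes> f))"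
        using lv_sq[OF m_closed[OF e f]] by simp
      also have "(e \<otimes> f) \<otimes> (e \<otimes> f) = e \<otimes> ((f \<otimes> e) \<otimes> f)" using e f by (simp add: m_assoc m_closed)
      finally show ?thesis using mono[of e "(f \<otimes> e) \<otimes> f"] mono[of "f \<otimes> e" f] e f by (simp add: m_closed)
    qed
    have lv: "lv (f \<otimes> e) = lv (e \<otimes> f)" using le[OF e(1) f(1)] le[OF f(1) e(1)] by simp
    obtain g where g: "g \<in> carrier S" "g \<otimes> g = g" and gt: "\<And>t. \<lbrakk>t \<in> carrier S; lv t = lv (e \<otimes> f)\<rbrakk> \<Longrightarrow>
      g \<otimes> t = t \<and> t \<otimes> g = t \<and> (\<exists>u\<in>carrier S. t \<otimes> u = g \<and> u \<otimes> t = g)"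
      using lvl[OF ef(1)] by blast
    obtain u where u: "u \<in> carrier S" "e \<otimes> f \<otimes> u = g" "u \<otimes> (e \<otimes> f) = g" using gt[OF ef(1) refl] by blast
    obtain v where v: "v \<in> carrier S" "f \<otimes> e \<otimes> v = g" "v \<otimes> (f \<otimes> e) = g" using gt[OF ef(2) lv] by blast
    have absorb: "x \<otimes> (x \<otimes> y) = x \<otimes> y" "y \<otimes> x \<otimes> x = y \<otimes> x" if "x \<in> carrier S" "y \<in> carrier S" "x \<otimes> x = x" for x y
      using that by (simp_all add: m_assoc[symmetric]) (simp add: m_assoc)
    \<comment> \<open>The unit \<open>g\<close> of that level is a left and right multiple of
      \<open>e \<otimes> f\<close> and of \<open>f \<otimes> e\<close>, so it absorbs
      \<open>e\<close> and \<open>f\<close> on both sides.\<close>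
    have eg: "e \<otimes> g = g" using absorb(1)[OF e(1) f(1) e(2)] u e f by (metis m_assoc m_closed)
    have gf: "g \<otimes> f = g" using absorb(2)[OF f(1) e(1) f(2)] u e f by (metis m_assoc m_closed)
    have fg: "f \<otimes> g = g" using absorb(1)[OF f(1) e(1) f(2)] v e f by (metis m_assoc m_closed)
    have ge: "g \<otimes> e = g" using absorb(2)[OF e(1) f(1) e(2)] v e f by (metis m_assoc m_closed)
    have "e \<otimes> f = g \<otimes> (e \<otimes> f)" using gt[OF ef(1) refl] by simp
    also have "\<dots> = g \<otimes> e \<otimes> f" using g e f by (simp add: m_assoc)
    finally have 1: "e \<otimes> f = g" using ge gf by simp
    have "f \<otimes> e = f \<otimes> e \<otimes> g" using gt[OF ef(2) lv] by simp
    also have "\<dots> = f \<otimes> (e \<otimes> g)" using g e f by (simp add: m_assoc)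
    finally have "f \<otimes> e = g" using eg fg by simp
    then show ?thesis using 1 g by simp
  qed
  have central: "e \<otimes> s = s \<otimes> e" if e: "e \<in> carrier S" "e \<otimes> e = e" and s: "s \<in> carrier S" for e s
  proof -
    obtain f u where f: "f \<in> carrier S" "f \<otimes> f = f" "f \<otimes> s = s" "s \<otimes> f = s"
      and u: "u \<in> carrier S" "s \<otimes> u = f" "u \<otimes> s = f"
      using lvl[OF s] s by metis
    define g where "g = e \<otimes> f"
    have ge: "g = f \<otimes> e" "g \<otimes> g = g" using comm[OF e f(1,2)] unfolding g_def by blast+
    have gf: "g \<otimes> f = g" unfolding g_def using e f(1,2) by (simp only: m_assoc)
    have "f \<otimes> (f \<otimes> e) = f \<otimes> f \<otimes> e" using e f(1) by (simp only: m_assoc)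
    then have "f \<otimes> g = g" using ge(1) f(2) by simp
    then have g: "g \<in> carrier S" "g \<otimes> g = g" "g = f \<otimes> e" "g \<otimes> f = g" "f \<otimes> g = g"
      using ge gf e f(1) by (simp_all add: g_def m_closed)
    \<comment> \<open>\<open>u\<close> undoes \<open>s\<close> up to \<open>f\<close>, which
      \<open>g\<close> absorbs; so multiplication by \<open>s\<close> does not leave the level of
      \<open>g\<close>.\<close>
    have lv1: "lv (g \<otimes> s) = lv g"
      using mono[of g s] mono[of "g \<otimes> s" u] g s u by (simp add: m_assoc m_closed)
    have lv2: "lv (s \<otimes> g) = lv g"
      using mono[of s g] mono[of u "s \<otimes> g"] g s u by (simp add: m_assoc[symmetric] m_closed)
    obtain g' where g': "\<And>t. \<lbrakk>t \<in> carrier S; lv t = lv g\<rbrakk> \<Longrightarrow> g' \<otimes> t = t \<and> t \<otimes> g' = t \<and> (t \<otimes> t = t \<longrightarrow> t = g')"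
      using lvl[OF g(1)] by blast
    then have "g' = g" using g by blast
    then have "g \<otimes> s \<otimes> g = g \<otimes> s" "g \<otimes> (s \<otimes> g) = s \<otimes> g"
      using g'[of "g \<otimes> s"] g'[of "s \<otimes> g"] lv1 lv2 g s by (simp_all add: m_closed)
    then have "g \<otimes> s = s \<otimes> g" using g s by (simp add: m_assoc)
    moreover have "e \<otimes> s = g \<otimes> s" using e f s by (simp add: g_def m_assoc)
    moreover have "s \<otimes> e = s \<otimes> g" using e f s g(3) by (simp add: m_assoc[symmetric])
    ultimately show ?thesis by simp
  qed
  show ?thesis
  proof unfold_locales
    show "e \<otimes> s = s \<otimes> e" if "e \<in> carrier S" "e \<otimes> e = e" "s \<in> carrier S" for e s by (rule central[OF that])
    show "\<exists>t\<in>carrier S. s \<otimes> t = t \<otimes> s \<and> s \<otimes> t \<otimes> s = s \<and> t \<otimes> s \<otimes> t = t" if s: "s \<in> carrier S" for s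
      using lvl[OF s] s by metis
  qed
qed

end

context clifford_semigroup
begin

text \<open>The classification stated for maximal subgroups instead of the factors of a
  series.\<close>

definition good :: bool where
  "good \<longleftrightarrow> (\<forall>e. idem e \<longrightarrow> higman_group (Gp e) \<or> cyclic_5_8_12 (Gp e)) \<and>
    (\<forall>e f. idem e \<longrightarrow> idem f \<longrightarrow> cyclic_5_8_12 (Gp e) \<longrightarrow> cyclic_5_8_12 (Gp f) \<longrightarrow> e = f)"

text \<open>\<open>group_inside\<close> quantifies over the unit; on a maximal subgroup only its
  idempotent is possible.\<close>

lemma Gp_unit_unique:
  assumes e: "idem e" and g: "group (S\<lparr>carrier := H e, one := u\<rparr>)"
  shows "u = e"
proof -
  interpret K: group "S\<lparr>carrier := H e, one := u\<rparr>" by (rule g)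
  interpret L: group "Gp e" by (rule Gp_group[OF e])
  have "u \<in> H e" "u \<otimes> u = u" using K.one_closed K.l_one[OF K.one_closed] by simp_all
  then show ?thesis using L.l_cancel_one[of u u] by simp
qed

text \<open>Two inverses b and c of \<open>a\<close> satisfy
  \<open>b = c \<otimes> a \<otimes> b = c\<close>, because their products with \<open>a\<close> are
  idempotent and central.\<close>

lemma inverse_semigroup: "inverse_semigroup S"
  unfolding inverse_semigroup_def
proof (intro ballI impI)
  fix a assume a: "a \<in> carrier S"
  obtain t where t: "t \<in> carrier S" "a \<otimes> t = t \<otimes> a" "a \<otimes> t \<otimes> a = a" "t \<otimes> a \<otimes> t = t"
    using regular[OF a] by blast
  have uniq: "b = c \<otimes> a \<otimes> b"
    if b: "b \<in> carrier S" "a \<otimes> b \<otimes> a = a" "b \<otimes> a \<otimes> b = b" and c: "c \<in> carrier S" "a \<otimes> c \<otimes> a = a" for b c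
  proof -
    have ca: "c \<otimes> a \<otimes> (c \<otimes> a) = c \<otimes> a"
    proof -
      have "c \<otimes> a \<otimes> (c \<otimes> a) = c \<otimes> (a \<otimes> c \<otimes> a)" using a c(1) by (simp only: m_assoc m_closed)
      then show ?thesis by (simp only: c(2))
    qed
    have "b = b \<otimes> (a \<otimes> c \<otimes> a) \<otimes> b" by (simp only: b(3) c(2))
    also have "\<dots> = b \<otimes> a \<otimes> (c \<otimes> a) \<otimes> b" using a b(1) c(1) by (simp only: m_assoc m_closed)
    also have "b \<otimes> a \<otimes> (c \<otimes> a) = c \<otimes> a \<otimes> (b \<otimes> a)"
      by (rule idem_central[OF m_closed[OF c(1) a] ca m_closed[OF b(1) a], symmetric])
    also have "c \<otimes> a \<otimes> (b \<otimes> a) \<otimes> b = c \<otimes> a \<otimes> (b \<otimes> a \<otimes> b)" using a b(1) c(1) by (simp only: m_assoc m_closed)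
    finally show ?thesis by (simp only: b(3))
  qed
  have uniq': "c = c \<otimes> a \<otimes> b"
    if b: "b \<in> carrier S" "a \<otimes> b \<otimes> a = a" and c: "c \<in> carrier S" "a \<otimes> c \<otimes> a = a" "c \<otimes> a \<otimes> c = c" for b c
  proof -
    have ab: "a \<otimes> b \<otimes> (a \<otimes> b) = a \<otimes> b"
    proof -
      have "a \<otimes> b \<otimes> (a \<otimes> b) = (a \<otimes> b \<otimes> a) \<otimes> b" using a b(1) by (simp only: m_assoc m_closed)
      then show ?thesis by (simp only: b(2))
    qed
    have "c = c \<otimes> (a \<otimes> b \<otimes> a) \<otimes> c" by (simp only: b(2) c(3))
    also have "\<dots> = c \<otimes> (a \<otimes> b \<otimes> (a \<otimes> c))" using a b(1) c(1) by (simp only: m_assoc m_closed)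
    also have "a \<otimes> b \<otimes> (a \<otimes> c) = a \<otimes> c \<otimes> (a \<otimes> b)"
      by (rule idem_central[OF m_closed[OF a b(1)] ab m_closed[OF a c(1)]])
    also have "c \<otimes> (a \<otimes> c \<otimes> (a \<otimes> b)) = (c \<otimes> a \<otimes> c) \<otimes> a \<otimes> b" using a b(1) c(1) by (simp only: m_assoc m_closed)
    finally show ?thesis by (simp only: c(3))
  qed
  show "\<exists>!b. b \<in> carrier S \<and> a \<otimes> b \<otimes> a = a \<and> b \<otimes> a \<otimes> b = b"
  proof (rule ex1I[of _ t])
    fix b assume b: "b \<in> carrier S \<and> a \<otimes> b \<otimes> a = a \<and> b \<otimes> a \<otimes> b = b"
    have "b = t \<otimes> a \<otimes> b" by (rule uniq) (use b t in auto)
    moreover have "t = t \<otimes> a \<otimes> b" by (rule uniq') (use b t in auto)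
    ultimately show "b = t" by simp
  qed (use t in auto)
qed

end

lemma good_imp_disjoint_union:
  fixes S :: "'s monoid"
  assumes "clifford_semigroup S" and good: "clifford_semigroup.good S"
  shows "disjoint_union_of_groups S"
proof -
  interpret clifford_semigroup S by fact
  define \<G> where "\<G> = {H e | e. idem e}"
  have "partition_on (carrier S) \<G>"
  proof (rule partition_onI)
    show "\<Union> \<G> = carrier S"
      unfolding \<G>_def using H_cover H_sub by blast
    show "disjnt p q" if "p \<in> \<G>" "q \<in> \<G>" "p \<noteq> q" for p q
      using that H_disjoint unfolding \<G>_def disjnt_def by blast
    show "{} \<notin> \<G>" unfolding \<G>_def using idem_in_H by blast
  qed
  moreover have "\<forall>X\<in>\<G>. group_inside higman_group S X \<or> group_inside cyclic_5_8_12 S X"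
    using good unfolding \<G>_def good_def group_inside_def by blast
  moreover have "card {X \<in> \<G>. group_inside cyclic_5_8_12 S X} \<le> 1"
  proof -
    have "\<exists>e. idem e \<and> X = H e \<and> cyclic_5_8_12 (Gp e)" if X: "X \<in> \<G>" "group_inside cyclic_5_8_12 S X" for X
    proof -
      obtain e u where e: "idem e" "X = H e" "cyclic_5_8_12 (S\<lparr>carrier := H e, one := u\<rparr>)"
        using X unfolding \<G>_def group_inside_def by blast
      then have "u = e" by (intro Gp_unit_unique) (auto simp: cyclic_5_8_12_def)
      then show ?thesis using e by blast
    qed
    then have eq: "X = Y" if "X \<in> \<G>" "group_inside cyclic_5_8_12 S X" "Y \<in> \<G>" "group_inside cyclic_5_8_12 S Y" for X Y
      using that good unfolding good_def by metis
    have "finite \<G>"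
      by (rule finite_subset[of _ "Pow (carrier S)"]) (use finite_carrier H_sub in \<open>auto simp: \<G>_def\<close>)
    then show ?thesis using eq by (subst One_nat_def, subst card_le_Suc0_iff_eq) auto
  qed
  ultimately show ?thesis unfolding disjoint_union_of_groups_def by blast
qed

lemma good_imp_series:
  fixes S :: "'s monoid"
  assumes "clifford_semigroup S" and good: "clifford_semigroup.good S"
  shows "has_hyperbolic_series S"
proof -
  interpret clifford_semigroup S by fact
  obtain n I es where ser: "principal_series S n I"
    and es: "\<And>i. i \<in> {1..n} \<Longrightarrow> idem (es i) \<and> I i - I (Suc i) = H (es i)" and inj: "inj_on es {1..n}"
    using principal_series_exists by blast
  have ideal: "semigroup_ideal S (I i)" if "i \<in> {1..Suc n}" for i
    using ser that by (simp add: principal_series_def)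
  have factor: "factor_iso_group S (I i) (I (Suc i)) (Gp (es i))" if "i \<in> {1..n}" for i
    using factor_iso_H[of "es i" "I (Suc i)" "I i"] es[OF that] ideal[of "Suc i"] that by auto
  \<comment> \<open>The count in \<open>has_hyperbolic_series\<close> allows any group isomorphic to
    the factor; each of them is isomorphic to the maximal subgroup.\<close>
  have cyc: "cyclic_5_8_12 (Gp (es i))"
    if i: "i \<in> {1..n}" and ex: "\<exists>G :: 's monoid. cyclic_5_8_12 G \<and> factor_iso_group S (I i) (I (Suc i)) G" for i
  proof -
    obtain G :: "'s monoid" where G: "cyclic_5_8_12 G" "factor_iso_group S (I i) (I (Suc i)) G" using ex by blast
    have "group G" using G by (simp add: cyclic_5_8_12_def)
    from factor_iso_groupD[OF G(2) this] ideal[of i] i obtain u where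
      u: "group (S\<lparr>carrier := I i - I (Suc i), one := u\<rparr>)" "G \<cong> S\<lparr>carrier := I i - I (Suc i), one := u\<rparr>" by auto
    have eq: "I i - I (Suc i) = H (es i)" using es[OF i] by blast
    have "u = es i" using u(1) es[OF i] unfolding eq by (intro Gp_unit_unique) auto
    then show ?thesis using cyclic_5_8_12_iso[OF u(2,1) G(1)] eq by simp
  qed
  have "\<forall>i\<in>{1..n}. \<exists>G :: 's monoid. (higman_group G \<or> cyclic_5_8_12 G) \<and> factor_iso_group S (I i) (I (Suc i)) G"
    using good es factor unfolding good_def by blast
  moreover have "card {i \<in> {1..n}. \<exists>G :: 's monoid. cyclic_5_8_12 G \<and> factor_iso_group S (I i) (I (Suc i)) G} \<le> 1"
  proof -
    have "i = j" if "i \<in> {1..n}" "\<exists>G :: 's monoid. cyclic_5_8_12 G \<and> factor_iso_group S (I i) (I (Suc i)) G"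
      "j \<in> {1..n}" "\<exists>G :: 's monoid. cyclic_5_8_12 G \<and> factor_iso_group S (I j) (I (Suc j)) G" for i j
    proof -
      have "es i = es j" using cyc[OF that(1,2)] cyc[OF that(3,4)] es that(1,3) good unfolding good_def by blast
      then show ?thesis using that(1,3) by (rule inj_onD[OF inj])
    qed
    then show ?thesis by (subst One_nat_def, subst card_le_Suc0_iff_eq) auto
  qed
  ultimately show ?thesis unfolding has_hyperbolic_series_def using ser by blast
qed

text \<open>The level of an element is the last term of the series containing it. The layers are
  then exactly the maximal subgroups.\<close>

lemma series_imp_good:
  fixes S :: "'s monoid"
  assumes "finite_semigroup S" and ser: "has_hyperbolic_series S"
  shows "clifford_semigroup S \<and> clifford_semigroup.good S"
proof -
  interpret finite_semigroup S by fact
  obtain n I where I: "principal_series S n I"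
    and ty: "\<And>i. i \<in> {1..n} \<Longrightarrow> \<exists>G :: 's monoid. (higman_group G \<or> cyclic_5_8_12 G) \<and> factor_iso_group S (I i) (I (Suc i)) G"
    and card1: "card {i \<in> {1..n}. \<exists>G :: 's monoid. cyclic_5_8_12 G \<and> factor_iso_group S (I i) (I (Suc i)) G} \<le> 1"
    using ser unfolding has_hyperbolic_series_def by blast
  have ideal: "semigroup_ideal S (I i)" if "i \<in> {1..Suc n}" for i
    using I that by (simp add: principal_series_def)
  have I1: "I 1 = carrier S" "I (Suc n) = {}" using I by (simp_all add: principal_series_def)
  have step: "I (Suc i) \<subseteq> I i" if "i \<in> {1..n}" for i
    using I that by (auto simp: principal_series_def)
  have anti: "I j \<subseteq> I i" if "1 \<le> i" "i \<le> j" "j \<le> Suc n" for i j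
    using that(2,3)
  proof (induction j rule: dec_induct)
    case (step k)
    then show ?case using \<open>\<And>i. i \<in> {1..n} \<Longrightarrow> I (Suc i) \<subseteq> I i\<close>[of k] that(1) by auto
  qed simp
  define lv where "lv s = Max {i \<in> {1..n}. s \<in> I i}" for s
  have lv: "lv s \<in> {1..n} \<and> s \<in> I (lv s)" and lv_max: "\<And>i. \<lbrakk>i \<in> {1..n}; s \<in> I i\<rbrakk> \<Longrightarrow> i \<le> lv s"
    if s: "s \<in> carrier S" for s
  proof -
    have "n \<noteq> 0" using I1 s by (metis One_nat_def empty_iff)
    then have "1 \<in> {i \<in> {1..n}. s \<in> I i}" using s I1 by auto
    then have "lv s \<in> {i \<in> {1..n}. s \<in> I i}" unfolding lv_def by (intro Max_in) auto
    then show "lv s \<in> {1..n} \<and> s \<in> I (lv s)" by blast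
    show "i \<le> lv s" if "i \<in> {1..n}" "s \<in> I i" for i unfolding lv_def using that by (intro Max_ge) auto
  qed
  have X: "{t \<in> carrier S. lv t = i} = I i - I (Suc i)" if i: "i \<in> {1..n}" for i
  proof (intro equalityI subsetI)
    fix t assume "t \<in> {t \<in> carrier S. lv t = i}"
    then have t: "t \<in> carrier S" "lv t = i" by auto
    have "t \<notin> I (Suc i)"
    proof
      assume a: "t \<in> I (Suc i)"
      then have "i \<noteq> n" using I1 by auto
      then show False using lv_max[OF t(1), of "Suc i"] a t i by auto
    qed
    then show "t \<in> I i - I (Suc i)" using lv[OF t(1)] t by auto
  next
    fix t assume t: "t \<in> I i - I (Suc i)"
    then have tS: "t \<in> carrier S" using ideal[of i] i by (auto simp: semigroup_ideal_def)
    have "\<not> Suc i \<le> lv t" using anti[of "Suc i" "lv t"] lv[OF tS] t by auto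
    moreover have "i \<le> lv t" using lv_max[OF tS i] t by blast
    ultimately show "t \<in> {t \<in> carrier S. lv t = i}" using tS by auto
  qed
  have grp: "\<exists>u. group (S\<lparr>carrier := I i - I (Suc i), one := u\<rparr>) \<and>
    (higman_group (S\<lparr>carrier := I i - I (Suc i), one := u\<rparr>) \<or> cyclic_5_8_12 (S\<lparr>carrier := I i - I (Suc i), one := u\<rparr>))"
    if i: "i \<in> {1..n}" for i
  proof -
    obtain G :: "'s monoid" where G: "higman_group G \<or> cyclic_5_8_12 G" "factor_iso_group S (I i) (I (Suc i)) G"
      using ty[OF i] by blast
    have "group G" using G higman_group_properties(1) by (auto simp: cyclic_5_8_12_def)
    from factor_iso_groupD[OF G(2) this] ideal[of i] i obtain u where
      u: "group (S\<lparr>carrier := I i - I (Suc i), one := u\<rparr>)" "G \<cong> S\<lparr>carrier := I i - I (Suc i), one := u\<rparr>" by auto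
    then show ?thesis using G(1) higman_group_iso[OF u(2,1)] cyclic_5_8_12_iso[OF u(2,1)] by blast
  qed
  have "clifford_semigroup S"
  proof (rule clifford_from_levels[of lv])
    show "lv s \<le> lv (s \<otimes>\<^bsub>S\<^esub> t) \<and> lv t \<le> lv (s \<otimes>\<^bsub>S\<^esub> t)" if s: "s \<in> carrier S" and t: "t \<in> carrier S" for s t
    proof
      have "s \<otimes>\<^bsub>S\<^esub> t \<in> I (lv s)" using ideal[of "lv s"] lv[OF s] t by (auto simp: semigroup_ideal_def)
      then show "lv s \<le> lv (s \<otimes>\<^bsub>S\<^esub> t)" using lv_max[OF m_closed[OF s t]] lv[OF s] by blast
      have "s \<otimes>\<^bsub>S\<^esub> t \<in> I (lv t)" using ideal[of "lv t"] lv[OF t] s by (auto simp: semigroup_ideal_def)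
      then show "lv t \<le> lv (s \<otimes>\<^bsub>S\<^esub> t)" using lv_max[OF m_closed[OF s t]] lv[OF t] by blast
    qed
    show "\<exists>e. group (S\<lparr>carrier := {t \<in> carrier S. lv t = lv s}, one := e\<rparr>)" if "s \<in> carrier S" for s
      using X[of "lv s"] grp[of "lv s"] lv[OF that] by auto
  qed
  then interpret clifford_semigroup S .
  \<comment> \<open>The elements of a maximal subgroup divide each other and share a level;
    conversely, the layer is a group with unit \<open>e\<close>.\<close>
  have HX: "H e = I (lv e) - I (Suc (lv e))" if e: "idem e" for e
  proof -
    have eS: "e \<in> carrier S" using e by simp
    have i: "lv e \<in> {1..n}" using lv[OF eS] by blast
    obtain u where u: "group (S\<lparr>carrier := {t \<in> carrier S. lv t = lv e}, one := u\<rparr>)" using X[OF i] grp[OF i] by auto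
    interpret K: group "S\<lparr>carrier := {t \<in> carrier S. lv t = lv e}, one := u\<rparr>" by (rule u)
    have ue: "u = e" using K.l_cancel_one[of e e] eS e by simp
    have mono: "lv s \<le> lv (s \<otimes>\<^bsub>S\<^esub> t)" "lv t \<le> lv (s \<otimes>\<^bsub>S\<^esub> t)" if s: "s \<in> carrier S" and t: "t \<in> carrier S" for s t
    proof -
      have "s \<otimes>\<^bsub>S\<^esub> t \<in> I (lv s)" using ideal[of "lv s"] lv[OF s] t by (auto simp: semigroup_ideal_def)
      then show "lv s \<le> lv (s \<otimes>\<^bsub>S\<^esub> t)" using lv_max[OF m_closed[OF s t]] lv[OF s] by blast
      have "s \<otimes>\<^bsub>S\<^esub> t \<in> I (lv t)" using ideal[of "lv t"] lv[OF t] s by (auto simp: semigroup_ideal_def)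
      then show "lv t \<le> lv (s \<otimes>\<^bsub>S\<^esub> t)" using lv_max[OF m_closed[OF s t]] lv[OF t] by blast
    qed
    have "H e = {t \<in> carrier S. lv t = lv e}"
    proof (intro equalityI subsetI)
      fix s assume s: "s \<in> H e"
      obtain t where t: "t \<in> H e" "s \<otimes>\<^bsub>S\<^esub> t = e" using H_inverse[OF s] by blast
      have "lv s \<le> lv e" using mono(1)[of s t] H_sub[OF s] H_sub[OF t(1)] t(2) by simp
      moreover have "lv e \<le> lv s" using mono(1)[of e s] H_sub[OF s] eS H_unit[OF e s] by simp
      ultimately show "s \<in> {t \<in> carrier S. lv t = lv e}" using H_sub[OF s] by simp
    next
      fix s assume s: "s \<in> {t \<in> carrier S. lv t = lv e}"
      show "s \<in> H e"
        using K.l_one[of s] K.r_inv[of s] K.l_inv[of s] K.inv_closed[of s] K.l_one[of "inv\<^bsub>S\<lparr>carrier := {t \<in> carrier S. lv t = lv e}, one := u\<rparr>\<^esub> s"] s ue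
        by (intro H_I[of _ _ "inv\<^bsub>S\<lparr>carrier := {t \<in> carrier S. lv t = lv e}, one := u\<rparr>\<^esub> s"]) auto
    qed
    then show ?thesis using X[OF i] by simp
  qed
  have lvi: "lv e \<in> {1..n}" if "idem e" for e using lv[of e] that by simp
  have "higman_group (Gp e) \<or> cyclic_5_8_12 (Gp e)" if e: "idem e" for e
    using grp[OF lvi[OF e]] Gp_unit_unique[OF e] unfolding HX[OF e, symmetric] by blast
  moreover have "e = f" if e: "idem e" "cyclic_5_8_12 (Gp e)" and f: "idem f" "cyclic_5_8_12 (Gp f)" for e f
  proof -
    let ?C = "{i \<in> {1..n}. \<exists>G :: 's monoid. cyclic_5_8_12 G \<and> factor_iso_group S (I i) (I (Suc i)) G}"
    have "lv g \<in> ?C" if g: "idem g" "cyclic_5_8_12 (Gp g)" for g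
      using factor_iso_H[OF g(1) ideal HX[OF g(1), symmetric]] lvi[OF g(1)] g(2) by auto
    then have "lv e \<in> ?C" "lv f \<in> ?C" using e f by blast+
    moreover have "finite ?C" by simp
    then have "\<forall>i\<in>?C. \<forall>j\<in>?C. i = j" using card1 card_le_Suc0_iff_eq[of ?C] by simp
    ultimately have "lv e = lv f" by blast
    then have "e \<in> H f" using HX[OF e(1)] HX[OF f(1)] idem_in_H[OF e(1)] by simp
    then show ?thesis using H_disjoint[OF e(1) f(1) idem_in_H[OF e(1)]] by blast
  qed
  ultimately have good unfolding good_def by blast
  then show ?thesis using \<open>clifford_semigroup S\<close> by blast
qed

section \<open>Semigroup algebras\<close>

lemma algebra_simps_record [simp]:
  "carrier (semigroup_algebra S) = {f. \<forall>s. s \<notin> carrier S \<longrightarrow> f s = 0}"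
  "f \<otimes>\<^bsub>semigroup_algebra S\<^esub> g = convolution S f g"
  "\<zero>\<^bsub>semigroup_algebra S\<^esub> = (\<lambda>_. 0)"
  "f \<oplus>\<^bsub>semigroup_algebra S\<^esub> g = (\<lambda>s. f s + g s)"
  "c \<odot>\<^bsub>semigroup_algebra S\<^esub> f = (\<lambda>s. c * f s)"
  by (simp_all add: semigroup_algebra_def Let_def)

definition delta :: "'a \<Rightarrow> 'a \<Rightarrow> 'r::comm_ring_1" where
  "delta s t = (if t = s then 1 else 0)"

lemma sum_swap3:
  "(\<Sum>p\<in>A. \<Sum>u\<in>B. \<Sum>v\<in>C. X p u v) = (\<Sum>u\<in>B. \<Sum>v\<in>C. \<Sum>p\<in>A. X p u v)"
proof -
  have "(\<Sum>p\<in>A. \<Sum>u\<in>B. \<Sum>v\<in>C. X p u v) = (\<Sum>u\<in>B. \<Sum>p\<in>A. \<Sum>v\<in>C. X p u v)" by (rule sum.swap)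
  also have "\<dots> = (\<Sum>u\<in>B. \<Sum>v\<in>C. \<Sum>p\<in>A. X p u v)" by (rule sum.cong[OF refl], rule sum.swap)
  finally show ?thesis .
qed

lemma sum_swap4:
  "(\<Sum>p\<in>A. \<Sum>v\<in>B. \<Sum>t\<in>C. \<Sum>u\<in>E. X p v t u) = (\<Sum>t\<in>C. \<Sum>u\<in>E. \<Sum>v\<in>B. \<Sum>p\<in>A. X p v t u)"
proof -
  have "(\<Sum>p\<in>A. \<Sum>v\<in>B. \<Sum>t\<in>C. \<Sum>u\<in>E. X p v t u) = (\<Sum>v\<in>B. \<Sum>t\<in>C. \<Sum>p\<in>A. \<Sum>u\<in>E. X p v t u)"
    by (rule sum_swap3)
  also have "\<dots> = (\<Sum>t\<in>C. \<Sum>p\<in>A. \<Sum>v\<in>B. \<Sum>u\<in>E. X p v t u)" by (rule sum_swap3)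
  also have "\<dots> = (\<Sum>t\<in>C. \<Sum>u\<in>E. \<Sum>v\<in>B. \<Sum>p\<in>A. X p v t u)"
  proof (rule sum.cong[OF refl])
    fix t
    have "(\<Sum>p\<in>A. \<Sum>v\<in>B. \<Sum>u\<in>E. X p v t u) = (\<Sum>v\<in>B. \<Sum>u\<in>E. \<Sum>p\<in>A. X p v t u)" by (rule sum_swap3)
    also have "\<dots> = (\<Sum>u\<in>E. \<Sum>v\<in>B. \<Sum>p\<in>A. X p v t u)" by (rule sum.swap)
    finally show "(\<Sum>p\<in>A. \<Sum>v\<in>B. \<Sum>u\<in>E. X p v t u) = (\<Sum>u\<in>E. \<Sum>v\<in>B. \<Sum>p\<in>A. X p v t u)" .
  qed
  finally show ?thesis .
qed

context finite_semigroup
begin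

lemma conv_alt:
  "convolution S f g s = (\<Sum>t\<in>carrier S. \<Sum>u\<in>carrier S. if t \<otimes> u = s then f t * g u else 0)"
proof -
  have "convolution S f g s = (\<Sum>p\<in>{p \<in> carrier S \<times> carrier S. fst p \<otimes> snd p = s}. f (fst p) * g (snd p))"
    unfolding convolution_def by (rule sum.cong) auto
  also have "\<dots> = (\<Sum>p\<in>carrier S \<times> carrier S. if fst p \<otimes> snd p = s then f (fst p) * g (snd p) else 0)"
    using finite_carrier by (simp add: sum.inter_filter)
  also have "\<dots> = (\<Sum>t\<in>carrier S. \<Sum>u\<in>carrier S. if t \<otimes> u = s then f t * g u else 0)"
    by (simp add: sum.cartesian_product case_prod_beta)
  finally show ?thesis .
qed

lemma conv_outside: "s \<notin> carrier S \<Longrightarrow> convolution S f g s = 0"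
  unfolding conv_alt using m_closed by (intro sum.neutral ballI) auto

lemma conv_add_left: "convolution S (\<lambda>s. f s + g s) h = (\<lambda>s. convolution S f h s + convolution S g h s)"
  by (rule ext) (auto simp: conv_alt sum.distrib[symmetric] distrib_right intro!: sum.cong)

lemma conv_add_right: "convolution S h (\<lambda>s. f s + g s) = (\<lambda>s. convolution S h f s + convolution S h g s)"
  by (rule ext) (auto simp: conv_alt sum.distrib[symmetric] distrib_left intro!: sum.cong)

lemma conv_scale_left: "convolution S (\<lambda>s. c * f s) h = (\<lambda>s. c * convolution S f h s)"
  by (rule ext) (simp add: conv_alt sum_distrib_left mult.assoc if_distrib cong: if_cong)

lemma conv_scale_right: "convolution S h (\<lambda>s. c * f s) = (\<lambda>s. c * convolution S h f s)"
  by (rule ext) (simp add: conv_alt sum_distrib_left mult.left_commute if_distrib cong: if_cong)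

lemma conv_diff_left: "convolution S (\<lambda>s. f s - g s) h = (\<lambda>s. convolution S f h s - convolution S g h s)"
  using conv_add_left[of f "\<lambda>s. - 1 * g s" h] unfolding conv_scale_left by simp

lemma conv_diff_right: "convolution S h (\<lambda>s. f s - g s) = (\<lambda>s. convolution S h f s - convolution S h g s)"
  using conv_add_right[of h f "\<lambda>s. - 1 * g s"] unfolding conv_scale_right by simp

lemma conv_assoc: "convolution S (convolution S f g) h = convolution S f (convolution S g h)"
proof (rule ext)
  fix s
  let ?C = "carrier S"
  have "convolution S (convolution S f g) h s =
      (\<Sum>p\<in>?C. \<Sum>v\<in>?C. \<Sum>t\<in>?C. \<Sum>u\<in>?C. if t \<otimes> u = p then (if p \<otimes> v = s then f t * g u * h v else 0) else 0)"
    unfolding conv_alt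
  proof (rule sum.cong[OF refl], rule sum.cong[OF refl])
    fix p v
    show "(if p \<otimes> v = s then (\<Sum>t\<in>?C. \<Sum>u\<in>?C. if t \<otimes> u = p then f t * g u else 0) * h v else 0) =
      (\<Sum>t\<in>?C. \<Sum>u\<in>?C. if t \<otimes> u = p then (if p \<otimes> v = s then f t * g u * h v else 0) else 0)"
      by (cases "p \<otimes> v = s") (auto simp: sum_distrib_right intro!: sum.cong sum.neutral)
  qed
  also have "\<dots> = (\<Sum>t\<in>?C. \<Sum>u\<in>?C. \<Sum>v\<in>?C. \<Sum>p\<in>?C. if t \<otimes> u = p then (if p \<otimes> v = s then f t * g u * h v else 0) else 0)"
    by (rule sum_swap4)
  also have "\<dots> = (\<Sum>t\<in>?C. \<Sum>u\<in>?C. \<Sum>v\<in>?C. if t \<otimes> u \<otimes> v = s then f t * g u * h v else 0)"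
    using finite_carrier m_closed by (intro sum.cong refl) (simp add: sum.delta')
  also have "\<dots> = (\<Sum>t\<in>?C. \<Sum>u\<in>?C. \<Sum>v\<in>?C. \<Sum>p\<in>?C. if u \<otimes> v = p then (if t \<otimes> p = s then f t * (g u * h v) else 0) else 0)"
    using finite_carrier m_closed m_assoc by (intro sum.cong refl) (simp add: sum.delta' mult.assoc)
  also have "\<dots> = (\<Sum>t\<in>?C. \<Sum>p\<in>?C. \<Sum>u\<in>?C. \<Sum>v\<in>?C. if u \<otimes> v = p then (if t \<otimes> p = s then f t * (g u * h v) else 0) else 0)"
    by (rule sum.cong[OF refl], rule sum_swap3[symmetric])
  also have "\<dots> = convolution S f (convolution S g h) s"
    unfolding conv_alt
  proof (rule sum.cong[OF refl], rule sum.cong[OF refl])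
    fix t p
    show "(\<Sum>u\<in>?C. \<Sum>v\<in>?C. if u \<otimes> v = p then (if t \<otimes> p = s then f t * (g u * h v) else 0) else 0) =
      (if t \<otimes> p = s then f t * (\<Sum>u\<in>?C. \<Sum>v\<in>?C. if u \<otimes> v = p then g u * h v else 0) else 0)"
      by (cases "t \<otimes> p = s") (auto simp: sum_distrib_left intro!: sum.cong sum.neutral)
  qed
  finally show "convolution S (convolution S f g) h s = convolution S f (convolution S g h) s" .
qed

lemma conv_delta: "\<lbrakk>s \<in> carrier S; t \<in> carrier S\<rbrakk> \<Longrightarrow> convolution S (delta s) (delta t) = delta (s \<otimes> t)"
proof (rule ext)
  fix x assume st: "s \<in> carrier S" "t \<in> carrier S"
  have "convolution S (delta s) (delta t) x =
    (\<Sum>p\<in>carrier S. if p = s then (\<Sum>q\<in>carrier S. if q = t then (if p \<otimes> q = x then 1 else 0) else 0) else 0)"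
    unfolding conv_alt delta_def by (intro sum.cong refl) (auto intro!: sum.cong sum.neutral)
  also have "\<dots> = delta (s \<otimes> t) x" using st finite_carrier by (simp add: delta_def)
  finally show "convolution S (delta s) (delta t) x = delta (s \<otimes> t) x" .
qed

lemma conv_of_int:
  "convolution S (\<lambda>s. of_int (f s)) (\<lambda>s. of_int (g s)) = (\<lambda>s. of_int (convolution S f g s))"
  by (rule ext) (simp add: conv_alt if_distrib cong: if_cong)

lemma delta_carrier [simp]: "s \<in> carrier S \<Longrightarrow> delta s \<in> carrier (semigroup_algebra S)"
  by (auto simp: delta_def)

lemma identity_of_one:
  assumes "has_identity (semigroup_algebra S :: ('r::comm_ring_1, 'a \<Rightarrow> 'r) module)"
  shows "identity_of (carrier (semigroup_algebra S)) (convolution S) (\<one>\<^bsub>semigroup_algebra S :: ('r, 'a \<Rightarrow> 'r) module\<^esub>)"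
proof -
  let ?A = "{f :: 'a \<Rightarrow> 'r. \<forall>s. s \<notin> carrier S \<longrightarrow> f s = 0}"
  have "\<exists>e. identity_of ?A (convolution S) e"
    using assms unfolding has_identity_def by (simp add: semigroup_algebra_def Let_def)
  then obtain e where e: "identity_of ?A (convolution S) e" by blast
  have "e' = e" if "identity_of ?A (convolution S) e'" for e'
    using e that unfolding identity_of_def by (metis (no_types))
  with e have "\<exists>!e. identity_of ?A (convolution S) e" by blast
  then have "identity_of ?A (convolution S) (THE e. identity_of ?A (convolution S) e)" by (rule theI')
  then show ?thesis by (simp add: semigroup_algebra_def Let_def)
qed

lemma ring_algebra:
  assumes id: "has_identity (semigroup_algebra S :: ('r::comm_ring_1, 'a \<Rightarrow> 'r) module)"
  shows "ring (semigroup_algebra S :: ('r, 'a \<Rightarrow> 'r) module)"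
proof -
  let ?A = "semigroup_algebra S :: ('r, 'a \<Rightarrow> 'r) module"
  have one: "\<one>\<^bsub>?A\<^esub> \<in> carrier ?A" "\<And>x. x \<in> carrier ?A \<Longrightarrow> convolution S \<one>\<^bsub>?A\<^esub> x = x \<and> convolution S x \<one>\<^bsub>?A\<^esub> = x"
    using identity_of_one[OF id] unfolding identity_of_def by auto
  show ?thesis
  proof (rule ringI)
    show "abelian_group ?A"
    proof (rule abelian_groupI)
      show "\<exists>y\<in>carrier ?A. y \<oplus>\<^bsub>?A\<^esub> x = \<zero>\<^bsub>?A\<^esub>" if "x \<in> carrier ?A" for x
        using that by (intro bexI[of _ "\<lambda>s. - x s"]) auto
    qed (auto simp: add_ac)
    show "monoid ?A"
      by (rule monoidI) (use one conv_outside in \<open>auto simp: conv_assoc\<close>)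
  qed (auto simp: conv_add_left conv_add_right)
qed

lemma common_denominator:
  fixes x :: "'a \<Rightarrow> rat"
  assumes "x \<in> carrier (semigroup_algebra S)"
  obtains N f where "N > (0::int)" "f \<in> carrier (semigroup_algebra S)" "\<And>s. of_int N * x s = of_int (f s)"
proof -
  have "\<exists>N>0::int. \<forall>s\<in>T. \<exists>k::int. of_int N * x s = of_int k" if "finite T" for T
    using that
  proof (induction T rule: finite_induct)
    case empty
    show ?case by (intro exI[of _ 1]) simp
  next
    case (insert a T)
    then obtain N where N: "N > 0" "\<forall>s\<in>T. \<exists>k::int. of_int N * x s = of_int k" by blast
    obtain p q where pq: "quotient_of (x a) = (p, q)" by fastforce
    have q: "q > 0" "x a = of_int p / of_int q" using quotient_of_denom_pos[OF pq] quotient_of_div[OF pq] by auto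
    have "\<exists>k::int. of_int (N * q) * x s = of_int k" if s: "s \<in> insert a T" for s
    proof (cases "s = a")
      case True
      then show ?thesis using q by (intro exI[of _ "N * p"]) simp
    next
      case False
      then obtain k :: int where "of_int N * x s = of_int k" using N s by blast
      then have "of_int (N * q) * x s = of_int (k * q)" by (metis mult.assoc mult.commute of_int_mult)
      then show ?thesis by blast
    qed
    then show ?case using N q by (intro exI[of _ "N * q"]) auto
  qed
  then obtain N where N: "N > 0" "\<forall>s\<in>carrier S. \<exists>k::int. of_int N * x s = of_int k" using finite_carrier by blast
  then obtain f where f: "\<And>s. s \<in> carrier S \<Longrightarrow> of_int N * x s = of_int (f s :: int)" by metis
  show thesis
  proof (rule that[OF N(1), of "\<lambda>s. if s \<in> carrier S then f s else 0"])
    show "of_int N * x s = of_int (if s \<in> carrier S then f s else 0)" for s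
      using f assms by auto
  qed simp
qed

end

section \<open>Integral coefficients and orders\<close>

locale integral_algebra = finite_semigroup +
  assumes has_id: "has_identity (semigroup_algebra S :: (int, 'a \<Rightarrow> int) module)"
begin

abbreviation M :: "(int, 'a \<Rightarrow> int) module" where "M \<equiv> semigroup_algebra S"
abbreviation A :: "(rat, 'a \<Rightarrow> rat) module" where "A \<equiv> semigroup_algebra S"

definition emb :: "('a \<Rightarrow> int) \<Rightarrow> 'a \<Rightarrow> rat" where "emb f = (\<lambda>s. of_int (f s))"

sublocale M: ring M by (rule ring_algebra[OF has_id])

lemma one_M: "\<one>\<^bsub>M\<^esub> \<in> carrier M" "\<And>x. x \<in> carrier M \<Longrightarrow> convolution S \<one>\<^bsub>M\<^esub> x = x \<and> convolution S x \<one>\<^bsub>M\<^esub> = x"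
  using identity_of_one[OF has_id] unfolding identity_of_def by auto

lemma emb_mult: "convolution S (emb f) (emb g) = emb (convolution S f g)"
  unfolding emb_def by (rule conv_of_int)

lemma emb_inj: "emb f = emb g \<longleftrightarrow> f = g"
  by (auto simp: emb_def fun_eq_iff)

lemma emb_closed: "f \<in> carrier M \<Longrightarrow> emb f \<in> carrier A"
  by (simp add: emb_def)

text \<open>The identity is given for integral coefficients only. Each rational element has an
  integral multiple, so it is an identity for these too.\<close>

lemma emb_one_identity: "identity_of (carrier A) (convolution S) (emb \<one>\<^bsub>M\<^esub>)"
  unfolding identity_of_def
proof (intro conjI ballI)
  show "emb \<one>\<^bsub>M\<^esub> \<in> carrier A" by (rule emb_closed[OF one_M(1)])
  fix x assume x: "x \<in> carrier A"
  obtain N f where N: "N > 0" "f \<in> carrier M" "\<And>s. of_int N * x s = of_int (f s)"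
    using common_denominator[OF x] by blast
  have Nx: "(\<lambda>s. of_int N * x s) = emb f" using N by (simp add: emb_def)
  have "(\<lambda>s. of_int N * convolution S (emb \<one>\<^bsub>M\<^esub>) x s) = (\<lambda>s. of_int N * x s)"
    unfolding conv_scale_right[symmetric] Nx emb_mult using one_M N by simp
  then have "of_int N * convolution S (emb \<one>\<^bsub>M\<^esub>) x s = of_int N * x s" for s by (rule fun_cong)
  then show "convolution S (emb \<one>\<^bsub>M\<^esub>) x = x" using N(1) by (intro ext) simp
  have "(\<lambda>s. of_int N * convolution S x (emb \<one>\<^bsub>M\<^esub>) s) = (\<lambda>s. of_int N * x s)"
    unfolding conv_scale_left[symmetric] Nx emb_mult using one_M N by simp
  then have "of_int N * convolution S x (emb \<one>\<^bsub>M\<^esub>) s = of_int N * x s" for s by (rule fun_cong)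
  then show "convolution S x (emb \<one>\<^bsub>M\<^esub>) = x" using N(1) by (intro ext) simp
qed

lemma has_id_A: "has_identity A"
  unfolding has_identity_def using emb_one_identity by (auto simp: identity_of_def)

sublocale A: ring A by (rule ring_algebra[OF has_id_A])

lemma one_A: "\<one>\<^bsub>A\<^esub> = emb \<one>\<^bsub>M\<^esub>"
  using identity_of_one[OF has_id_A] emb_one_identity unfolding identity_of_def by metis

lemma emb_pow: "emb f [^]\<^bsub>A\<^esub> (k::nat) = emb (f [^]\<^bsub>M\<^esub> k)"
  by (induction k) (simp_all add: one_A emb_mult)

lemma minus_A: "x \<in> carrier A \<Longrightarrow> \<ominus>\<^bsub>A\<^esub> x = (\<lambda>s. - x s)"
  by (rule A.minus_equality) auto

text \<open>A nonzero nilpotent element has a nonzero power of square 0, and a multiple of that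
  power is integral.\<close>

lemma no_nilpotents_iff:
  "no_nonzero_nilpotents A \<longleftrightarrow> (\<forall>f\<in>carrier M. convolution S f f = (\<lambda>_. 0) \<longrightarrow> f = (\<lambda>_. 0))"
proof
  assume nn: "no_nonzero_nilpotents A"
  show "\<forall>f\<in>carrier M. convolution S f f = (\<lambda>_. 0) \<longrightarrow> f = (\<lambda>_. 0)"
  proof (intro ballI impI)
    fix f assume f: "f \<in> carrier M" "convolution S f f = (\<lambda>_. 0)"
    have "emb f [^]\<^bsub>A\<^esub> (2::nat) = \<zero>\<^bsub>A\<^esub>"
      using f emb_closed[OF f(1)] A.l_one[OF emb_closed[OF f(1)]] by (simp add: numeral_2_eq_2 emb_mult) (simp add: emb_def)
    then have "emb f = \<zero>\<^bsub>A\<^esub>" using nn emb_closed[OF f(1)] unfolding no_nonzero_nilpotents_def by (metis pos2)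
    then show "f = (\<lambda>_. 0)" by (simp add: emb_def fun_eq_iff)
  qed
next
  assume red: "\<forall>f\<in>carrier M. convolution S f f = (\<lambda>_. 0) \<longrightarrow> f = (\<lambda>_. 0)"
  have sq: "x = \<zero>\<^bsub>A\<^esub>" if x: "x \<in> carrier A" "x \<otimes>\<^bsub>A\<^esub> x = \<zero>\<^bsub>A\<^esub>" for x
  proof -
    obtain N f where N: "N > 0" "f \<in> carrier M" "\<And>s. of_int N * x s = of_int (f s)"
      using common_denominator[OF x(1)] by blast
    have Nx: "emb f = (\<lambda>s. of_int N * x s)" using N by (simp add: emb_def)
    have "emb (convolution S f f) = (\<lambda>s. of_int N * (of_int N * convolution S x x s))"
      unfolding emb_mult[symmetric] Nx conv_scale_left conv_scale_right ..
    then have "convolution S f f = (\<lambda>_. 0)" using x(2) by (simp add: emb_def fun_eq_iff)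
    then have "f = (\<lambda>_. 0)" using red N by blast
    then show ?thesis using N by (simp add: fun_eq_iff)
  qed
  show "no_nonzero_nilpotents A"
    unfolding no_nonzero_nilpotents_def
  proof (intro ballI impI)
    fix x assume x: "x \<in> carrier A" and "\<exists>k::nat. k > 0 \<and> x [^]\<^bsub>A\<^esub> k = \<zero>\<^bsub>A\<^esub>"
    then obtain k :: nat where k: "k > 0" "x [^]\<^bsub>A\<^esub> k = \<zero>\<^bsub>A\<^esub>" by blast
    have "x [^]\<^bsub>A\<^esub> k = \<zero>\<^bsub>A\<^esub> \<Longrightarrow> k > 0 \<Longrightarrow> x = \<zero>\<^bsub>A\<^esub>"
    proof (induction k rule: less_induct)
      case (less k)
      show ?case
      proof (cases "k = 1")
        case True
        then show ?thesis using less.prems(1) A.nat_pow_one A.l_one[OF x] by (simp add: A.nat_pow_Suc)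
      next
        case False
        \<comment> \<open>Half of \<open>k\<close>, rounded up: the power with exponent
          \<open>j + j\<close> is still 0, and \<open>j < k\<close> as soon as
          \<open>k > 1\<close>.\<close>
        define j where "j = (k + 1) div 2"
        have j: "j < k" "j > 0" "k \<le> j + j" using less.prems(2) False by (simp_all add: j_def)
        have "x [^]\<^bsub>A\<^esub> (j + j) = x [^]\<^bsub>A\<^esub> k \<otimes>\<^bsub>A\<^esub> x [^]\<^bsub>A\<^esub> (j + j - k)"
          using A.nat_pow_mult[OF x, of k "j + j - k"] j by simp
        also have "\<dots> = \<zero>\<^bsub>A\<^esub>" unfolding less.prems(1) by (rule A.l_null[OF A.nat_pow_closed[OF x]])
        finally have "x [^]\<^bsub>A\<^esub> j \<otimes>\<^bsub>A\<^esub> x [^]\<^bsub>A\<^esub> j = \<zero>\<^bsub>A\<^esub>" unfolding A.nat_pow_mult[OF x] .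
        then have "x [^]\<^bsub>A\<^esub> j = \<zero>\<^bsub>A\<^esub>" by (rule sq[OF A.nat_pow_closed[OF x]])
        then show ?thesis using less.IH[OF j(1)] j(2) by blast
      qed
    qed
    then show "x = \<zero>\<^bsub>A\<^esub>" using k by blast
  qed
qed

subsection \<open>Orders\<close>

definition ZS :: "('a \<Rightarrow> rat) set" where "ZS = emb ` carrier M"

lemma delta_sum:
  fixes f :: "'a \<Rightarrow> 'r::comm_ring_1"
  assumes "f \<in> carrier (semigroup_algebra S)"
  shows "f = (\<lambda>x. \<Sum>s\<in>carrier S. f s * delta s x)"
proof (rule ext)
  fix x
  have "(\<Sum>s\<in>carrier S. f s * delta s x) = (\<Sum>s\<in>carrier S. if s = x then f s else 0)"
    by (rule sum.cong) (auto simp: delta_def)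
  also have "\<dots> = f x" using assms finite_carrier by auto
  finally show "f x = (\<Sum>s\<in>carrier S. f s * delta s x)" by simp
qed

lemma subgroup_sum:
  assumes H: "subgroup H (add_monoid A)" and f: "\<And>s. s \<in> T \<Longrightarrow> f s \<in> H" "finite T"
  shows "(\<lambda>x. \<Sum>s\<in>T. f s x) \<in> H"
  using f(2,1)
proof (induction T rule: finite_induct)
  case empty
  then show ?case using subgroup.one_closed[OF H] by simp
next
  case (insert a T)
  then show ?case using subgroup.m_closed[OF H, of "f a" "\<lambda>x. \<Sum>s\<in>T. f s x"] by simp
qed

lemma subgroup_neg:
  assumes H: "subgroup H (add_monoid A)" and f: "f \<in> H"
  shows "(\<lambda>x. - f x) \<in> H"
proof -
  have "f \<in> carrier A" using subgroup.subset[OF H] f by auto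
  then have "\<ominus>\<^bsub>A\<^esub> f = (\<lambda>x. - f x)" by (rule minus_A)
  then show ?thesis using subgroup.m_inv_closed[OF H f] by (simp add: a_inv_def)
qed

lemma subgroup_int_mult:
  assumes H: "subgroup H (add_monoid A)" and f: "f \<in> H"
  shows "(\<lambda>x. of_int k * f x) \<in> H"
proof -
  have nat: "(\<lambda>x. of_nat n * f x) \<in> H" for n
  proof (induction n)
    case 0
    then show ?case using subgroup.one_closed[OF H] by simp
  next
    case (Suc n)
    then show ?case using subgroup.m_closed[OF H f Suc] by (simp add: distrib_right)
  qed
  show ?thesis
  proof (cases k rule: int_cases2)
    case (nonneg n)
    then show ?thesis using nat[of n] by simp
  next
    case (nonpos n)
    then show ?thesis using subgroup_neg[OF H nat[of n]] by simp
  qed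
qed

lemma emb_delta_sum:
  assumes "f \<in> carrier M"
  shows "emb f = (\<lambda>x. \<Sum>s\<in>carrier S. of_int (f s) * emb (delta s) x)"
proof (rule ext)
  fix x
  have "emb f x = of_int (\<Sum>s\<in>carrier S. f s * delta s x)"
    using fun_cong[OF delta_sum[OF assms], of x] by (simp add: emb_def)
  then show "emb f x = (\<Sum>s\<in>carrier S. of_int (f s) * emb (delta s) x)" by (simp add: emb_def)
qed

lemma Z_order_ZS: "Z_order A ZS"
  unfolding Z_order_def
proof (intro conjI)
  have sub: "ZS \<subseteq> carrier A" using emb_closed by (auto simp: ZS_def)
  show "subring ZS A"
  proof (rule A.subringI)
    show "ZS \<subseteq> carrier A" by (rule sub)
    show "\<one>\<^bsub>A\<^esub> \<in> ZS" using one_M(1) by (auto simp: ZS_def one_A)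
    fix x y assume "x \<in> ZS" "y \<in> ZS"
    then obtain f g where fg: "f \<in> carrier M" "g \<in> carrier M" "x = emb f" "y = emb g" by (auto simp: ZS_def)
    have "\<ominus>\<^bsub>A\<^esub> x = emb (\<lambda>s. - f s)" using fg minus_A[OF emb_closed[OF fg(1)]] by (simp add: emb_def)
    then show "\<ominus>\<^bsub>A\<^esub> x \<in> ZS" using fg by (auto simp: ZS_def)
    have "x \<oplus>\<^bsub>A\<^esub> y = emb (\<lambda>s. f s + g s)" using fg by (simp add: emb_def)
    then show "x \<oplus>\<^bsub>A\<^esub> y \<in> ZS" using fg by (auto simp: ZS_def)
    have "x \<otimes>\<^bsub>A\<^esub> y = emb (convolution S f g)" using fg by (simp add: emb_mult)
    then show "x \<otimes>\<^bsub>A\<^esub> y \<in> ZS" using conv_outside by (auto simp: ZS_def)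
  qed
  define B where "B = (\<lambda>s. emb (delta s)) ` carrier S"
  have B: "B \<subseteq> ZS" unfolding B_def ZS_def using delta_carrier by blast
  have gB: "subgroup (generate (add_monoid A) B) (add_monoid A)"
    by (rule group.generate_is_subgroup[OF A.a_group]) (use B sub in auto)
  have "ZS \<subseteq> generate (add_monoid A) B"
  proof
    fix x assume "x \<in> ZS"
    then obtain f where f: "f \<in> carrier M" "x = emb f" by (auto simp: ZS_def)
    show "x \<in> generate (add_monoid A) B"
      unfolding f(2) emb_delta_sum[OF f(1)]
      by (intro subgroup_sum[OF gB] subgroup_int_mult[OF gB] finite_carrier) (auto intro: generate.incl simp: B_def)
  qed
  moreover have "subgroup ZS (add_monoid A)"
    using subring.axioms(1)[OF \<open>subring ZS A\<close>] .
  then have "generate (add_monoid A) B \<subseteq> ZS" by (rule group.generate_subgroup_incl[OF A.a_group B])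
  ultimately have "generate (add_monoid A) B = ZS" by blast
  moreover have "finite B" using finite_carrier by (simp add: B_def)
  ultimately show "\<exists>B. finite B \<and> B \<subseteq> ZS \<and> generate (add_monoid A) B = ZS" using B by blast
  show "generate (add_monoid A) {q \<odot>\<^bsub>A\<^esub> x | q x. x \<in> ZS} = carrier A"
  proof
    let ?Q = "{q \<odot>\<^bsub>A\<^esub> x | q x. x \<in> ZS}"
    have Q: "?Q \<subseteq> carrier A" using sub by auto
    show "generate (add_monoid A) ?Q \<subseteq> carrier A" using group.generate_incl[OF A.a_group, of ?Q] Q by simp
    have gQ: "subgroup (generate (add_monoid A) ?Q) (add_monoid A)"
      by (rule group.generate_is_subgroup[OF A.a_group]) (use Q in simp)
    show "carrier A \<subseteq> generate (add_monoid A) ?Q"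
    proof
      fix x assume x: "x \<in> carrier A"
      have "(\<lambda>t. x s * delta s t) \<in> ?Q" if "s \<in> carrier S" for s
      proof -
        have "emb (delta s) \<in> ZS" using delta_carrier[OF that] unfolding ZS_def by (rule imageI)
        moreover have "(\<lambda>t. x s * delta s t) = x s \<odot>\<^bsub>A\<^esub> emb (delta s)" by (simp add: emb_def delta_def fun_eq_iff)
        ultimately show ?thesis by blast
      qed
      then have "(\<lambda>t. \<Sum>s\<in>carrier S. x s * delta s t) \<in> generate (add_monoid A) ?Q"
        by (intro subgroup_sum[OF gQ] finite_carrier generate.incl)
      then show "x \<in> generate (add_monoid A) ?Q" using delta_sum[OF x] by simp
    qed
  qed
qed

text \<open>An order spans the algebra over the rationals, so it contains a positive multiple of
  each of the finitely many \<open>delta s\<close>.\<close>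

lemma order_contains_multiple:
  assumes ord: "Z_order A \<Gamma>"
  obtains m where "m > (0::int)" "\<And>f. f \<in> carrier M \<Longrightarrow> (\<lambda>s. of_int m * emb f s) \<in> \<Gamma>"
proof -
  have G: "subgroup \<Gamma> (add_monoid A)" using ord subring.axioms(1) unfolding Z_order_def by blast
  have gen: "generate (add_monoid A) {q \<odot>\<^bsub>A\<^esub> x | q x. x \<in> \<Gamma>} = carrier A" using ord by (simp add: Z_order_def)
  have ex: "\<exists>m>0::int. (\<lambda>s. of_int m * x s) \<in> \<Gamma>" if x: "x \<in> generate (add_monoid A) {q \<odot>\<^bsub>A\<^esub> x | q x. x \<in> \<Gamma>}" for x
    using x
  proof induction
    case one
    then show ?case using subgroup.one_closed[OF G] by (intro exI[of _ 1]) simp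
  next
    case (incl h)
    then obtain q y where h: "h = (\<lambda>s. q * y s)" "y \<in> \<Gamma>" by auto
    obtain a b where ab: "quotient_of q = (a, b)" by fastforce
    have b: "b > 0" "of_int b * q = of_int a"
      using quotient_of_denom_pos[OF ab] quotient_of_div[OF ab] by auto
    have "(\<lambda>s. of_int b * h s) = (\<lambda>s. of_int a * y s)" unfolding h using b by (simp add: mult.assoc[symmetric])
    then show ?case using b subgroup_int_mult[OF G h(2), of a] by (intro exI[of _ b]) simp
  next
    case (inv h)
    then obtain q y where h: "h = (\<lambda>s. q * y s)" "y \<in> \<Gamma>" by auto
    obtain a b where ab: "quotient_of q = (a, b)" by fastforce
    have b: "b > 0" "of_int b * q = of_int a"
      using quotient_of_denom_pos[OF ab] quotient_of_div[OF ab] by auto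
    have hA: "h \<in> carrier A" using h subgroup.subset[OF G] by auto
    have "inv\<^bsub>add_monoid A\<^esub> h = (\<lambda>s. - h s)" using minus_A[OF hA] by (simp add: a_inv_def)
    moreover have "(\<lambda>s. of_int b * - h s) = (\<lambda>s. of_int (- a) * y s)"
      unfolding h using b by (simp add: mult.assoc[symmetric])
    ultimately show ?case using b subgroup_int_mult[OF G h(2), of "- a"] by (intro exI[of _ b]) simp
  next
    case (eng h1 h2)
    then obtain m1 m2 where m: "m1 > 0" "(\<lambda>s. of_int m1 * h1 s) \<in> \<Gamma>" "m2 > 0" "(\<lambda>s. of_int m2 * h2 s) \<in> \<Gamma>" by blast
    have "(\<lambda>s. of_int m2 * (of_int m1 * h1 s) + of_int m1 * (of_int m2 * h2 s)) \<in> \<Gamma>"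
      using subgroup.m_closed[OF G subgroup_int_mult[OF G m(2), of m2] subgroup_int_mult[OF G m(4), of m1]] by simp
    then have "(\<lambda>s. of_int (m1 * m2) * (h1 \<otimes>\<^bsub>add_monoid A\<^esub> h2) s) \<in> \<Gamma>" by (simp add: algebra_simps)
    then show ?case using m by (intro exI[of _ "m1 * m2"]) auto
  qed
  have exd: "\<exists>m>0::int. (\<lambda>t. of_int m * emb (delta s) t) \<in> \<Gamma>" if "s \<in> carrier S" for s
    using ex[of "emb (delta s)"] emb_closed[OF delta_carrier[OF that]] unfolding gen by blast
  have "\<exists>m>0::int. \<forall>s\<in>T. (\<lambda>t. of_int m * emb (delta s) t) \<in> \<Gamma>" if "finite T" "T \<subseteq> carrier S" for T
    using that
  proof (induction T rule: finite_induct)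
    case empty
    show ?case by (intro exI[of _ 1]) simp
  next
    case (insert a T)
    then obtain m where m: "m > 0" "\<forall>s\<in>T. (\<lambda>t. of_int m * emb (delta s) t) \<in> \<Gamma>" by auto
    obtain k where k: "k > 0" "(\<lambda>t. of_int k * emb (delta a) t) \<in> \<Gamma>" using exd[of a] insert by auto
    have "(\<lambda>t. of_int (m * k) * emb (delta s) t) \<in> \<Gamma>" if s: "s \<in> insert a T" for s
    proof (cases "s = a")
      case True
      then show ?thesis using subgroup_int_mult[OF G k(2), of m] by (simp add: mult.assoc)
    next
      case False
      then have "(\<lambda>t. of_int m * emb (delta s) t) \<in> \<Gamma>" using m s by blast
      from subgroup_int_mult[OF G this, of k] show ?thesis by (simp add: mult_ac)
    qed
    then show ?case using m k by (intro exI[of _ "m * k"]) auto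
  qed
  from this[OF finite_carrier order_refl]
  obtain m where m: "m > 0" "\<forall>s\<in>carrier S. (\<lambda>t. of_int m * emb (delta s) t) \<in> \<Gamma>" by blast
  have "(\<lambda>s. of_int m * emb f s) \<in> \<Gamma>" if f: "f \<in> carrier M" for f
  proof -
    have "(\<lambda>x. \<Sum>s\<in>carrier S. of_int (f s) * (of_int m * emb (delta s) x)) \<in> \<Gamma>"
      by (rule subgroup_sum[OF G _ finite_carrier], rule subgroup_int_mult[OF G]) (use m(2) in blast)
    then show ?thesis unfolding emb_delta_sum[OF f] by (simp add: sum_distrib_left mult_ac)
  qed
  then show thesis using that m(1) by blast
qed

text \<open>There are finitely many coefficient vectors modulo \<open>m\<close>, so two powers of
  the unit agree modulo \<open>m\<close>; the smaller one is cancelled.\<close>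

lemma power_congruent_1:
  assumes u: "u \<in> carrier M" "u' \<in> carrier M" "convolution S u u' = \<one>\<^bsub>M\<^esub>" "convolution S u' u = \<one>\<^bsub>M\<^esub>" and m: "m > (0::int)"
  shows "\<exists>k>0::nat. \<exists>y\<in>carrier M. u [^]\<^bsub>M\<^esub> k = (\<lambda>s. \<one>\<^bsub>M\<^esub> s + m * y s)"
proof -
  define r where "r n = (\<lambda>s. (u [^]\<^bsub>M\<^esub> (n::nat)) s mod m)" for n
  have pc: "u [^]\<^bsub>M\<^esub> n \<in> carrier M" "u' [^]\<^bsub>M\<^esub> n \<in> carrier M" for n :: nat
    using M.nat_pow_closed[OF u(1)] M.nat_pow_closed[OF u(2)] by blast+
  have "r n \<in> {f. \<forall>x. (x \<in> carrier S \<longrightarrow> f x \<in> {0..<m}) \<and> (x \<notin> carrier S \<longrightarrow> f x = 0)}" for n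
    using pc(1)[of n] m by (auto simp: r_def)
  then have "range r \<subseteq> {f. \<forall>x. (x \<in> carrier S \<longrightarrow> f x \<in> {0..<m}) \<and> (x \<notin> carrier S \<longrightarrow> f x = 0)}" by blast
  then have "finite (range r)"
    by (rule finite_subset) (rule finite_set_of_finite_funs[OF finite_carrier], simp)
  then have "\<not> inj r" using finite_imageD infinite_UNIV_nat by blast
  then obtain a b where ab: "a < b" "r a = r b" by (metis injI linorder_neqE_nat)
  define k where "k = b - a"
  define z where "z s = ((u [^]\<^bsub>M\<^esub> b) s - (u [^]\<^bsub>M\<^esub> a) s) div m" for s
  have "m dvd (u [^]\<^bsub>M\<^esub> b) s - (u [^]\<^bsub>M\<^esub> a) s" for s
    using ab(2) unfolding r_def fun_eq_iff by (metis mod_eq_dvd_iff)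
  then have z: "u [^]\<^bsub>M\<^esub> b = (\<lambda>s. (u [^]\<^bsub>M\<^esub> a) s + m * z s)" by (auto simp: z_def)
  have zM: "z \<in> carrier M" using pc(1)[of a] pc(1)[of b] by (auto simp: z_def)
  have inv: "convolution S (u' [^]\<^bsub>M\<^esub> n) (u [^]\<^bsub>M\<^esub> n) = \<one>\<^bsub>M\<^esub>" for n :: nat
  proof (induction n)
    case 0
    then show ?case using one_M by simp
  next
    case (Suc n)
    have "u' [^]\<^bsub>M\<^esub> Suc n = convolution S (u' [^]\<^bsub>M\<^esub> n) u'" by simp
    moreover have "u [^]\<^bsub>M\<^esub> Suc n = convolution S u (u [^]\<^bsub>M\<^esub> n)"
      using M.nat_pow_Suc2[OF u(1), of n] by simp
    ultimately have "convolution S (u' [^]\<^bsub>M\<^esub> Suc n) (u [^]\<^bsub>M\<^esub> Suc n) =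
      convolution S (u' [^]\<^bsub>M\<^esub> n) (convolution S (convolution S u' u) (u [^]\<^bsub>M\<^esub> n))"
      by (simp only: conv_assoc)
    then show ?case unfolding u(4) using Suc one_M(2)[OF pc(1)] by simp
  qed
  have "u [^]\<^bsub>M\<^esub> b = convolution S (u [^]\<^bsub>M\<^esub> a) (u [^]\<^bsub>M\<^esub> k)"
    using M.nat_pow_mult[OF u(1), of a k] ab by (simp add: k_def)
  then have "u [^]\<^bsub>M\<^esub> k = convolution S (u' [^]\<^bsub>M\<^esub> a) (u [^]\<^bsub>M\<^esub> b)"
    using one_M(2)[OF pc(1)[of k]] by (simp add: conv_assoc[symmetric] inv)
  also have "\<dots> = (\<lambda>s. \<one>\<^bsub>M\<^esub> s + m * convolution S (u' [^]\<^bsub>M\<^esub> a) z s)"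
    unfolding z conv_add_right conv_scale_right inv ..
  finally show ?thesis using ab conv_outside
    by (intro exI[of _ k] conjI bexI[of _ "convolution S (u' [^]\<^bsub>M\<^esub> a) z"]) (auto simp: k_def)
qed

lemma M_inverse_power:
  assumes u: "u \<in> carrier M" "u' \<in> carrier M" "convolution S u u' = \<one>\<^bsub>M\<^esub>" "convolution S u' u = \<one>\<^bsub>M\<^esub>"
  shows "convolution S (u [^]\<^bsub>M\<^esub> (n::nat)) (u' [^]\<^bsub>M\<^esub> n) = \<one>\<^bsub>M\<^esub>"
proof -
  have eq: "convolution S u u' = convolution S u' u" using u by simp
  have "(u \<otimes>\<^bsub>M\<^esub> u') [^]\<^bsub>M\<^esub> n = u [^]\<^bsub>M\<^esub> n \<otimes>\<^bsub>M\<^esub> u' [^]\<^bsub>M\<^esub> n"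
    by (rule M.pow_mult_distrib) (use u eq in simp_all)
  moreover have "(u \<otimes>\<^bsub>M\<^esub> u') [^]\<^bsub>M\<^esub> n = \<one>\<^bsub>M\<^esub>" using u M.nat_pow_one by simp
  ultimately show ?thesis by simp
qed

text \<open>The order contains 1 and \<open>m\<close> times every integral element, hence everything
  congruent to 1 modulo \<open>m\<close>. The inverse of a unit congruent to 1 is again of this
  form.\<close>

lemma power_in_order:
  assumes ord: "Z_order A \<Gamma>" and m: "m > (0::int)" "\<forall>f\<in>carrier M. (\<lambda>s. of_int m * emb f s) \<in> \<Gamma>"
    and u: "u \<in> carrier M" "u' \<in> carrier M" "convolution S u u' = \<one>\<^bsub>M\<^esub>" "convolution S u' u = \<one>\<^bsub>M\<^esub>"
  shows "\<exists>k>0::nat. emb (u [^]\<^bsub>M\<^esub> k) \<in> \<Gamma> \<and> emb (u' [^]\<^bsub>M\<^esub> k) \<in> \<Gamma>"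
proof -
  have sr: "subring \<Gamma> A" using ord unfolding Z_order_def by blast
  have G: "subgroup \<Gamma> (add_monoid A)" by (rule subring.axioms(1)[OF sr])
  have one: "emb \<one>\<^bsub>M\<^esub> \<in> \<Gamma>" using subringE(3)[OF sr] by (simp add: one_A)
  from power_congruent_1[OF u m(1)] obtain k :: nat and y
    where k: "k > 0" "y \<in> carrier M" "u [^]\<^bsub>M\<^esub> k = (\<lambda>s. \<one>\<^bsub>M\<^esub> s + m * y s)" by (elim exE bexE conjE)
  have shift: "emb (\<lambda>s. \<one>\<^bsub>M\<^esub> s + m * z s) \<in> \<Gamma>" if z: "z \<in> carrier M" for z
  proof -
    have "emb (\<lambda>s. \<one>\<^bsub>M\<^esub> s + m * z s) = emb \<one>\<^bsub>M\<^esub> \<oplus>\<^bsub>A\<^esub> (\<lambda>s. of_int m * emb z s)" by (simp add: emb_def)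
    also have "\<dots> \<in> \<Gamma>" using subgroup.m_closed[OF G one m(2)[rule_format, OF z]] by simp
    finally show ?thesis .
  qed
  \<comment> \<open>The two powers multiply to 1; solving for the inverse leaves 1 minus
    \<open>m\<close> times this convolution.\<close>
  define z where "z = (\<lambda>s. - 1 * convolution S y (u' [^]\<^bsub>M\<^esub> k) s)"
  have zM: "z \<in> carrier M" by (simp add: z_def conv_outside)
  have pc: "u' [^]\<^bsub>M\<^esub> k \<in> carrier M" by (rule M.nat_pow_closed[OF u(2)])
  have "\<one>\<^bsub>M\<^esub> = convolution S (u [^]\<^bsub>M\<^esub> k) (u' [^]\<^bsub>M\<^esub> k)" using M_inverse_power[OF u] by simp
  also have "\<dots> = (\<lambda>s. (u' [^]\<^bsub>M\<^esub> k) s + m * convolution S y (u' [^]\<^bsub>M\<^esub> k) s)"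
    unfolding k(3) conv_add_left conv_scale_left using one_M(2)[OF pc] by simp
  finally have "u' [^]\<^bsub>M\<^esub> k = (\<lambda>s. \<one>\<^bsub>M\<^esub> s + m * z s)" by (auto simp: z_def fun_eq_iff)
  then show ?thesis using k shift[OF k(2)] shift[OF zM] by (intro exI[of _ k]) simp
qed

text \<open>The hyperbolic property speaks of one unknown order, the conclusion of the integral
  semigroup ring. Powers of the units lie in that order, and without a relation they would embed the
  free abelian group of rank 2.\<close>

theorem hyperbolic_units_dep:
  assumes hyp: "hyperbolic_property A"
    and u: "u \<in> carrier M" "u' \<in> carrier M" "convolution S u u' = \<one>\<^bsub>M\<^esub>" "convolution S u' u = \<one>\<^bsub>M\<^esub>"
    and v: "v \<in> carrier M" "v' \<in> carrier M" "convolution S v v' = \<one>\<^bsub>M\<^esub>" "convolution S v' v = \<one>\<^bsub>M\<^esub>"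
    and uv: "convolution S u v = convolution S v u"
  shows "\<exists>(a::nat) (b::nat). (a, b) \<noteq> (0, 0) \<and>
    (convolution S (u [^]\<^bsub>M\<^esub> a) (v [^]\<^bsub>M\<^esub> b) = \<one>\<^bsub>M\<^esub> \<or> u [^]\<^bsub>M\<^esub> a = v [^]\<^bsub>M\<^esub> b)"
proof (rule ccontr)
  assume indep: "\<not> ?thesis"
  obtain \<Gamma> where ord: "Z_order A \<Gamma>" and none: "mon (integer_group \<times>\<times> integer_group) (units_of (A\<lparr>carrier := \<Gamma>\<rparr>)) = {}"
    using hyp unfolding hyperbolic_property_def by blast
  have sr: "subring \<Gamma> A" using ord unfolding Z_order_def by blast
  obtain m where m: "m > (0::int)" "\<forall>f\<in>carrier M. (\<lambda>s. of_int m * emb f s) \<in> \<Gamma>"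
    by (rule order_contains_multiple[OF ord]) blast
  obtain k :: nat where k: "k > 0" "emb (u [^]\<^bsub>M\<^esub> k) \<in> \<Gamma>" "emb (u' [^]\<^bsub>M\<^esub> k) \<in> \<Gamma>"
    using power_in_order[OF ord m u] by blast
  obtain l :: nat where l: "l > 0" "emb (v [^]\<^bsub>M\<^esub> l) \<in> \<Gamma>" "emb (v' [^]\<^bsub>M\<^esub> l) \<in> \<Gamma>"
    using power_in_order[OF ord m v] by blast
  define B where "B = A\<lparr>carrier := \<Gamma>\<rparr>"
  interpret B: ring B unfolding B_def by (rule A.subring_is_ring[OF sr])
  have mB: "x \<otimes>\<^bsub>B\<^esub> y = convolution S x y" "\<one>\<^bsub>B\<^esub> = emb \<one>\<^bsub>M\<^esub>" for x y by (simp_all add: B_def one_A)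
  have powB: "x [^]\<^bsub>B\<^esub> (n::nat) = x [^]\<^bsub>A\<^esub> n" for x n by (simp add: nat_pow_def B_def)
  define p where "p = emb (u [^]\<^bsub>M\<^esub> k)"
  define q where "q = emb (v [^]\<^bsub>M\<^esub> l)"
  have pU: "p \<in> Units B"
    unfolding Units_def using k M_inverse_power[OF u] M_inverse_power[OF u(2,1,4,3)]
    by (auto simp: mB p_def emb_mult B_def one_A intro!: bexI[of _ "emb (u' [^]\<^bsub>M\<^esub> k)"])
  have qU: "q \<in> Units B"
    unfolding Units_def using l M_inverse_power[OF v] M_inverse_power[OF v(2,1,4,3)]
    by (auto simp: mB q_def emb_mult B_def one_A intro!: bexI[of _ "emb (v' [^]\<^bsub>M\<^esub> l)"])
  interpret U: group "units_of B" by (rule B.units_group)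
  have pc: "p \<in> carrier (units_of B)" "q \<in> carrier (units_of B)" using pU qU by (simp_all add: units_of_def)
  have mU: "x \<otimes>\<^bsub>units_of B\<^esub> y = convolution S x y" "\<one>\<^bsub>units_of B\<^esub> = emb \<one>\<^bsub>M\<^esub>" for x y
    by (simp_all add: units_of_def mB)
  have powU: "x [^]\<^bsub>units_of B\<^esub> (n::nat) = x [^]\<^bsub>A\<^esub> n" for x n
    by (simp add: nat_pow_def units_of_def B_def)
  have pa: "p [^]\<^bsub>units_of B\<^esub> (a::nat) = emb (u [^]\<^bsub>M\<^esub> (k * a))" "q [^]\<^bsub>units_of B\<^esub> (a::nat) = emb (v [^]\<^bsub>M\<^esub> (l * a))" for a
    by (simp_all add: powU p_def q_def emb_pow M.nat_pow_pow[OF u(1)] M.nat_pow_pow[OF v(1)])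
  have uvk: "convolution S (u [^]\<^bsub>M\<^esub> (i::nat)) (v [^]\<^bsub>M\<^esub> (j::nat)) = convolution S (v [^]\<^bsub>M\<^esub> j) (u [^]\<^bsub>M\<^esub> i)" for i j
  proof -
    have "v \<otimes>\<^bsub>M\<^esub> u [^]\<^bsub>M\<^esub> i = u [^]\<^bsub>M\<^esub> i \<otimes>\<^bsub>M\<^esub> v" for i :: nat
      using M.group_commutes_pow[of u v i] u v uv by simp
    then show ?thesis using M.group_commutes_pow[of v "u [^]\<^bsub>M\<^esub> i" j] M.nat_pow_closed[OF u(1), of i] v by simp
  qed
  have pq: "p \<otimes>\<^bsub>units_of B\<^esub> q = q \<otimes>\<^bsub>units_of B\<^esub> p" using uvk by (simp add: mU p_def q_def emb_mult)
  \<comment> \<open>The four sign patterns of integral exponents are reduced to the two forms with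
    natural exponents.\<close>
  have triv: "i = 0 \<and> j = 0"
    if e: "p [^]\<^bsub>units_of B\<^esub> (i::int) \<otimes>\<^bsub>units_of B\<^esub> q [^]\<^bsub>units_of B\<^esub> (j::int) = \<one>\<^bsub>units_of B\<^esub>" for i j
  proof -
    have no: "a = 0 \<and> b = 0" if "p [^]\<^bsub>units_of B\<^esub> (a::nat) \<otimes>\<^bsub>units_of B\<^esub> q [^]\<^bsub>units_of B\<^esub> (b::nat) = \<one>\<^bsub>units_of B\<^esub>
      \<or> p [^]\<^bsub>units_of B\<^esub> a = q [^]\<^bsub>units_of B\<^esub> b" for a b
    proof -
      have d: "convolution S (u [^]\<^bsub>M\<^esub> (k * a)) (v [^]\<^bsub>M\<^esub> (l * b)) = \<one>\<^bsub>M\<^esub> \<or> u [^]\<^bsub>M\<^esub> (k * a) = v [^]\<^bsub>M\<^esub> (l * b)"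
        using that by (simp add: pa mU emb_mult emb_inj)
      have "(k * a, l * b) = (0, 0)"
      proof (rule ccontr)
        assume "(k * a, l * b) \<noteq> (0, 0)"
        with d indep show False by blast
      qed
      then show ?thesis using k l by simp
    qed
    note pcl = U.int_pow_closed[OF pc(1)] U.int_pow_closed[OF pc(2)]
    have pqi: "p [^]\<^bsub>units_of B\<^esub> i = inv\<^bsub>units_of B\<^esub> (q [^]\<^bsub>units_of B\<^esub> j)" using e pcl by (simp add: U.inv_equality)
    have pq2: "p [^]\<^bsub>units_of B\<^esub> i = q [^]\<^bsub>units_of B\<^esub> (- j)" using pqi pc by (simp add: U.int_pow_neg)
    have pq3: "p [^]\<^bsub>units_of B\<^esub> (- i) = q [^]\<^bsub>units_of B\<^esub> j" using pqi pc by (simp add: U.int_pow_neg)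
    have pq4: "p [^]\<^bsub>units_of B\<^esub> (- i) \<otimes>\<^bsub>units_of B\<^esub> q [^]\<^bsub>units_of B\<^esub> (- j) = \<one>\<^bsub>units_of B\<^esub>"
      using pq3 pc by (simp add: U.int_pow_neg)
    consider a b :: nat where "i = int a" "j = int b" | a b :: nat where "i = int a" "j = - int b"
      | a b :: nat where "i = - int a" "j = int b" | a b :: nat where "i = - int a" "j = - int b"
      by (cases i rule: int_cases2; cases j rule: int_cases2) auto
    then show ?thesis
    proof cases
      case 1
      then show ?thesis using no[of a b] e by (simp add: int_pow_int)
    next
      case 2
      then show ?thesis using no[of a b] pq2 by (simp add: int_pow_int)
    next
      case 3
      then show ?thesis using no[of a b] pq3 by (simp add: int_pow_int)
    next
      case 4
      then show ?thesis using no[of a b] pq4 by (simp add: int_pow_int)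
    qed
  qed
  define h where "h = (\<lambda>(i::int, j::int). p [^]\<^bsub>units_of B\<^esub> i \<otimes>\<^bsub>units_of B\<^esub> q [^]\<^bsub>units_of B\<^esub> j)"
  have comm_int: "q [^]\<^bsub>units_of B\<^esub> (j::int) \<otimes>\<^bsub>units_of B\<^esub> p [^]\<^bsub>units_of B\<^esub> (i::int) = p [^]\<^bsub>units_of B\<^esub> i \<otimes>\<^bsub>units_of B\<^esub> q [^]\<^bsub>units_of B\<^esub> j" for i j
  proof -
    have nat: "x [^]\<^bsub>units_of B\<^esub> (j::int) \<otimes>\<^bsub>units_of B\<^esub> y = y \<otimes>\<^bsub>units_of B\<^esub> x [^]\<^bsub>units_of B\<^esub> j"
      if xy: "x \<otimes>\<^bsub>units_of B\<^esub> y = y \<otimes>\<^bsub>units_of B\<^esub> x" "x \<in> carrier (units_of B)" "y \<in> carrier (units_of B)" for x y j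
    proof (cases j rule: int_cases2)
      case (nonneg n)
      then show ?thesis using U.centralize_pow[OF xy, of n] by (simp add: int_pow_int)
    next
      case (nonpos n)
      then show ?thesis using U.centralize_inv[OF U.centralize_pow[OF xy, of n]] xy
        by (simp add: U.int_pow_neg int_pow_int)
    qed
    have 1: "p [^]\<^bsub>units_of B\<^esub> i \<otimes>\<^bsub>units_of B\<^esub> q = q \<otimes>\<^bsub>units_of B\<^esub> p [^]\<^bsub>units_of B\<^esub> i"
      by (rule nat[OF pq pc])
    show ?thesis by (rule nat[OF 1[symmetric] pc(2) U.int_pow_closed[OF pc(1)]])
  qed
  have "h \<in> hom (integer_group \<times>\<times> integer_group) (units_of B)"
  proof (rule homI)
    fix x y :: "int \<times> int"
    obtain i j i' j' where xy: "x = (i, j)" "y = (i', j')" by (cases x, cases y)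
    note cl = U.int_pow_closed[OF pc(1)] U.int_pow_closed[OF pc(2)]
    have "h (i + i', j + j') = p [^]\<^bsub>units_of B\<^esub> i \<otimes>\<^bsub>units_of B\<^esub> (p [^]\<^bsub>units_of B\<^esub> i' \<otimes>\<^bsub>units_of B\<^esub> q [^]\<^bsub>units_of B\<^esub> j) \<otimes>\<^bsub>units_of B\<^esub> q [^]\<^bsub>units_of B\<^esub> j'"
      using pc cl by (simp add: h_def U.int_pow_mult U.m_assoc)
    also have "\<dots> = p [^]\<^bsub>units_of B\<^esub> i \<otimes>\<^bsub>units_of B\<^esub> (q [^]\<^bsub>units_of B\<^esub> j \<otimes>\<^bsub>units_of B\<^esub> p [^]\<^bsub>units_of B\<^esub> i') \<otimes>\<^bsub>units_of B\<^esub> q [^]\<^bsub>units_of B\<^esub> j'"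
      by (simp only: comm_int)
    also have "\<dots> = h (i, j) \<otimes>\<^bsub>units_of B\<^esub> h (i', j')" using cl by (simp add: h_def U.m_assoc)
    finally show "h (x \<otimes>\<^bsub>integer_group \<times>\<times> integer_group\<^esub> y) = h x \<otimes>\<^bsub>units_of B\<^esub> h y"
      by (simp add: xy)
  qed (use pc in \<open>auto simp: h_def\<close>)
  moreover have "inj_on h (carrier (integer_group \<times>\<times> integer_group))"
  proof (rule inj_onI)
    fix x y :: "int \<times> int" assume eq: "h x = h y"
    obtain i j i' j' where xy: "x = (i, j)" "y = (i', j')" by (cases x, cases y)
    note cl = U.int_pow_closed[OF pc(1)] U.int_pow_closed[OF pc(2)]
    have "p [^]\<^bsub>units_of B\<^esub> (- i') \<otimes>\<^bsub>units_of B\<^esub> h (i, j) \<otimes>\<^bsub>units_of B\<^esub> q [^]\<^bsub>units_of B\<^esub> (- j') =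
      p [^]\<^bsub>units_of B\<^esub> (- i') \<otimes>\<^bsub>units_of B\<^esub> h (i', j') \<otimes>\<^bsub>units_of B\<^esub> q [^]\<^bsub>units_of B\<^esub> (- j')" using eq xy by simp
    moreover have "p [^]\<^bsub>units_of B\<^esub> (- i') \<otimes>\<^bsub>units_of B\<^esub> h (i, j) \<otimes>\<^bsub>units_of B\<^esub> q [^]\<^bsub>units_of B\<^esub> (- j') =
      p [^]\<^bsub>units_of B\<^esub> (- i' + i) \<otimes>\<^bsub>units_of B\<^esub> q [^]\<^bsub>units_of B\<^esub> (j + - j')" for i j
      using cl pc by (simp only: h_def case_prod_conv U.int_pow_mult U.m_assoc U.m_closed)
    ultimately have "p [^]\<^bsub>units_of B\<^esub> (- i' + i) \<otimes>\<^bsub>units_of B\<^esub> q [^]\<^bsub>units_of B\<^esub> (j + - j') = \<one>\<^bsub>units_of B\<^esub>" by simp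
    then show "x = y" using triv xy by fastforce
  qed
  ultimately have "h \<in> mon (integer_group \<times>\<times> integer_group) (units_of B)" by (simp add: mon_def)
  then show False using none unfolding B_def by blast
qed

end

section \<open>Representations of a semilattice of groups\<close>

context finite_semigroup
begin

definition lin :: "('a \<Rightarrow> 'r::ring_1) \<Rightarrow> ('a \<Rightarrow> int) \<Rightarrow> 'r" where
  "lin F f = (\<Sum>s\<in>carrier S. of_int (f s) * F s)"

lemma lin_add: "lin F (\<lambda>s. f s + g s) = lin F f + lin F g"
  by (simp add: lin_def sum.distrib distrib_right)

lemma lin_diff: "lin F (\<lambda>s. f s - g s) = lin F f - lin F g"
  by (simp add: lin_def sum_subtractf left_diff_distrib)

lemma lin_delta: 
  assumes "s \<in> carrier S"
  shows "lin F (delta s) = F s"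
proof -
  have "lin F (delta s) = (\<Sum>t\<in>carrier S. if t = s then F t else 0)"
    unfolding lin_def delta_def by (rule sum.cong) auto
  then show ?thesis using assms finite_carrier by simp
qed

lemma lin_mult:
  assumes F: "\<And>s t. \<lbrakk>s \<in> carrier S; t \<in> carrier S\<rbrakk> \<Longrightarrow> F (s \<otimes> t) = F s * F t"
  shows "lin F (convolution S f g) = lin F f * lin F g"
proof -
  let ?C = "carrier S"
  have "lin F (convolution S f g) =
      (\<Sum>s\<in>?C. \<Sum>t\<in>?C. \<Sum>u\<in>?C. if t \<otimes> u = s then of_int (f t * g u) * F s else 0)"
    unfolding lin_def conv_alt of_int_sum sum_distrib_right by (intro sum.cong refl) simp
  also have "\<dots> = (\<Sum>t\<in>?C. \<Sum>u\<in>?C. \<Sum>s\<in>?C. if t \<otimes> u = s then of_int (f t * g u) * F s else 0)"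
    by (rule sum_swap3)
  also have "\<dots> = (\<Sum>t\<in>?C. \<Sum>u\<in>?C. of_int (f t * g u) * F (t \<otimes> u))"
    using finite_carrier m_closed by (intro sum.cong refl) (simp add: sum.delta')
  also have "\<dots> = (\<Sum>t\<in>?C. \<Sum>u\<in>?C. (of_int (f t) * F t) * (of_int (g u) * F u))"
  proof (intro sum.cong refl)
    fix t u assume "t \<in> ?C" "u \<in> ?C"
    have "of_int (f t * g u) * (F t * F u) = of_int (f t) * (of_int (g u) * F t) * F u" by (simp add: mult.assoc)
    also have "\<dots> = of_int (f t) * (F t * of_int (g u)) * F u" by (simp only: mult_of_int_commute)
    finally show "of_int (f t * g u) * F (t \<otimes> u) = (of_int (f t) * F t) * (of_int (g u) * F u)"
      using F[OF \<open>t \<in> ?C\<close> \<open>u \<in> ?C\<close>] by (simp add: mult.assoc)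
  qed
  finally show ?thesis by (simp add: lin_def sum_product)
qed

end

locale clifford_algebra = clifford_semigroup S + integral_algebra S for S (structure)
begin

abbreviation D :: "'a \<Rightarrow> 'a \<Rightarrow> 'a int_endo" where
  "D e \<equiv> left_endo (Gp e)"

abbreviation ZGp :: "'a \<Rightarrow> 'a int_endo set" where
  "ZGp e \<equiv> int_group_ring.ZG (Gp e) (D e)"

abbreviation cfp :: "'a \<Rightarrow> 'a int_endo \<Rightarrow> 'a \<Rightarrow> int" where
  "cfp e \<equiv> int_group_ring.cf (Gp e) (D e)"

text \<open>If \<open>e\<close> is not below the unit of \<open>s\<close>, then
  \<open>s \<otimes> e\<close> lies outside \<open>H e\<close>; the value 0 keeps the map
  multiplicative.\<close>

definition F :: "'a \<Rightarrow> 'a \<Rightarrow> 'a int_endo" where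
  "F e s = (if ue s \<otimes> e = e then D e (s \<otimes> e) else 0)"

definition phi :: "'a \<Rightarrow> ('a \<Rightarrow> int) \<Rightarrow> 'a int_endo" where
  "phi e = lin (F e)"

lemma GR: "idem e \<Longrightarrow> int_group_ring (Gp e) (D e)"
  using left_endo_group_ring[OF Gp_group] finite_H by simp

lemma F_mult:
  assumes e: "idem e" and s: "s \<in> carrier S" and t: "t \<in> carrier S"
  shows "F e (s \<otimes> t) = F e s * F e t"
proof -
  interpret E: int_group_ring "Gp e" "D e" by (rule GR[OF e])
  have u: "idem (ue s)" "idem (ue t)" using ue s t by auto
  note c = idem_closed[OF u(1)] idem_closed[OF u(2)] idem_closed[OF e]
  \<comment> \<open>\<open>e\<close> lies below a product of idempotents exactly if it lies below
    both factors.\<close>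
  have iff: "ue (s \<otimes> t) \<otimes> e = e \<longleftrightarrow> ue s \<otimes> e = e \<and> ue t \<otimes> e = e"
  proof
    assume "ue (s \<otimes> t) \<otimes> e = e"
    then have ste: "ue s \<otimes> (ue t \<otimes> e) = e" using ue_mult[OF s t] c by (simp add: m_assoc)
    have "ue s \<otimes> e = (ue s \<otimes> ue s) \<otimes> (ue t \<otimes> e)" 
      using arg_cong[OF ste, of "\<lambda>x. ue s \<otimes> x"] c m_assoc[OF c(1) c(1) m_closed[OF c(2,3)]] by simp
    then have 1: "ue s \<otimes> e = e" using u(1) ste by simp
    have tse: "ue t \<otimes> (ue s \<otimes> e) = e" 
      using ste central[OF u(1) c(2)] c by (simp add: m_assoc[symmetric])
    then show "ue s \<otimes> e = e \<and> ue t \<otimes> e = e" using 1 by simp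
  next
    assume "ue s \<otimes> e = e \<and> ue t \<otimes> e = e"
    then show "ue (s \<otimes> t) \<otimes> e = e" using ue_mult[OF s t] c by (simp add: m_assoc)
  qed
  show ?thesis
  proof (cases "ue s \<otimes> e = e \<and> ue t \<otimes> e = e")
    case True
    then have H: "s \<otimes> e \<in> H e" "t \<otimes> e \<in> H e" using mult_idem_in_H_iff[OF e] s t by auto
    have "(s \<otimes> e) \<otimes> (t \<otimes> e) = s \<otimes> (e \<otimes> (t \<otimes> e))" using s t c by (simp add: m_assoc m_closed)
    also have "\<dots> = s \<otimes> (t \<otimes> e)" using H_unit[OF e H(2)] by simp
    also have "\<dots> = s \<otimes> t \<otimes> e" using s t c by (simp add: m_assoc)
    finally have "D e (s \<otimes> t \<otimes> e) = D e (s \<otimes> e) * D e (t \<otimes> e)"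
      using E.D_mult[of "s \<otimes> e" "t \<otimes> e"] H by simp
    then show ?thesis using True iff by (simp add: F_def)
  qed (use iff in \<open>auto simp: F_def\<close>)
qed

lemma phi_mult: "idem e \<Longrightarrow> phi e (convolution S f g) = phi e f * phi e g"
  unfolding phi_def by (rule lin_mult) (rule F_mult)

lemma phi_delta: "\<lbrakk>idem e; idem g\<rbrakk> \<Longrightarrow> phi g (delta e) = (if e \<otimes> g = g then 1 else 0)"
proof -
  assume e: "idem e" and g: "idem g"
  interpret E: int_group_ring "Gp g" "D g" by (rule GR[OF g])
  have "ue e = e" by (rule ue_eq[OF e idem_in_H[OF e]])
  then show ?thesis using E.D_one e by (simp add: phi_def lin_delta F_def)
qed

lemma phi_zero [simp]: "phi e (\<lambda>_. 0) = 0"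
  by (simp add: phi_def lin_def)

lemma F_in_ZG: "\<lbrakk>idem e; s \<in> carrier S\<rbrakk> \<Longrightarrow> F e s \<in> ZGp e"
  using int_group_ring.zero_in_ZG[OF GR] int_group_ring.D_in_ZG[OF GR] mult_idem_in_H_iff
  by (auto simp: F_def)

lemma phi_in_ZG: "idem e \<Longrightarrow> phi e f \<in> ZGp e"
  unfolding phi_def lin_def
  by (rule int_group_ring.sum_in_ZG[OF GR], assumption)
    (rule int_group_ring.of_int_mult_in_ZG[OF GR], assumption, rule F_in_ZG)

lemma phi_eq_lift:
  assumes e: "idem e" and f: "\<And>t. \<lbrakk>t \<in> carrier S; t \<notin> H e\<rbrakk> \<Longrightarrow> f t = 0 \<or> F e t = 0"
  shows "phi e f = int_group_ring.lift (Gp e) (D e) f"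
proof -
  interpret E: int_group_ring "Gp e" "D e" by (rule GR[OF e])
  have "of_int (f t) * F e t = 0" if "t \<in> carrier S - H e" for t using f[of t] that by auto
  then have "phi e f = (\<Sum>t\<in>H e. of_int (f t) * F e t)"
    unfolding phi_def lin_def using H_sub by (intro sum.mono_neutral_right finite_carrier) auto
  also have "\<dots> = (\<Sum>t\<in>H e. of_int (f t) * D e t)"
    using e ue_eq H_unit[OF e] by (intro sum.cong refl) (simp add: F_def)
  finally show ?thesis by (simp add: E.lift_def)
qed

lemma cfp_closed: "idem e \<Longrightarrow> cfp e w \<in> carrier M"
  using int_group_ring.cf_outside[OF GR, of e _ w] H_sub by fastforce

lemma phi_cfp: 
  assumes "idem e" "w \<in> ZGp e"
  shows "phi e (cfp e w) = w"
  using phi_eq_lift[OF assms(1), of "cfp e w"] int_group_ring.cf_outside[OF GR[OF assms(1)], of _ w]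
    int_group_ring.lift_cf[OF GR[OF assms(1)] assms(2)] by simp

lemma phi_diff: "phi e (\<lambda>s. f s - g s) = phi e f - phi e g"
  by (simp add: phi_def lin_diff)

lemma phi_add: "phi e (\<lambda>s. f s + g s) = phi e f + phi e g"
  by (simp add: phi_def lin_add)

text \<open>At an element of the support whose group lies highest, no other component contributes.\<close>

lemma phi_jointly_injective:
  assumes x: "x \<in> carrier M" and 0: "\<And>e. idem e \<Longrightarrow> phi e x = 0"
  shows "x = (\<lambda>_. 0)"
proof (rule ccontr)
  assume "x \<noteq> (\<lambda>_. 0)"
  then obtain s0 where s0: "x s0 \<noteq> 0" by auto
  define T where "T = {s \<in> carrier S. x s \<noteq> 0}"
  have T: "finite T" "T \<noteq> {}" using finite_carrier s0 x by (auto simp: T_def)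
  have "Max ((\<lambda>s. rank (ue s)) ` T) \<in> (\<lambda>s. rank (ue s)) ` T" using T by (intro Max_in) auto
  then obtain s where s: "s \<in> T" "rank (ue s) = Max ((\<lambda>s. rank (ue s)) ` T)" by force
  have mx: "rank (ue t) \<le> rank (ue s)" if "t \<in> T" for t using that T s(2) by simp
  have sC: "s \<in> carrier S" using s by (simp add: T_def)
  define e where "e = ue s"
  have e: "idem e" "s \<in> H e" using ue[OF sC] by (auto simp: e_def)
  interpret E: int_group_ring "Gp e" "D e" by (rule GR[OF e(1)])
  have "x t = 0 \<or> F e t = 0" if t: "t \<in> carrier S" "t \<notin> H e" for t
  proof (rule ccontr)
    assume "\<not> ?thesis"
    then have "t \<in> T" "ue t \<otimes> e = e" using t by (auto simp: T_def F_def split: if_splits)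
    moreover have "e \<noteq> ue t" using t ue[OF t(1)] by auto
    ultimately show False using rank_less[OF e(1), of "ue t"] ue[OF t(1)] mx[of t] by (simp add: e_def)
  qed
  then have "E.lift x = 0" using phi_eq_lift[OF e(1), of x] 0[OF e(1)] by simp
  then have "x s = 0" using E.D_indep[of x s] e(2) unfolding E.lift_def by simp
  then show False using s by (simp add: T_def)
qed

lemma phi_eqI:
  assumes "x \<in> carrier M" "y \<in> carrier M" "\<And>e. idem e \<Longrightarrow> phi e x = phi e y"
  shows "x = y"
proof -
  have "(\<lambda>s. x s - y s) = (\<lambda>_. 0)"
    by (rule phi_jointly_injective) (use assms in \<open>auto simp: phi_diff\<close>)
  then show ?thesis by (simp add: fun_eq_iff)
qed

lemma phi_one [simp]:
  assumes e: "idem e"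
  shows "phi e \<one>\<^bsub>M\<^esub> = 1"
proof -
  have d: "phi e (delta e) = 1" using phi_delta[OF e e] e by simp
  have "convolution S \<one>\<^bsub>M\<^esub> (delta e) = delta e"
    by (rule one_M(2)[OF delta_carrier[OF idem_closed[OF e]], THEN conjunct1])
  then show ?thesis using phi_mult[OF e, of "\<one>\<^bsub>M\<^esub>" "delta e"] d by simp
qed

lemma phi_pow: "idem e \<Longrightarrow> phi e (x [^]\<^bsub>M\<^esub> (k::nat)) = phi e x ^ k"
  by (induction k) (simp_all add: phi_mult power_commutes)

lemma conv_closed: "convolution S f g \<in> carrier M"
  by (simp add: conv_outside)

lemma phi_unit_pair:
  assumes "idem e" "convolution S u u' = \<one>\<^bsub>M\<^esub>" "convolution S u' u = \<one>\<^bsub>M\<^esub>"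
  shows "int_group_ring.unit_pair (Gp e) (D e) (phi e u) (phi e u')"
  using phi_mult[OF assms(1), of u u'] phi_mult[OF assms(1), of u' u] assms phi_in_ZG[OF assms(1)]
  by (simp add: int_group_ring.unit_pair_def[OF GR[OF assms(1)]])

lemma good_conj:
  assumes good and e: "idem e"
  shows "higman_conj (Gp e) (D e)"
proof -
  interpret E: int_group_ring "Gp e" "D e" by (rule GR[OF e])
  have "higman_group (Gp e) \<or> cyclic_5_8_12 (Gp e)" using assms by (simp add: good_def)
  then show ?thesis
  proof
    assume h: "higman_group (Gp e)"
    show ?thesis by unfold_locales (rule higman_group_properties(3)[OF h])
  next
    assume h: "cyclic_5_8_12 (Gp e)"
    show ?thesis by unfold_locales (rule disjI1, rule cyclic_5_8_12_conj[OF h])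
  qed
qed

lemma good_imp_reduced:
  assumes good
  shows "no_nonzero_nilpotents A"
  unfolding no_nilpotents_iff
proof (intro ballI impI)
  fix f assume f: "f \<in> carrier M" "convolution S f f = (\<lambda>_. 0)"
  show "f = (\<lambda>_. 0)"
  proof (rule phi_jointly_injective[OF f(1)])
    fix e assume e: "idem e"
    have "phi e f * phi e f = 0" using phi_mult[OF e, of f f] f(2) by simp
    then show "phi e f = 0" by (rule higman_conj.ZG_reduced[OF good_conj[OF assms e] phi_in_ZG[OF e]])
  qed
qed

text \<open>Units are torsion in all components but at most one. A relation in the exceptional
  component is raised to a power \<open>K\<close> that removes the torsion of all others at
  once.\<close>

lemma good_units_dep:
  assumes good
    and u: "u \<in> carrier M" "convolution S u u' = \<one>\<^bsub>M\<^esub>" "convolution S u' u = \<one>\<^bsub>M\<^esub>"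
    and v: "v \<in> carrier M" "convolution S v v' = \<one>\<^bsub>M\<^esub>" "convolution S v' v = \<one>\<^bsub>M\<^esub>"
  shows "\<exists>(a::nat) (b::nat). (a, b) \<noteq> (0, 0) \<and>
    (convolution S (u [^]\<^bsub>M\<^esub> a) (v [^]\<^bsub>M\<^esub> b) = \<one>\<^bsub>M\<^esub> \<or> u [^]\<^bsub>M\<^esub> a = v [^]\<^bsub>M\<^esub> b)"
proof -
  define K where "K = (\<Prod>e\<in>{e. idem e}. 2 * card (H e))"
  have finE: "finite {e. idem e}" using finite_carrier by (rule rev_finite_subset) auto
  have K: "K \<noteq> 0" unfolding K_def using finE finite_H idem_in_H by (auto simp: card_eq_0_iff)
  have tors: "phi e w ^ (i * K) = 1"
    if e: "idem e" "\<not> cyclic_5_8_12 (Gp e)" and w: "convolution S w w' = \<one>\<^bsub>M\<^esub>" "convolution S w' w = \<one>\<^bsub>M\<^esub>" for e w w' i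
  proof -
    have h: "higman_group (Gp e)" using e \<open>good\<close> unfolding good_def by blast
    interpret E: higman_conj "Gp e" "D e" by (rule good_conj[OF \<open>good\<close> e(1)])
    have cH: "carrier (Gp e) = H e" by simp
    have pw: "phi e w ^ (2 * card (H e)) = 1"
      using E.higman_unit_torsion[OF higman_group_properties(4)[OF h]] phi_unit_pair[OF e(1) w]
      unfolding E.unit_pair_def cH by blast
    have "e \<in> {e. idem e}" using e(1) by (rule CollectI)
    from dvd_prodI[OF finE this, of "\<lambda>e. 2 * card (H e)"] have "2 * card (H e) dvd K" unfolding K_def .
    then obtain c where "K = 2 * card (H e) * c" by (rule dvdE)
    then have iK: "i * K = 2 * card (H e) * (c * i)" by (simp only: mult_ac)
    show ?thesis unfolding iK power_mult[of _ "2 * card (H e)" "c * i"] pw power_one ..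
  qed
  obtain a b :: nat where ab: "(a, b) \<noteq> (0, 0)"
    "(\<forall>e. idem e \<longrightarrow> cyclic_5_8_12 (Gp e) \<longrightarrow> phi e u ^ a * phi e v ^ b = 1) \<or>
     (\<forall>e. idem e \<longrightarrow> cyclic_5_8_12 (Gp e) \<longrightarrow> phi e u ^ a = phi e v ^ b)"
  proof (cases "\<exists>e. idem e \<and> cyclic_5_8_12 (Gp e)")
    case True
    then obtain e where e: "idem e" "cyclic_5_8_12 (Gp e)" by blast
    interpret E: int_group_ring "Gp e" "D e" by (rule GR[OF e(1)])
    obtain x where x: "x \<in> carrier (Gp e)" "E.ord x \<in> {5, 8, 12}" "carrier (Gp e) = range (\<lambda>k::nat. x [^]\<^bsub>Gp e\<^esub> k)"
      using e(2) unfolding cyclic_5_8_12_iff by blast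
    have "mult_dep (phi e u) (phi e v)"
      by (rule E.units_dep_5_8_12[OF x(1,3,2) phi_unit_pair[OF e(1) u(2,3)] phi_unit_pair[OF e(1) v(2,3)]])
    moreover have "f = e" if "idem f" "cyclic_5_8_12 (Gp f)" for f
      using that e \<open>good\<close> unfolding good_def by blast
    ultimately show ?thesis using that unfolding mult_dep_def by metis
  next
    case False
    then show ?thesis using that[of 1 0] by auto
  qed
  from ab(2) show ?thesis
  proof
    assume *: "\<forall>e. idem e \<longrightarrow> cyclic_5_8_12 (Gp e) \<longrightarrow> phi e u ^ a * phi e v ^ b = 1"
    have "convolution S (u [^]\<^bsub>M\<^esub> (a * K)) (v [^]\<^bsub>M\<^esub> (b * K)) = \<one>\<^bsub>M\<^esub>"
    proof (rule phi_eqI[OF conv_closed one_M(1)])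
      fix e assume e: "idem e"
      interpret E: int_group_ring "Gp e" "D e" by (rule GR[OF e])
      have "phi e u ^ (a * K) * phi e v ^ (b * K) = 1"
      proof (cases "cyclic_5_8_12 (Gp e)")
        case True
        then show ?thesis using left_right_inverse_power[of "phi e u ^ a" "phi e v ^ b" K] * e by (simp add: power_mult)
      qed (use tors[OF e _ u(2,3)] tors[OF e _ v(2,3)] in simp)
      then show "phi e (convolution S (u [^]\<^bsub>M\<^esub> (a * K)) (v [^]\<^bsub>M\<^esub> (b * K))) = phi e \<one>\<^bsub>M\<^esub>"
        using e by (simp add: phi_mult phi_pow)
    qed
    then show ?thesis using ab(1) K by (intro exI[of _ "a * K"] exI[of _ "b * K"]) auto
  next
    assume *: "\<forall>e. idem e \<longrightarrow> cyclic_5_8_12 (Gp e) \<longrightarrow> phi e u ^ a = phi e v ^ b"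
    have "u [^]\<^bsub>M\<^esub> (a * K) = v [^]\<^bsub>M\<^esub> (b * K)"
    proof (rule phi_eqI[OF M.nat_pow_closed[OF u(1)] M.nat_pow_closed[OF v(1)]])
      fix e assume e: "idem e"
      have "phi e u ^ (a * K) = phi e v ^ (b * K)"
        by (cases "cyclic_5_8_12 (Gp e)") (use * e tors[OF e _ u(2,3)] tors[OF e _ v(2,3)] in \<open>simp_all add: power_mult\<close>)
      then show "phi e (u [^]\<^bsub>M\<^esub> (a * K)) = phi e (v [^]\<^bsub>M\<^esub> (b * K))" using e by (simp add: phi_pow)
    qed
    then show ?thesis using ab(1) K by (intro exI[of _ "a * K"] exI[of _ "b * K"]) auto
  qed
qed

text \<open>
  If \<open>\<kappa>\<close> is mapped to 0 or 1 in every component, then \<open>psi e \<kappa>\<close> lets \<open>w\<close> act on the components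
  selected by \<open>\<kappa>\<close> and leaves the others fixed.
\<close>

definition psi :: "'a \<Rightarrow> ('a \<Rightarrow> int) \<Rightarrow> 'a int_endo \<Rightarrow> 'a \<Rightarrow> int" where
  "psi e \<kappa> w = (\<lambda>s. convolution S (cfp e w) \<kappa> s + (\<one>\<^bsub>M\<^esub> s - \<kappa> s))"

lemma psi_closed: "\<kappa> \<in> carrier M \<Longrightarrow> psi e \<kappa> w \<in> carrier M"
  using one_M(1) by (simp add: psi_def conv_outside)

lemma phi_psi:
  assumes "idem g" "phi g \<kappa> = 0 \<or> phi g \<kappa> = 1"
  shows "phi g (psi e \<kappa> w) = (if phi g \<kappa> = 1 then phi g (cfp e w) else 1)"
  using assms by (auto simp: psi_def phi_add phi_diff phi_mult)

text \<open>Extension by 0 embeds the group ring at \<open>e\<close> in the semigroup ring, since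
  products of elements of \<open>H e\<close> stay in \<open>H e\<close>.\<close>

lemma conv_cfp:
  assumes e: "idem e" and w: "w \<in> ZGp e" "w' \<in> ZGp e"
  shows "convolution S (cfp e w) (cfp e w') = cfp e (w * w')"
proof -
  interpret E: int_group_ring "Gp e" "D e" by (rule GR[OF e])
  have out: "cfp e w s = 0" if "s \<notin> H e" for w s using E.cf_outside[of s w] that by simp
  have outc: "convolution S (cfp e w) (cfp e w') s = 0" if s: "s \<notin> H e" for s
  proof -
    have "(if t \<otimes> u = s then cfp e w t * cfp e w' u else 0) = 0" for t u
    proof (cases "t \<in> H e \<and> u \<in> H e")
      case True
      then have "t \<otimes> u \<in> H e" using H_mult[OF e e, of t u] e by simp
      then show ?thesis using s by auto
    qed (use out in auto)
    then show ?thesis unfolding conv_alt by (simp only: sum.neutral_const)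
  qed
  have ww: "w * w' \<in> ZGp e" using w by simp
  have "E.lift (convolution S (cfp e w) (cfp e w')) = phi e (convolution S (cfp e w) (cfp e w'))"
    by (rule phi_eq_lift[OF e, symmetric]) (use outc in blast)
  also have "\<dots> = w * w'" using phi_mult[OF e] phi_cfp[OF e] w by simp
  also have "\<dots> = E.lift (cfp e (w * w'))" by (rule E.lift_cf[OF ww, symmetric])
  finally have "\<forall>s\<in>H e. convolution S (cfp e w) (cfp e w') s = cfp e (w * w') s"
    using E.lift_eq_iff by simp
  then show ?thesis using out outc by (intro ext) metis
qed

lemma phi_cfp_one:
  assumes e: "idem e" and g: "idem g"
  shows "phi g (cfp e 1) = (if e \<otimes> g = g then 1 else 0)"
proof -
  have "cfp e 1 = delta e" using int_group_ring.cf_one[OF GR[OF e]] by (auto simp: delta_def)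
  then show ?thesis using phi_delta[OF e g] by simp
qed

text \<open>A component selected by \<kappa> lies below \<open>e\<close>, so the unit of the group
  ring at \<open>e\<close> is mapped to 1 there. At the other components both factors are 1.\<close>

lemma conv_psi:
  assumes e: "idem e" and k: "\<kappa> \<in> carrier M"
    "\<And>g. idem g \<Longrightarrow> phi g \<kappa> = 0 \<or> phi g \<kappa> = 1 \<and> e \<otimes> g = g"
    and w: "w \<in> ZGp e" "w' \<in> ZGp e" "w * w' = 1"
  shows "convolution S (psi e \<kappa> w) (psi e \<kappa> w') = \<one>\<^bsub>M\<^esub>"
proof (rule phi_eqI[OF conv_closed one_M(1)])
  fix g assume g: "idem g"
  have k01: "phi g \<kappa> = 0 \<or> phi g \<kappa> = 1" using k(2)[OF g] by blast
  have "phi g (cfp e w) * phi g (cfp e w') = 1" if "phi g \<kappa> = 1"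
  proof -
    have "e \<otimes> g = g" using k(2)[OF g] that by auto
    then show ?thesis using phi_mult[OF g, of "cfp e w" "cfp e w'"] conv_cfp[OF e w(1,2)] w(3) phi_cfp_one[OF e g] by simp
  qed
  then show "phi g (convolution S (psi e \<kappa> w) (psi e \<kappa> w')) = phi g \<one>\<^bsub>M\<^esub>"
    using phi_psi[OF g k01] phi_mult[OF g] g by simp
qed

section \<open>Types of the groups when the algebra is reduced and hyperbolic\<close>

context
  assumes red: "no_nonzero_nilpotents A" and hyp: "hyperbolic_property A"
begin

text \<open>The extended units are units of the semigroup ring, so the hyperbolic property yields a
  relation, which \<open>phi g\<close> spreads to every component. The selectors \<kappa> and \<mu>
  are left open, to be chosen so that the units commute.\<close>

lemma psi_units_dep:
  assumes e: "idem e" and k: "\<kappa> \<in> carrier M"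
    "\<And>g. idem g \<Longrightarrow> phi g \<kappa> = 0 \<or> phi g \<kappa> = 1 \<and> e \<otimes> g = g"
    and f: "idem f" and l: "\<mu> \<in> carrier M"
    "\<And>g. idem g \<Longrightarrow> phi g \<mu> = 0 \<or> phi g \<mu> = 1 \<and> f \<otimes> g = g"
    and u: "int_group_ring.unit_pair (Gp e) (D e) u u'" and v: "int_group_ring.unit_pair (Gp f) (D f) v v'"
    and comm: "\<And>g. \<lbrakk>idem g; phi g \<kappa> = 1; phi g \<mu> = 1\<rbrakk> \<Longrightarrow>
      phi g (cfp e u) * phi g (cfp f v) = phi g (cfp f v) * phi g (cfp e u)"
  shows "\<exists>(a::nat) (b::nat). (a, b) \<noteq> (0, 0) \<and>
    ((\<forall>g. idem g \<longrightarrow> phi g (psi e \<kappa> u) ^ a * phi g (psi f \<mu> v) ^ b = 1) \<or>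
     (\<forall>g. idem g \<longrightarrow> phi g (psi e \<kappa> u) ^ a = phi g (psi f \<mu> v) ^ b))"
proof -
  note u' = u[unfolded int_group_ring.unit_pair_def[OF GR[OF e]]]
  note v' = v[unfolded int_group_ring.unit_pair_def[OF GR[OF f]]]
  have uv: "convolution S (psi e \<kappa> u) (psi f \<mu> v) = convolution S (psi f \<mu> v) (psi e \<kappa> u)"
  proof (rule phi_eqI[OF conv_closed conv_closed])
    fix g assume g: "idem g"
    have k01: "phi g \<kappa> = 0 \<or> phi g \<kappa> = 1" using k(2)[OF g] by blast
    have l01: "phi g \<mu> = 0 \<or> phi g \<mu> = 1" using l(2)[OF g] by blast
    show "phi g (convolution S (psi e \<kappa> u) (psi f \<mu> v)) = phi g (convolution S (psi f \<mu> v) (psi e \<kappa> u))"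
      unfolding phi_mult[OF g] phi_psi[OF g k01] phi_psi[OF g l01] using comm[OF g] by simp
  qed
  have "\<exists>(a::nat) (b::nat). (a, b) \<noteq> (0, 0) \<and>
    (convolution S (psi e \<kappa> u [^]\<^bsub>M\<^esub> a) (psi f \<mu> v [^]\<^bsub>M\<^esub> b) = \<one>\<^bsub>M\<^esub> \<or> psi e \<kappa> u [^]\<^bsub>M\<^esub> a = psi f \<mu> v [^]\<^bsub>M\<^esub> b)"
    by (rule hyperbolic_units_dep[OF hyp psi_closed[OF k(1)] psi_closed[OF k(1), of e u']
        conv_psi[OF e k] conv_psi[OF e k] psi_closed[OF l(1)] psi_closed[OF l(1), of f v']
        conv_psi[OF f l] conv_psi[OF f l] uv]) (use u' v' in blast)+
  then obtain a b :: nat where ab: "(a, b) \<noteq> (0, 0)"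
    "convolution S (psi e \<kappa> u [^]\<^bsub>M\<^esub> a) (psi f \<mu> v [^]\<^bsub>M\<^esub> b) = \<one>\<^bsub>M\<^esub> \<or> psi e \<kappa> u [^]\<^bsub>M\<^esub> a = psi f \<mu> v [^]\<^bsub>M\<^esub> b" by (elim exE conjE)
  from ab(2) have "(\<forall>g. idem g \<longrightarrow> phi g (psi e \<kappa> u) ^ a * phi g (psi f \<mu> v) ^ b = 1) \<or>
     (\<forall>g. idem g \<longrightarrow> phi g (psi e \<kappa> u) ^ a = phi g (psi f \<mu> v) ^ b)"
  proof
    assume 1: "convolution S (psi e \<kappa> u [^]\<^bsub>M\<^esub> a) (psi f \<mu> v [^]\<^bsub>M\<^esub> b) = \<one>\<^bsub>M\<^esub>"
    have "phi g (psi e \<kappa> u) ^ a * phi g (psi f \<mu> v) ^ b = 1" if g: "idem g" for g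
      using arg_cong[OF 1, of "phi g"] unfolding phi_mult[OF g] phi_pow[OF g] phi_one[OF g] .
    then show ?thesis by blast
  next
    assume 1: "psi e \<kappa> u [^]\<^bsub>M\<^esub> a = psi f \<mu> v [^]\<^bsub>M\<^esub> b"
    have "phi g (psi e \<kappa> u) ^ a = phi g (psi f \<mu> v) ^ b" if g: "idem g" for g
      using arg_cong[OF 1, of "phi g"] unfolding phi_pow[OF g] .
    then show ?thesis by blast
  qed
  then show ?thesis using ab(1) by blast
qed

text \<open>With the selector \<open>delta e\<close> a unit at \<open>e\<close> acts on all
  components below \<open>e\<close>; units that commute at \<open>e\<close> still commute there,
  because \<open>cfp e\<close> is multiplicative.\<close>

lemma group_of_type:
  assumes e: "idem e"
  shows "higman_group (Gp e) \<or> cyclic_5_8_12 (Gp e)"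
proof -
  interpret E: int_group_ring "Gp e" "D e" by (rule GR[OF e])
  show ?thesis
  proof (rule E.few_units_classification)
    fix r assume r: "r \<in> ZGp e" "r * r = 0"
    have "cfp e 0 = (\<lambda>_. 0)" using E.cf_zero by (rule ext)
    then have "convolution S (cfp e r) (cfp e r) = (\<lambda>_. 0)" using conv_cfp[OF e r(1) r(1)] r(2) by simp
    then have "cfp e r = (\<lambda>_. 0)" using red[unfolded no_nilpotents_iff] cfp_closed[OF e] by blast
    then show "r = 0" using phi_cfp[OF e r(1)] by simp
  next
    have k: "delta e \<in> carrier M" by (rule delta_carrier[OF idem_closed[OF e]])
    have k01: "phi g (delta e) = 0 \<or> phi g (delta e) = 1 \<and> e \<otimes> g = g" if "idem g" for g
      using phi_delta[OF e that] by simp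
    have ke: "phi e (delta e) = 1" using phi_delta[OF e e] e by simp
    show "E.comm_units_dep" unfolding E.comm_units_dep_def
    proof (intro allI impI)
      fix u u' v v' assume u: "E.unit_pair u u'" and v: "E.unit_pair v v'" and uv: "u * v = v * u"
      have z: "u \<in> ZGp e" "v \<in> ZGp e" using u v by (auto simp: E.unit_pair_def)
      have pe: "phi e (psi e (delta e) u) = u" "phi e (psi e (delta e) v) = v"
        using phi_psi[OF e disjI2[OF ke]] ke phi_cfp[OF e] z by simp_all
      have "phi g (cfp e u) * phi g (cfp e v) = phi g (cfp e v) * phi g (cfp e u)" if g: "idem g" for g
        unfolding phi_mult[OF g, symmetric] conv_cfp[OF e z] conv_cfp[OF e z(2,1)] uv ..
      from psi_units_dep[OF e k k01 e k k01 u v this] obtain a b :: nat where ab: "(a, b) \<noteq> (0, 0)"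
        "(\<forall>g. idem g \<longrightarrow> phi g (psi e (delta e) u) ^ a * phi g (psi e (delta e) v) ^ b = 1) \<or>
         (\<forall>g. idem g \<longrightarrow> phi g (psi e (delta e) u) ^ a = phi g (psi e (delta e) v) ^ b)" by blast
      from ab(2) have "u ^ a * v ^ b = 1 \<or> u ^ a = v ^ b"
        by (elim disjE) (drule spec[of _ e], use e pe in simp)+
      with ab(1) show "mult_dep u v" unfolding mult_dep_def by blast
    qed
  qed
qed

lemma no_two_cyclic:
  assumes e: "idem e" and f: "idem f" and ef: "e \<otimes> f \<noteq> e"
    and ce: "cyclic_5_8_12 (Gp e)" and cf: "cyclic_5_8_12 (Gp f)"
  shows False
proof -
  interpret E: int_group_ring "Gp e" "D e" by (rule GR[OF e])
  interpret F: int_group_ring "Gp f" "D f" by (rule GR[OF f])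
  obtain x where x: "x \<in> carrier (Gp e)" "E.ord x \<in> {5, 8, 12}" using ce unfolding cyclic_5_8_12_iff by blast
  obtain y where y: "y \<in> carrier (Gp f)" "F.ord y \<in> {5, 8, 12}" using cf unfolding cyclic_5_8_12_iff by blast
  obtain u u' where u: "E.unit_pair u u'" "\<forall>k>0. u ^ k \<noteq> 1" using E.infinite_order_unit_5_8_12[OF x] by blast
  obtain v v' where v: "F.unit_pair v v'" "\<forall>k>0. v ^ k \<noteq> 1" using F.infinite_order_unit_5_8_12[OF y] by blast
  note c = idem_closed[OF e] idem_closed[OF f]
  have i: "idem (e \<otimes> f)" by (rule idem_mult[OF e f])
  \<comment> \<open>Subtracting \<open>delta (e \<otimes> f)\<close> removes the components below
    both idempotents, so no component sees both units and they commute. The component at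
    \<open>e\<close> survives because \<open>e \<otimes> f \<noteq> e\<close>.\<close>
  define \<kappa> :: "'a \<Rightarrow> int" where "\<kappa> = (\<lambda>s. delta e s - delta (e \<otimes> f) s)"
  have k: "\<kappa> \<in> carrier M" using c idem_closed[OF i] by (auto simp: \<kappa>_def delta_def)
  have pk: "phi g \<kappa> = (if e \<otimes> g = g \<and> e \<otimes> f \<otimes> g \<noteq> g then 1 else 0)" if g: "idem g" for g
  proof -
    have "e \<otimes> g = g" if efg: "e \<otimes> f \<otimes> g = g"
    proof -
      have "e \<otimes> (e \<otimes> f \<otimes> g) = e \<otimes> f \<otimes> g" using e c g by (simp add: m_assoc[symmetric] m_closed)
      then show ?thesis using efg by simp
    qed
    then show ?thesis using phi_delta[OF e g] phi_delta[OF i g] by (auto simp: \<kappa>_def phi_diff)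
  qed
  have k01: "phi g \<kappa> = 0 \<or> phi g \<kappa> = 1 \<and> e \<otimes> g = g" if "idem g" for g using pk[OF that] by auto
  have l: "delta f \<in> carrier M" by (rule delta_carrier[OF c(2)])
  have l01: "phi g (delta f) = 0 \<or> phi g (delta f) = 1 \<and> f \<otimes> g = g" if "idem g" for g
    using phi_delta[OF f that] by simp
  have comm: "e \<otimes> f = f \<otimes> e" by (rule central[OF f c(1)])
  have efe: "e \<otimes> f \<otimes> e = e \<otimes> f" using central[OF e m_closed[OF c]] e c by (simp add: m_assoc[symmetric])
  have eff: "e \<otimes> f \<otimes> f = e \<otimes> f" using f c by (simp add: m_assoc)
  have "phi e \<kappa> = 1" using pk[OF e] e efe ef by simp
  moreover have "phi f \<kappa> = 0" using pk[OF f] eff by simp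
  moreover have "phi e (delta f) = 0" using phi_delta[OF f e] ef comm by simp
  moreover have "phi f (delta f) = 1" using phi_delta[OF f f] f by simp
  moreover have "u \<in> ZGp e" "v \<in> ZGp f" using u(1) v(1) by (auto simp: E.unit_pair_def F.unit_pair_def)
  \<comment> \<open>The first unit is visible at \<open>e\<close> and trivial at \<open>f\<close>,
    the second the other way round, so a common relation makes both torsion.\<close>
  ultimately have vals: "phi e (psi e \<kappa> u) = u" "phi f (psi e \<kappa> u) = 1" "phi e (psi f (delta f) v) = 1" "phi f (psi f (delta f) v) = v"
    using phi_psi[OF e, of \<kappa> e u] phi_psi[OF f, of \<kappa> e u] phi_psi[OF e, of "delta f" f v] phi_psi[OF f, of "delta f" f v]
      phi_cfp[OF e] phi_cfp[OF f] by simp_all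
  have "e \<otimes> f \<otimes> g = g" if "idem g" "e \<otimes> g = g" "f \<otimes> g = g" for g using that c by (simp add: m_assoc)
  then have "phi g (cfp e u) * phi g (cfp f v) = phi g (cfp f v) * phi g (cfp e u)"
    if "idem g" "phi g \<kappa> = 1" "phi g (delta f) = 1" for g
    using that pk[OF that(1)] phi_delta[OF f that(1)] by (auto split: if_splits)
  from psi_units_dep[OF e k k01 f l l01 u(1) v(1) this] obtain a b :: nat where ab: "(a, b) \<noteq> (0, 0)"
    "(\<forall>g. idem g \<longrightarrow> phi g (psi e \<kappa> u) ^ a * phi g (psi f (delta f) v) ^ b = 1) \<or>
     (\<forall>g. idem g \<longrightarrow> phi g (psi e \<kappa> u) ^ a = phi g (psi f (delta f) v) ^ b)" by blast
  have "u ^ a = 1 \<and> v ^ b = 1"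
    using ab(2)
  proof
    assume "\<forall>g. idem g \<longrightarrow> phi g (psi e \<kappa> u) ^ a * phi g (psi f (delta f) v) ^ b = 1"
    from spec[OF this, of e] spec[OF this, of f] show ?thesis using e f vals by simp
  next
    assume "\<forall>g. idem g \<longrightarrow> phi g (psi e \<kappa> u) ^ a = phi g (psi f (delta f) v) ^ b"
    from spec[OF this, of e] spec[OF this, of f] show ?thesis using e f vals by simp
  qed
  then show False using u(2) v(2) ab(1) by auto
qed

lemma good_if_few_units: good
  unfolding good_def
proof (intro conjI allI impI)
  show "higman_group (Gp e) \<or> cyclic_5_8_12 (Gp e)" if "idem e" for e by (rule group_of_type[OF that])
  fix e f assume ef: "idem e" "idem f" "cyclic_5_8_12 (Gp e)" "cyclic_5_8_12 (Gp f)"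
  have "e \<otimes> f = e" "f \<otimes> e = f" using no_two_cyclic ef by blast+
  then show "e = f" using central[OF ef(1) idem_closed[OF ef(2)]] by simp
qed

end

end

context clifford_algebra
begin

text \<open>One order suffices, and the integral semigroup ring is taken. A relation between the
  images of the two basis vectors contradicts injectivity.\<close>

lemma good_imp_hyperbolic:
  assumes good
  shows "hyperbolic_property A"
  unfolding hyperbolic_property_def
proof (intro exI conjI)
  show "Z_order A ZS" by (rule Z_order_ZS)
  let ?B = "A\<lparr>carrier := ZS\<rparr>"
  let ?Z2 = "integer_group \<times>\<times> integer_group"
  interpret B: ring ?B
    using Z_order_ZS unfolding Z_order_def by (blast intro: A.subring_is_ring)
  interpret U: group "units_of ?B" by (rule B.units_group)
  have Z2: "group ?Z2" by (intro DirProd_group) simp_all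
  show "mon ?Z2 (units_of ?B) = {}"
  proof (rule ccontr)
    assume "mon ?Z2 (units_of ?B) \<noteq> {}"
    then obtain h where h: "h \<in> hom ?Z2 (units_of ?B)" "inj_on h (carrier ?Z2)" by (auto simp: mon_def)
    have inj: "x = y" if "h x = h y" for x y by (rule inj_onD[OF h(2) that]) simp_all
    have hm: "h (i + i', j + j') = convolution S (h (i, j)) (h (i', j'))" for i j i' j'
      using hom_mult[OF h(1), of "(i, j)" "(i', j')"] by (simp add: units_of_def)
    have h0: "h (0, 0) = emb \<one>\<^bsub>M\<^esub>"
      using hom_one[OF h(1) Z2 U.is_group] by (simp add: units_of_def one_A[symmetric])
    have lift: "\<exists>u u'. u \<in> carrier M \<and> h x = emb u \<and> convolution S u u' = \<one>\<^bsub>M\<^esub> \<and> convolution S u' u = \<one>\<^bsub>M\<^esub>" for x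
    proof -
      have "h x \<in> carrier (units_of ?B)" using hom_in_carrier[OF h(1), of x] by simp
      then have "h x \<in> Units ?B" by (simp only: units_of_carrier)
      then obtain y where y: "y \<in> ZS" "h x \<in> ZS" "convolution S y (h x) = emb \<one>\<^bsub>M\<^esub>" "convolution S (h x) y = emb \<one>\<^bsub>M\<^esub>"
        unfolding Units_def by (auto simp: one_A[symmetric])
      then obtain u u' where "u \<in> carrier M" "u' \<in> carrier M" "h x = emb u" "y = emb u'" unfolding ZS_def by blast
      then show ?thesis using y by (intro exI[of _ u] exI[of _ u']) (simp add: emb_mult emb_inj)
    qed
    obtain u u' where u: "u \<in> carrier M" "h (1, 0) = emb u" "convolution S u u' = \<one>\<^bsub>M\<^esub>" "convolution S u' u = \<one>\<^bsub>M\<^esub>"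
      using lift[of "(1, 0)"] by blast
    obtain v v' where v: "v \<in> carrier M" "h (0, 1) = emb v" "convolution S v v' = \<one>\<^bsub>M\<^esub>" "convolution S v' v = \<one>\<^bsub>M\<^esub>"
      using lift[of "(0, 1)"] by blast
    have hu: "h (int a, 0) = emb (u [^]\<^bsub>M\<^esub> a)" for a
    proof (induction a)
      case (Suc a)
      then show ?case using hm[of "int a" 1 0 0] u(2) by (simp add: emb_mult add.commute)
    qed (simp add: h0)
    have hv: "h (0, int b) = emb (v [^]\<^bsub>M\<^esub> b)" for b
    proof (induction b)
      case (Suc b)
      then show ?case using hm[of 0 0 "int b" 1] v(2) by (simp add: emb_mult add.commute)
    qed (simp add: h0)
    obtain a b :: nat where ab: "(a, b) \<noteq> (0, 0)"
      "convolution S (u [^]\<^bsub>M\<^esub> a) (v [^]\<^bsub>M\<^esub> b) = \<one>\<^bsub>M\<^esub> \<or> u [^]\<^bsub>M\<^esub> a = v [^]\<^bsub>M\<^esub> b"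
      using good_units_dep[OF assms u(1,3,4) v(1,3,4)] by (elim exE conjE)
    from ab(2) have "h (int a, int b) = h (0, 0) \<or> h (int a, 0) = h (0, int b)"
      using hm[of "int a" 0 0 "int b"] by (auto simp: hu hv emb_mult h0)
    then have "a = 0 \<and> b = 0" using inj by fastforce
    then show False using ab(1) by simp
  qed
qed

end

section \<open>Semigroups with reduced semigroup algebra\<close>

context integral_algebra
begin

context
  assumes red: "no_nonzero_nilpotents A"
begin

text \<open>Either pair of equations makes the square of the difference of \<open>x\<close> and
  \<open>y\<close> vanish in the semigroup ring.\<close>

lemma reduced_eqI:
  assumes x: "x \<in> carrier S" and y: "y \<in> carrier S"
    and xy: "x \<otimes> x = y \<otimes> x \<and> x \<otimes> y = y \<otimes> y \<or> x \<otimes> x = x \<otimes> y \<and> y \<otimes> x = y \<otimes> y"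
  shows "x = y"
proof -
  define w :: "'a \<Rightarrow> int" where "w = (\<lambda>s. delta x s - delta y s)"
  have "convolution S w w = (\<lambda>s. delta (x \<otimes> x) s - delta (x \<otimes> y) s - (delta (y \<otimes> x) s - delta (y \<otimes> y) s))"
    unfolding w_def conv_diff_left conv_diff_right using x y by (simp add: conv_delta)
  then have "convolution S w w = (\<lambda>_. 0)" using xy by auto
  moreover have "w \<in> carrier M" using x y by (auto simp: w_def delta_def)
  ultimately have "w = (\<lambda>_. 0)" using red[unfolded no_nilpotents_iff] by blast
  from fun_cong[OF this, of x] show ?thesis by (simp add: w_def delta_def split: if_splits)
qed

lemma reduced_idem_central:
  assumes e: "e \<in> carrier S" "e \<otimes> e = e" and s: "s \<in> carrier S"
  shows "e \<otimes> s = s \<otimes> e"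
proof -
  have ee: "e \<otimes> (e \<otimes> x) = e \<otimes> x" if "x \<in> carrier S" for x
    using m_assoc[OF e(1) e(1) that] e(2) by simp
  have "e \<otimes> s = e \<otimes> s \<otimes> e"
    by (rule reduced_eqI) (use e s in \<open>simp_all add: m_closed m_assoc ee\<close>)
  moreover have "s \<otimes> e = e \<otimes> s \<otimes> e"
    by (rule reduced_eqI) (use e s in \<open>simp_all add: m_closed m_assoc ee\<close>)
  ultimately show ?thesis by simp
qed

text \<open>\<open>spow s n\<close> is the power of \<open>s\<close> with exponent \<open>n + 1\<close>.\<close>

primrec spow :: "'a \<Rightarrow> nat \<Rightarrow> 'a" where
  "spow s 0 = s"
| "spow s (Suc n) = spow s n \<otimes> s"

lemma spow_closed: "s \<in> carrier S \<Longrightarrow> spow s n \<in> carrier S"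
  by (induction n) (simp_all add: m_closed)

lemma spow_mult: "s \<in> carrier S \<Longrightarrow> spow s m \<otimes> spow s n = spow s (Suc (m + n))"
  by (induction n) (simp_all add: m_assoc[symmetric] spow_closed)

lemma spow_shift: "spow s m = spow s n \<Longrightarrow> spow s (m + l) = spow s (n + l)"
  by (induction l) simp_all

lemma reduced_regular:
  assumes s: "s \<in> carrier S"
  shows "\<exists>t\<in>carrier S. s \<otimes> t = t \<otimes> s \<and> s \<otimes> t \<otimes> s = s \<and> t \<otimes> s \<otimes> t = t"
proof -
  have "finite (range (spow s))" by (rule finite_subset[OF _ finite_carrier]) (use spow_closed[OF s] in auto)
  then have "\<not> inj (spow s)" using finite_imageD infinite_UNIV_nat by blast
  then have "\<exists>i j. i < j \<and> spow s i = spow s j" by (metis injI linorder_neqE_nat)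
  \<comment> \<open>\<open>i\<close> is the index at which the powers of \<open>s\<close> enter
    their cycle.\<close>
  then obtain i where i: "\<exists>j. i < j \<and> spow s i = spow s j"
    "\<And>k. k < i \<Longrightarrow> \<not> (\<exists>j. k < j \<and> spow s k = spow s j)"
    using exists_least_iff[of "\<lambda>i. \<exists>j. i < j \<and> spow s i = spow s j"] by blast
  obtain j where j: "i < j" "spow s i = spow s j" using i(1) by blast
  have "i = 0"
  proof (cases i)
    case (Suc k)
    obtain l where l: "j = Suc l" using j by (cases j) auto
    have eq: "spow s (Suc k + d) = spow s (Suc l + d)" for d using spow_shift[of s "Suc k" "Suc l"] j l Suc by metis
    \<comment> \<open>The products of these two powers with themselves and with each other lie in
      the cycle and agree, so the cycle would begin one step earlier.\<close>
    have "spow s k = spow s l"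
      by (rule reduced_eqI[OF spow_closed[OF s] spow_closed[OF s]])
        (use eq[of k] eq[of l] in \<open>simp add: spow_mult[OF s] add.commute[of k l]\<close>)
    then show ?thesis using i(2)[of k] j Suc l by auto
  qed
  then obtain p where p: "j = Suc p" "spow s (Suc p) = s" using j by (cases j) auto
  have per: "spow s (Suc p + d) = spow s d" for d using spow_shift[of s "Suc p" 0 d] p by simp
  \<comment> \<open>The period is \<open>p + 1\<close>, so the exponent \<open>p\<close> would give
    the inverse. One more period keeps the exponent positive even for \<open>p = 0\<close>; exponent
    \<open>2 * p + 1\<close> is index \<open>2 * p\<close>.\<close>
  define t where "t = spow s (2 * p)"
  have st: "s \<otimes> t = spow s (Suc (2 * p))" "t \<otimes> s = spow s (Suc (2 * p))"
    using spow_mult[OF s, of 0 "2 * p"] by (simp_all add: t_def)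
  have "s \<otimes> t \<otimes> s = s" using per[of "Suc p"] p by (simp add: st mult_2)
  moreover have "t \<otimes> s \<otimes> t = t" 
    using per[of "Suc p + 2 * p"] per[of "2 * p"] spow_mult[OF s, of "Suc (2 * p)" "2 * p"]
    unfolding st(2) by (simp add: t_def mult_2 add_ac)
  ultimately show ?thesis using st spow_closed[OF s] by (intro bexI[of _ t]) (auto simp: t_def)
qed

lemma reduced_clifford: "clifford_semigroup S"
  by unfold_locales (rule reduced_idem_central reduced_regular; assumption)+

end

end

theorem theorem4p3:
  fixes S :: "'s monoid"
  assumes "finite_semigroup S"
    and "has_identity (integral_semigroup_ring S)"
  shows "(no_nonzero_nilpotents (rational_semigroup_algebra S) \<and>
          hyperbolic_property (rational_semigroup_algebra S)
            \<longleftrightarrow> has_hyperbolic_series S) \<and>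
         (has_hyperbolic_series S \<longrightarrow>
            inverse_semigroup S \<and> disjoint_union_of_groups S)"
proof -
  interpret integral_algebra S
    by (intro integral_algebra.intro integral_algebra_axioms.intro assms)
  have alg: "clifford_algebra S" if "clifford_semigroup S"
    by (intro clifford_algebra.intro that integral_algebra_axioms)
  show ?thesis
  proof (intro conjI iffI impI)
    assume h: "no_nonzero_nilpotents A \<and> hyperbolic_property A"
    then have c: "clifford_semigroup S" using reduced_clifford by blast
    show "has_hyperbolic_series S"
      using good_imp_series[OF c] clifford_algebra.good_if_few_units[OF alg[OF c]] h by blast
  next
    assume "has_hyperbolic_series S"
    then have c: "clifford_semigroup S" and g: "clifford_semigroup.good S"
      using series_imp_good[OF assms(1)] by blast+
    show "no_nonzero_nilpotents A" by (rule clifford_algebra.good_imp_reduced[OF alg[OF c] g])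
    show "hyperbolic_property A" by (rule clifford_algebra.good_imp_hyperbolic[OF alg[OF c] g])
    show "inverse_semigroup S" by (rule clifford_semigroup.inverse_semigroup[OF c])
    show "disjoint_union_of_groups S" by (rule good_imp_disjoint_union[OF c g])
  qed
qed

end
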